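(* Let $n\in\mathbb{N}$, and consider the Poisson algebra $\mathcal{A}=\mathbb{C}[x_1,\dots,x_n]$ with bracket $$\{f,g\}=\sum_{i<j}x_ix_j\Bigl(\frac{\partial f}{\partial x_i}\frac{\partial g}{\partial x_j}-\frac{\partial f}{\partial x_j}\frac{\partial g}{\partial x_i}\Bigr)\qquad(f,g\in\mathcal{A}).$$ Let $(A,p,\mathcal{U})$ be a continuous Fréchet algebra bundle over an open connected subset $X\subset\mathbb{C}$ containing $0$. Assume that for each $h\in X$ the fiber $A_h$ contains $\mathcal{A}_h=\mathcal{O}^{\mathrm{reg}}_{\exp(ih)}(\mathbb{C}^n)$ as a dense subalgebra, and that for each $j=1,\dots,n$ the constant section $x_j$ of $A$ (that is, $X\ni h\mapsto x_j\in\mathcal{A}_h\subset A_h$) is continuous (for example, we can let $X=\mathbb{C}$ and $A=\tilde{\mathsf{E}}(\mathbb{D}^n_r)$ or $A=\tilde{\mathsf{E}}(\mathbb{B}^n_r)$, where $r\in(0,+\infty]$). Let $i_h\colon\mathcal{A}\to\mathcal{A}_h$ be the vector space isomorphism given by $x^k\mapsto x^k$ ($k\in\mathbb{Z}_+^n$). Then $\bigl(A,\{\mathcal{A}_h,i_h\}_{h\in X}\bigr)$ is a strict Fréchet deformation quantization of $\mathcal{A}$.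
   Context: All algebras are complex, associative and unital. $\mathbb{Z}_+=\{0,1,\dots\}$, $x^k=x_1^{k_1}\cdots x_n^{k_n}$. For $q\in\mathbb{C}\setminus\{0\}$, $\mathcal{O}^{\mathrm{reg}}_q(\mathbb{C}^n)$ is the algebra generated by $x_1,\dots,x_n$ with relations $x_jx_k=qx_kx_j$ ($j<k$); the monomials $x^k$ form a basis. A Poisson algebra is a commutative algebra with a Lie bracket $\{\cdot,\cdot\}$ that is a derivation in each argument. Strict Fréchet deformation quantization. Let $\mathcal{A}$ be a Poisson algebra and $X\subset\mathbb{C}$ open connected, $0\in X$. A strict Fréchet deformation quantization of $\mathcal{A}$ consists of: a continuous Fréchet algebra bundle $(A,p,\mathcal{U})$ over $X$; a family of dense subalgebras $\mathcal{A}_h\subset A_h$ ($h\in X$); and vector space isomorphisms $i_h\colon\mathcal{A}\to\mathcal{A}_h$, $a\mapsto a_h$ ($h\in X$), such that $i_0$ is an algebra isomorphism; and it is required that for all $a,b\in\mathcal{A}$ $$\frac{a_hb_h-b_ha_h}{h}-i\{a,b\}_h\to0_0\qquad(h\to0),$$ where convergence is in the total space $A$ and $0_0$ is the zero of the fiber $A_0$. Bundles. A family of vector spaces over a set $X$ is a pair $(E,p)$ with $p\colon E\to X$ surjective and a vector space structure on each fiber $E_x=p^{-1}(x)$. If $X$ is a topological space, a prebundle of topological vector spaces over $X$ is a family $(E,p)$ with a topology on $E$ such that $p$ is continuous and open and the zero section, addition $E\times_XE\to E$ and scalar multiplication $\mathbb{C}\times E\to E$ are continuous; $\Gamma(V,E)$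 is the space of continuous sections over $V\subset X$. A seminorm on $E$ is a function $E\to[0,+\infty)$ restricting to a seminorm on each fiber. A family $\mathcal{N}=\{\|\cdot\|_\lambda:\lambda\in\Lambda\}$ of seminorms on $E$ is directed if for all $\lambda,\mu$ there are $C>0$, $\nu$ with $\|\cdot\|_\lambda\le C\|\cdot\|_\nu$, $\|\cdot\|_\mu\le C\|\cdot\|_\nu$. A set $S\subset E$ is absolutely convex (absorbing) if each $S\cap E_x$ is so in $E_x$. A locally convex uniform vector structure on $E$ is a family $\mathcal{U}$ of absorbing absolutely convex subsets of $E$ closed under multiplication by nonzero scalars, finite intersections, and passage to larger absolutely convex subsets. For directed $\mathcal{N}$, $\mathcal{U}_{\mathcal{N}}$ consists of all absolutely convex sets containing some $\{u\in E:\|u\|_\lambda<\varepsilon\}$, $\lambda\in\Lambda$, $\varepsilon>0$. A locally convex bundle is a triple $(E,p,\mathcal{U})$ with $(E,p)$ a prebundle of topological vector spaces and $\mathcal{U}$ a locally convex uniform vector structure such that: each $U\in\mathcal{U}$ contains an open $U_0\in\mathcal{U}$; the sets $s(V)+U=\{s_{p(u)}+u:u\in U,\,p(u)\in V\}$ ($V\subset X$ open, $s\in\Gamma(V,E)$, $U\in\mathcal{U}$ open) form a base of the topology of $E$; and for each $x$ the set of values at $x$ of continuous sections over open neighborhoods of $x$ is dense in $E_x$. It is a Fréchet algebra bundle if moreover each $E_x$ is an algebra and is a Fréchet algebra (complete metrizable locally convex algebra) in the inherited topology, the multiplication $E\times_XE\to E$ is continuous, and for each $U\in\mathcal{U}$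 there is $V\in\mathcal{U}$ with $uv\in U$ for all $u,v\in V$ with $p(u)=p(v)$. A directed family $\mathcal{N}$ of seminorms on $E$ is admissible if the tubes $\{v\in E:p(v)\in V,\ \|v-s_{p(v)}\|_\lambda<\varepsilon\}$ ($V\subset X$ open, $s\in\Gamma(V,E)$, $\lambda\in\Lambda$, $\varepsilon>0$) are open and form a base of the topology of $E$, and for each $x$ the set of values at $x$ of continuous sections over open neighborhoods of $x$ is dense in $E_x$ for the topology given by $\mathcal{N}$. The bundle is continuous if $\mathcal{U}=\mathcal{U}_{\mathcal{N}}$ for some admissible directed family $\mathcal{N}$ of seminorms that are continuous functions on $E$. The bundles $\tilde{\mathsf{E}}$. $W_{n,d}=\{1,\dots,n\}^d$, $W_n=\bigsqcup_{d\ge0}W_{n,d}$, $|\alpha|=d$ for $\alpha\in W_{n,d}$, $\zeta_\alpha=\zeta_{\alpha_1}\cdots\zeta_{\alpha_d}$; $\mathrm{s}(\alpha)=\mathrm{card}\{i\in\{1,\dots,d-1\}:\alpha_i\ne\alpha_{i+1}\}$ if $d=|\alpha|\ge2$, $\mathrm{s}(\alpha)=|\alpha|-1$ if $|\alpha|\le1$. $\mathcal{F}(\mathbb{D}^n_r)$ (resp. $\mathcal{F}(\mathbb{B}^n_r)$) is the Fréchet algebra of formal series $a=\sum_{\alpha\in W_n}c_\alpha\zeta_\alpha$ in free variables with $\sum_\alpha|c_\alpha|\rho^{|\alpha|}\tau^{\mathrm{s}(\alpha)+1}<\infty$ for all $\rho\in(0,r)$, $\tau\ge1$ (resp. $\sum_{d\ge0}(\sum_{|\alpha|=d}|c_\alpha|^2)^{1/2}\rho^d<\infty$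 for all $\rho\in(0,r)$), topologized by these norms. For $F$ one of these, let $\tilde I$ be the closed two-sided ideal of the Fréchet algebra $\mathcal{O}(\mathbb{C},F)$ of holomorphic $F$-valued functions on $\mathbb{C}$ generated by $\zeta_j\zeta_k-e^{ih}\zeta_k\zeta_j$ ($j<k$), $h$ being the coordinate on $\mathbb{C}$; put $R=\mathcal{O}(\mathbb{C},F)/\tilde I$. The bundle $\tilde{\mathsf{E}}(\mathbb{D}^n_r)$ (resp. $\tilde{\mathsf{E}}(\mathbb{B}^n_r)$) over $\mathbb{C}$ has total space $\bigsqcup_{h\in\mathbb{C}}R_h$, where $R_h=R/\overline{\mathfrak{m}_hR}$, $\mathfrak{m}_h=\{f\in\mathcal{O}(\mathbb{C}):f(h)=0\}$; its locally convex uniform vector structure is determined by the quotient seminorms on the $R_h$ of all continuous seminorms on $R$, and its topology has as base the sets $\{v:p(v)\in V,\ \|v-u_{p(v)}\|<\varepsilon\}$ ($V\subset\mathbb{C}$ open, $u\in R$ with class $u_h$ in $R_h$, $\|\cdot\|$ a continuous seminorm on $R$, $\varepsilon>0$). Here $x_j\in R_h$ is the class of $\zeta_j$, and $\mathcal{O}^{\mathrm{reg}}_{\exp(ih)}(\mathbb{C}^n)$ is regarded as the subalgebra of $R_h$ generated by $x_1,\dots,x_n$. *)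

theory Defs
  imports
    "HOL-Analysis.Analysis"
    "HOL-Library.Poly_Mapping"
    "HOL-Algebra.Module"
    "HOL-Algebra.QuotRing"
    "HOL-Algebra.Subrings"
begin

section \<open>Complex algebras\<close>

text \<open>Vector spaces and algebras over the complex numbers are records of type
  \<open>(complex, 'a) module\<close>, so that the fibers of one bundle may have different operations.\<close>

definition complex_ring :: "complex ring" where
  "complex_ring = \<lparr>carrier = UNIV, mult = (*), one = 1, zero = 0, add = (+)\<rparr>"

abbreviation complex_vs :: "(complex, 'a) module \<Rightarrow> bool" where
  "complex_vs M \<equiv> Module.module complex_ring M"

definition complex_algebra :: "(complex, 'a) module \<Rightarrow> bool" where
  "complex_algebra A \<longleftrightarrow> complex_vs A \<and> ring A \<and>
     (\<forall>c. \<forall>u\<in>carrier A. \<forall>v\<in>carrier A.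
        (c \<odot>\<^bsub>A\<^esub> u) \<otimes>\<^bsub>A\<^esub> v = c \<odot>\<^bsub>A\<^esub> (u \<otimes>\<^bsub>A\<^esub> v) \<and>
        u \<otimes>\<^bsub>A\<^esub> (c \<odot>\<^bsub>A\<^esub> v) = c \<odot>\<^bsub>A\<^esub> (u \<otimes>\<^bsub>A\<^esub> v))"

definition complex_subalgebra :: "'a set \<Rightarrow> (complex, 'a) module \<Rightarrow> bool" where
  "complex_subalgebra B A \<longleftrightarrow> submodule B complex_ring A \<and> subring B A"

definition complex_linear ::
    "(complex, 'a) module \<Rightarrow> (complex, 'b) module \<Rightarrow> ('a \<Rightarrow> 'b) \<Rightarrow> bool" where
  "complex_linear A B f \<longleftrightarrow> f \<in> carrier A \<rightarrow> carrier B \<and>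
     (\<forall>u\<in>carrier A. \<forall>v\<in>carrier A. f (u \<oplus>\<^bsub>A\<^esub> v) = f u \<oplus>\<^bsub>B\<^esub> f v) \<and>
     (\<forall>c. \<forall>u\<in>carrier A. f (c \<odot>\<^bsub>A\<^esub> u) = c \<odot>\<^bsub>B\<^esub> f u)"

definition complex_alg_hom ::
    "(complex, 'a) module \<Rightarrow> (complex, 'b) module \<Rightarrow> ('a \<Rightarrow> 'b) \<Rightarrow> bool" where
  "complex_alg_hom A B f \<longleftrightarrow> complex_linear A B f \<and> f \<in> ring_hom A B"

definition alg_quot :: "(complex, 'a) module \<Rightarrow> 'a set \<Rightarrow> (complex, 'a set) module" where
  "alg_quot A I = ring.extend (A Quot I)
     (module.fields (\<lambda>c K. \<Union>u\<in>K. I +>\<^bsub>A\<^esub> (c \<odot>\<^bsub>A\<^esub> u)))"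

definition poisson_algebra :: "(complex, 'a) module \<Rightarrow> ('a \<Rightarrow> 'a \<Rightarrow> 'a) \<Rightarrow> bool" where
  "poisson_algebra P br \<longleftrightarrow> Module.algebra complex_ring P \<and>
     (\<forall>f\<in>carrier P. complex_linear P P (br f) \<and> complex_linear P P (\<lambda>g. br g f)) \<and>
     (\<forall>f\<in>carrier P. br f f = \<zero>\<^bsub>P\<^esub>) \<and>
     (\<forall>f\<in>carrier P. \<forall>g\<in>carrier P. \<forall>k\<in>carrier P.
        br f (br g k) \<oplus>\<^bsub>P\<^esub> br g (br k f) \<oplus>\<^bsub>P\<^esub> br k (br f g) = \<zero>\<^bsub>P\<^esub>) \<and>
     (\<forall>f\<in>carrier P. \<forall>g\<in>carrier P. \<forall>k\<in>carrier P.
        br f (g \<otimes>\<^bsub>P\<^esub> k) = br f g \<otimes>\<^bsub>P\<^esub> k \<oplus>\<^bsub>P\<^esub> g \<otimes>\<^bsub>P\<^esub> br f k \<and>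
        br (g \<otimes>\<^bsub>P\<^esub> k) f = br g f \<otimes>\<^bsub>P\<^esub> k \<oplus>\<^bsub>P\<^esub> g \<otimes>\<^bsub>P\<^esub> br k f)"

section \<open>Seminorms and Frechet algebras\<close>

definition seminorm_on :: "(complex, 'a) module \<Rightarrow> ('a \<Rightarrow> real) \<Rightarrow> bool" where
  "seminorm_on M N \<longleftrightarrow>
     (\<forall>u\<in>carrier M. 0 \<le> N u) \<and>
     (\<forall>u\<in>carrier M. \<forall>v\<in>carrier M. N (u \<oplus>\<^bsub>M\<^esub> v) \<le> N u + N v) \<and>
     (\<forall>c. \<forall>u\<in>carrier M. N (c \<odot>\<^bsub>M\<^esub> u) = cmod c * N u)"

definition seminorm_topology :: "(complex, 'a) module \<Rightarrow> ('a \<Rightarrow> real) set \<Rightarrow> 'a topology" where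
  "seminorm_topology M \<N> = topology (\<lambda>S. S \<subseteq> carrier M \<and>
     (\<forall>u\<in>S. \<exists>\<F> \<epsilon>. finite \<F> \<and> \<F> \<subseteq> \<N> \<and> 0 < \<epsilon> \<and>
        {v \<in> carrier M. \<forall>N\<in>\<F>. N (v \<ominus>\<^bsub>M\<^esub> u) < \<epsilon>} \<subseteq> S))"

definition convex_in :: "(complex, 'a) module \<Rightarrow> 'a set \<Rightarrow> bool" where
  "convex_in M S \<longleftrightarrow> (\<forall>u\<in>S. \<forall>v\<in>S. \<forall>t::real. 0 \<le> t \<and> t \<le> 1 \<longrightarrow>
     (of_real (1 - t) \<odot>\<^bsub>M\<^esub> u) \<oplus>\<^bsub>M\<^esub> (of_real t \<odot>\<^bsub>M\<^esub> v) \<in> S)"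

text \<open>Completeness refers to the translation-invariant uniformity; as the topology is
  metrizable, it suffices to consider Cauchy sequences.\<close>

definition frechet_algebra :: "(complex, 'a) module \<Rightarrow> 'a topology \<Rightarrow> bool" where
  "frechet_algebra A T \<longleftrightarrow> complex_algebra A \<and> topspace T = carrier A \<and>
     continuous_map (prod_topology T T) T (\<lambda>(u, v). u \<oplus>\<^bsub>A\<^esub> v) \<and>
     continuous_map (prod_topology euclidean T) T (\<lambda>(c, u). c \<odot>\<^bsub>A\<^esub> u) \<and>
     continuous_map (prod_topology T T) T (\<lambda>(u, v). u \<otimes>\<^bsub>A\<^esub> v) \<and>
     (\<forall>W. openin T W \<and> \<zero>\<^bsub>A\<^esub> \<in> W \<longrightarrow>
        (\<exists>C. openin T C \<and> \<zero>\<^bsub>A\<^esub> \<in> C \<and> convex_in A C \<and> C \<subseteq> W)) \<and>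
     metrizable_space T \<and>
     (\<forall>\<sigma>::nat \<Rightarrow> 'a. range \<sigma> \<subseteq> carrier A \<and>
        (\<forall>W. openin T W \<and> \<zero>\<^bsub>A\<^esub> \<in> W \<longrightarrow> (\<exists>M. \<forall>k\<ge>M. \<forall>l\<ge>M. \<sigma> k \<ominus>\<^bsub>A\<^esub> \<sigma> l \<in> W))
        \<longrightarrow> (\<exists>u. limitin T \<sigma> u sequentially))"

section \<open>Bundles\<close>

text \<open>\<open>fib E x\<close> carries the operations of the fiber over \<open>x\<close>. The ring multiplication and unit in
  \<open>fib E x\<close> are irrelevant until \<open>frechet_algebra_bundle\<close>. \<open>unif\<close> is the locally convex uniform
  vector structure.\<close>

record ('x, 'e) bundle_data =
  base :: "'x topology"
  total :: "'e topology"
  proj :: "'e \<Rightarrow> 'x"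
  fib :: "'x \<Rightarrow> (complex, 'e) module"
  unif :: "'e set set"

definition vector_space_family :: "('x, 'e) bundle_data \<Rightarrow> bool" where
  "vector_space_family E \<longleftrightarrow>
     proj E ` topspace (total E) = topspace (base E) \<and>
     (\<forall>x\<in>topspace (base E). complex_vs (fib E x) \<and>
        carrier (fib E x) = {u \<in> topspace (total E). proj E u = x})"

definition fiber_product :: "('x, 'e) bundle_data \<Rightarrow> ('e \<times> 'e) topology" where
  "fiber_product E =
     subtopology (prod_topology (total E) (total E)) {(u, v). proj E u = proj E v}"

definition tvs_prebundle :: "('x, 'e) bundle_data \<Rightarrow> bool" where
  "tvs_prebundle E \<longleftrightarrow> vector_space_family E \<and>
     continuous_map (total E) (base E) (proj E) \<and>
     open_map (total E) (base E) (proj E) \<and>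
     continuous_map (base E) (total E) (\<lambda>x. \<zero>\<^bsub>fib E x\<^esub>) \<and>
     continuous_map (fiber_product E) (total E) (\<lambda>(u, v). u \<oplus>\<^bsub>fib E (proj E u)\<^esub> v) \<and>
     continuous_map (prod_topology euclidean (total E)) (total E)
       (\<lambda>(c, u). c \<odot>\<^bsub>fib E (proj E u)\<^esub> u)"

definition sections :: "'x set \<Rightarrow> ('x, 'e) bundle_data \<Rightarrow> ('x \<Rightarrow> 'e) set" where
  "sections V E = {s. continuous_map (subtopology (base E) V) (total E) s \<and>
                      (\<forall>x\<in>V. proj E (s x) = x)}"

definition section_values :: "('x, 'e) bundle_data \<Rightarrow> 'x \<Rightarrow> 'e set" where
  "section_values E x = {s x |s V. openin (base E) V \<and> x \<in> V \<and> s \<in> sections V E}"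

definition fiber_topology :: "('x, 'e) bundle_data \<Rightarrow> 'x \<Rightarrow> 'e topology" where
  "fiber_topology E x = subtopology (total E) (carrier (fib E x))"

definition absolutely_convex :: "('x, 'e) bundle_data \<Rightarrow> 'e set \<Rightarrow> bool" where
  "absolutely_convex E S \<longleftrightarrow> S \<subseteq> topspace (total E) \<and>
     (\<forall>x\<in>topspace (base E). \<forall>u\<in>S \<inter> carrier (fib E x). \<forall>v\<in>S \<inter> carrier (fib E x). \<forall>a b.
        cmod a + cmod b \<le> 1 \<longrightarrow> (a \<odot>\<^bsub>fib E x\<^esub> u) \<oplus>\<^bsub>fib E x\<^esub> (b \<odot>\<^bsub>fib E x\<^esub> v) \<in> S)"

definition absorbing :: "('x, 'e) bundle_data \<Rightarrow> 'e set \<Rightarrow> bool" where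
  "absorbing E S \<longleftrightarrow> S \<subseteq> topspace (total E) \<and>
     (\<forall>x\<in>topspace (base E). \<forall>u\<in>carrier (fib E x).
        \<exists>\<epsilon>>0. \<forall>c. cmod c \<le> \<epsilon> \<longrightarrow> c \<odot>\<^bsub>fib E x\<^esub> u \<in> S)"

definition lc_uniform_structure :: "('x, 'e) bundle_data \<Rightarrow> 'e set set \<Rightarrow> bool" where
  "lc_uniform_structure E \<U> \<longleftrightarrow>
     (\<forall>S\<in>\<U>. absorbing E S \<and> absolutely_convex E S) \<and>
     (\<forall>S\<in>\<U>. \<forall>c. c \<noteq> 0 \<longrightarrow> (\<lambda>u. c \<odot>\<^bsub>fib E (proj E u)\<^esub> u) ` S \<in> \<U>) \<and>
     (\<forall>S\<in>\<U>. \<forall>S'\<in>\<U>. S \<inter> S' \<in> \<U>) \<and>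
     (\<forall>S\<in>\<U>. \<forall>S'. S \<subseteq> S' \<and> absolutely_convex E S' \<longrightarrow> S' \<in> \<U>)"

definition section_tube ::
    "('x, 'e) bundle_data \<Rightarrow> ('x \<Rightarrow> 'e) \<Rightarrow> 'x set \<Rightarrow> 'e set \<Rightarrow> 'e set" where
  "section_tube E s V U = {s (proj E u) \<oplus>\<^bsub>fib E (proj E u)\<^esub> u |u. u \<in> U \<and> proj E u \<in> V}"

text \<open>\<open>openin T = arbitrary union_of P\<close> says that the sets satisfying \<open>P\<close> form a base of \<open>T\<close>,
  cf. \<open>openin_topology_base_unique\<close>.\<close>

definition locally_convex_bundle :: "('x, 'e) bundle_data \<Rightarrow> bool" where
  "locally_convex_bundle E \<longleftrightarrow> tvs_prebundle E \<and> lc_uniform_structure E (unif E) \<and>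
     (\<forall>U\<in>unif E. \<exists>U\<^sub>0\<in>unif E. openin (total E) U\<^sub>0 \<and> U\<^sub>0 \<subseteq> U) \<and>
     openin (total E) = arbitrary union_of (\<lambda>W. \<exists>V s U. openin (base E) V \<and> s \<in> sections V E \<and>
        U \<in> unif E \<and> openin (total E) U \<and> W = section_tube E s V U) \<and>
     (\<forall>x\<in>topspace (base E).
        fiber_topology E x closure_of section_values E x = carrier (fib E x))"

definition frechet_algebra_bundle :: "('x, 'e) bundle_data \<Rightarrow> bool" where
  "frechet_algebra_bundle E \<longleftrightarrow> locally_convex_bundle E \<and>
     (\<forall>x\<in>topspace (base E). frechet_algebra (fib E x) (fiber_topology E x)) \<and>
     continuous_map (fiber_product E) (total E) (\<lambda>(u, v). u \<otimes>\<^bsub>fib E (proj E u)\<^esub> v) \<and>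
     (\<forall>U\<in>unif E. \<exists>V\<in>unif E. \<forall>u\<in>V. \<forall>v\<in>V.
        proj E u = proj E v \<longrightarrow> u \<otimes>\<^bsub>fib E (proj E u)\<^esub> v \<in> U)"

definition bundle_seminorm :: "('x, 'e) bundle_data \<Rightarrow> ('e \<Rightarrow> real) \<Rightarrow> bool" where
  "bundle_seminorm E N \<longleftrightarrow> (\<forall>x\<in>topspace (base E). seminorm_on (fib E x) N)"

definition directed_seminorms :: "('x, 'e) bundle_data \<Rightarrow> ('e \<Rightarrow> real) set \<Rightarrow> bool" where
  "directed_seminorms E \<N> \<longleftrightarrow> (\<forall>N\<in>\<N>. bundle_seminorm E N) \<and>
     (\<forall>N\<in>\<N>. \<forall>N'\<in>\<N>. \<exists>C>0. \<exists>M\<in>\<N>. \<forall>u\<in>topspace (total E). N u \<le> C * M u \<and> N' u \<le> C * M u)"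

definition unif_of_seminorms :: "('x, 'e) bundle_data \<Rightarrow> ('e \<Rightarrow> real) set \<Rightarrow> 'e set set" where
  "unif_of_seminorms E \<N> = {S. absolutely_convex E S \<and>
     (\<exists>N\<in>\<N>. \<exists>\<epsilon>>0. {u \<in> topspace (total E). N u < \<epsilon>} \<subseteq> S)}"

definition seminorm_tube ::
    "('x, 'e) bundle_data \<Rightarrow> ('x \<Rightarrow> 'e) \<Rightarrow> 'x set \<Rightarrow> ('e \<Rightarrow> real) \<Rightarrow> real \<Rightarrow> 'e set" where
  "seminorm_tube E s V N \<epsilon> = {v \<in> topspace (total E). proj E v \<in> V \<and>
     N (v \<ominus>\<^bsub>fib E (proj E v)\<^esub> s (proj E v)) < \<epsilon>}"

definition admissible :: "('x, 'e) bundle_data \<Rightarrow> ('e \<Rightarrow> real) set \<Rightarrow> bool" where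
  "admissible E \<N> \<longleftrightarrow> directed_seminorms E \<N> \<and>
     openin (total E) = arbitrary union_of (\<lambda>W. \<exists>V s N \<epsilon>. openin (base E) V \<and> s \<in> sections V E \<and>
        N \<in> \<N> \<and> 0 < \<epsilon> \<and> W = seminorm_tube E s V N \<epsilon>) \<and>
     (\<forall>x\<in>topspace (base E).
        seminorm_topology (fib E x) \<N> closure_of section_values E x = carrier (fib E x))"

definition continuous_bundle :: "('x, 'e) bundle_data \<Rightarrow> bool" where
  "continuous_bundle E \<longleftrightarrow> (\<exists>\<N>. admissible E \<N> \<and>
     (\<forall>N\<in>\<N>. continuous_map (total E) euclideanreal N) \<and> unif E = unif_of_seminorms E \<N>)"

section \<open>Strict Frechet deformation quantization\<close>

definition strict_frechet_deformation_quantization ::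
    "(complex, 'a) module \<Rightarrow> ('a \<Rightarrow> 'a \<Rightarrow> 'a) \<Rightarrow> complex set \<Rightarrow> (complex, 'e) bundle_data \<Rightarrow>
     (complex \<Rightarrow> 'e set) \<Rightarrow> (complex \<Rightarrow> 'a \<Rightarrow> 'e) \<Rightarrow> bool" where
  "strict_frechet_deformation_quantization P br X A D i \<longleftrightarrow>
     poisson_algebra P br \<and>
     open X \<and> connected X \<and> 0 \<in> X \<and>
     base A = top_of_set X \<and> frechet_algebra_bundle A \<and> continuous_bundle A \<and>
     (\<forall>h\<in>X. complex_subalgebra (D h) (fib A h) \<and>
        fiber_topology A h closure_of D h = carrier (fib A h)) \<and>
     (\<forall>h\<in>X. complex_linear P (fib A h) (i h) \<and> bij_betw (i h) (carrier P) (D h)) \<and>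
     complex_alg_hom P (fib A 0) (i 0) \<and>
     (\<forall>a\<in>carrier P. \<forall>b\<in>carrier P.
        limitin (total A)
          (\<lambda>h. ((1 / h) \<odot>\<^bsub>fib A h\<^esub>
                 (i h a \<otimes>\<^bsub>fib A h\<^esub> i h b \<ominus>\<^bsub>fib A h\<^esub> i h b \<otimes>\<^bsub>fib A h\<^esub> i h a))
               \<ominus>\<^bsub>fib A h\<^esub> (\<i> \<odot>\<^bsub>fib A h\<^esub> i h (br a b)))
          \<zero>\<^bsub>fib A 0\<^esub> (at 0 within X))"

section \<open>Polynomials and quantum affine space\<close>

text \<open>The index set \<open>{1..n}\<close> is rendered as a type \<open>'n :: {finite, linorder}\<close> with \<open>CARD('n) = n\<close>;
  the order matters for the relations and for the monomials \<open>x\<^sup>k\<close>. Multi-indices are elements of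
  \<open>'n \<Rightarrow>\<^sub>0 nat\<close>, polynomials are finitely supported functions of multi-indices (multiplied by
  convolution), and words in the free generators are elements of \<open>'n list\<close>.\<close>

type_synonym 'n mpol = "('n \<Rightarrow>\<^sub>0 nat) \<Rightarrow>\<^sub>0 complex"

definition poly_alg :: "(complex, 'n mpol) module" where
  "poly_alg = \<lparr>carrier = UNIV, mult = (*), one = 1, zero = 0, add = (+),
     smult = (\<lambda>c f. Poly_Mapping.single 0 c * f)\<rparr>"

definition poly_var :: "'n \<Rightarrow> 'n mpol" where
  "poly_var j = Poly_Mapping.single (Poly_Mapping.single j 1) 1"

definition poly_deriv :: "'n \<Rightarrow> 'n mpol \<Rightarrow> 'n mpol" where
  "poly_deriv j f = (\<Sum>k\<in>Poly_Mapping.keys f.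
     Poly_Mapping.single (k - Poly_Mapping.single j 1)
       (of_nat (Poly_Mapping.lookup k j) * Poly_Mapping.lookup f k))"

definition poly_bracket ::
    "'n::{finite, linorder} mpol \<Rightarrow> 'n mpol \<Rightarrow> 'n mpol" where
  "poly_bracket f g = (\<Sum>(i, j) | i < j. poly_var i * poly_var j *
     (poly_deriv i f * poly_deriv j g - poly_deriv j f * poly_deriv i g))"

definition word_basis :: "'n list \<Rightarrow> 'n list \<Rightarrow> complex" where
  "word_basis \<alpha> = (\<lambda>w. if w = \<alpha> then 1 else 0)"

definition word_mult ::
    "('n list \<Rightarrow> complex) \<Rightarrow> ('n list \<Rightarrow> complex) \<Rightarrow> 'n list \<Rightarrow> complex" where
  "word_mult a b = (\<lambda>w. \<Sum>d\<le>length w. a (take d w) * b (drop d w))"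

definition free_algebra :: "(complex, 'n list \<Rightarrow> complex) module" where
  "free_algebra = \<lparr>carrier = {a. finite {w. a w \<noteq> 0}}, mult = word_mult, one = word_basis [],
     zero = (\<lambda>w. 0), add = (\<lambda>a b w. a w + b w), smult = (\<lambda>c a w. c * a w)\<rparr>"

definition q_relation :: "complex \<Rightarrow> 'n \<Rightarrow> 'n \<Rightarrow> 'n list \<Rightarrow> complex" where
  "q_relation q j k = (\<lambda>w. word_basis [j, k] w - q * word_basis [k, j] w)"

definition q_ideal :: "complex \<Rightarrow> ('n::linorder list \<Rightarrow> complex) set" where
  "q_ideal q = Idl\<^bsub>free_algebra\<^esub> {q_relation q j k |j k. j < k}"

definition qreg :: "complex \<Rightarrow> (complex, ('n::linorder list \<Rightarrow> complex) set) module" where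
  "qreg q = alg_quot free_algebra (q_ideal q)"

definition qreg_var :: "complex \<Rightarrow> 'n::linorder \<Rightarrow> ('n list \<Rightarrow> complex) set" where
  "qreg_var q j = q_ideal q +>\<^bsub>free_algebra\<^esub> word_basis [j]"

definition qreg_monomial ::
    "complex \<Rightarrow> ('n::{finite, linorder} \<Rightarrow>\<^sub>0 nat) \<Rightarrow> ('n list \<Rightarrow> complex) set" where
  "qreg_monomial q k = foldr (\<otimes>\<^bsub>qreg q\<^esub>)
     (map (\<lambda>j. qreg_var q j [^]\<^bsub>qreg q\<^esub> Poly_Mapping.lookup k j) (sorted_list_of_set UNIV))
     \<one>\<^bsub>qreg q\<^esub>"

text \<open>The linear map sending the commutative monomial \<open>x\<^sup>k\<close> to the ordered monomial \<open>x\<^sup>k\<close>.\<close>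

definition qreg_of_poly ::
    "complex \<Rightarrow> 'n::{finite, linorder} mpol \<Rightarrow> ('n list \<Rightarrow> complex) set" where
  "qreg_of_poly q f = finsum (qreg q)
     (\<lambda>k. Poly_Mapping.lookup f k \<odot>\<^bsub>qreg q\<^esub> qreg_monomial q k) (Poly_Mapping.keys f)"

text \<open>The inclusions of the algebras generated by \<open>x\<^sub>1, \<dots>, x\<^sub>n\<close> with
  \<open>x\<^sub>j x\<^sub>k = exp (i h) x\<^sub>k x\<^sub>j\<close> into the fibers are given by injective homomorphisms \<open>\<iota> h\<close>.\<close>

definition contains_qreg ::
    "(complex, 'e) bundle_data \<Rightarrow>
     (complex \<Rightarrow> ('n::{finite, linorder} list \<Rightarrow> complex) set \<Rightarrow> 'e) \<Rightarrow> bool" where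
  "contains_qreg A \<iota> \<longleftrightarrow>
     (\<forall>h\<in>topspace (base A). complex_alg_hom (qreg (exp (\<i> * h))) (fib A h) (\<iota> h) \<and>
        inj_on (\<iota> h) (carrier (qreg (exp (\<i> * h)))) \<and>
        fiber_topology A h closure_of (\<iota> h ` carrier (qreg (exp (\<i> * h)))) = carrier (fib A h)) \<and>
     (\<forall>j. continuous_map (base A) (total A) (\<lambda>h. \<iota> h (qreg_var (exp (\<i> * h)) j)))"

section \<open>The bundles associated with the free polydisk and the free ball\<close>

definition switches :: "'n list \<Rightarrow> int" where
  "switches \<alpha> = (if 2 \<le> length \<alpha>
     then int (card {i. i < length \<alpha> - 1 \<and> \<alpha> ! i \<noteq> \<alpha> ! Suc i}) else int (length \<alpha>) - 1)"

definition polydisk_norm :: "real \<Rightarrow> real \<Rightarrow> ('n list \<Rightarrow> complex) \<Rightarrow> real" where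
  "polydisk_norm \<rho> \<tau> a =
     (\<Sum>\<^sub>\<infinity>\<alpha>\<in>UNIV. cmod (a \<alpha>) * \<rho> ^ length \<alpha> * \<tau> powi (switches \<alpha> + 1))"

definition polydisk_series :: "ereal \<Rightarrow> ('n list \<Rightarrow> complex) set" where
  "polydisk_series r = {a. \<forall>\<rho> \<tau>. 0 < \<rho> \<and> ereal \<rho> < r \<and> 1 \<le> \<tau> \<longrightarrow>
     (\<lambda>\<alpha>. cmod (a \<alpha>) * \<rho> ^ length \<alpha> * \<tau> powi (switches \<alpha> + 1)) summable_on UNIV}"

definition polydisk_norms :: "ereal \<Rightarrow> (('n list \<Rightarrow> complex) \<Rightarrow> real) set" where
  "polydisk_norms r = {polydisk_norm \<rho> \<tau> |\<rho> \<tau>. 0 < \<rho> \<and> ereal \<rho> < r \<and> 1 \<le> \<tau>}"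

definition degree_norm :: "nat \<Rightarrow> ('n::finite list \<Rightarrow> complex) \<Rightarrow> real" where
  "degree_norm d a = sqrt (\<Sum>\<alpha> | length \<alpha> = d. (cmod (a \<alpha>))\<^sup>2)"

definition ball_norm :: "real \<Rightarrow> ('n::finite list \<Rightarrow> complex) \<Rightarrow> real" where
  "ball_norm \<rho> a = suminf (\<lambda>d. degree_norm d a * \<rho> ^ d)"

definition ball_series :: "ereal \<Rightarrow> ('n::finite list \<Rightarrow> complex) set" where
  "ball_series r = {a. \<forall>\<rho>. 0 < \<rho> \<and> ereal \<rho> < r \<longrightarrow> summable (\<lambda>d. degree_norm d a * \<rho> ^ d)}"

definition ball_norms :: "ereal \<Rightarrow> (('n::finite list \<Rightarrow> complex) \<Rightarrow> real) set" where
  "ball_norms r = {ball_norm \<rho> |\<rho>. 0 < \<rho> \<and> ereal \<rho> < r}"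

text \<open>In what follows, \<open>F\<close> is the underlying set of an algebra of free power series and \<open>\<N>\<close> is a
  family of seminorms defining its topology.\<close>

definition holomorphic_series ::
    "('n list \<Rightarrow> complex) set \<Rightarrow> (('n list \<Rightarrow> complex) \<Rightarrow> real) set \<Rightarrow>
     (complex \<Rightarrow> 'n list \<Rightarrow> complex) set" where
  "holomorphic_series F \<N> = {f. range f \<subseteq> F \<and>
     (\<forall>z. \<exists>g\<in>F. \<forall>N\<in>\<N>. ((\<lambda>w. N (\<lambda>\<alpha>. (f w \<alpha> - f z \<alpha>) / (w - z) - g \<alpha>)) \<longlongrightarrow> 0) (at z))}"

definition hol_algebra ::
    "('n list \<Rightarrow> complex) set \<Rightarrow> (('n list \<Rightarrow> complex) \<Rightarrow> real) set \<Rightarrow>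
     (complex, complex \<Rightarrow> 'n list \<Rightarrow> complex) module" where
  "hol_algebra F \<N> = \<lparr>carrier = holomorphic_series F \<N>,
     mult = (\<lambda>f g z. word_mult (f z) (g z)), one = (\<lambda>z. word_basis []), zero = (\<lambda>z \<alpha>. 0),
     add = (\<lambda>f g z \<alpha>. f z \<alpha> + g z \<alpha>), smult = (\<lambda>c f z \<alpha>. c * f z \<alpha>)\<rparr>"

definition hol_topology ::
    "('n list \<Rightarrow> complex) set \<Rightarrow> (('n list \<Rightarrow> complex) \<Rightarrow> real) set \<Rightarrow>
     (complex \<Rightarrow> 'n list \<Rightarrow> complex) topology" where
  "hol_topology F \<N> = seminorm_topology (hol_algebra F \<N>)
     {\<lambda>f. SUP z\<in>K. N (f z) |K N. compact K \<and> K \<noteq> {} \<and> N \<in> \<N>}"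

definition closed_ideal_generated ::
    "(complex, 'a) module \<Rightarrow> 'a topology \<Rightarrow> 'a set \<Rightarrow> 'a set" where
  "closed_ideal_generated A T S = \<Inter>{I. ideal I A \<and> closedin T I \<and> S \<subseteq> I}"

definition quot_topology :: "(complex, 'a) module \<Rightarrow> 'a topology \<Rightarrow> 'a set \<Rightarrow> 'a set topology" where
  "quot_topology A T I = topology (\<lambda>S. S \<subseteq> carrier (alg_quot A I) \<and>
     openin T {u \<in> carrier A. I +>\<^bsub>A\<^esub> u \<in> S})"

definition def_ideal ::
    "('n::linorder list \<Rightarrow> complex) set \<Rightarrow> (('n list \<Rightarrow> complex) \<Rightarrow> real) set \<Rightarrow>
     (complex \<Rightarrow> 'n list \<Rightarrow> complex) set" where
  "def_ideal F \<N> = closed_ideal_generated (hol_algebra F \<N>) (hol_topology F \<N>)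
     {\<lambda>z. q_relation (exp (\<i> * z)) j k |j k. j < k}"

definition def_algebra ::
    "('n::linorder list \<Rightarrow> complex) set \<Rightarrow> (('n list \<Rightarrow> complex) \<Rightarrow> real) set \<Rightarrow>
     (complex, (complex \<Rightarrow> 'n list \<Rightarrow> complex) set) module" where
  "def_algebra F \<N> = alg_quot (hol_algebra F \<N>) (def_ideal F \<N>)"

definition def_topology ::
    "('n::linorder list \<Rightarrow> complex) set \<Rightarrow> (('n list \<Rightarrow> complex) \<Rightarrow> real) set \<Rightarrow>
     (complex \<Rightarrow> 'n list \<Rightarrow> complex) set topology" where
  "def_topology F \<N> = quot_topology (hol_algebra F \<N>) (hol_topology F \<N>) (def_ideal F \<N>)"

definition def_class ::
    "('n::linorder list \<Rightarrow> complex) set \<Rightarrow> (('n list \<Rightarrow> complex) \<Rightarrow> real) set \<Rightarrow>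
     (complex \<Rightarrow> 'n list \<Rightarrow> complex) \<Rightarrow> (complex \<Rightarrow> 'n list \<Rightarrow> complex) set" where
  "def_class F \<N> f = def_ideal F \<N> +>\<^bsub>hol_algebra F \<N>\<^esub> f"

text \<open>The closure of \<open>\<mm>\<^sub>h R\<close>, where \<open>\<mm>\<^sub>h R\<close> consists of the finite sums of products \<open>f \<cdot> [g] = [f g]\<close>
  with \<open>f\<close> an entire function vanishing at \<open>h\<close> and \<open>[g] \<in> R\<close>.\<close>

definition def_max_ideal ::
    "('n::linorder list \<Rightarrow> complex) set \<Rightarrow> (('n list \<Rightarrow> complex) \<Rightarrow> real) set \<Rightarrow> complex \<Rightarrow>
     (complex \<Rightarrow> 'n list \<Rightarrow> complex) set set" where
  "def_max_ideal F \<N> h = def_topology F \<N> closure_of generate (add_monoid (def_algebra F \<N>))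
     {def_class F \<N> (\<lambda>z \<alpha>. f z * g z \<alpha>) |f g.
        f holomorphic_on UNIV \<and> f h = 0 \<and> g \<in> carrier (hol_algebra F \<N>)}"

definition def_fiber ::
    "('n::linorder list \<Rightarrow> complex) set \<Rightarrow> (('n list \<Rightarrow> complex) \<Rightarrow> real) set \<Rightarrow> complex \<Rightarrow>
     (complex, (complex \<Rightarrow> 'n list \<Rightarrow> complex) set set) module" where
  "def_fiber F \<N> h = alg_quot (def_algebra F \<N>) (def_max_ideal F \<N> h)"

definition tagged :: "'x \<Rightarrow> (complex, 'a) module \<Rightarrow> (complex, 'x \<times> 'a) module" where
  "tagged x A = \<lparr>carrier = Pair x ` carrier A, mult = (\<lambda>u v. (x, snd u \<otimes>\<^bsub>A\<^esub> snd v)),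
     one = (x, \<one>\<^bsub>A\<^esub>), zero = (x, \<zero>\<^bsub>A\<^esub>), add = (\<lambda>u v. (x, snd u \<oplus>\<^bsub>A\<^esub> snd v)),
     smult = (\<lambda>c u. (x, c \<odot>\<^bsub>A\<^esub> snd u))\<rparr>"

type_synonym 'n def_point = "complex \<times> (complex \<Rightarrow> 'n list \<Rightarrow> complex) set set"

text \<open>The section \<open>h \<mapsto> u\<^sub>h\<close> determined by \<open>u \<in> R\<close>.\<close>

definition def_section ::
    "('n::linorder list \<Rightarrow> complex) set \<Rightarrow> (('n list \<Rightarrow> complex) \<Rightarrow> real) set \<Rightarrow>
     (complex \<Rightarrow> 'n list \<Rightarrow> complex) set \<Rightarrow> complex \<Rightarrow> 'n def_point" where
  "def_section F \<N> u h = (h, def_max_ideal F \<N> h +>\<^bsub>def_algebra F \<N>\<^esub> u)"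

text \<open>A point of \<open>R\<^sub>h\<close> is a coset in \<open>R\<close>; its quotient seminorm is the infimum over the coset.\<close>

definition quotient_seminorms ::
    "('n::linorder list \<Rightarrow> complex) set \<Rightarrow> (('n list \<Rightarrow> complex) \<Rightarrow> real) set \<Rightarrow>
     ('n def_point \<Rightarrow> real) set" where
  "quotient_seminorms F \<N> = {\<lambda>v. INF u\<in>snd v. N u |N. seminorm_on (def_algebra F \<N>) N \<and>
     continuous_map (def_topology F \<N>) euclideanreal N}"

definition def_total_topology ::
    "('n::linorder list \<Rightarrow> complex) set \<Rightarrow> (('n list \<Rightarrow> complex) \<Rightarrow> real) set \<Rightarrow>
     'n def_point topology" where
  "def_total_topology F \<N> = topology (arbitrary union_of (\<lambda>W. \<exists>V u Q \<epsilon>. open V \<and>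
     u \<in> carrier (def_algebra F \<N>) \<and> Q \<in> quotient_seminorms F \<N> \<and> 0 < \<epsilon> \<and>
     W = {(h, v) |h v. h \<in> V \<and> v \<in> carrier (def_fiber F \<N> h) \<and>
       Q ((h, v) \<ominus>\<^bsub>tagged h (def_fiber F \<N> h)\<^esub> def_section F \<N> u h) < \<epsilon>}))"

text \<open>\<open>unif_of_seminorms\<close> does not use the field \<open>unif\<close>, which is therefore first filled with a
  placeholder.\<close>

definition def_bundle ::
    "('n::linorder list \<Rightarrow> complex) set \<Rightarrow> (('n list \<Rightarrow> complex) \<Rightarrow> real) set \<Rightarrow>
     (complex, 'n def_point) bundle_data" where
  "def_bundle F \<N> =
     (let E = \<lparr>base = top_of_set UNIV, total = def_total_topology F \<N>, proj = fst,
               fib = (\<lambda>h. tagged h (def_fiber F \<N> h)), unif = {}\<rparr>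
      in E\<lparr>unif := unif_of_seminorms E (quotient_seminorms F \<N>)\<rparr>)"

text \<open>The bundle satisfies the hypotheses of the deformation theorem over the whole complex plane,
  the embedded generators \<open>x\<^sub>j\<close> being the classes of the free generators.\<close>

definition def_bundle_hypotheses ::
    "('n::{finite, linorder} list \<Rightarrow> complex) set \<Rightarrow> (('n list \<Rightarrow> complex) \<Rightarrow> real) set \<Rightarrow> bool" where
  "def_bundle_hypotheses F \<N> \<longleftrightarrow>
     frechet_algebra_bundle (def_bundle F \<N>) \<and> continuous_bundle (def_bundle F \<N>) \<and>
     (\<exists>\<iota>. contains_qreg (def_bundle F \<N>) \<iota> \<and>
        (\<forall>h j. \<iota> h (qreg_var (exp (\<i> * h)) j) =
           def_section F \<N> (def_class F \<N> (\<lambda>z. word_basis [j])) h))"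

end

theory Submission
  imports Defs "HOL-Combinatorics.Multiset_Permutations"
begin

text \<open>Sorting a word with \<open>x\<^sub>k x\<^sub>j = q\<^sup>-\<^sup>1 x\<^sub>j x\<^sub>k\<close> (\<open>j < k\<close>) costs the factor \<open>q ^ (- inversions w)\<close>.
  Hence an element of the free algebra lies in the ideal of the relations iff its coefficients,
  collected after sorting, all vanish. For monomials this gives
  \<open>x\<^sup>k x\<^sup>l = q ^ (- c k l) x\<^sup>k\<^sup>+\<^sup>l\<close> with \<open>c k l = (\<Sum>i<j. k\<^sub>j l\<^sub>i)\<close>, while
  \<open>{x\<^sup>k, x\<^sup>l} = (c l k - c k l) x\<^sup>k\<^sup>+\<^sup>l\<close>; so the deformation condition is the derivative of
  \<open>exp (- i h c)\<close> at \<open>0\<close>, multiplied by a continuous section.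

  The sorted coefficients also make sense for the power series in \<open>F\<close>. Their joint kernel at
  \<open>q = exp (i h)\<close> turns out to be the kernel of \<open>F \<rightarrow> R\<^sub>h\<close>, so that \<open>R\<^sub>h\<close> is a quotient of the fixed
  space \<open>F\<close>. The diagonal operator with entries \<open>exp (i (h' - h) inversions w)\<close> carries the kernel at
  \<open>h\<close> to that at \<open>h'\<close> and is close to the identity on bounded degrees, which makes the quotient norm of
  a fixed series continuous in \<open>h\<close>. These norms, cut off outside compact sets, define the
  same topology and the same uniform structure as the quotient seminorms of \<open>R\<close>, and they are continuous along
  the sections coming from \<open>R\<close>.\<close>

section \<open>Complex algebras and their quotients\<close>

text \<open>The ideals behind \<open>R\<close> and its fibers are given only as closures, so they
  are determined by squeezing. The families whose sorted coefficients vanish at \<open>h\<close>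
  form a closed ideal containing the relations, which bounds the kernel from above. Conversely, a
  truncation of such a family reduces, modulo the relations, to finitely many sorted words whose
  coefficients are entire functions of the parameter vanishing at \<open>h\<close>; truncations
  converge uniformly on compact sets, so the closure exhausts the upper bound. The other obstacle is
  that a quotient seminorm is easily seen to be upper semicontinuous along a section, but not lower
  semicontinuous. The diagonal operator that compares two fibers is estimated on bounded degrees
  only, because the number of inversions may grow like the square of the degree. This suffices,
  since the error of a truncation is bounded independently of \<open>h\<close>.\<close>

lemma complex_ring_simps [simp]:
  "carrier complex_ring = UNIV" "a \<otimes>\<^bsub>complex_ring\<^esub> b = a * b" "\<one>\<^bsub>complex_ring\<^esub> = 1"
  "\<zero>\<^bsub>complex_ring\<^esub> = 0" "a \<oplus>\<^bsub>complex_ring\<^esub> b = a + b"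
  by (auto simp: complex_ring_def)

lemma cring_complex_ring: "cring complex_ring"
proof (rule cringI)
  show "abelian_group complex_ring"
    by (rule abelian_groupI) (auto simp: algebra_simps intro: exI[of _ "- x" for x])
  show "comm_monoid complex_ring"
    by unfold_locales (auto simp: algebra_simps)
qed (auto simp: algebra_simps)

text \<open>The module axioms are written out with complex scalars instead of being imported from
  \<open>module complex_ring A\<close>, so that the rules mention neither
  \<open>complex_ring\<close> nor its carrier. \<open>complex_vs\<close> recovers the
  module.\<close>

locale calg = ring A for A :: "(complex, 'a) module" (structure) +
  assumes smult_closed [simp, intro]: "x \<in> carrier A \<Longrightarrow> c \<odot> x \<in> carrier A"
    and smult_l_distr: "x \<in> carrier A \<Longrightarrow> (a + b) \<odot> x = a \<odot> x \<oplus> b \<odot> x"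
    and smult_r_distr: "x \<in> carrier A \<Longrightarrow> y \<in> carrier A \<Longrightarrow> a \<odot> (x \<oplus> y) = a \<odot> x \<oplus> a \<odot> y"
    and smult_assoc: "x \<in> carrier A \<Longrightarrow> (a * b) \<odot> x = a \<odot> (b \<odot> x)"
    and smult_one [simp]: "x \<in> carrier A \<Longrightarrow> 1 \<odot> x = x"
    and smult_mult_l: "x \<in> carrier A \<Longrightarrow> y \<in> carrier A \<Longrightarrow> (c \<odot> x) \<otimes> y = c \<odot> (x \<otimes> y)"
    and smult_mult_r: "x \<in> carrier A \<Longrightarrow> y \<in> carrier A \<Longrightarrow> x \<otimes> (c \<odot> y) = c \<odot> (x \<otimes> y)"
begin

lemma complex_vs: "complex_vs A"
  by (rule moduleI)
    (auto simp: cring_complex_ring smult_l_distr smult_r_distr smult_assoc abelian_group_axioms)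

lemma smult_zero_l [simp]: "x \<in> carrier A \<Longrightarrow> 0 \<odot> x = \<zero>"
  using module.smult_l_null[OF complex_vs] by simp

lemma smult_zero_r [simp]: "c \<odot> \<zero> = \<zero>"
  using module.smult_r_null[OF complex_vs] by simp

lemma smult_minus_one: "x \<in> carrier A \<Longrightarrow> (-1) \<odot> x = \<ominus> x"
proof -
  assume x: "x \<in> carrier A"
  have "(-1) \<odot> x \<oplus> x = \<zero>"
    using smult_l_distr[OF x, of "-1" 1] x by simp
  then show ?thesis
    using x by (simp add: minus_equality)
qed

lemma minus_conv_smult: "x \<in> carrier A \<Longrightarrow> y \<in> carrier A \<Longrightarrow> x \<ominus> y = x \<oplus> (-1) \<odot> y"
  by (simp add: a_minus_def smult_minus_one)

text \<open>Turns scalars into ring elements, so that ring ideals are automatically linear subspaces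
  (\<open>smult_mem\<close>).\<close>

lemma smult_conv_mult: "x \<in> carrier A \<Longrightarrow> c \<odot> x = (c \<odot> \<one>) \<otimes> x"
  by (simp add: smult_mult_l)

lemma smult_minus_r: "x \<in> carrier A \<Longrightarrow> y \<in> carrier A \<Longrightarrow> c \<odot> (x \<ominus> y) = c \<odot> x \<ominus> c \<odot> y"
  by (simp add: minus_conv_smult smult_r_distr smult_assoc[symmetric] mult.commute)

lemma smult_finsum:
  "finite S \<Longrightarrow> (\<And>i. i \<in> S \<Longrightarrow> f i \<in> carrier A) \<Longrightarrow>
    c \<odot> finsum A f S = finsum A (\<lambda>i. c \<odot> f i) S"
  by (induction S rule: finite_induct) (auto simp: smult_r_distr)

lemma idealI:
  assumes "I \<subseteq> carrier A" "\<zero> \<in> I"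
    and "\<And>x y. x \<in> I \<Longrightarrow> y \<in> I \<Longrightarrow> x \<oplus> y \<in> I"
    and l: "\<And>x y. x \<in> I \<Longrightarrow> y \<in> carrier A \<Longrightarrow> y \<otimes> x \<in> I"
    and "\<And>x y. x \<in> I \<Longrightarrow> y \<in> carrier A \<Longrightarrow> x \<otimes> y \<in> I"
  shows "ideal I A"
proof (rule Ideal.idealI[OF ring_axioms])
  show "subgroup I (add_monoid A)"
  proof (rule add.subgroupI)
    fix x assume x: "x \<in> I"
    \<comment> \<open>Closure under negatives comes from absorption, since
      \<open>\<ominus> x\<close> is the product of the scalar \<open>-1\<close>, as a ring element,
      with \<open>x\<close>.\<close>
    then have "((-1) \<odot> \<one>) \<otimes> x \<in> I"
      by (rule l) simp
    moreover have "((-1) \<odot> \<one>) \<otimes> x = \<ominus> x"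
      using x assms(1) smult_minus_one smult_mult_l[of \<one> x "-1"] by (simp add: subset_iff)
    ultimately show "\<ominus> x \<in> I"
      by simp
  qed (use assms in auto)
qed (use assms in auto)

end

lemma complex_algebra_iff_calg: "complex_algebra A \<longleftrightarrow> calg A"
proof
  assume A: "complex_algebra A"
  then interpret module complex_ring A
    by (simp add: complex_algebra_def)
  interpret ring A
    using A by (simp add: complex_algebra_def)
  show "calg A"
    by unfold_locales
      (use A smult_closed smult_l_distr smult_r_distr smult_assoc1 smult_one
        in \<open>auto simp: complex_algebra_def\<close>)
next
  assume "calg A"
  then interpret calg A .
  show "complex_algebra A"
    by (simp add: complex_algebra_def complex_vs ring_axioms smult_mult_l smult_mult_r)
qed

locale calg_ideal = calg A + ideal I A for I and A (structure)
begin

abbreviation cls where "cls x \<equiv> I +> x"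

lemma carrier_quot: "carrier (alg_quot A I) = cls ` carrier A"
  by (auto simp: alg_quot_def ring.defs FactRing_simps)

lemma cls_closed [simp]: "x \<in> carrier A \<Longrightarrow> cls x \<in> carrier (alg_quot A I)"
  by (simp add: carrier_quot)

lemma zero_quot: "\<zero>\<^bsub>alg_quot A I\<^esub> = cls \<zero>"
  using a_rcos_zero[OF ideal_axioms] by (simp add: alg_quot_def ring.defs FactRing_def)

lemma one_quot: "\<one>\<^bsub>alg_quot A I\<^esub> = cls \<one>"
  by (simp add: alg_quot_def ring.defs FactRing_def)

lemma add_quot: "x \<in> carrier A \<Longrightarrow> y \<in> carrier A \<Longrightarrow>
    cls x \<oplus>\<^bsub>alg_quot A I\<^esub> cls y = cls (x \<oplus> y)"
  by (simp add: alg_quot_def ring.defs FactRing_def a_rcos_sum)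

lemma mult_quot: "x \<in> carrier A \<Longrightarrow> y \<in> carrier A \<Longrightarrow>
    cls x \<otimes>\<^bsub>alg_quot A I\<^esub> cls y = cls (x \<otimes> y)"
  by (simp add: alg_quot_def ring.defs FactRing_def rcoset_mult_add)

lemma cls_eq_iff:
  assumes "x \<in> carrier A" "y \<in> carrier A"
  shows "cls x = cls y \<longleftrightarrow> x \<ominus> y \<in> I"
proof -
  have "cls x = cls y \<longleftrightarrow> x \<in> cls y"
    using assms a_repr_independence' a_repr_independenceD a_rcos_self by metis
  then show ?thesis
    using a_rcos_module_minus[OF ring_axioms assms(2) assms(1)] by simp
qed

lemma cls_eq_zero_iff: "x \<in> carrier A \<Longrightarrow> cls x = cls \<zero> \<longleftrightarrow> x \<in> I"
  by (simp add: cls_eq_iff a_minus_def)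

lemma mem_cls_iff: "x \<in> carrier A \<Longrightarrow> y \<in> cls x \<longleftrightarrow> y \<in> carrier A \<and> cls y = cls x"
  using a_repr_independence' a_rcos_self a_r_coset_subset_G[OF a_subset] by (metis subsetD)

lemma smult_mem: "x \<in> I \<Longrightarrow> c \<odot> x \<in> I"
  using I_l_closed[of x "c \<odot> \<one>"] smult_conv_mult[of x c] a_subset by auto

text \<open>The union in \<open>alg_quot\<close> runs over copies of one coset: the multiples by
  \<open>c\<close> of two representatives differ by an element of the subspace
  \<open>I\<close>.\<close>

lemma smult_quot: "x \<in> carrier A \<Longrightarrow> c \<odot>\<^bsub>alg_quot A I\<^esub> cls x = cls (c \<odot> x)"
proof -
  assume x: "x \<in> carrier A"
  have "cls (c \<odot> u) = cls (c \<odot> x)" if "u \<in> cls x" for u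
  proof -
    have u: "u \<in> carrier A" "u \<ominus> x \<in> I"
      using that x by (auto simp: mem_cls_iff cls_eq_iff)
    then show ?thesis
      using x smult_mem[of "u \<ominus> x" c] by (simp add: cls_eq_iff smult_minus_r)
  qed
  moreover have "x \<in> cls x"
    using x by (rule a_rcos_self)
  ultimately have "(\<Union>u\<in>cls x. cls (c \<odot> u)) = cls (c \<odot> x)"
    by blast
  then show ?thesis
    by (simp add: alg_quot_def ring.defs module.defs)
qed

text \<open>\<open>alg_quot A I\<close> extends the record \<open>A Quot I\<close> by a scalar
  multiplication and so has another type; the axioms are transferred through the equality of the
  ring fields.\<close>

lemma ring_quot: "ring (alg_quot A I)"
proof -
  interpret Q: ring "A Quot I"
    by (rule quotient_is_ring)
  have eq: "carrier (alg_quot A I) = carrier (A Quot I)" "mult (alg_quot A I) = mult (A Quot I)"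
    "one (alg_quot A I) = one (A Quot I)" "zero (alg_quot A I) = zero (A Quot I)"
    "add (alg_quot A I) = add (A Quot I)"
    by (simp_all add: alg_quot_def ring.defs)
  show ?thesis
  proof (rule ringI)
    show "abelian_group (alg_quot A I)"
      by (rule abelian_groupI)
        (auto simp: eq Q.a_ac intro: Q.l_neg bexI[of _ "\<ominus>\<^bsub>A Quot I\<^esub> x" for x])
    show "Group.monoid (alg_quot A I)"
      by (rule monoidI) (auto simp: eq Q.m_assoc)
  qed (auto simp: eq Q.l_distr Q.r_distr)
qed

lemma calg_quot: "calg (alg_quot A I)"
proof -
  interpret Q: ring "alg_quot A I"
    by (rule ring_quot)
  show ?thesis
    by unfold_locales
      (auto simp: carrier_quot smult_quot add_quot mult_quot smult_l_distr smult_r_distr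
        smult_assoc smult_mult_l smult_mult_r)
qed

lemma minus_quot: "x \<in> carrier A \<Longrightarrow> y \<in> carrier A \<Longrightarrow>
    cls x \<ominus>\<^bsub>alg_quot A I\<^esub> cls y = cls (x \<ominus> y)"
  using calg.minus_conv_smult[OF calg_quot, of "cls x" "cls y"]
  by (simp add: smult_quot add_quot minus_conv_smult)

lemma finsum_quot: "finite S \<Longrightarrow> (\<And>i. i \<in> S \<Longrightarrow> f i \<in> carrier A) \<Longrightarrow>
    finsum (alg_quot A I) (\<lambda>i. cls (f i)) S = cls (finsum A f S)"
proof (induction S rule: finite_induct)
  interpret Q: ring "alg_quot A I"
    by (rule ring_quot)
  case empty
  show ?case
    by (simp add: zero_quot)
next
  interpret Q: ring "alg_quot A I"
    by (rule ring_quot)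
  case (insert i S)
  then show ?case
    by (subst Q.finsum_insert) (auto simp: add_quot)
qed

end

section \<open>Words and normal ordering\<close>

lemma word_mult_Nil: "word_mult a b [] = a [] * b []"
  by (simp add: word_mult_def)

text \<open>Separates the cut before the first letter from all others. This recursion lets
  identities for the convolution, such as associativity, be proved by induction on the word.\<close>

lemma word_mult_Cons: "word_mult a b (x # w) = a [] * b (x # w) + word_mult (\<lambda>u. a (x # u)) b w"
  by (simp add: word_mult_def atMost_Suc_eq_insert_0 sum.reindex image_Suc_atMost[symmetric] del: sum.atMost_Suc)

lemma word_mult_add_left: "word_mult (\<lambda>w. a w + a' w) b = (\<lambda>w. word_mult a b w + word_mult a' b w)"
  by (simp add: word_mult_def algebra_simps sum.distrib)

lemma word_mult_add_right: "word_mult a (\<lambda>w. b w + b' w) = (\<lambda>w. word_mult a b w + word_mult a b' w)"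
  by (simp add: word_mult_def algebra_simps sum.distrib)

lemma word_mult_diff_right: "word_mult a (\<lambda>w. b w - b' w) = (\<lambda>w. word_mult a b w - word_mult a b' w)"
  by (simp add: word_mult_def algebra_simps sum_subtractf)

lemma word_mult_smult_left: "word_mult (\<lambda>w. c * a w) b = (\<lambda>w. c * word_mult a b w)"
  by (simp add: word_mult_def algebra_simps sum_distrib_left)

lemma word_mult_smult_right: "word_mult a (\<lambda>w. c * b w) = (\<lambda>w. c * word_mult a b w)"
  by (simp add: word_mult_def algebra_simps sum_distrib_left)

lemma word_mult_assoc: "word_mult (word_mult a b) c = word_mult a (word_mult b c)"
proof
  show "word_mult (word_mult a b) c w = word_mult a (word_mult b c) w" for w
    by (induction w arbitrary: a b)
      (simp_all add: word_mult_Nil word_mult_Cons word_mult_add_left word_mult_smult_left algebra_simps)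
qed

lemma word_mult_basis: "word_mult (word_basis u) (word_basis v) = word_basis (u @ v)"
proof
  fix w
  have "word_basis u (take d w) * word_basis v (drop d w) =
      (if d = length u then if w = u @ v then 1 else 0 else 0)" if "d \<le> length w" for d
  proof -
    have *: "word_basis u x * word_basis v y = (if x = u \<and> y = v then 1 else 0)" for x y
      by (simp add: word_basis_def)
    have **: "take d w = u \<and> drop d w = v \<longleftrightarrow> d = length u \<and> w = u @ v"
      using that by (metis append_eq_conv_conj append_take_drop_id length_take min.absorb2)
    show ?thesis
      unfolding * ** by simp
  qed
  then have "word_mult (word_basis u) (word_basis v) w =
      (\<Sum>d\<le>length w. if d = length u then if w = u @ v then 1 else 0 else 0)"
    unfolding word_mult_def by (intro sum.cong) auto
  then show "word_mult (word_basis u) (word_basis v) w = word_basis (u @ v) w"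
    by (auto simp: word_basis_def)
qed

lemma word_mult_one_left [simp]: "word_mult (word_basis []) a = a"
proof
  show "word_mult (word_basis []) a w = a w" for w
    by (cases w) (simp_all add: word_mult_Nil word_mult_Cons word_basis_def, simp add: word_mult_def)
qed

lemma word_mult_one_right [simp]: "word_mult a (word_basis []) = a"
proof
  show "word_mult a (word_basis []) w = a w" for w
    by (induction w arbitrary: a) (simp_all add: word_mult_Nil word_mult_Cons word_basis_def)
qed

lemma word_mult_zero [simp]: "word_mult (\<lambda>w. 0) a = (\<lambda>w. 0)" "word_mult a (\<lambda>w. 0) = (\<lambda>w. 0)"
  by (simp_all add: word_mult_def)

lemma finite_support_word_mult:
  assumes "finite {w. a w \<noteq> 0}" "finite {w. b w \<noteq> 0}"
  shows "finite {w. word_mult a b w \<noteq> 0}"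
proof (rule finite_subset)
  show "{w. word_mult a b w \<noteq> 0} \<subseteq> (\<lambda>(u, v). u @ v) ` ({w. a w \<noteq> 0} \<times> {w. b w \<noteq> 0})"
  proof
    fix w assume "w \<in> {w. word_mult a b w \<noteq> 0}"
    then obtain d where "a (take d w) * b (drop d w) \<noteq> 0"
      unfolding word_mult_def using sum.neutral by (metis (mono_tags, lifting) mem_Collect_eq)
    then show "w \<in> (\<lambda>(u, v). u @ v) ` ({w. a w \<noteq> 0} \<times> {w. b w \<noteq> 0})"
      by (intro rev_image_eqI[of "(take d w, drop d w)"]) auto
  qed
qed (use assms in auto)

lemma finite_support_basis: "finite {w. word_basis u w \<noteq> 0}"
  by (rule finite_subset[of _ "{u}"]) (auto simp: word_basis_def)

lemma finite_support_induct [consumes 1, case_names zero add]: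
  fixes a :: "'b \<Rightarrow> complex"
  assumes "finite {w. a w \<noteq> 0}" and "P (\<lambda>w. 0)"
    and "\<And>a u c. finite {w. a w \<noteq> 0} \<Longrightarrow> P a \<Longrightarrow> P (\<lambda>w. a w + c * (if w = u then 1 else 0))"
  shows "P a"
proof -
  have "P a" if "finite S" "{w. a w \<noteq> 0} \<subseteq> S" for S a
    using that
  proof (induction S arbitrary: a rule: finite_induct)
    case empty
    then have "a = (\<lambda>w. 0)"
      by auto
    then show ?case
      using assms(2) by simp
  next
    case (insert u S)
    define b where "b = a(u := 0)"
    have b: "{w. b w \<noteq> 0} \<subseteq> S"
      using insert by (auto simp: b_def)
    have "P (\<lambda>w. b w + a u * (if w = u then 1 else 0))"
      using finite_subset[OF b insert(1)] insert.IH[OF b] by (rule assms(3))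
    also have "(\<lambda>w. b w + a u * (if w = u then 1 else 0)) = a"
      by (auto simp: b_def)
    finally show ?case .
  qed
  then show ?thesis
    using assms(1) by blast
qed

section \<open>The free algebra\<close>

lemma free_algebra_simps [simp]:
  "carrier free_algebra = {a. finite {w. a w \<noteq> 0}}"
  "a \<otimes>\<^bsub>free_algebra\<^esub> b = word_mult a b" "\<one>\<^bsub>free_algebra\<^esub> = word_basis []"
  "\<zero>\<^bsub>free_algebra\<^esub> = (\<lambda>w. 0)" "a \<oplus>\<^bsub>free_algebra\<^esub> b = (\<lambda>w. a w + b w)"
  "c \<odot>\<^bsub>free_algebra\<^esub> a = (\<lambda>w. c * a w)"
  by (auto simp: free_algebra_def)

lemma finite_support_add:
  fixes a b :: "'b \<Rightarrow> complex"
  shows "finite {w. a w \<noteq> 0} \<Longrightarrow> finite {w. b w \<noteq> 0} \<Longrightarrow> finite {w. a w + b w \<noteq> 0}"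
  by (rule finite_subset[of _ "{w. a w \<noteq> 0} \<union> {w. b w \<noteq> 0}"]) auto

lemma finite_support_smult:
  fixes a :: "'b \<Rightarrow> complex"
  shows "finite {w. a w \<noteq> 0} \<Longrightarrow> finite {w. c * a w \<noteq> 0}"
  by (rule finite_subset[of _ "{w. a w \<noteq> 0}"]) auto

interpretation free_algebra: calg free_algebra
proof -
  have "ring free_algebra"
  proof (rule ringI)
    show "abelian_group free_algebra"
    proof (rule abelian_groupI)
      fix a :: "'n list \<Rightarrow> complex" assume "a \<in> carrier free_algebra"
      then show "\<exists>b\<in>carrier free_algebra. b \<oplus>\<^bsub>free_algebra\<^esub> a = \<zero>\<^bsub>free_algebra\<^esub>"
        by (intro bexI[of _ "\<lambda>w. - a w"]) auto
    qed (auto simp: finite_support_add algebra_simps)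
    show "Group.monoid free_algebra"
      by (rule monoidI)
        (auto simp: word_mult_assoc finite_support_word_mult finite_support_basis)
  qed (auto simp: word_mult_add_left word_mult_add_right)
  then interpret ring free_algebra .
  show "calg free_algebra"
    by unfold_locales
      (auto simp: finite_support_smult[simplified] algebra_simps word_mult_smult_left word_mult_smult_right)
qed

section \<open>Inversions and sorted coefficients\<close>

fun inversions :: "'n::linorder list \<Rightarrow> nat" where
  "inversions [] = 0"
| "inversions (a # w) = length (filter (\<lambda>b. b < a) w) + inversions w"

text \<open>The inversions between a block of letters \<open>M\<close> and a later block
  \<open>N\<close>. They depend only on the contents of the blocks, which is why the sorted
  coefficients of a product are determined by those of its factors.\<close>

definition cross_inversions :: "'n::linorder multiset \<Rightarrow> 'n multiset \<Rightarrow> nat" where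
  "cross_inversions M N = (\<Sum>a\<in>#M. size {#b \<in># N. b < a#})"

lemma inversions_append:
  "inversions (u @ v) = inversions u + inversions v + cross_inversions (mset u) (mset v)"
  by (induction u) (auto simp: cross_inversions_def simp flip: mset_filter)

lemma inversions_sorted: "sorted w \<Longrightarrow> inversions w = 0"
  by (induction w) (auto simp: filter_empty_conv)

text \<open>Turns a bound on the degree into a bound on the exponents, as used in
  \<open>nrm_perturb\<close>.\<close>

lemma inversions_le: "inversions w \<le> (length w)\<^sup>2"
proof (induction w)
  case (Cons a w)
  have "length (filter (\<lambda>b. b < a) w) \<le> length w"
    by simp
  then have "inversions (a # w) \<le> length w + (length w)\<^sup>2"
    using Cons by (simp only: inversions.simps add_mono)
  then show ?case
    by (simp add: power2_eq_square)
qed auto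

text \<open>The element \<open>c\<close> plays the part of \<open>inverse q\<close> but is only
  assumed to commute with the words. This covers \<open>qreg\<close>, where it is a scalar, as well
  as the deformation algebra, where it is the class of the nonconstant function
  \<open>exp (- (\<i> * z))\<close>.\<close>

lemma (in ring) normal_ordering:
  fixes y :: "'n::linorder list \<Rightarrow> 'a"
  assumes y: "\<And>u. y u \<in> carrier R" "\<And>u v. y (u @ v) = y u \<otimes> y v" "y [] = \<one>"
    and c: "c \<in> carrier R" "\<And>u. c \<otimes> y u = y u \<otimes> c"
    and rel: "\<And>j k. j < k \<Longrightarrow> y [k, j] = c \<otimes> y [j, k]"
  shows "y w = c [^] inversions w \<otimes> y (sort w)"
proof -
  have Cons': "y (a # w) = y [a] \<otimes> y w" for a w
    using y(2)[of "[a]" w] by simp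
  have cpow: "c [^] (m::nat) \<otimes> y u = y u \<otimes> c [^] m" for m u
    using c(1) y(1)[of u] c(2)[of u] by (induction m) (simp_all add: m_assoc, simp flip: m_assoc)
  have swap: "y u \<otimes> (c [^] (m::nat) \<otimes> x) = c [^] m \<otimes> (y u \<otimes> x)" if "x \<in> carrier R" for m u x
    using that c(1) y(1) cpow[of m u] by (simp flip: m_assoc)
  \<comment> \<open>One pass of insertion sort: \<open>a\<close> moves past the letters of
    \<open>s\<close> that are smaller and picks up one factor \<open>c\<close> for each.\<close>
  have insort: "y (a # s) = c [^] length (filter (\<lambda>b. b < a) s) \<otimes> y (insort a s)" if "sorted s" for a s
    using that
  proof (induction s)
    case Nil
    then show ?case using y by simp
  next
    case (Cons b s)
    show ?case
    proof (cases "a \<le> b")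
      case True
      then have "length (filter (\<lambda>b. b < a) (b # s)) = 0"
        using Cons.prems by (auto simp: filter_empty_conv)
      then show ?thesis
        using True y by (simp del: filter.simps)
    next
      case False
      let ?m = "length (filter (\<lambda>b. b < a) s)"
      have "y (a # b # s) = y [a, b] \<otimes> y s"
        using y(2)[of "[a, b]" s] by simp
      also have "\<dots> = c \<otimes> y ([b] @ a # s)"
      proof -
        have "y ([b] @ a # s) = y [b, a] \<otimes> y s"
          using y(2)[of "[b, a]" s] by simp
        then show ?thesis
          using rel[of b a] False y(1) c(1) by (simp add: m_assoc)
      qed
      also have "\<dots> = c \<otimes> (y [b] \<otimes> (c [^] ?m \<otimes> y (insort a s)))"
        using Cons by (simp add: y(2) del: append.simps)
      also have "\<dots> = c \<otimes> c [^] ?m \<otimes> y (b # insort a s)"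
        using y(1) c(1) Cons'[of b "insort a s"] by (simp add: swap m_assoc)
      also have "c \<otimes> c [^] ?m = c [^] Suc ?m"
        by (simp only: nat_pow_Suc2[OF c(1)])
      finally show ?thesis
        using False not_le_imp_less[OF False] by simp
    qed
  qed
  show ?thesis
  proof (induction w)
    case Nil
    then show ?case using y by simp
  next
    case (Cons a w)
    let ?m = "length (filter (\<lambda>b. b < a) w)"
    \<comment> \<open>Sorting the tail first does not change the number of its letters below
      \<open>a\<close>, so this count is the one in \<open>inversions\<close>.\<close>
    have m: "length (filter (\<lambda>b. b < a) (sort w)) = ?m"
      by (metis mset_filter mset_sort size_mset)
    have "y (a # w) = y [a] \<otimes> (c [^] inversions w \<otimes> y (sort w))"
      using Cons.IH Cons'[of a w] by simp
    also have "\<dots> = c [^] inversions w \<otimes> y (a # sort w)"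
      using Cons'[of a "sort w"] y c cpow[of "inversions w" "[a]"]
      by (simp add: m_assoc[symmetric])
    also have "\<dots> = c [^] inversions w \<otimes> (c [^] ?m \<otimes> y (sort (a # w)))"
      using insort[of "sort w" a] m by simp
    also have "\<dots> = c [^] (inversions w + ?m) \<otimes> y (sort (a # w))"
      using y c by (simp add: m_assoc[symmetric] nat_pow_mult)
    finally show ?case
      by (simp add: add.commute)
  qed
qed

lemma finite_mset_eq [simp]: "finite {w. mset w = M}"
  using finite_permutations_of_multiset[of M] by (simp add: permutations_of_multiset_def)

text \<open>Only finitely many words have content \<open>M\<close>, so the sum makes sense for every
  function on words, in particular for infinite power series.\<close>

definition normal_coeff :: "complex \<Rightarrow> ('n::linorder list \<Rightarrow> complex) \<Rightarrow> 'n multiset \<Rightarrow> complex" where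
  "normal_coeff q a M = (\<Sum>w | mset w = M. a w * inverse q ^ inversions w)"

lemma normal_coeff_add: "normal_coeff q (\<lambda>w. a w + b w) M = normal_coeff q a M + normal_coeff q b M"
  by (simp add: normal_coeff_def algebra_simps sum.distrib)

lemma normal_coeff_diff: "normal_coeff q (\<lambda>w. a w - b w) M = normal_coeff q a M - normal_coeff q b M"
  by (simp add: normal_coeff_def algebra_simps sum_subtractf)

lemma normal_coeff_smult: "normal_coeff q (\<lambda>w. c * a w) M = c * normal_coeff q a M"
  by (simp add: normal_coeff_def algebra_simps sum_distrib_left)

lemma normal_coeff_zero [simp]: "normal_coeff q (\<lambda>w. 0) M = 0"
  by (simp add: normal_coeff_def)

lemma normal_coeff_basis:
  "normal_coeff q (word_basis u) M = (if M = mset u then inverse q ^ inversions u else 0)"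
proof -
  have "normal_coeff q (word_basis u) M =
      (\<Sum>w | mset w = M. if w = u then inverse q ^ inversions u else 0)"
    unfolding normal_coeff_def by (intro sum.cong) (auto simp: word_basis_def)
  then show ?thesis
    by auto
qed

text \<open>A word of content \<open>M\<close> with a cutting position is the same as a sub-multiset
  \<open>N\<close> together with a word of content \<open>N\<close> and one of content
  \<open>M - N\<close>; the exponent splits by \<open>inversions_append\<close>. As a consequence
  the common kernel of the coefficients is an ideal, also among power series.\<close>

lemma normal_coeff_word_mult:
  "normal_coeff q (word_mult a b) M =
    (\<Sum>N | N \<subseteq># M. inverse q ^ cross_inversions N (M - N) * normal_coeff q a N * normal_coeff q b (M - N))"
proof -
  let ?g = "\<lambda>u v. a u * b v * inverse q ^ inversions (u @ v)"
  have fin: "finite {N. N \<subseteq># M}"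
  proof (rule finite_subset)
    show "{N. N \<subseteq># M} \<subseteq> mset ` {w. set w \<subseteq> set_mset M \<and> length w \<le> size M}"
    proof
      fix N assume "N \<in> {N. N \<subseteq># M}"
      moreover obtain w where "N = mset w"
        by (metis ex_mset)
      ultimately show "N \<in> mset ` {w. set w \<subseteq> set_mset M \<and> length w \<le> size M}"
        using set_mset_mono[of N M] size_mset_mono[of N M] by auto
    qed
  qed (simp add: finite_lists_length_le)
  have "normal_coeff q (word_mult a b) M =
      (\<Sum>w | mset w = M. \<Sum>d\<le>length w. ?g (take d w) (drop d w))"
    by (simp add: normal_coeff_def word_mult_def sum_distrib_right)
  also have "\<dots> = (\<Sum>(w, d)\<in>Sigma {w. mset w = M} (\<lambda>w. {..length w}). ?g (take d w) (drop d w))"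
    by (subst sum.Sigma) auto
  also have "\<dots> = (\<Sum>(u, v) | mset u + mset v = M. ?g u v)"
    by (rule sum.reindex_bij_witness[where j = "\<lambda>(w, d). (take d w, drop d w)"
          and i = "\<lambda>(u, v). (u @ v, length u)"])
      (auto simp flip: mset_append)
  also have "\<dots> = (\<Sum>(N, u, v)\<in>Sigma {N. N \<subseteq># M} (\<lambda>N. {u. mset u = N} \<times> {v. mset v = M - N}). ?g u v)"
    by (rule sum.reindex_bij_witness[where j = "\<lambda>(u, v). (mset u, u, v)"
          and i = "\<lambda>(N, u, v). (u, v)"]) auto
  also have "\<dots> = (\<Sum>N | N \<subseteq># M. \<Sum>(u, v)\<in>{u. mset u = N} \<times> {v. mset v = M - N}. ?g u v)"
    by (subst sum.Sigma) (auto simp: fin case_prod_beta)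
  also have "\<dots> = (\<Sum>N | N \<subseteq># M. \<Sum>u | mset u = N. \<Sum>v | mset v = M - N. ?g u v)"
    by (intro sum.cong refl) (simp add: sum.cartesian_product)
  also have "\<dots> = (\<Sum>N | N \<subseteq># M. \<Sum>u | mset u = N. \<Sum>v | mset v = M - N.
      inverse q ^ cross_inversions N (M - N) *
      ((a u * inverse q ^ inversions u) * (b v * inverse q ^ inversions v)))"
    by (intro sum.cong refl) (auto simp: inversions_append power_add)
  also have "\<dots> = (\<Sum>N | N \<subseteq># M. inverse q ^ cross_inversions N (M - N) *
      normal_coeff q a N * normal_coeff q b (M - N))"
  proof (intro sum.cong refl)
    fix N
    show "(\<Sum>u | mset u = N. \<Sum>v | mset v = M - N. inverse q ^ cross_inversions N (M - N) *
        ((a u * inverse q ^ inversions u) * (b v * inverse q ^ inversions v))) =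
      inverse q ^ cross_inversions N (M - N) * normal_coeff q a N * normal_coeff q b (M - N)"
      by (simp only: normal_coeff_def mult.assoc[of "inverse q ^ cross_inversions N (M - N)"]
          sum_distrib_left[symmetric] sum_distrib_right[symmetric])
  qed
  finally show ?thesis .
qed

text \<open>The word \<open>[j, k]\<close> is sorted and contributes \<open>1\<close>, while
  \<open>[k, j]\<close> has one inversion and contributes \<open>- q * inverse q\<close>.\<close>

lemma normal_coeff_q_relation:
  assumes "j < k" "q \<noteq> 0"
  shows "normal_coeff q (q_relation q j k) M = 0"
  using assms unfolding q_relation_def
  by (auto simp: normal_coeff_diff normal_coeff_smult normal_coeff_basis add_mset_commute)

section \<open>The algebra of quantum affine space\<close>

lemma q_relation_closed: "q_relation q j k \<in> carrier free_algebra"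
  unfolding q_relation_def
  using finite_support_add[OF finite_support_basis finite_support_smult[OF finite_support_basis, of "-q"]]
  by simp

lemma calg_ideal_q_ideal: "calg_ideal (q_ideal q) free_algebra"
proof (rule calg_ideal.intro)
  show "calg free_algebra" ..
  show "ideal (q_ideal q) free_algebra"
    unfolding q_ideal_def
    by (rule free_algebra.genideal_ideal) (auto simp: q_relation_closed[simplified])
qed

lemma normal_coeff_kernel_ideal: "ideal {a \<in> carrier free_algebra. normal_coeff q a = (\<lambda>M. 0)} free_algebra"
  by (rule free_algebra.idealI)
    (auto simp: normal_coeff_add finite_support_add normal_coeff_word_mult finite_support_word_mult
      fun_eq_iff)

lemma q_ideal_normal_coeff:
  assumes "q \<noteq> 0" "a \<in> q_ideal q"
  shows "normal_coeff q a M = 0"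
proof -
  have "q_ideal q \<subseteq> {a \<in> carrier free_algebra. normal_coeff q a = (\<lambda>M. 0)}"
    unfolding q_ideal_def
    using assms(1)
    by (intro free_algebra.genideal_minimal normal_coeff_kernel_ideal)
      (auto simp: q_relation_closed[simplified] normal_coeff_q_relation)
  then show ?thesis
    using assms(2) by (auto simp: fun_eq_iff)
qed

abbreviation qcls :: "complex \<Rightarrow> ('n::linorder list \<Rightarrow> complex) \<Rightarrow> ('n list \<Rightarrow> complex) set" where
  "qcls q a \<equiv> q_ideal q +>\<^bsub>free_algebra\<^esub> a"

interpretation qreg: calg "qreg q" for q
  unfolding qreg_def by (rule calg_ideal.calg_quot[OF calg_ideal_q_ideal])

lemmas qreg_simps = calg_ideal.carrier_quot[OF calg_ideal_q_ideal, folded qreg_def] calg_ideal.zero_quot[OF calg_ideal_q_ideal, folded qreg_def]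
  calg_ideal.one_quot[OF calg_ideal_q_ideal, folded qreg_def] calg_ideal.add_quot[OF calg_ideal_q_ideal, folded qreg_def]
  calg_ideal.mult_quot[OF calg_ideal_q_ideal, folded qreg_def] calg_ideal.smult_quot[OF calg_ideal_q_ideal, folded qreg_def]
  calg_ideal.minus_quot[OF calg_ideal_q_ideal, folded qreg_def]

lemma qcls_basis_closed [simp]: "qcls q (word_basis w) \<in> carrier (qreg q)"
  by (simp add: qreg_simps finite_support_basis)

lemma qcls_basis_append:
  "qcls q (word_basis (u @ v)) = qcls q (word_basis u) \<otimes>\<^bsub>qreg q\<^esub> qcls q (word_basis v)"
  by (simp add: qreg_simps finite_support_basis word_mult_basis)

lemma qcls_basis_sort:
  assumes q: "q \<noteq> 0"
  shows "qcls q (word_basis w) = inverse q ^ inversions w \<odot>\<^bsub>qreg q\<^esub> qcls q (word_basis (sort w))"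
proof -
  \<comment> \<open>The scalar \<open>inverse q\<close> as an element of the algebra, since
    \<open>normal_ordering\<close> takes its \<open>c\<close> from the ring.\<close>
  let ?c = "inverse q \<odot>\<^bsub>qreg q\<^esub> \<one>\<^bsub>qreg q\<^esub> :: ('a list \<Rightarrow> complex) set"
  have c: "?c [^]\<^bsub>qreg q\<^esub> m = inverse q ^ m \<odot>\<^bsub>qreg q\<^esub> \<one>\<^bsub>qreg q\<^esub>" for m :: nat
    by (induction m) (auto simp: qreg.smult_mult_l qreg.smult_mult_r qreg.smult_assoc[symmetric] mult.commute)
  have "qcls q (word_basis w) = ?c [^]\<^bsub>qreg q\<^esub> inversions w \<otimes>\<^bsub>qreg q\<^esub> qcls q (word_basis (sort w))"
  proof (rule qreg.normal_ordering[where y = "\<lambda>w. qcls q (word_basis w)"])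
    fix j k :: 'a assume "j < k"
    then have "q_relation q j k \<in> q_ideal q"
      unfolding q_ideal_def using q_relation_closed
      by (intro subsetD[OF free_algebra.genideal_self]) auto
    then have "word_basis [j, k] \<ominus>\<^bsub>free_algebra\<^esub> (\<lambda>w. q * word_basis [k, j] w) \<in> q_ideal q"
      using finite_support_smult[OF finite_support_basis, of q "[k, j]"]
      by (subst free_algebra.minus_conv_smult) (simp_all add: finite_support_basis q_relation_def)
    then have "qcls q (word_basis [j, k]) = qcls q (\<lambda>w. q * word_basis [k, j] w)"
      using finite_support_smult[OF finite_support_basis, of q "[k, j]"]
      by (simp add: calg_ideal.cls_eq_iff[OF calg_ideal_q_ideal] finite_support_basis)
    also have "\<dots> = q \<odot>\<^bsub>qreg q\<^esub> qcls q (word_basis [k, j])"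
      by (simp add: qreg_simps finite_support_basis)
    finally show "qcls q (word_basis [k, j]) = ?c \<otimes>\<^bsub>qreg q\<^esub> qcls q (word_basis [j, k])"
      using q by (simp add: qreg.smult_mult_l qreg.smult_assoc[symmetric])
  next
    show "qcls q (word_basis ([] :: 'a list)) = \<one>\<^bsub>qreg q\<^esub>"
      by (simp add: qreg_simps)
  qed (simp_all add: qcls_basis_append qreg.smult_mult_l qreg.smult_mult_r del: append.simps)
  then show ?thesis
    by (simp add: c qreg.smult_mult_l)
qed

definition normal_form :: "complex \<Rightarrow> ('n::linorder list \<Rightarrow> complex) \<Rightarrow> 'n list \<Rightarrow> complex" where
  "normal_form q a w = (if sorted w then normal_coeff q a (mset w) else 0)"

lemma normal_form_basis:
  "normal_form q (word_basis u) = (\<lambda>w. inverse q ^ inversions u * word_basis (sort u) w)"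
proof
  fix w
  have "sorted w \<and> mset w = mset u \<longleftrightarrow> w = sort u"
    by (metis mset_sort properties_for_sort sorted_sort)
  then show "normal_form q (word_basis u) w = inverse q ^ inversions u * word_basis (sort u) w"
    by (auto simp: normal_form_def normal_coeff_basis) (auto simp: word_basis_def)
qed

text \<open>Both sides are linear in \<open>a\<close>, so it suffices to treat basis words, where it
  is \<open>qcls_basis_sort\<close>. This is the spanning half of the basis theorem: every class is
  represented by a combination of sorted words.\<close>

lemma qcls_normal_form:
  assumes "q \<noteq> 0" "finite {w. a w \<noteq> 0}"
  shows "finite {w. normal_form q a w \<noteq> 0} \<and> qcls q (normal_form q a) = qcls q a"
  using assms(2)
proof (induction a rule: finite_support_induct)
  case zero
  then show ?case
    by (simp add: normal_form_def cong: if_cong)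
next
  case (add a u c)
  have eq: "(\<lambda>w. a w + c * (if w = u then 1 else 0)) = (\<lambda>w. a w + c * word_basis u w)"
    by (simp add: word_basis_def)
  have nf: "normal_form q (\<lambda>w. a w + c * word_basis u w) =
      (\<lambda>w. normal_form q a w + c * normal_form q (word_basis u) w)"
    by (auto simp: normal_form_def normal_coeff_add normal_coeff_smult)
  have b: "finite {w. normal_form q (word_basis u) w \<noteq> 0}"
    "qcls q (normal_form q (word_basis u)) = qcls q (word_basis u)"
    unfolding normal_form_basis using finite_support_smult[OF finite_support_basis]
    by (auto simp: qcls_basis_sort[OF assms(1), of u] qreg_simps finite_support_basis)
  have "qcls q (\<lambda>w. normal_form q a w + c * normal_form q (word_basis u) w) =
      qcls q (normal_form q a) \<oplus>\<^bsub>qreg q\<^esub> c \<odot>\<^bsub>qreg q\<^esub> qcls q (normal_form q (word_basis u))"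
    using add b(1) finite_support_smult[OF b(1), of c]
    by (subst qreg_simps, simp, subst qreg_simps) auto
  also have "\<dots> = qcls q (\<lambda>w. a w + c * word_basis u w)"
    using add b finite_support_smult[OF finite_support_basis, of c u]
    by (simp add: qreg_simps finite_support_basis)
  finally show ?case
    using add b finite_support_smult[OF b(1), of c]
    unfolding eq nf by (auto intro!: finite_support_add)
qed

text \<open>The Poincare-Birkhoff-Witt theorem as a membership test: spanning by sorted words gives
  one direction, and the invariance of the sorted coefficients, that is, the independence of sorted
  words, gives the other.\<close>

lemma q_ideal_iff:
  assumes "q \<noteq> 0" "finite {w. a w \<noteq> 0}"
  shows "a \<in> q_ideal q \<longleftrightarrow> normal_coeff q a = (\<lambda>M. 0)"
proof
  assume "normal_coeff q a = (\<lambda>M. 0)"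
  then have "normal_form q a = (\<lambda>w. 0)"
    by (auto simp: normal_form_def)
  then have "qcls q a = qcls q (\<lambda>w. 0)"
    using qcls_normal_form[OF assms] by simp
  then show "a \<in> q_ideal q"
    using calg_ideal.cls_eq_zero_iff[OF calg_ideal_q_ideal, of a q] assms(2) by simp
qed (use q_ideal_normal_coeff[OF assms(1)] in auto)

lemma free_minus:
  "a \<in> carrier free_algebra \<Longrightarrow> b \<in> carrier free_algebra \<Longrightarrow> a \<ominus>\<^bsub>free_algebra\<^esub> b = (\<lambda>w. a w - b w)"
  by (simp add: free_algebra.minus_conv_smult)

lemma qcls_eq_iff:
  assumes "q \<noteq> 0" "a \<in> carrier free_algebra" "b \<in> carrier free_algebra"
  shows "qcls q a = qcls q b \<longleftrightarrow> normal_coeff q a = normal_coeff q b"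
proof -
  have "finite {w. a w - b w \<noteq> 0}"
    using finite_support_add[of a "\<lambda>w. - b w"] assms by simp
  then show ?thesis
    using assms q_ideal_iff[of q "\<lambda>w. a w - b w"]
    by (simp add: calg_ideal.cls_eq_iff[OF calg_ideal_q_ideal] free_minus fun_eq_iff normal_coeff_diff)
qed

section \<open>The Poisson algebra\<close>

lemma mpol_induct [case_names zero add]:
  fixes f :: "'n mpol"
  assumes "P 0" and "\<And>f k c. P f \<Longrightarrow> P (f + Poly_Mapping.single k c)"
  shows "P f"
proof (induction f rule: update_induct)
  case (update f k c)
  then have "Poly_Mapping.update k c f = f + Poly_Mapping.single k c"
    by (intro poly_mapping_eqI)
      (auto simp: lookup_update lookup_add lookup_single when_def in_keys_iff)
  then show ?case
    using update assms(2) by simp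
qed (rule assms(1))

lemma poly_deriv_superset:
  assumes "finite K" "Poly_Mapping.keys f \<subseteq> K"
  shows "poly_deriv j f = (\<Sum>k\<in>K. Poly_Mapping.single (k - Poly_Mapping.single j 1)
       (of_nat (Poly_Mapping.lookup k j) * Poly_Mapping.lookup f k))"
  unfolding poly_deriv_def
  by (rule sum.mono_neutral_left) (use assms in \<open>auto simp: in_keys_iff\<close>)

lemma poly_deriv_add: "poly_deriv j (f + g) = poly_deriv j f + poly_deriv j g"
proof -
  let ?K = "Poly_Mapping.keys f \<union> Poly_Mapping.keys g"
  have "Poly_Mapping.keys (f + g) \<subseteq> ?K"
    by (rule keys_add)
  then show ?thesis
    using poly_deriv_superset[of ?K "f + g" j] poly_deriv_superset[of ?K f j]
      poly_deriv_superset[of ?K g j]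
    by (simp add: lookup_add algebra_simps single_add sum.distrib)
qed

lemma poly_deriv_single:
  "poly_deriv j (Poly_Mapping.single k c) =
    Poly_Mapping.single (k - Poly_Mapping.single j 1) (of_nat (Poly_Mapping.lookup k j) * c)"
  using poly_deriv_superset[of "{k}" "Poly_Mapping.single k c" j] by simp

lemma poly_bracket_add_left: "poly_bracket (f + f') g = poly_bracket f g + poly_bracket f' g"
  by (simp add: poly_bracket_def poly_deriv_add algebra_simps sum.distrib[symmetric] case_prod_beta)

lemma poly_bracket_add_right: "poly_bracket f (g + g') = poly_bracket f g + poly_bracket f g'"
  by (simp add: poly_bracket_def poly_deriv_add algebra_simps sum.distrib[symmetric] case_prod_beta)

lemma poly_deriv_zero [simp]: "poly_deriv j 0 = 0"
  by (simp add: poly_deriv_def)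

lemma poly_bracket_zero [simp]: "poly_bracket 0 f = 0" "poly_bracket f 0 = 0"
  by (simp_all add: poly_bracket_def)

lemma poly_bracket_self: "poly_bracket f f = 0"
  by (simp add: poly_bracket_def mult.commute)

text \<open>The structure constant of the bracket on monomials: the bracket is log-canonical, that
  is, \<open>x\<^sup>k\<close> and \<open>x\<^sup>l\<close> have bracket \<open>log_form k l\<close>
  times \<open>x\<^sup>k\<^sup>+\<^sup>l\<close>.\<close>

definition log_form :: "('n::{finite, linorder} \<Rightarrow>\<^sub>0 nat) \<Rightarrow> ('n \<Rightarrow>\<^sub>0 nat) \<Rightarrow> complex" where
  "log_form k l = (\<Sum>(i, j) | i < j. of_nat (Poly_Mapping.lookup k i * Poly_Mapping.lookup l j) -
     of_nat (Poly_Mapping.lookup k j * Poly_Mapping.lookup l i))"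

lemma log_form_add_right: "log_form k (l + m) = log_form k l + log_form k m"
  by (simp add: log_form_def lookup_add algebra_simps sum.distrib[symmetric] case_prod_beta)

lemma log_form_swap: "log_form l k = - log_form k l"
  by (simp add: log_form_def sum_negf[symmetric] case_prod_beta algebra_simps)

text \<open>Subtraction of multi-indices is truncated, so the derivatives and the factors
  \<open>x\<^sub>i x\<^sub>j\<close> cancel only for nonzero exponents. For a zero exponent the
  coefficient of the derivative vanishes instead, see \<open>poly_bracket_single\<close>.\<close>

lemma monomial_minus_plus:
  assumes "Poly_Mapping.lookup k i \<noteq> 0" "Poly_Mapping.lookup l j \<noteq> 0"
  shows "Poly_Mapping.single i 1 + Poly_Mapping.single j 1 +
    ((k - Poly_Mapping.single i 1) + (l - Poly_Mapping.single j 1)) = k + (l :: 'n \<Rightarrow>\<^sub>0 nat)"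
  using assms
  by (intro poly_mapping_eqI) (auto simp: lookup_add lookup_minus lookup_single when_def)

lemma poly_bracket_single:
  "poly_bracket (Poly_Mapping.single k a) (Poly_Mapping.single l b) =
    Poly_Mapping.single (k + l) (log_form k l * a * b)"
proof -
  have *: "poly_var i * poly_var j *
      (poly_deriv i (Poly_Mapping.single k a) * poly_deriv j (Poly_Mapping.single l b)) =
    Poly_Mapping.single (k + l)
      (of_nat (Poly_Mapping.lookup k i * Poly_Mapping.lookup l j) * a * b)" for i j
  proof (cases "Poly_Mapping.lookup k i \<noteq> 0 \<and> Poly_Mapping.lookup l j \<noteq> 0")
    case True
    then show ?thesis
      using monomial_minus_plus[of k i l j]
      by (simp add: poly_var_def poly_deriv_single mult_single algebra_simps)
  next
    case False
    then show ?thesis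
      by (auto simp: poly_var_def poly_deriv_single)
  qed
  have "poly_var i * poly_var j *
      (poly_deriv i (Poly_Mapping.single k a) * poly_deriv j (Poly_Mapping.single l b) -
       poly_deriv j (Poly_Mapping.single k a) * poly_deriv i (Poly_Mapping.single l b)) =
    Poly_Mapping.single (k + l)
      ((of_nat (Poly_Mapping.lookup k i * Poly_Mapping.lookup l j) -
        of_nat (Poly_Mapping.lookup k j * Poly_Mapping.lookup l i)) * a * b)" for i j
    using *[of i j] *[of j i]
    by (simp add: right_diff_distrib mult.commute[of "poly_var j" "poly_var i"] left_diff_distrib
        single_diff)
  then have "poly_bracket (Poly_Mapping.single k a) (Poly_Mapping.single l b) =
      (\<Sum>(i, j) | i < j. Poly_Mapping.single (k + l)
      ((of_nat (Poly_Mapping.lookup k i * Poly_Mapping.lookup l j) -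
        of_nat (Poly_Mapping.lookup k j * Poly_Mapping.lookup l i)) * a * b))"
    by (simp add: poly_bracket_def)
  also have "\<dots> = Poly_Mapping.single (k + l) (log_form k l * a * b)"
    by (rule poly_mapping_eqI)
      (auto simp: lookup_sum lookup_single when_def log_form_def sum_distrib_right case_prod_beta)
  finally show ?thesis .
qed

text \<open>By additivity everything reduces to monomials, where the Leibniz rule is additivity of
  \<open>log_form\<close> in its second argument.\<close>

lemma poly_bracket_Leibniz: "poly_bracket f (g * k) = poly_bracket f g * k + g * poly_bracket f k"
proof (induction f rule: mpol_induct)
  case f: (add f m a)
  have "poly_bracket (Poly_Mapping.single m a) (g * k) =
      poly_bracket (Poly_Mapping.single m a) g * k + g * poly_bracket (Poly_Mapping.single m a) k"
  proof (induction g rule: mpol_induct)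
    case g: (add g l b)
    have "poly_bracket (Poly_Mapping.single m a) (Poly_Mapping.single l b * k) =
      poly_bracket (Poly_Mapping.single m a) (Poly_Mapping.single l b) * k +
      Poly_Mapping.single l b * poly_bracket (Poly_Mapping.single m a) k"
      by (induction k rule: mpol_induct)
        (simp_all add: poly_bracket_add_right distrib_left poly_bracket_single mult_single
          log_form_add_right single_add[symmetric] algebra_simps)
    then show ?case
      using g by (simp add: distrib_right poly_bracket_add_right)
  qed simp
  then show ?case
    using f by (simp add: poly_bracket_add_left distrib_left distrib_right)
qed simp

text \<open>On monomials the three terms are multiples of the same monomial, and their coefficients
  cancel because \<open>log_form\<close> is additive and antisymmetric.\<close>

lemma poly_bracket_Jacobi:
  "poly_bracket f (poly_bracket g k) + poly_bracket g (poly_bracket k f) +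
    poly_bracket k (poly_bracket f g) = 0"
proof (induction f rule: mpol_induct)
  case f: (add f m a)
  let ?m = "Poly_Mapping.single m a"
  have "poly_bracket ?m (poly_bracket g k) + poly_bracket g (poly_bracket k ?m) +
    poly_bracket k (poly_bracket ?m g) = 0"
  proof (induction g rule: mpol_induct)
    case g: (add g l b)
    let ?l = "Poly_Mapping.single l b"
    have "poly_bracket ?m (poly_bracket ?l k) + poly_bracket ?l (poly_bracket k ?m) +
      poly_bracket k (poly_bracket ?m ?l) = 0"
    proof (induction k rule: mpol_induct)
      case k: (add k j c)
      let ?j = "Poly_Mapping.single j c"
      have "m + (l + j) = l + (j + m)" "m + (l + j) = j + (m + l)"
        by (simp_all add: ac_simps)
      then have "poly_bracket ?m (poly_bracket ?l ?j) + poly_bracket ?l (poly_bracket ?j ?m) +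
        poly_bracket ?j (poly_bracket ?m ?l) =
        Poly_Mapping.single (m + (l + j)) (log_form m (l + j) * a * (log_form l j * b * c) +
          log_form l (j + m) * b * (log_form j m * c * a) +
          log_form j (m + l) * c * (log_form m l * a * b))"
        by (simp add: poly_bracket_single single_add)
      also have "\<dots> = 0"
        by (simp add: log_form_add_right log_form_swap[of m l] log_form_swap[of m j]
            log_form_swap[of l j] algebra_simps)
      finally show ?case
        using k by (simp add: poly_bracket_add_left poly_bracket_add_right algebra_simps)
    qed simp
    then show ?case
      using g by (simp add: poly_bracket_add_left poly_bracket_add_right algebra_simps)
  qed simp
  then show ?case
    using f by (simp add: poly_bracket_add_left poly_bracket_add_right algebra_simps)
qed simp

lemma poly_bracket_swap: "poly_bracket f g = - poly_bracket g f"
proof -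
  have "poly_bracket g f + poly_bracket f g = 0"
    using poly_bracket_self[of "f + g"] poly_bracket_self[of f] poly_bracket_self[of g]
    by (simp add: poly_bracket_add_left poly_bracket_add_right)
  then show ?thesis
    by (simp add: eq_neg_iff_add_eq_0 add.commute)
qed

lemma poly_bracket_Leibniz_left:
  "poly_bracket (g * k) f = poly_bracket g f * k + g * poly_bracket k f"
  using poly_bracket_Leibniz[of f g k] poly_bracket_swap[of "g * k" f] poly_bracket_swap[of f g]
    poly_bracket_swap[of f k] by simp

lemma poly_alg_simps [simp]:
  "carrier poly_alg = UNIV" "f \<otimes>\<^bsub>poly_alg\<^esub> g = f * g" "\<one>\<^bsub>poly_alg\<^esub> = 1" "\<zero>\<^bsub>poly_alg\<^esub> = 0"
  "f \<oplus>\<^bsub>poly_alg\<^esub> g = f + g" "c \<odot>\<^bsub>poly_alg\<^esub> f = Poly_Mapping.single 0 c * f"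
  by (simp_all add: poly_alg_def)

lemma poly_bracket_const [simp]:
  "poly_bracket f (Poly_Mapping.single 0 c) = 0" "poly_bracket (Poly_Mapping.single 0 c) f = 0"
proof -
  show *: "poly_bracket f (Poly_Mapping.single 0 c) = 0"
    by (induction f rule: mpol_induct)
      (auto simp: poly_bracket_add_left poly_bracket_single log_form_def)
  show "poly_bracket (Poly_Mapping.single 0 c) f = 0"
    using poly_bracket_swap[of "Poly_Mapping.single 0 c" f] * by simp
qed

lemma poisson_algebra_poly:
  "poisson_algebra (poly_alg :: (complex, 'n::{finite, linorder} mpol) module) poly_bracket"
proof -
  have "Module.algebra complex_ring (poly_alg :: (complex, 'n mpol) module)"
  proof (rule algebraI[OF cring_complex_ring])
    show "cring (poly_alg :: (complex, 'n mpol) module)"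
    proof (rule cringI)
      show "abelian_group (poly_alg :: (complex, 'n mpol) module)"
        by (rule abelian_groupI) (auto simp: algebra_simps intro: exI[of _ "- x" for x])
      show "comm_monoid (poly_alg :: (complex, 'n mpol) module)"
        by unfold_locales (auto simp: algebra_simps)
    qed (auto simp: algebra_simps)
  qed (auto simp: distrib_left distrib_right single_add mult.assoc mult_single[of 0 _ 0, simplified, symmetric])
  then show ?thesis
    unfolding poisson_algebra_def complex_linear_def
    by (simp add: poly_bracket_add_left poly_bracket_add_right poly_bracket_self poly_bracket_Jacobi poly_bracket_Leibniz
        poly_bracket_Leibniz_left)
qed

section \<open>Ordered monomials\<close>

text \<open>The multi-index counterpart of \<open>mset\<close>; it connects words with exponents of
  polynomials.\<close>

definition content :: "'n list \<Rightarrow> 'n \<Rightarrow>\<^sub>0 nat" where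
  "content w = sum_list (map (\<lambda>j. Poly_Mapping.single j 1) w)"

definition ordered_word :: "('n::{finite, linorder} \<Rightarrow>\<^sub>0 nat) \<Rightarrow> 'n list" where
  "ordered_word k = concat (map (\<lambda>j. replicate (Poly_Mapping.lookup k j) j) (sorted_list_of_set UNIV))"

lemma lookup_content: "Poly_Mapping.lookup (content w) j = count (mset w) j"
  by (induction w) (auto simp: content_def lookup_add lookup_single when_def)

lemma content_eq_iff: "content u = content v \<longleftrightarrow> mset u = mset v"
  by (metis lookup_content multiset_eqI poly_mapping_eqI)

lemma sorted_concat_replicate:
  "sorted js \<Longrightarrow> sorted (concat (map (\<lambda>j. replicate (m j) j) js))"
  by (induction js) (auto simp: sorted_append sorted_replicate)

lemma sorted_ordered_word: "sorted (ordered_word k)"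
  unfolding ordered_word_def by (rule sorted_concat_replicate) simp

lemma content_append: "content (u @ v) = content u + content v"
  by (simp add: content_def)

lemma count_concat_replicate:
  "distinct js \<Longrightarrow> count (mset (concat (map (\<lambda>j. replicate (m j) j) js))) i =
    (if i \<in> set js then m i else 0)"
  by (induction js) auto

lemma count_ordered_word: "count (mset (ordered_word k)) i = Poly_Mapping.lookup k i"
  unfolding ordered_word_def by (subst count_concat_replicate) auto

lemma content_ordered_word: "content (ordered_word k) = k"
  by (rule poly_mapping_eqI) (simp add: lookup_content count_ordered_word)

lemma ordered_word_content: "ordered_word (content w) = sort w"
  by (metis content_eq_iff content_ordered_word properties_for_sort sorted_ordered_word)

lemma ordered_word_eq_iff: "ordered_word k = w \<longleftrightarrow> sorted w \<and> content w = k"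
  by (metis content_ordered_word ordered_word_content sorted_ordered_word sorted_sort_id)

abbreviation qmono :: "complex \<Rightarrow> ('n::{finite, linorder} \<Rightarrow>\<^sub>0 nat) \<Rightarrow> ('n list \<Rightarrow> complex) set" where
  "qmono q k \<equiv> qcls q (word_basis (ordered_word k))"

lemma qreg_monomial_eq: "qreg_monomial q k = qmono q k"
proof -
  have pow: "qreg_var q j [^]\<^bsub>qreg q\<^esub> m = qcls q (word_basis (replicate m j))" for j and m :: nat
    by (induction m)
      (auto simp: qreg_var_def qreg_simps finite_support_basis word_mult_basis replicate_append_same)
  have "foldr (\<otimes>\<^bsub>qreg q\<^esub>) (map (\<lambda>j. qreg_var q j [^]\<^bsub>qreg q\<^esub> Poly_Mapping.lookup k j) js) \<one>\<^bsub>qreg q\<^esub> =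
    qcls q (word_basis (concat (map (\<lambda>j. replicate (Poly_Mapping.lookup k j) j) js)))" for js
    by (induction js) (auto simp: pow qreg_simps finite_support_basis word_mult_basis)
  then show ?thesis
    by (simp add: qreg_monomial_def ordered_word_def)
qed

text \<open>A representative of \<open>qreg_of_poly q f\<close> in the free algebra that is the same
  for every \<open>q\<close>.\<close>

definition ordered_lift :: "'n::{finite, linorder} mpol \<Rightarrow> 'n list \<Rightarrow> complex" where
  "ordered_lift f w = (if sorted w then Poly_Mapping.lookup f (content w) else 0)"

lemma finite_support_ordered_lift: "finite {w. ordered_lift f w \<noteq> 0}"
proof (rule finite_subset)
  show "{w. ordered_lift f w \<noteq> 0} \<subseteq> ordered_word ` Poly_Mapping.keys f"
  proof
    fix w assume "w \<in> {w. ordered_lift f w \<noteq> 0}"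
    then have "sorted w" "content w \<in> Poly_Mapping.keys f"
      by (auto simp: ordered_lift_def in_keys_iff split: if_splits)
    then show "w \<in> ordered_word ` Poly_Mapping.keys f"
      using ordered_word_eq_iff[of "content w" w] by (intro image_eqI[of _ _ "content w"]) auto
  qed
qed simp

lemma word_basis_ordered_word:
  "word_basis (ordered_word k) w = (if sorted w \<and> content w = k then 1 else 0)"
  using ordered_word_eq_iff[of k w] unfolding word_basis_def by metis

lemma ordered_lift_sum:
  "ordered_lift f w = (\<Sum>k\<in>Poly_Mapping.keys f. Poly_Mapping.lookup f k * word_basis (ordered_word k) w)"
proof -
  have "(\<Sum>k\<in>Poly_Mapping.keys f. Poly_Mapping.lookup f k * word_basis (ordered_word k) w) =
      (\<Sum>k\<in>Poly_Mapping.keys f. if k = content w then if sorted w then Poly_Mapping.lookup f k else 0 else 0)"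
    by (intro sum.cong refl) (simp add: word_basis_ordered_word)
  then show ?thesis
    by (simp add: ordered_lift_def in_keys_iff)
qed

lemma free_finsum:
  assumes "finite S" "\<And>i. i \<in> S \<Longrightarrow> finite {w. f i w \<noteq> 0}"
  shows "finsum free_algebra f S = (\<lambda>w. \<Sum>i\<in>S. f i w)"
  using assms
proof (induction S rule: finite_induct)
  case (insert i S)
  then show ?case
    by (subst free_algebra.finsum_insert) auto
qed simp

lemma qreg_of_poly_eq: "qreg_of_poly q f = qcls q (ordered_lift f)"
proof -
  let ?t = "\<lambda>k w. Poly_Mapping.lookup f k * word_basis (ordered_word k) w"
  have t: "?t k \<in> carrier free_algebra" for k
    using finite_support_smult[OF finite_support_basis] by simp
  have "qreg_of_poly q f = finsum (qreg q) (\<lambda>k. qcls q (?t k)) (Poly_Mapping.keys f)"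
    unfolding qreg_of_poly_def
    by (simp add: qreg_monomial_eq qreg_simps finite_support_basis)
  also have "\<dots> = qcls q (finsum free_algebra ?t (Poly_Mapping.keys f))"
    unfolding qreg_def using t
    by (intro calg_ideal.finsum_quot[OF calg_ideal_q_ideal]) auto
  also have "finsum free_algebra ?t (Poly_Mapping.keys f) = ordered_lift f"
    using t by (subst free_finsum) (auto simp: ordered_lift_sum)
  finally show ?thesis .
qed

lemma lookup_single_zero_mult: "Poly_Mapping.lookup (Poly_Mapping.single 0 c * f) k = c * Poly_Mapping.lookup (f :: 'n mpol) k"
  by (simp add: mult_map_scale_conv_mult[symmetric] map.rep_eq when_def)

lemma qreg_of_poly_closed [simp]: "qreg_of_poly q f \<in> carrier (qreg q)"
  by (simp add: qreg_of_poly_eq qreg_simps finite_support_ordered_lift)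

lemma qreg_of_poly_add: "qreg_of_poly q (f + g) = qreg_of_poly q f \<oplus>\<^bsub>qreg q\<^esub> qreg_of_poly q g"
proof -
  have "ordered_lift (f + g) = (\<lambda>w. ordered_lift f w + ordered_lift g w)"
    by (auto simp: ordered_lift_def lookup_add)
  then show ?thesis
    by (simp add: qreg_of_poly_eq qreg_simps finite_support_ordered_lift)
qed

lemma qreg_of_poly_smult:
  "qreg_of_poly q (Poly_Mapping.single 0 c * f) = c \<odot>\<^bsub>qreg q\<^esub> qreg_of_poly q f"
proof -
  have "ordered_lift (Poly_Mapping.single 0 c * f) = (\<lambda>w. c * ordered_lift f w)"
    by (auto simp: ordered_lift_def lookup_single_zero_mult)
  then show ?thesis
    by (simp add: qreg_of_poly_eq qreg_simps finite_support_ordered_lift)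
qed

lemma ordered_lift_single: "ordered_lift (Poly_Mapping.single k c) = (\<lambda>w. c * word_basis (ordered_word k) w)"
  by (rule ext) (auto simp: ordered_lift_def word_basis_ordered_word lookup_single when_def)

lemma qreg_of_poly_single:
  "qreg_of_poly q (Poly_Mapping.single k c) = c \<odot>\<^bsub>qreg q\<^esub> qmono q k"
  by (simp add: qreg_of_poly_eq ordered_lift_single qreg_simps finite_support_basis)

lemma qreg_of_poly_zero: "qreg_of_poly q 0 = \<zero>\<^bsub>qreg q\<^esub>"
proof -
  have "ordered_lift (0 :: 'a mpol) = (\<lambda>w. 0)"
    by (auto simp: ordered_lift_def)
  then show ?thesis
    by (simp add: qreg_of_poly_eq qreg_simps)
qed

text \<open>Among the rearrangements of \<open>w\<close> only the sorted one has a nonzero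
  coefficient in the lift, and it has no inversions. So \<open>f\<close> can be read off from its
  class, which gives \<open>inj_qreg_of_poly\<close>.\<close>

lemma normal_coeff_ordered_lift: "normal_coeff q (ordered_lift f) (mset w) = Poly_Mapping.lookup f (content w)"
proof -
  have "normal_coeff q (ordered_lift f) (mset w) =
      (\<Sum>u | mset u = mset w. if u = sort w then Poly_Mapping.lookup f (content w) else 0)"
    unfolding normal_coeff_def
  proof (intro sum.cong refl)
    fix u assume u: "u \<in> {u. mset u = mset w}"
    then have "sorted u \<longleftrightarrow> u = sort w"
      using properties_for_sort[where xs = w and ys = u] by auto
    then show "ordered_lift f u * inverse q ^ inversions u =
        (if u = sort w then Poly_Mapping.lookup f (content w) else 0)"
      using u content_eq_iff[of u w] by (auto simp: ordered_lift_def inversions_sorted)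
  qed
  then show ?thesis
    by simp
qed

lemma inj_qreg_of_poly:
  assumes "q \<noteq> 0"
  shows "inj (qreg_of_poly q)"
proof (rule injI)
  fix f g :: "'a mpol" assume "qreg_of_poly q f = qreg_of_poly q g"
  then have "normal_coeff q (ordered_lift f) = normal_coeff q (ordered_lift g)"
    using assms by (simp add: qreg_of_poly_eq qcls_eq_iff finite_support_ordered_lift)
  then show "f = g"
    using normal_coeff_ordered_lift[of q f "ordered_word k" for k]
      normal_coeff_ordered_lift[of q g "ordered_word k" for k]
    by (intro poly_mapping_eqI) (simp add: content_ordered_word)
qed

lemma surj_qreg_of_poly:
  assumes "q \<noteq> 0"
  shows "range (qreg_of_poly q :: 'n::{finite, linorder} mpol \<Rightarrow> _) = carrier (qreg q)"
proof
  show "carrier (qreg q) \<subseteq> range (qreg_of_poly q :: 'n mpol \<Rightarrow> _)"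
  proof
    fix x :: "('n list \<Rightarrow> complex) set" assume "x \<in> carrier (qreg q)"
    then obtain a where a: "finite {w. a w \<noteq> 0}" "x = qcls q a"
      by (auto simp: qreg_simps)
    have "\<exists>f. qcls q a = qreg_of_poly q f"
      using a(1)
    proof (induction a rule: finite_support_induct)
      case zero
      show ?case
        by (rule exI[of _ 0]) (simp add: qreg_of_poly_zero qreg_simps)
    next
      case (add a u c)
      then obtain f where f: "qcls q a = qreg_of_poly q f"
        by blast
      have "qcls q (\<lambda>w. a w + c * word_basis u w) = qcls q a \<oplus>\<^bsub>qreg q\<^esub> c \<odot>\<^bsub>qreg q\<^esub> qcls q (word_basis u)"
        using add finite_support_smult[OF finite_support_basis, of c u]
        by (simp add: qreg_simps finite_support_basis)
      also have "\<dots> = qreg_of_poly q (f + Poly_Mapping.single 0 c *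
          Poly_Mapping.single (content u) (inverse q ^ inversions u))"
        by (subst qcls_basis_sort[OF assms])
          (simp add: f qreg_of_poly_add qreg_of_poly_smult qreg_of_poly_single ordered_word_content
            del: mult_single)
      finally show ?case
        by (auto simp: word_basis_def)
    qed
    then show "x \<in> range (qreg_of_poly q)"
      using a by auto
  qed
qed auto

definition cross_form :: "('n::{finite, linorder} \<Rightarrow>\<^sub>0 nat) \<Rightarrow> ('n \<Rightarrow>\<^sub>0 nat) \<Rightarrow> nat" where
  "cross_form k l = (\<Sum>(i, j) | i < j. Poly_Mapping.lookup k j * Poly_Mapping.lookup l i)"

lemma sum_mset_count: "(\<Sum>a\<in>#M. f a) = (\<Sum>a\<in>UNIV. count M a * f (a :: 'n::finite) :: nat)"
proof (induction M)
  case (add x M)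
  have "(\<Sum>a\<in>UNIV. count (add_mset x M) a * f a) =
      (\<Sum>a\<in>UNIV. (if a = x then f a else 0) + count M a * f a)"
    by (intro sum.cong) auto
  then show ?case
    using add by (simp add: sum.distrib)
qed simp

lemma cross_inversions_ordered_word:
  "cross_inversions (mset (ordered_word k)) (mset (ordered_word l)) = cross_form k l"
proof -
  have "size {#b \<in># N. b < a#} = (\<Sum>b | b < a. count N b)" for N and a :: 'a
  proof -
    have "size {#b \<in># N. b < a#} = (\<Sum>b\<in>UNIV. count {#b \<in># N. b < a#} b * 1)"
      using sum_mset_count[where M = "{#b \<in># N. b < a#}" and f = "\<lambda>_. 1"] by simp
    also have "\<dots> = (\<Sum>b | b < a. count N b)"
      by (rule sum.mono_neutral_cong_right) auto
    finally show ?thesis .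
  qed
  then have "cross_inversions (mset (ordered_word k)) (mset (ordered_word l)) =
      (\<Sum>j\<in>UNIV. \<Sum>i | i < j. Poly_Mapping.lookup k j * Poly_Mapping.lookup l i)"
    by (simp add: cross_inversions_def sum_mset_count count_ordered_word sum_distrib_left)
  also have "\<dots> = cross_form k l"
    unfolding cross_form_def
    by (subst sum.Sigma) (auto intro!: sum.reindex_bij_witness[of _ "\<lambda>(i, j). (j, i)" "\<lambda>(j, i). (i, j)"])
  finally show ?thesis .
qed

text \<open>The point where quantum and classical side meet: the structure constant of the bracket
  is the antisymmetrized exponent of the product of ordered monomials.\<close>

lemma log_form_eq: "log_form k l = of_nat (cross_form l k) - of_nat (cross_form k l)"
  by (simp add: log_form_def cross_form_def sum_subtractf case_prod_beta mult.commute)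

lemma qmono_mult:
  assumes "q \<noteq> 0"
  shows "qmono q k \<otimes>\<^bsub>qreg q\<^esub> qmono q l = inverse q ^ cross_form k l \<odot>\<^bsub>qreg q\<^esub> qmono q (k + l)"
proof -
  have "qmono q k \<otimes>\<^bsub>qreg q\<^esub> qmono q l = qcls q (word_basis (ordered_word k @ ordered_word l))"
    by (simp add: qcls_basis_append)
  also have "\<dots> = inverse q ^ cross_form k l \<odot>\<^bsub>qreg q\<^esub>
      qcls q (word_basis (sort (ordered_word k @ ordered_word l)))"
    by (subst qcls_basis_sort[OF assms])
      (simp add: inversions_append inversions_sorted sorted_ordered_word cross_inversions_ordered_word)
  also have "sort (ordered_word k @ ordered_word l) = ordered_word (k + l)"
    by (metis content_append content_ordered_word ordered_word_content)
  finally show ?thesis .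
qed

lemma qmono_zero: "qmono q 0 = \<one>\<^bsub>qreg q\<^esub>"
  using ordered_word_eq_iff[of "0 :: 'a \<Rightarrow>\<^sub>0 nat" "[]"] by (simp add: content_def qreg_simps)

lemma qreg_of_poly_one: "qreg_of_poly q 1 = \<one>\<^bsub>qreg q\<^esub>"
  using qreg_of_poly_single[of q 0 1] by (simp add: qmono_zero)

text \<open>At \<open>q = 1\<close> the reordering factor in \<open>qmono_mult\<close> equals
  \<open>1\<close>. This makes the map over \<open>h = 0\<close> an algebra homomorphism.\<close>

lemma qreg_of_poly_mult_1: "qreg_of_poly 1 (f * g) = qreg_of_poly 1 f \<otimes>\<^bsub>qreg 1\<^esub> qreg_of_poly 1 g"
proof (induction f rule: mpol_induct)
  case f: (add f k a)
  have "qreg_of_poly 1 (Poly_Mapping.single k a * g) =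
      qreg_of_poly 1 (Poly_Mapping.single k a) \<otimes>\<^bsub>qreg 1\<^esub> qreg_of_poly 1 g"
  proof (induction g rule: mpol_induct)
    case g: (add g l b)
    have "qreg_of_poly 1 (Poly_Mapping.single k a * Poly_Mapping.single l b) =
        qreg_of_poly 1 (Poly_Mapping.single k a) \<otimes>\<^bsub>qreg 1\<^esub> qreg_of_poly 1 (Poly_Mapping.single l b)"
      by (simp add: mult_single qreg_of_poly_single qreg.smult_mult_l qreg.smult_mult_r qmono_mult
          qreg.smult_assoc[symmetric] mult_ac)
    then show ?case
      using g by (simp add: distrib_left qreg_of_poly_add qreg.r_distr)
  qed (simp add: qreg_of_poly_zero)
  then show ?case
    using f by (simp add: distrib_right qreg_of_poly_add qreg.l_distr)
qed (simp add: qreg_of_poly_zero)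

section \<open>The semiclassical limit\<close>

lemma vector_space_familyD:
  assumes "vector_space_family E"
  shows "x \<in> topspace (base E) \<Longrightarrow> complex_vs (fib E x)"
    and "x \<in> topspace (base E) \<Longrightarrow> u \<in> carrier (fib E x) \<longleftrightarrow> u \<in> topspace (total E) \<and> proj E u = x"
    and "u \<in> topspace (total E) \<Longrightarrow> proj E u \<in> topspace (base E)"
    and "u \<in> topspace (total E) \<Longrightarrow> u \<in> carrier (fib E (proj E u))"
  using assms unfolding vector_space_family_def by auto

lemma limitin_fiber_product:
  assumes "limitin (total E) f l F" "limitin (total E) g m F"
    and "eventually (\<lambda>h. proj E (f h) = proj E (g h)) F" "proj E l = proj E m"
  shows "limitin (fiber_product E) (\<lambda>h. (f h, g h)) (l, m) F"
  unfolding fiber_product_def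
  using assms by (simp add: limitin_subtopology limitin_pairwise o_def)

text \<open>The base point is passed as a separate function \<open>x\<close> because the sections
  are known to lie over \<open>h\<close> only for \<open>h\<close> in \<open>X\<close>, hence only
  eventually along the filter.\<close>

lemma limitin_fiber_add:
  assumes E: "tvs_prebundle E"
    and lim: "limitin (total E) f l F" "limitin (total E) g m F"
    and fib: "eventually (\<lambda>h. proj E (f h) = x h \<and> proj E (g h) = x h) F" "proj E l = y" "proj E m = y"
  shows "limitin (total E) (\<lambda>h. f h \<oplus>\<^bsub>fib E (x h)\<^esub> g h) (l \<oplus>\<^bsub>fib E y\<^esub> m) F"
proof -
  have "limitin (fiber_product E) (\<lambda>h. (f h, g h)) (l, m) F"
    using lim fib by (intro limitin_fiber_product) (auto elim: eventually_mono)
  moreover have "continuous_map (fiber_product E) (total E) (\<lambda>(u, v). u \<oplus>\<^bsub>fib E (proj E u)\<^esub> v)"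
    using E by (simp add: tvs_prebundle_def)
  ultimately have "limitin (total E) (\<lambda>h. f h \<oplus>\<^bsub>fib E (proj E (f h))\<^esub> g h) (l \<oplus>\<^bsub>fib E y\<^esub> m) F"
    using continuous_map_limit fib(2) by (fastforce simp: o_def)
  then show ?thesis
    by (rule limitin_transform_eventually[rotated]) (use fib(1) in \<open>auto elim: eventually_mono\<close>)
qed

lemma limitin_fiber_smult:
  assumes E: "tvs_prebundle E"
    and lim: "(c \<longlongrightarrow> a) F" "limitin (total E) f l F"
    and fib: "eventually (\<lambda>h. proj E (f h) = x h) F" "proj E l = y"
  shows "limitin (total E) (\<lambda>h. c h \<odot>\<^bsub>fib E (x h)\<^esub> f h) (a \<odot>\<^bsub>fib E y\<^esub> l) F"
proof -
  have "limitin (prod_topology euclidean (total E)) (\<lambda>h. (c h, f h)) (a, l) F"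
    using lim by (simp add: limitin_pairwise o_def)
  moreover have "continuous_map (prod_topology euclidean (total E)) (total E)
      (\<lambda>(c, u). c \<odot>\<^bsub>fib E (proj E u)\<^esub> u)"
    using E by (simp add: tvs_prebundle_def)
  ultimately have "limitin (total E) (\<lambda>h. c h \<odot>\<^bsub>fib E (proj E (f h))\<^esub> f h) (a \<odot>\<^bsub>fib E y\<^esub> l) F"
    using continuous_map_limit fib(2) by (fastforce simp: o_def)
  then show ?thesis
    by (rule limitin_transform_eventually[rotated]) (use fib(1) in \<open>auto elim: eventually_mono\<close>)
qed

lemma continuous_map_fiber_mult:
  assumes "continuous_map (fiber_product E) (total E) (\<lambda>(u, v). u \<otimes>\<^bsub>fib E (proj E u)\<^esub> v)"
    and s: "continuous_map (base E) (total E) s" and t: "continuous_map (base E) (total E) t"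
    and fib: "\<And>x. x \<in> topspace (base E) \<Longrightarrow> proj E (s x) = x"
      "\<And>x. x \<in> topspace (base E) \<Longrightarrow> proj E (t x) = x"
  shows "continuous_map (base E) (total E) (\<lambda>x. s x \<otimes>\<^bsub>fib E x\<^esub> t x)"
proof -
  have "continuous_map (base E) (fiber_product E) (\<lambda>x. (s x, t x))"
    unfolding fiber_product_def
    using s t fib by (auto simp: continuous_map_in_subtopology continuous_map_pairwise o_def)
  from continuous_map_compose[OF this assms(1)]
  have "continuous_map (base E) (total E) (\<lambda>x. s x \<otimes>\<^bsub>fib E (proj E (s x))\<^esub> t x)"
    by (simp add: o_def)
  then show ?thesis
    by (rule continuous_map_eq) (simp add: fib)
qed

lemma limitin_section:
  assumes "continuous_map (base E) (total E) s" "base E = top_of_set X" "x \<in> X"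
  shows "limitin (total E) s (s x) (at x within X)"
  unfolding limitin_def
proof (intro conjI allI impI)
  show "s x \<in> topspace (total E)"
    using assms continuous_map_image_subset_topspace by fastforce
  fix U assume U: "openin (total E) U \<and> s x \<in> U"
  then have "openin (top_of_set X) {y \<in> X. s y \<in> U}"
    using openin_continuous_map_preimage[OF assms(1), of U] assms(2) by simp
  then obtain T where "open T" "{y \<in> X. s y \<in> U} = X \<inter> T"
    by (auto simp: openin_open)
  then show "\<forall>\<^sub>F y in at x within X. s y \<in> U"
    unfolding eventually_at_topological using U assms(3) by (intro exI[of _ T]) blast
qed

locale calg_hom = A: calg A + B: calg B for A and B +
  fixes \<phi>
  assumes hom: "complex_alg_hom A B \<phi>"
begin

lemma closed [simp]: "x \<in> carrier A \<Longrightarrow> \<phi> x \<in> carrier B"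
  and add: "x \<in> carrier A \<Longrightarrow> y \<in> carrier A \<Longrightarrow> \<phi> (x \<oplus>\<^bsub>A\<^esub> y) = \<phi> x \<oplus>\<^bsub>B\<^esub> \<phi> y"
  and smult: "x \<in> carrier A \<Longrightarrow> \<phi> (c \<odot>\<^bsub>A\<^esub> x) = c \<odot>\<^bsub>B\<^esub> \<phi> x"
  and mult: "x \<in> carrier A \<Longrightarrow> y \<in> carrier A \<Longrightarrow> \<phi> (x \<otimes>\<^bsub>A\<^esub> y) = \<phi> x \<otimes>\<^bsub>B\<^esub> \<phi> y"
  and one: "\<phi> \<one>\<^bsub>A\<^esub> = \<one>\<^bsub>B\<^esub>"
  using hom ring_hom_mult[of \<phi> A B] ring_hom_one[of \<phi> A B]
  by (auto simp: complex_alg_hom_def complex_linear_def)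

lemma minus: "x \<in> carrier A \<Longrightarrow> y \<in> carrier A \<Longrightarrow> \<phi> (x \<ominus>\<^bsub>A\<^esub> y) = \<phi> x \<ominus>\<^bsub>B\<^esub> \<phi> y"
  by (simp add: A.minus_conv_smult B.minus_conv_smult add smult)

lemma zero: "\<phi> \<zero>\<^bsub>A\<^esub> = \<zero>\<^bsub>B\<^esub>"
  using smult[of "\<zero>\<^bsub>A\<^esub>" 0] by simp

lemma complex_subalgebra_image: "complex_subalgebra (\<phi> ` carrier A) B"
proof -
  have neg: "\<ominus>\<^bsub>B\<^esub> x \<in> \<phi> ` carrier A" if "x \<in> \<phi> ` carrier A" for x
    using that by (auto simp: B.smult_minus_one[symmetric] simp flip: smult)
  have "submodule (\<phi> ` carrier A) complex_ring B"
    by (rule module.submoduleI[OF B.complex_vs])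
      (auto simp: neg simp flip: zero add smult)
  moreover have "subring (\<phi> ` carrier A) B"
    by (rule B.subringI) (auto simp: neg simp flip: one add mult)
  ultimately show ?thesis
    by (simp add: complex_subalgebra_def)
qed

end

text \<open>The expression of the deformation condition, formed in the quantum affine space before
  embedding it into a fiber. Biadditivity and the formula for monomials then become pure
  algebra.\<close>

definition quantum_defect ::
    "complex \<Rightarrow> 'n::{finite, linorder} mpol \<Rightarrow> 'n mpol \<Rightarrow> ('n list \<Rightarrow> complex) set" where
  "quantum_defect h a b = (let Q = qreg (exp (\<i> * h)); i = qreg_of_poly (exp (\<i> * h)) in
     ((1 / h) \<odot>\<^bsub>Q\<^esub> (i a \<otimes>\<^bsub>Q\<^esub> i b \<ominus>\<^bsub>Q\<^esub> i b \<otimes>\<^bsub>Q\<^esub> i a)) \<ominus>\<^bsub>Q\<^esub> (\<i> \<odot>\<^bsub>Q\<^esub> i (poly_bracket a b)))"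

lemma quantum_defect_closed [simp]: "quantum_defect h a b \<in> carrier (qreg (exp (\<i> * h)))"
  by (simp add: quantum_defect_def Let_def)

lemma quantum_defect_add_left:
  "quantum_defect h (a + a') b =
    quantum_defect h a b \<oplus>\<^bsub>qreg (exp (\<i> * h))\<^esub> quantum_defect h a' b"
  by (simp add: quantum_defect_def Let_def qreg_of_poly_add poly_bracket_add_left qreg.minus_conv_smult
      qreg.smult_r_distr qreg.l_distr qreg.r_distr qreg.a_ac)

lemma quantum_defect_add_right:
  "quantum_defect h a (b + b') =
    quantum_defect h a b \<oplus>\<^bsub>qreg (exp (\<i> * h))\<^esub> quantum_defect h a b'"
  by (simp add: quantum_defect_def Let_def qreg_of_poly_add poly_bracket_add_right qreg.minus_conv_smult
      qreg.smult_r_distr qreg.l_distr qreg.r_distr qreg.a_ac)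

lemma quantum_defect_zero:
  "quantum_defect h 0 b = \<zero>\<^bsub>qreg (exp (\<i> * h))\<^esub>" "quantum_defect h a 0 = \<zero>\<^bsub>qreg (exp (\<i> * h))\<^esub>"
  by (simp_all add: quantum_defect_def Let_def qreg_of_poly_zero qreg.minus_conv_smult)

definition monomial_defect ::
    "('n::{finite, linorder} \<Rightarrow>\<^sub>0 nat) \<Rightarrow> ('n \<Rightarrow>\<^sub>0 nat) \<Rightarrow> complex \<Rightarrow> complex" where
  "monomial_defect k l h =
    (1 / h) * (inverse (exp (\<i> * h)) ^ cross_form k l - inverse (exp (\<i> * h)) ^ cross_form l k) -
    \<i> * log_form k l"

lemma quantum_defect_single:
  "quantum_defect h (Poly_Mapping.single k a) (Poly_Mapping.single l b) =
    (a * b * monomial_defect k l h) \<odot>\<^bsub>qreg (exp (\<i> * h))\<^esub> qmono (exp (\<i> * h)) (k + l)"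
proof -
  let ?q = "exp (\<i> * h)"
  let ?Q = "qreg ?q :: (complex, ('a list \<Rightarrow> complex) set) module"
  have prod: "qreg_of_poly ?q (Poly_Mapping.single k a) \<otimes>\<^bsub>qreg ?q\<^esub> qreg_of_poly ?q (Poly_Mapping.single l b) =
    (a * b * inverse ?q ^ cross_form k l) \<odot>\<^bsub>qreg ?q\<^esub> qmono ?q (k + l)" for k l :: "'a \<Rightarrow>\<^sub>0 nat" and a b
    by (simp add: qreg_of_poly_single qreg.smult_mult_l qreg.smult_mult_r qmono_mult
        qreg.smult_assoc[symmetric] mult_ac)
  have "quantum_defect h (Poly_Mapping.single k a) (Poly_Mapping.single l b) =
    ((1 / h) * (a * b * inverse ?q ^ cross_form k l) + (1 / h) * (-1 * (b * a * inverse ?q ^ cross_form l k)) +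
      (-1) * (\<i> * (log_form k l * a * b))) \<odot>\<^bsub>?Q\<^esub> qmono ?q (k + l)"
    unfolding quantum_defect_def Let_def prod poly_bracket_single add.commute[of l k]
    by (simp only: qreg_of_poly_single qreg.minus_conv_smult qreg.smult_l_distr qreg.smult_r_distr
        qreg.smult_assoc qcls_basis_closed qreg.smult_closed qreg.a_closed)
  also have "(1 / h) * (a * b * inverse ?q ^ cross_form k l) + (1 / h) * (-1 * (b * a * inverse ?q ^ cross_form l k)) +
      (-1) * (\<i> * (log_form k l * a * b)) = a * b * monomial_defect k l h"
    by (simp add: monomial_defect_def algebra_simps diff_divide_distrib)
  finally show ?thesis .
qed

text \<open>Covers the product of two constants. The unit section is not among the sections assumed
  to be continuous, so here the defect has to vanish identically and not just in the limit.\<close>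

lemma monomial_defect_zero:
  assumes "k + l = 0"
  shows "monomial_defect k l h = 0"
proof -
  have "Poly_Mapping.lookup (k + l) j = 0" for j
    using assms by simp
  then have "k = l"
    by (intro poly_mapping_eqI) (simp add: lookup_add)
  then show ?thesis
    by (simp add: monomial_defect_def log_form_eq)
qed

text \<open>The difference of powers of \<open>inverse (exp (\<i> * h))\<close> is \<open>0\<close>
  at \<open>h = 0\<close>, so division by \<open>h\<close> gives a difference quotient. The
  derivative at \<open>0\<close> is \<open>\<i>\<close> times the antisymmetrized exponent, which is
  \<open>\<i> * log_form k l\<close>.\<close>

lemma tendsto_monomial_defect: "(monomial_defect k l \<longlongrightarrow> 0) (at 0)"
proof -
  let ?f = "\<lambda>h. inverse (exp (\<i> * h)) ^ cross_form k l - inverse (exp (\<i> * h)) ^ cross_form l k"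
  have eq: "inverse (exp (\<i> * h)) ^ m = exp (- (\<i> * of_nat m * h))" for h :: complex and m
    by (simp add: exp_minus[symmetric] exp_of_nat_mult[symmetric] mult_ac)
  have "(?f has_field_derivative \<i> * log_form k l) (at 0)"
    unfolding eq by (auto intro!: derivative_eq_intros simp: log_form_eq algebra_simps)
  then have "(\<lambda>h. (?f (0 + h) - ?f 0) / h) \<midarrow>0\<rightarrow> \<i> * log_form k l"
    unfolding DERIV_def .
  then have "((\<lambda>h. ?f h / h - \<i> * log_form k l) \<longlongrightarrow> \<i> * log_form k l - \<i> * log_form k l) (at 0)"
    by (intro tendsto_intros) simp
  then show ?thesis
    by (simp add: monomial_defect_def[abs_def])
qed

lemma frechet_algebra_bundleD:
  assumes "frechet_algebra_bundle E"
  shows "tvs_prebundle E" "vector_space_family E" "x \<in> topspace (base E) \<Longrightarrow> calg (fib E x)"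
    "continuous_map (fiber_product E) (total E) (\<lambda>(u, v). u \<otimes>\<^bsub>fib E (proj E u)\<^esub> v)"
  using assms
  by (auto simp: frechet_algebra_bundle_def locally_convex_bundle_def tvs_prebundle_def
      frechet_algebra_def complex_algebra_iff_calg)

lemma strict_deformation_quantization:
  fixes X :: "complex set" and A :: "(complex, 'e) bundle_data"
    and \<iota> :: "complex \<Rightarrow> ('n::{finite, linorder} list \<Rightarrow> complex) set \<Rightarrow> 'e"
  assumes X: "open X" "connected X" "0 \<in> X" and base: "base A = top_of_set X"
    and A: "frechet_algebra_bundle A" "continuous_bundle A" and \<iota>: "contains_qreg A \<iota>"
  shows "strict_frechet_deformation_quantization (poly_alg :: (complex, 'n mpol) module) poly_bracket X A
        (\<lambda>h. \<iota> h ` carrier (qreg (exp (\<i> * h))))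
        (\<lambda>h f. \<iota> h (qreg_of_poly (exp (\<i> * h)) f))"
proof -
  note AD = frechet_algebra_bundleD[OF A(1)]
  have hom: "calg_hom (qreg (exp (\<i> * h))) (fib A h) (\<iota> h)" if "h \<in> X" for h
    using that \<iota> AD(3)[of h]
    by (intro calg_hom.intro qreg.calg_axioms calg_hom_axioms.intro)
      (auto simp: contains_qreg_def base)
  have proj: "proj A (\<iota> h x) = h" if "h \<in> X" "x \<in> carrier (qreg (exp (\<i> * h)))" for h x
    using calg_hom.closed[OF hom[OF that(1)] that(2)] vector_space_familyD(2)[OF AD(2), of h] that(1)
    by (simp add: base)
  let ?F = "at 0 within X"
  have ev: "eventually (\<lambda>h. h \<in> X) ?F"
    by (simp add: eventually_at_filter)
  \<comment> \<open>Products of the sections \<open>x\<^sub>j\<close> are continuous because the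
    multiplication of the bundle is. The induction starts at words with one letter, the only ones
    for which continuity is given.\<close>
  have sec: "continuous_map (base A) (total A) (\<lambda>h. \<iota> h (qcls (exp (\<i> * h)) (word_basis w)))"
    if "w \<noteq> []" for w
    using that
  proof (induction w rule: list_nonempty_induct)
    case (single j)
    then show ?case
      using \<iota> by (auto simp: contains_qreg_def qreg_var_def)
  next
    case (cons j w)
    have "continuous_map (base A) (total A) (\<lambda>h. \<iota> h (qcls (exp (\<i> * h)) (word_basis [j]))
        \<otimes>\<^bsub>fib A h\<^esub> \<iota> h (qcls (exp (\<i> * h)) (word_basis w)))"
      using \<iota> cons.IH
      by (intro continuous_map_fiber_mult[OF AD(4)]) (auto simp: contains_qreg_def qreg_var_def proj base)
    then show ?case
    proof (rule continuous_map_eq)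
      fix h assume "h \<in> topspace (base A)"
      then interpret calg_hom "qreg (exp (\<i> * h))" "fib A h" "\<iota> h"
        using hom by (simp add: base)
      show "\<iota> h (qcls (exp (\<i> * h)) (word_basis [j])) \<otimes>\<^bsub>fib A h\<^esub> \<iota> h (qcls (exp (\<i> * h)) (word_basis w)) =
          \<iota> h (qcls (exp (\<i> * h)) (word_basis (j # w)))"
        using qcls_basis_append[of "exp (\<i> * h)" "[j]" w] by (simp add: mult)
    qed
  qed
  interpret A0: calg "fib A 0"
    using AD(3)[of 0] X(3) by (simp add: base)
  have zero: "limitin (total A) (\<lambda>h. \<zero>\<^bsub>fib A h\<^esub>) \<zero>\<^bsub>fib A 0\<^esub> ?F"
    using AD(1) X(3) base by (intro limitin_section) (auto simp: tvs_prebundle_def)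
  have proj0: "proj A \<zero>\<^bsub>fib A 0\<^esub> = 0"
    using vector_space_familyD(2)[OF AD(2), of 0 "\<zero>\<^bsub>fib A 0\<^esub>"] X(3) by (simp add: base)
  have lim_single: "limitin (total A)
      (\<lambda>h. \<iota> h (quantum_defect h (Poly_Mapping.single k a) (Poly_Mapping.single l b))) \<zero>\<^bsub>fib A 0\<^esub> ?F" for k l a b
  proof (cases "k + l = 0")
    case True
    show ?thesis
    proof (rule limitin_transform_eventually[OF _ zero], rule eventually_mono[OF ev])
      fix h assume "h \<in> X"
      then interpret calg_hom "qreg (exp (\<i> * h))" "fib A h" "\<iota> h"
        by (rule hom)
      show "\<zero>\<^bsub>fib A h\<^esub> = \<iota> h (quantum_defect h (Poly_Mapping.single k a) (Poly_Mapping.single l b))"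
        by (simp add: quantum_defect_single monomial_defect_zero[OF True] zero)
    qed
  next
    case False
    let ?Y = "\<lambda>h. \<iota> h (qmono (exp (\<i> * h)) (k + l))"
    have ne: "ordered_word (k + l) \<noteq> []"
      using False content_ordered_word[of "k + l"] by (auto simp: content_def)
    \<comment> \<open>Joint continuity of the scalar multiplication: the scalars tend to
      \<open>0\<close> while the monomial section converges to its value at
      \<open>0\<close>.\<close>
    have "limitin (total A) (\<lambda>h. (a * b * monomial_defect k l h) \<odot>\<^bsub>fib A h\<^esub> ?Y h) (0 \<odot>\<^bsub>fib A 0\<^esub> ?Y 0) ?F"
    proof (rule limitin_fiber_smult[OF AD(1)])
      show "((\<lambda>h. a * b * monomial_defect k l h) \<longlongrightarrow> 0) ?F"
        by (rule tendsto_mult_right_zero, rule tendsto_within_subset[OF tendsto_monomial_defect]) simp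
      show "limitin (total A) ?Y (?Y 0) ?F"
        by (rule limitin_section[OF sec[OF ne] base X(3)])
    qed (use X(3) in \<open>auto simp: proj intro: eventually_mono[OF ev]\<close>)
    also have "0 \<odot>\<^bsub>fib A 0\<^esub> ?Y 0 = \<zero>\<^bsub>fib A 0\<^esub>"
      using calg_hom.closed[OF hom[OF X(3)]] by (intro A0.smult_zero_l) auto
    finally show ?thesis
    proof (rule limitin_transform_eventually[rotated], intro eventually_mono[OF ev])
      fix h assume "h \<in> X"
      then interpret calg_hom "qreg (exp (\<i> * h))" "fib A h" "\<iota> h"
        by (rule hom)
      show "(a * b * monomial_defect k l h) \<odot>\<^bsub>fib A h\<^esub> ?Y h =
          \<iota> h (quantum_defect h (Poly_Mapping.single k a) (Poly_Mapping.single l b))"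
        by (simp add: quantum_defect_single smult)
    qed
  qed
  have lim_add: "limitin (total A) (\<lambda>h. \<iota> h (u h \<oplus>\<^bsub>qreg (exp (\<i> * h))\<^esub> v h)) \<zero>\<^bsub>fib A 0\<^esub> ?F"
    if lim: "limitin (total A) (\<lambda>h. \<iota> h (u h)) \<zero>\<^bsub>fib A 0\<^esub> ?F" "limitin (total A) (\<lambda>h. \<iota> h (v h)) \<zero>\<^bsub>fib A 0\<^esub> ?F"
      and uv: "\<And>h. u h \<in> carrier (qreg (exp (\<i> * h)))" "\<And>h. v h \<in> carrier (qreg (exp (\<i> * h)))" for u v
  proof -
    have "limitin (total A) (\<lambda>h. \<iota> h (u h) \<oplus>\<^bsub>fib A h\<^esub> \<iota> h (v h)) (\<zero>\<^bsub>fib A 0\<^esub> \<oplus>\<^bsub>fib A 0\<^esub> \<zero>\<^bsub>fib A 0\<^esub>) ?F"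
      by (rule limitin_fiber_add[OF AD(1) lim])
        (auto simp: proj uv proj0 intro: eventually_mono[OF ev])
    then have "limitin (total A) (\<lambda>h. \<iota> h (u h) \<oplus>\<^bsub>fib A h\<^esub> \<iota> h (v h)) \<zero>\<^bsub>fib A 0\<^esub> ?F"
      by simp
    then show ?thesis
      by (rule limitin_transform_eventually[rotated])
        (auto intro!: eventually_mono[OF ev] simp: calg_hom.add[OF hom] uv)
  qed
  have zero': "limitin (total A) (\<lambda>h. \<iota> h \<zero>\<^bsub>qreg (exp (\<i> * h))\<^esub>) \<zero>\<^bsub>fib A 0\<^esub> ?F"
    by (rule limitin_transform_eventually[OF _ zero])
      (auto intro!: eventually_mono[OF ev] simp: calg_hom.zero[OF hom])
  have lim: "limitin (total A) (\<lambda>h. \<iota> h (quantum_defect h a b)) \<zero>\<^bsub>fib A 0\<^esub> ?F" for a b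
  proof (induction a rule: mpol_induct)
    case (add a k c)
    have "limitin (total A) (\<lambda>h. \<iota> h (quantum_defect h (Poly_Mapping.single k c) b)) \<zero>\<^bsub>fib A 0\<^esub> ?F"
      by (induction b rule: mpol_induct)
        (simp_all add: quantum_defect_zero zero' quantum_defect_add_right lim_add lim_single)
    with add show ?case
      by (simp add: quantum_defect_add_left lim_add)
  qed (simp add: quantum_defect_zero zero')
  have "complex_linear (poly_alg :: (complex, 'n mpol) module) (fib A h) (\<lambda>f. \<iota> h (qreg_of_poly (exp (\<i> * h)) f))"
    "bij_betw (\<lambda>f. \<iota> h (qreg_of_poly (exp (\<i> * h)) f)) (carrier (poly_alg :: (complex, 'n mpol) module))
      (\<iota> h ` carrier (qreg (exp (\<i> * h))))" if h: "h \<in> X" for h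
  proof -
    interpret calg_hom "qreg (exp (\<i> * h))" "fib A h" "\<iota> h"
      using h by (rule hom)
    show "complex_linear (poly_alg :: (complex, 'n mpol) module) (fib A h) (\<lambda>f. \<iota> h (qreg_of_poly (exp (\<i> * h)) f))"
      by (auto simp: complex_linear_def qreg_of_poly_add qreg_of_poly_smult add smult)
    have "inj_on (\<iota> h) (range (qreg_of_poly (exp (\<i> * h))))"
      using \<iota> h by (simp add: contains_qreg_def base surj_qreg_of_poly)
    then have "inj (\<iota> h \<circ> qreg_of_poly (exp (\<i> * h)))"
      by (intro comp_inj_on inj_qreg_of_poly) auto
    then show "bij_betw (\<lambda>f. \<iota> h (qreg_of_poly (exp (\<i> * h)) f)) (carrier (poly_alg :: (complex, 'n mpol) module))
      (\<iota> h ` carrier (qreg (exp (\<i> * h))))"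
      by (auto simp: bij_betw_def o_def image_image simp flip: surj_qreg_of_poly)
  qed
  note i = this
  have "complex_alg_hom (poly_alg :: (complex, 'n mpol) module) (fib A 0) (\<lambda>f. \<iota> 0 (qreg_of_poly (exp (\<i> * 0)) f))"
  proof -
    interpret calg_hom "qreg 1" "fib A 0" "\<iota> 0"
      using hom[OF X(3)] by simp
    have "(\<lambda>f. \<iota> 0 (qreg_of_poly 1 f)) \<in> ring_hom (poly_alg :: (complex, 'n mpol) module) (fib A 0)"
      by (rule ring_hom_memI)
        (simp_all add: qreg_of_poly_mult_1 qreg_of_poly_add qreg_of_poly_one mult add one)
    then show ?thesis
      using i(1)[OF X(3)] by (simp add: complex_alg_hom_def)
  qed
  moreover have "limitin (total A)
          (\<lambda>h. ((1 / h) \<odot>\<^bsub>fib A h\<^esub>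
                 (\<iota> h (qreg_of_poly (exp (\<i> * h)) a) \<otimes>\<^bsub>fib A h\<^esub> \<iota> h (qreg_of_poly (exp (\<i> * h)) b)
                  \<ominus>\<^bsub>fib A h\<^esub> \<iota> h (qreg_of_poly (exp (\<i> * h)) b) \<otimes>\<^bsub>fib A h\<^esub> \<iota> h (qreg_of_poly (exp (\<i> * h)) a)))
               \<ominus>\<^bsub>fib A h\<^esub> (\<i> \<odot>\<^bsub>fib A h\<^esub> \<iota> h (qreg_of_poly (exp (\<i> * h)) (poly_bracket a b))))
          \<zero>\<^bsub>fib A 0\<^esub> ?F" for a b
  proof (rule limitin_transform_eventually[OF _ lim[of a b]], rule eventually_mono[OF ev])
    fix h assume "h \<in> X"
    then interpret calg_hom "qreg (exp (\<i> * h))" "fib A h" "\<iota> h"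
      by (rule hom)
    show "\<iota> h (quantum_defect h a b) = ((1 / h) \<odot>\<^bsub>fib A h\<^esub>
                 (\<iota> h (qreg_of_poly (exp (\<i> * h)) a) \<otimes>\<^bsub>fib A h\<^esub> \<iota> h (qreg_of_poly (exp (\<i> * h)) b)
                  \<ominus>\<^bsub>fib A h\<^esub> \<iota> h (qreg_of_poly (exp (\<i> * h)) b) \<otimes>\<^bsub>fib A h\<^esub> \<iota> h (qreg_of_poly (exp (\<i> * h)) a)))
               \<ominus>\<^bsub>fib A h\<^esub> (\<i> \<odot>\<^bsub>fib A h\<^esub> \<iota> h (qreg_of_poly (exp (\<i> * h)) (poly_bracket a b)))"
      by (simp add: quantum_defect_def Let_def minus smult mult)
  qed
  moreover have "complex_subalgebra (\<iota> h ` carrier (qreg (exp (\<i> * h)))) (fib A h) \<and>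
        fiber_topology A h closure_of (\<iota> h ` carrier (qreg (exp (\<i> * h)))) = carrier (fib A h)" if "h \<in> X" for h
    using that \<iota> calg_hom.complex_subalgebra_image[OF hom[OF that]]
    by (simp add: contains_qreg_def base)
  ultimately show ?thesis
    unfolding strict_frechet_deformation_quantization_def
    using X A base i by (simp add: poisson_algebra_poly)
qed

section \<open>Bundles generated by sections and seminorms\<close>

context calg
begin

lemma minus_add_cancel: "x \<in> carrier A \<Longrightarrow> y \<in> carrier A \<Longrightarrow> (x \<ominus> y) \<oplus> y = x"
  by (simp add: a_minus_def a_assoc l_neg)

lemma add_minus_cancel: "x \<in> carrier A \<Longrightarrow> y \<in> carrier A \<Longrightarrow> y \<oplus> (x \<ominus> y) = x"
  using minus_add_cancel by (simp add: a_comm)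

lemma add_minus_cancel_left: "x \<in> carrier A \<Longrightarrow> y \<in> carrier A \<Longrightarrow> (x \<oplus> y) \<ominus> x = y"
  by (simp add: a_minus_def a_comm[of x y] a_assoc r_neg)

lemma minus_add_minus: "x \<in> carrier A \<Longrightarrow> y \<in> carrier A \<Longrightarrow> z \<in> carrier A \<Longrightarrow>
    (x \<ominus> y) \<oplus> (y \<ominus> z) = x \<ominus> z"
  by (metis a_assoc a_minus_def add.inv_closed minus_add_cancel minus_closed)

lemma add_minus_add: "x \<in> carrier A \<Longrightarrow> y \<in> carrier A \<Longrightarrow> x' \<in> carrier A \<Longrightarrow> y' \<in> carrier A \<Longrightarrow>
    (x \<oplus> y) \<ominus> (x' \<oplus> y') = (x \<ominus> x') \<oplus> (y \<ominus> y')"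
  by (simp add: minus_conv_smult smult_r_distr a_ac)

lemma minus_minus_minus: "x \<in> carrier A \<Longrightarrow> y \<in> carrier A \<Longrightarrow> x' \<in> carrier A \<Longrightarrow> y' \<in> carrier A \<Longrightarrow>
    (x \<ominus> y) \<ominus> (x' \<ominus> y') = (x \<ominus> x') \<oplus> (y' \<ominus> y)"
  by (simp add: minus_conv_smult smult_r_distr smult_assoc[symmetric] a_ac)

lemma minus_self: "x \<in> carrier A \<Longrightarrow> x \<ominus> x = \<zero>"
  by (simp add: a_minus_def r_neg)

lemma minus_eq_zero_iff: "x \<in> carrier A \<Longrightarrow> y \<in> carrier A \<Longrightarrow> x \<ominus> y = \<zero> \<longleftrightarrow> x = y"
  by (metis minus_add_cancel l_zero minus_self)

text \<open>Written for continuity of the product at \<open>(x', y')\<close>: each summand contains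
  a difference, and the remaining factors are differences or values at the centre.\<close>

lemma mult_minus_mult: "x \<in> carrier A \<Longrightarrow> y \<in> carrier A \<Longrightarrow> x' \<in> carrier A \<Longrightarrow> y' \<in> carrier A \<Longrightarrow>
    x \<otimes> y \<ominus> x' \<otimes> y' = (x \<ominus> x') \<otimes> (y \<ominus> y') \<oplus> ((x \<ominus> x') \<otimes> y' \<oplus> x' \<otimes> (y \<ominus> y'))"
proof -
  assume c: "x \<in> carrier A" "y \<in> carrier A" "x' \<in> carrier A" "y' \<in> carrier A"
  define z where "z = (x \<ominus> x') \<otimes> (y \<ominus> y') \<oplus> ((x \<ominus> x') \<otimes> y' \<oplus> x' \<otimes> (y \<ominus> y'))"
  have z: "z \<in> carrier A"
    using c by (simp add: z_def)
  have "x \<otimes> y = ((x \<ominus> x') \<oplus> x') \<otimes> ((y \<ominus> y') \<oplus> y')"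
    using c by (simp add: minus_add_cancel)
  also have "\<dots> = x' \<otimes> y' \<oplus> z"
    using c by (simp add: z_def l_distr r_distr a_ac)
  finally show ?thesis
    using c z add_minus_cancel_left[of "x' \<otimes> y'" z] by (simp flip: z_def)
qed

text \<open>The analogue for scalar multiplication at \<open>(d, y)\<close>: one summand is small
  because \<open>x \<ominus> y\<close> is, the other because \<open>c - d\<close> is.\<close>

lemma smult_minus_smult: "x \<in> carrier A \<Longrightarrow> y \<in> carrier A \<Longrightarrow>
    c \<odot> x \<ominus> d \<odot> y = c \<odot> (x \<ominus> y) \<oplus> (c - d) \<odot> y"
  using smult_l_distr[of y "- c" "c - d"]
  by (simp add: minus_conv_smult smult_r_distr smult_assoc[symmetric] a_assoc smult_l_distr[symmetric])

context
  fixes N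
  assumes N: "seminorm_on A N"
begin

lemma seminorm_nonneg: "x \<in> carrier A \<Longrightarrow> 0 \<le> N x"
  and seminorm_add: "x \<in> carrier A \<Longrightarrow> y \<in> carrier A \<Longrightarrow> N (x \<oplus> y) \<le> N x + N y"
  and seminorm_smult: "x \<in> carrier A \<Longrightarrow> N (c \<odot> x) = cmod c * N x"
  using N by (auto simp: seminorm_on_def)

lemma seminorm_zero: "N \<zero> = 0"
  using seminorm_smult[of \<zero> 0] by simp

lemma seminorm_minus_swap: "x \<in> carrier A \<Longrightarrow> y \<in> carrier A \<Longrightarrow> N (x \<ominus> y) = N (y \<ominus> x)"
proof -
  assume "x \<in> carrier A" "y \<in> carrier A"
  moreover from this have "x \<ominus> y = (-1) \<odot> (y \<ominus> x)"
    by (simp add: minus_conv_smult smult_r_distr smult_assoc[symmetric] a_comm)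
  ultimately show ?thesis
    by (simp add: seminorm_smult)
qed

lemma seminorm_triangle: "x \<in> carrier A \<Longrightarrow> y \<in> carrier A \<Longrightarrow> z \<in> carrier A \<Longrightarrow>
    N (x \<ominus> z) \<le> N (x \<ominus> y) + N (y \<ominus> z)"
  using seminorm_add[of "x \<ominus> y" "y \<ominus> z"] by (simp add: minus_add_minus)

lemma seminorm_diff: "x \<in> carrier A \<Longrightarrow> y \<in> carrier A \<Longrightarrow> N x \<le> N y + N (x \<ominus> y)"
  using seminorm_add[of "x \<ominus> y" y] by (simp add: minus_add_cancel)

end
end

lemma openin_seminorm_topology:
  "openin (seminorm_topology M \<N>) S \<longleftrightarrow> S \<subseteq> carrier M \<and>
     (\<forall>u\<in>S. \<exists>\<F> \<epsilon>. finite \<F> \<and> \<F> \<subseteq> \<N> \<and> 0 < \<epsilon> \<and>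
        {v \<in> carrier M. \<forall>N\<in>\<F>. N (v \<ominus>\<^bsub>M\<^esub> u) < \<epsilon>} \<subseteq> S)"
proof -
  let ?P = "\<lambda>S. S \<subseteq> carrier M \<and>
     (\<forall>u\<in>S. \<exists>\<F> \<epsilon>. finite \<F> \<and> \<F> \<subseteq> \<N> \<and> 0 < \<epsilon> \<and>
        {v \<in> carrier M. \<forall>N\<in>\<F>. N (v \<ominus>\<^bsub>M\<^esub> u) < \<epsilon>} \<subseteq> S)"
  have "istopology ?P"
    unfolding istopology_def
  proof (rule conjI; intro allI impI)
    fix S T assume S: "?P S" and T: "?P T"
    show "?P (S \<inter> T)"
    proof (intro conjI ballI)
      fix u assume u: "u \<in> S \<inter> T"
      obtain \<F> \<epsilon> where 1: "finite \<F>" "\<F> \<subseteq> \<N>" "0 < \<epsilon>"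
        "{v \<in> carrier M. \<forall>N\<in>\<F>. N (v \<ominus>\<^bsub>M\<^esub> u) < \<epsilon>} \<subseteq> S"
        using S u by blast
      obtain \<F>' \<epsilon>' where 2: "finite \<F>'" "\<F>' \<subseteq> \<N>" "0 < \<epsilon>'"
        "{v \<in> carrier M. \<forall>N\<in>\<F>'. N (v \<ominus>\<^bsub>M\<^esub> u) < \<epsilon>'} \<subseteq> T"
        using T u by blast
      show "\<exists>\<F> \<epsilon>. finite \<F> \<and> \<F> \<subseteq> \<N> \<and> 0 < \<epsilon> \<and>
        {v \<in> carrier M. \<forall>N\<in>\<F>. N (v \<ominus>\<^bsub>M\<^esub> u) < \<epsilon>} \<subseteq> S \<inter> T"
        using 1 2 by (intro exI[of _ "\<F> \<union> \<F>'"] exI[of _ "min \<epsilon> \<epsilon>'"]) auto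
    qed (use S in blast)
  next
    fix \<K> assume "\<forall>K\<in>\<K>. ?P K"
    then show "?P (\<Union>\<K>)"
      by (intro conjI ballI Union_least) (blast, meson UnionE Union_upper subset_trans)
  qed
  then show ?thesis
    unfolding seminorm_topology_def by (simp add: topology_inverse')
qed

lemma topspace_seminorm_topology [simp]: "topspace (seminorm_topology M \<N>) = carrier M"
proof
  have "openin (seminorm_topology M \<N>) (carrier M)"
    unfolding openin_seminorm_topology
    by (intro conjI ballI exI[of _ "{}"] exI[of _ "1::real"]) auto
  then show "carrier M \<subseteq> topspace (seminorm_topology M \<N>)"
    by (rule openin_subset)
  show "topspace (seminorm_topology M \<N>) \<subseteq> carrier M"
    using openin_topspace[of "seminorm_topology M \<N>"] unfolding openin_seminorm_topology by blast
qed

text \<open>A checklist verified for the deformation bundle in \<open>section_bundle_E\<close>. The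
  sections pass through every vector and the seminorms are continuous along them, so tubes around
  members of \<open>\<Gamma>\<close> control the whole topology. The index shift in
  \<open>N_mult\<close> makes room for cutoff functions: a cutoff is in general not bounded by its
  own square.\<close>

locale section_bundle =
  fixes E :: "('x, 'e) bundle_data" and N :: "nat \<Rightarrow> 'e \<Rightarrow> real" and \<Gamma> :: "('x \<Rightarrow> 'e) set"
  assumes proj_total: "proj E ` topspace (total E) = topspace (base E)"
    and calg: "x \<in> topspace (base E) \<Longrightarrow> calg (fib E x)"
    and carrier_fib: "x \<in> topspace (base E) \<Longrightarrow> carrier (fib E x) = {u \<in> topspace (total E). proj E u = x}"
    and \<Gamma>_closed: "s \<in> \<Gamma> \<Longrightarrow> x \<in> topspace (base E) \<Longrightarrow> s x \<in> carrier (fib E x)"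
    and \<Gamma>_surj: "x \<in> topspace (base E) \<Longrightarrow> u \<in> carrier (fib E x) \<Longrightarrow> \<exists>s\<in>\<Gamma>. s x = u"
    and \<Gamma>_zero: "\<exists>r\<in>\<Gamma>. \<forall>x\<in>topspace (base E). r x = \<zero>\<^bsub>fib E x\<^esub>"
    and \<Gamma>_add: "s \<in> \<Gamma> \<Longrightarrow> t \<in> \<Gamma> \<Longrightarrow> \<exists>r\<in>\<Gamma>. \<forall>x\<in>topspace (base E). r x = s x \<oplus>\<^bsub>fib E x\<^esub> t x"
    and \<Gamma>_smult: "s \<in> \<Gamma> \<Longrightarrow> \<exists>r\<in>\<Gamma>. \<forall>x\<in>topspace (base E). r x = c \<odot>\<^bsub>fib E x\<^esub> s x"
    and \<Gamma>_mult: "s \<in> \<Gamma> \<Longrightarrow> t \<in> \<Gamma> \<Longrightarrow> \<exists>r\<in>\<Gamma>. \<forall>x\<in>topspace (base E). r x = s x \<otimes>\<^bsub>fib E x\<^esub> t x"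
    and seminorm: "x \<in> topspace (base E) \<Longrightarrow> seminorm_on (fib E x) (N m)"
    and N_mono: "x \<in> topspace (base E) \<Longrightarrow> u \<in> carrier (fib E x) \<Longrightarrow> N m u \<le> N (Suc m) u"
    and N_mult: "x \<in> topspace (base E) \<Longrightarrow> u \<in> carrier (fib E x) \<Longrightarrow> v \<in> carrier (fib E x) \<Longrightarrow>
      N m (u \<otimes>\<^bsub>fib E x\<^esub> v) \<le> N (Suc m) u * N (Suc m) v"
    and N_cont: "s \<in> \<Gamma> \<Longrightarrow> continuous_map (base E) euclideanreal (\<lambda>x. N m (s x))"
    and separated: "x \<in> topspace (base E) \<Longrightarrow> u \<in> carrier (fib E x) \<Longrightarrow> (\<And>m. N m u = 0) \<Longrightarrow> u = \<zero>\<^bsub>fib E x\<^esub>"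
    and complete: "x \<in> topspace (base E) \<Longrightarrow> range \<sigma> \<subseteq> carrier (fib E x) \<Longrightarrow>
      (\<And>m \<epsilon>. 0 < \<epsilon> \<Longrightarrow> \<exists>M. \<forall>k\<ge>M. \<forall>l\<ge>M. N m (\<sigma> k \<ominus>\<^bsub>fib E x\<^esub> \<sigma> l) < \<epsilon>) \<Longrightarrow>
      \<exists>u\<in>carrier (fib E x). \<forall>m. (\<lambda>k::nat. N m (\<sigma> k \<ominus>\<^bsub>fib E x\<^esub> u)) \<longlonglongrightarrow> 0"
    and open_total: "openin (total E) = arbitrary union_of (\<lambda>W. \<exists>V s m \<epsilon>. openin (base E) V \<and>
      s \<in> \<Gamma> \<and> 0 < \<epsilon> \<and> W = seminorm_tube E s V (N m) \<epsilon>)"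
    and unif: "unif E = unif_of_seminorms E (range N)"
begin

abbreviation "B \<equiv> topspace (base E)"

lemma mem_total: "u \<in> topspace (total E) \<Longrightarrow> proj E u \<in> B \<and> u \<in> carrier (fib E (proj E u))"
  using proj_total carrier_fib by fastforce

lemma mem_carrier: "x \<in> B \<Longrightarrow> u \<in> carrier (fib E x) \<Longrightarrow> u \<in> topspace (total E) \<and> proj E u = x"
  using carrier_fib by auto

lemma total_section:
  assumes "u \<in> topspace (total E)"
  obtains s x where "s \<in> \<Gamma>" "x \<in> B" "u = s x" "proj E u = x"
  using assms mem_total[OF assms] \<Gamma>_surj[of "proj E u" u] by metis

lemma N_mono': "x \<in> B \<Longrightarrow> u \<in> carrier (fib E x) \<Longrightarrow> m \<le> m' \<Longrightarrow> N m u \<le> N m' u"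
  by (rule lift_Suc_mono_le[of "\<lambda>m. N m u"]) (auto intro: N_mono)

lemma \<Gamma>_minus:
  assumes "s \<in> \<Gamma>" "t \<in> \<Gamma>"
  shows "\<exists>r\<in>\<Gamma>. \<forall>x\<in>B. r x = s x \<ominus>\<^bsub>fib E x\<^esub> t x"
proof -
  obtain t' where t': "t' \<in> \<Gamma>" "\<forall>x\<in>B. t' x = (-1) \<odot>\<^bsub>fib E x\<^esub> t x"
    using \<Gamma>_smult[OF assms(2)] by blast
  obtain r where "r \<in> \<Gamma>" "\<forall>x\<in>B. r x = s x \<oplus>\<^bsub>fib E x\<^esub> t' x"
    using \<Gamma>_add[OF assms(1) t'(1)] by blast
  then show ?thesis
    using t' \<Gamma>_closed[OF assms(1)] \<Gamma>_closed[OF assms(2)] calg.minus_conv_smult[OF calg] by metis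
qed

lemma N_minus_cont:
  assumes "s \<in> \<Gamma>" "t \<in> \<Gamma>"
  shows "continuous_map (base E) euclideanreal (\<lambda>x. N m (s x \<ominus>\<^bsub>fib E x\<^esub> t x))"
proof -
  obtain r where "r \<in> \<Gamma>" "\<forall>x\<in>B. r x = s x \<ominus>\<^bsub>fib E x\<^esub> t x"
    using \<Gamma>_minus[OF assms] by blast
  then show ?thesis
    by (intro continuous_map_eq[OF N_cont[of r m]]) auto
qed

lemma N_lt_open: "s \<in> \<Gamma> \<Longrightarrow> t \<in> \<Gamma> \<Longrightarrow> openin (base E) {x \<in> B. N m (s x \<ominus>\<^bsub>fib E x\<^esub> t x) < c}"
  using N_minus_cont[of s t m] unfolding continuous_map_upper_lower_semicontinuous_lt by blast

lemma N_lt_open': "s \<in> \<Gamma> \<Longrightarrow> openin (base E) {x \<in> B. N m (s x) < c}"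
  using N_cont[of s m] unfolding continuous_map_upper_lower_semicontinuous_lt by blast

abbreviation tube :: "('x \<Rightarrow> 'e) \<Rightarrow> 'x set \<Rightarrow> nat \<Rightarrow> real \<Rightarrow> 'e set" where
  "tube s V m \<epsilon> \<equiv> seminorm_tube E s V (N m) \<epsilon>"

lemma mem_tube: "u \<in> tube s V m \<epsilon> \<longleftrightarrow> u \<in> topspace (total E) \<and> proj E u \<in> V \<and>
    N m (u \<ominus>\<^bsub>fib E (proj E u)\<^esub> s (proj E u)) < \<epsilon>"
  by (auto simp: seminorm_tube_def)

lemma mem_tube_fiber: "x \<in> B \<Longrightarrow> u \<in> carrier (fib E x) \<Longrightarrow>
    u \<in> tube s V m \<epsilon> \<longleftrightarrow> x \<in> V \<and> N m (u \<ominus>\<^bsub>fib E x\<^esub> s x) < \<epsilon>"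
  using mem_carrier mem_tube by auto

lemma section_mem_tube: "s \<in> \<Gamma> \<Longrightarrow> x \<in> B \<Longrightarrow> x \<in> V \<Longrightarrow> 0 < \<epsilon> \<Longrightarrow> s x \<in> tube s V m \<epsilon>"
  using calg.minus_self[OF calg] calg.seminorm_zero[OF calg seminorm] \<Gamma>_closed
  by (simp add: mem_tube_fiber)

lemma open_tube: "openin (base E) V \<Longrightarrow> s \<in> \<Gamma> \<Longrightarrow> 0 < \<epsilon> \<Longrightarrow> openin (total E) (tube s V m \<epsilon>)"
  using open_total unfolding openin_topology_base_unique by blast

lemma tube_base:
  assumes "openin (total E) W" "u \<in> W"
  obtains V s m \<epsilon> where "openin (base E) V" "s \<in> \<Gamma>" "0 < \<epsilon>" "u \<in> tube s V m \<epsilon>" "tube s V m \<epsilon> \<subseteq> W"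
proof -
  have "\<forall>U x. openin (total E) U \<and> x \<in> U \<longrightarrow>
      (\<exists>W. (\<exists>V s m \<epsilon>. openin (base E) V \<and> s \<in> \<Gamma> \<and> 0 < \<epsilon> \<and> W = tube s V m \<epsilon>) \<and> x \<in> W \<and> W \<subseteq> U)"
    using open_total unfolding openin_topology_base_unique by (rule conjunct2)
  then show ?thesis
    using assms that by (metis (no_types, lifting))
qed

text \<open>Tubes can be recentred: where the distance from \<open>s\<close> to the old centre stays
  below \<open>c < \<delta>\<close>, a tube of radius \<open>\<delta> - c\<close> around
  \<open>s\<close> fits inside. Continuity of the seminorms along sections makes this set of base
  points open.\<close>

lemma open_nhd:
  assumes "openin (total E) W" "s \<in> \<Gamma>" "x \<in> B" "s x \<in> W"
  obtains V m \<epsilon> where "openin (base E) V" "x \<in> V" "0 < \<epsilon>" "tube s V m \<epsilon> \<subseteq> W"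
proof -
  obtain V t m \<delta> where V: "openin (base E) V" "t \<in> \<Gamma>" "s x \<in> tube t V m \<delta>" "tube t V m \<delta> \<subseteq> W"
    using tube_base[OF assms(1,4)] by metis
  note sx = \<Gamma>_closed[OF assms(2)] and tx = \<Gamma>_closed[OF V(2)]
  have x: "x \<in> V" "N m (s x \<ominus>\<^bsub>fib E x\<^esub> t x) < \<delta>"
    using V(3) assms sx by (auto simp: mem_tube_fiber)
  obtain c where c: "N m (s x \<ominus>\<^bsub>fib E x\<^esub> t x) < c" "c < \<delta>"
    using dense x by blast
  let ?V = "V \<inter> {x \<in> B. N m (s x \<ominus>\<^bsub>fib E x\<^esub> t x) < c}"
  have "tube s ?V m (\<delta> - c) \<subseteq> tube t V m \<delta>"
  proof
    fix u assume u: "u \<in> tube s ?V m (\<delta> - c)"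
    let ?y = "proj E u"
    have y: "?y \<in> B" "?y \<in> V" "u \<in> carrier (fib E ?y)" "N m (s ?y \<ominus>\<^bsub>fib E ?y\<^esub> t ?y) < c"
      "N m (u \<ominus>\<^bsub>fib E ?y\<^esub> s ?y) < \<delta> - c"
      using u mem_total by (auto simp: mem_tube)
    then have "N m (u \<ominus>\<^bsub>fib E ?y\<^esub> t ?y) < \<delta>"
      using calg.seminorm_triangle[OF calg[OF y(1)] seminorm[OF y(1)], of u "s ?y" "t ?y" m] sx tx by fastforce
    then show "u \<in> tube t V m \<delta>"
      using y by (simp add: mem_tube_fiber)
  qed
  then show ?thesis
    using V c x assms N_lt_open[OF assms(2) V(2), of m c]
    by (intro that[of ?V "\<delta> - c" m]) auto
qed

lemma open_totalI:
  assumes "W \<subseteq> topspace (total E)"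
    and "\<And>s x. s \<in> \<Gamma> \<Longrightarrow> x \<in> B \<Longrightarrow> s x \<in> W \<Longrightarrow>
      \<exists>V m \<epsilon>. openin (base E) V \<and> x \<in> V \<and> 0 < \<epsilon> \<and> tube s V m \<epsilon> \<subseteq> W"
  shows "openin (total E) W"
proof (subst openin_subopen, intro ballI)
  fix u assume "u \<in> W"
  then obtain s x where s: "s \<in> \<Gamma>" "x \<in> B" "u = s x"
    using assms(1) total_section by (metis subsetD)
  then obtain V m \<epsilon> where "openin (base E) V" "x \<in> V" "0 < \<epsilon>" "tube s V m \<epsilon> \<subseteq> W"
    using assms(2)[OF s(1,2)] s(3) \<open>u \<in> W\<close> by auto
  then show "\<exists>T. openin (total E) T \<and> u \<in> T \<and> T \<subseteq> W"
    using open_tube[OF _ s(1), of V \<epsilon> m] section_mem_tube[OF s(1,2), of V \<epsilon> m] s(3) by auto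
qed

section \<open>Continuity of the projection, the sections and the fiberwise operations\<close>

lemma continuous_proj: "continuous_map (total E) (base E) (proj E)"
proof (unfold continuous_map_def, intro conjI allI impI)
  show "proj E \<in> topspace (total E) \<rightarrow> B"
    using proj_total by blast
  fix V assume V: "openin (base E) V"
  show "openin (total E) {u \<in> topspace (total E). proj E u \<in> V}"
  proof (rule open_totalI)
    fix s x assume "s \<in> \<Gamma>" "x \<in> B" "s x \<in> {u \<in> topspace (total E). proj E u \<in> V}"
    then have "x \<in> V"
      using \<Gamma>_closed mem_carrier by auto
    then show "\<exists>V' m \<epsilon>. openin (base E) V' \<and> x \<in> V' \<and> 0 < \<epsilon> \<and>
        tube s V' m \<epsilon> \<subseteq> {u \<in> topspace (total E). proj E u \<in> V}"
      using V by (intro exI[of _ V] exI[of _ 0] exI[of _ 1]) (auto simp: mem_tube)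
  qed auto
qed

text \<open>Every point of \<open>W\<close> lies on a section, and a tube around that section inside
  \<open>W\<close> contains the section values over its entire base set.\<close>

lemma open_map_proj: "open_map (total E) (base E) (proj E)"
  unfolding open_map_def
proof (intro allI impI, subst openin_subopen, intro ballI)
  fix W x assume W: "openin (total E) W" "x \<in> proj E ` W"
  then obtain u where u: "u \<in> W" "proj E u = x"
    by blast
  then have "u \<in> topspace (total E)"
    using W openin_subset by blast
  then obtain s where s: "s \<in> \<Gamma>" "x \<in> B" "u = s x"
    using total_section u by metis
  have "s x \<in> W"
    using u(1) s(3) by simp
  then obtain V m \<epsilon> where V: "openin (base E) V" "x \<in> V" "0 < \<epsilon>" "tube s V m \<epsilon> \<subseteq> W"
    by (rule open_nhd[OF W(1) s(1,2)])
  have "V \<subseteq> proj E ` W"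
  proof
    fix y assume y: "y \<in> V"
    then have "y \<in> B"
      using V openin_subset by blast
    then show "y \<in> proj E ` W"
      using section_mem_tube[OF s(1) \<open>y \<in> B\<close> y V(3), of m] V(4)
        mem_carrier[OF \<open>y \<in> B\<close> \<Gamma>_closed[OF s(1) \<open>y \<in> B\<close>]]
      by (intro image_eqI[of _ _ "s y"]) auto
  qed
  then show "\<exists>T. openin (base E) T \<and> x \<in> T \<and> T \<subseteq> proj E ` W"
    using V by blast
qed

lemma continuous_section: "s \<in> \<Gamma> \<Longrightarrow> continuous_map (base E) (total E) s"
proof (unfold continuous_map_def, intro conjI allI impI)
  assume s: "s \<in> \<Gamma>"
  show "s \<in> B \<rightarrow> topspace (total E)"
    using s \<Gamma>_closed mem_carrier by blast
  fix W assume W: "openin (total E) W"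
  show "openin (base E) {x \<in> B. s x \<in> W}"
  proof (subst openin_subopen, intro ballI)
    fix x assume x: "x \<in> {x \<in> B. s x \<in> W}"
    from x have "x \<in> B" "s x \<in> W"
      by auto
    then obtain V m \<epsilon> where V: "openin (base E) V" "x \<in> V" "0 < \<epsilon>" "tube s V m \<epsilon> \<subseteq> W"
      by (rule open_nhd[OF W s])
    have "V \<subseteq> {x \<in> B. s x \<in> W}"
      using section_mem_tube[OF s _ _ V(3), of _ V m] openin_subset[OF V(1)] V(4) by auto
    then show "\<exists>T. openin (base E) T \<and> x \<in> T \<and> T \<subseteq> {x \<in> B. s x \<in> W}"
      using V by auto
  qed
qed

text \<open>Reduces the continuity of a fiberwise operation to an estimate around two sections
  through the given pair of points, uniform over nearby fibers.\<close>

lemma continuous_fiber_product: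
  assumes f: "\<And>x u v. x \<in> B \<Longrightarrow> u \<in> carrier (fib E x) \<Longrightarrow> v \<in> carrier (fib E x) \<Longrightarrow> f (u, v) \<in> carrier (fib E x)"
    and nhd: "\<And>s t W x. s \<in> \<Gamma> \<Longrightarrow> t \<in> \<Gamma> \<Longrightarrow> x \<in> B \<Longrightarrow> openin (total E) W \<Longrightarrow> f (s x, t x) \<in> W \<Longrightarrow>
      \<exists>V m \<epsilon>. openin (base E) V \<and> x \<in> V \<and> 0 < \<epsilon> \<and>
        (\<forall>y\<in>V. \<forall>u\<in>carrier (fib E y). \<forall>v\<in>carrier (fib E y). N m (u \<ominus>\<^bsub>fib E y\<^esub> s y) < \<epsilon> \<longrightarrow>
          N m (v \<ominus>\<^bsub>fib E y\<^esub> t y) < \<epsilon> \<longrightarrow> f (u, v) \<in> W)"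
  shows "continuous_map (fiber_product E) (total E) f"
proof (unfold continuous_map_def, intro conjI allI impI)
  have top: "topspace (fiber_product E) =
      {(u, v). u \<in> topspace (total E) \<and> v \<in> topspace (total E) \<and> proj E u = proj E v}"
    by (auto simp: fiber_product_def)
  show "f \<in> topspace (fiber_product E) \<rightarrow> topspace (total E)"
    unfolding top using f mem_total mem_carrier by auto metis
  fix W assume W: "openin (total E) W"
  show "openin (fiber_product E) {p \<in> topspace (fiber_product E). f p \<in> W}"
  proof (subst openin_subopen, intro ballI)
    fix p assume p: "p \<in> {p \<in> topspace (fiber_product E). f p \<in> W}"
    then obtain u v where uv: "p = (u, v)" "u \<in> topspace (total E)" "v \<in> topspace (total E)"
      "proj E u = proj E v" "f (u, v) \<in> W"
      unfolding top by auto
    obtain s x where s: "s \<in> \<Gamma>" "x \<in> B" "u = s x" "proj E u = x"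
      using total_section uv by metis
    obtain t where t: "t \<in> \<Gamma>" "v = t x"
      using total_section uv s by metis
    obtain V m \<epsilon> where V: "openin (base E) V" "x \<in> V" "0 < \<epsilon>"
      and *: "\<forall>y\<in>V. \<forall>u\<in>carrier (fib E y). \<forall>v\<in>carrier (fib E y). N m (u \<ominus>\<^bsub>fib E y\<^esub> s y) < \<epsilon> \<longrightarrow>
          N m (v \<ominus>\<^bsub>fib E y\<^esub> t y) < \<epsilon> \<longrightarrow> f (u, v) \<in> W"
      using nhd[OF s(1) t(1) s(2) W] uv(5) s(3) t(2) by auto
    let ?T = "(tube s V m \<epsilon> \<times> tube t V m \<epsilon>) \<inter> {(u, v). proj E u = proj E v}"
    have "openin (fiber_product E) ?T"
      unfolding fiber_product_def openin_subtopology
      using open_tube[OF V(1) s(1) V(3), of m] open_tube[OF V(1) t(1) V(3), of m]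
      by (intro exI[of _ "tube s V m \<epsilon> \<times> tube t V m \<epsilon>"]) (simp add: openin_prod_Times_iff)
    moreover have "p \<in> ?T"
      using uv s t V section_mem_tube by auto
    moreover have "?T \<subseteq> {p \<in> topspace (fiber_product E). f p \<in> W}"
    proof
      fix p' assume p': "p' \<in> ?T"
      obtain u' v' where uv': "p' = (u', v')"
        by fastforce
      let ?y = "proj E u'"
      have "u' \<in> topspace (total E)" "v' \<in> topspace (total E)" "proj E v' = ?y" "?y \<in> V"
        "N m (u' \<ominus>\<^bsub>fib E ?y\<^esub> s ?y) < \<epsilon>" "N m (v' \<ominus>\<^bsub>fib E ?y\<^esub> t ?y) < \<epsilon>"
        using p' uv' by (auto simp: mem_tube)
      moreover from this have "u' \<in> carrier (fib E ?y)" "v' \<in> carrier (fib E ?y)"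
        using mem_total by metis+
      ultimately show "p' \<in> {p \<in> topspace (fiber_product E). f p \<in> W}"
        unfolding top uv' using * by auto
    qed
    ultimately show "\<exists>T. openin (fiber_product E) T \<and> p \<in> T \<and> T \<subseteq> {p \<in> topspace (fiber_product E). f p \<in> W}"
      by blast
  qed
qed

lemma continuous_add: "continuous_map (fiber_product E) (total E) (\<lambda>(u, v). u \<oplus>\<^bsub>fib E (proj E u)\<^esub> v)"
proof (rule continuous_fiber_product, goal_cases)
  case (1 x u v)
  then interpret calg "fib E x"
    by (intro calg)
  show ?case
    using 1 mem_carrier by auto
next
  case (2 s t W x)
  obtain r where r: "r \<in> \<Gamma>" "\<forall>x\<in>B. r x = s x \<oplus>\<^bsub>fib E x\<^esub> t x"
    using \<Gamma>_add 2 by blast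
  have "r x \<in> W"
    using 2 r mem_carrier[OF _ \<Gamma>_closed[OF 2(1)]] by auto
  then obtain V m \<epsilon> where V: "openin (base E) V" "x \<in> V" "0 < \<epsilon>" "tube r V m \<epsilon> \<subseteq> W"
    by (rule open_nhd[OF 2(4) r(1) 2(3)])
  show ?case
  proof (intro exI[of _ V] exI[of _ m] exI[of _ "\<epsilon> / 2"] conjI ballI impI)
    fix y u v assume y: "y \<in> V" and uv: "u \<in> carrier (fib E y)" "v \<in> carrier (fib E y)"
      "N m (u \<ominus>\<^bsub>fib E y\<^esub> s y) < \<epsilon> / 2" "N m (v \<ominus>\<^bsub>fib E y\<^esub> t y) < \<epsilon> / 2"
    have yB: "y \<in> B"
      using y V openin_subset by blast
    interpret calg "fib E y"
      using yB by (rule calg)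
    have st: "s y \<in> carrier (fib E y)" "t y \<in> carrier (fib E y)"
      using \<Gamma>_closed 2 yB by auto
    have "N m ((u \<oplus>\<^bsub>fib E y\<^esub> v) \<ominus>\<^bsub>fib E y\<^esub> r y) < \<epsilon>"
      using seminorm_add[OF seminorm[OF yB, of m], of "u \<ominus>\<^bsub>fib E y\<^esub> s y" "v \<ominus>\<^bsub>fib E y\<^esub> t y"] uv st r(2) yB
      by (simp add: add_minus_add)
    then have "u \<oplus>\<^bsub>fib E y\<^esub> v \<in> tube r V m \<epsilon>"
      using uv y yB by (simp add: mem_tube_fiber)
    then show "(case (u, v) of (u, v) \<Rightarrow> u \<oplus>\<^bsub>fib E (proj E u)\<^esub> v) \<in> W"
      using V mem_carrier[OF yB uv(1)] by auto
  qed (use V in auto)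
qed

lemma continuous_mult: "continuous_map (fiber_product E) (total E) (\<lambda>(u, v). u \<otimes>\<^bsub>fib E (proj E u)\<^esub> v)"
proof (rule continuous_fiber_product, goal_cases)
  case (1 x u v)
  then interpret calg "fib E x"
    by (intro calg)
  show ?case
    using 1 mem_carrier by auto
next
  case (2 s t W x)
  obtain r where r: "r \<in> \<Gamma>" "\<forall>x\<in>B. r x = s x \<otimes>\<^bsub>fib E x\<^esub> t x"
    using \<Gamma>_mult 2 by blast
  have "r x \<in> W"
    using 2 r mem_carrier[OF _ \<Gamma>_closed[OF 2(1)]] by auto
  then obtain V m \<epsilon> where V: "openin (base E) V" "x \<in> V" "0 < \<epsilon>" "tube r V m \<epsilon> \<subseteq> W"
    by (rule open_nhd[OF 2(4) r(1) 2(3)])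
  \<comment> \<open>A strict bound for both sections at \<open>x\<close> in the seminorm of index
    \<open>Suc m\<close>; it persists over a neighbourhood of \<open>x\<close>.\<close>
  define K where "K = max (N (Suc m) (s x)) (N (Suc m) (t x)) + 1"
  have K: "0 < K" "N (Suc m) (s x) < K" "N (Suc m) (t x) < K"
    using calg.seminorm_nonneg[OF calg[OF 2(3)] seminorm[OF 2(3)], of "s x" "Suc m"] \<Gamma>_closed[OF 2(1) 2(3)]
    by (auto simp: K_def)
  \<comment> \<open>By \<open>mult_minus_mult\<close> the error is less than
    \<open>\<delta> + \<delta> * K + K * \<delta>\<close>, where the first term uses
    \<open>\<delta> \<le> 1\<close>.\<close>
  define \<delta> where "\<delta> = min 1 (\<epsilon> / (1 + 2 * K))"
  have "\<delta> * (1 + 2 * K) \<le> \<epsilon> / (1 + 2 * K) * (1 + 2 * K)"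
    using K(1) by (intro mult_right_mono) (auto simp: \<delta>_def)
  with K(1) V(3) have \<delta>: "0 < \<delta>" "\<delta> \<le> 1" "\<delta> * (1 + 2 * K) \<le> \<epsilon>"
    by (auto simp: \<delta>_def)
  let ?V = "V \<inter> ({x \<in> B. N (Suc m) (s x) < K} \<inter> {x \<in> B. N (Suc m) (t x) < K})"
  show ?case
  proof (intro exI[of _ ?V] exI[of _ "Suc m"] exI[of _ \<delta>] conjI ballI impI)
    show "openin (base E) ?V"
      using N_lt_open' V 2 by (intro openin_Int) auto
    show "x \<in> ?V"
      using V 2 K by auto
    fix y u v assume y: "y \<in> ?V" and uv: "u \<in> carrier (fib E y)" "v \<in> carrier (fib E y)"
      "N (Suc m) (u \<ominus>\<^bsub>fib E y\<^esub> s y) < \<delta>" "N (Suc m) (v \<ominus>\<^bsub>fib E y\<^esub> t y) < \<delta>"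
    have yB: "y \<in> B"
      using y by auto
    interpret calg "fib E y"
      using yB by (rule calg)
    note sn = seminorm[OF yB]
    have st: "s y \<in> carrier (fib E y)" "t y \<in> carrier (fib E y)"
      using \<Gamma>_closed 2 yB by auto
    define a b where "a = u \<ominus>\<^bsub>fib E y\<^esub> s y" and "b = v \<ominus>\<^bsub>fib E y\<^esub> t y"
    have ab: "a \<in> carrier (fib E y)" "b \<in> carrier (fib E y)" "N (Suc m) a < \<delta>" "N (Suc m) b < \<delta>"
      using uv st by (auto simp: a_def b_def)
    have nn: "0 \<le> N (Suc m) w" if "w \<in> carrier (fib E y)" for w
      using seminorm_nonneg[OF sn that] .
    have prod: "N m (a' \<otimes>\<^bsub>fib E y\<^esub> b') \<le> \<alpha> * \<beta>"
      if "a' \<in> carrier (fib E y)" "b' \<in> carrier (fib E y)" "N (Suc m) a' \<le> \<alpha>" "N (Suc m) b' \<le> \<beta>" for a' b' \<alpha> \<beta>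
    proof -
      have "N m (a' \<otimes>\<^bsub>fib E y\<^esub> b') \<le> N (Suc m) a' * N (Suc m) b'"
        using that yB by (intro N_mult) auto
      also have "\<dots> \<le> \<alpha> * \<beta>"
        using that nn by (intro mult_mono) (auto intro: order_trans)
      finally show ?thesis .
    qed
    have lt: "N m (a \<otimes>\<^bsub>fib E y\<^esub> b) < \<delta>"
    proof -
      have "N m (a \<otimes>\<^bsub>fib E y\<^esub> b) \<le> N (Suc m) a * 1"
        using ab \<delta> by (intro prod) auto
      then show ?thesis
        using ab by simp
    qed
    have "N m (u \<otimes>\<^bsub>fib E y\<^esub> v \<ominus>\<^bsub>fib E y\<^esub> s y \<otimes>\<^bsub>fib E y\<^esub> t y)
      = N m (a \<otimes>\<^bsub>fib E y\<^esub> b \<oplus>\<^bsub>fib E y\<^esub> (a \<otimes>\<^bsub>fib E y\<^esub> t y \<oplus>\<^bsub>fib E y\<^esub> s y \<otimes>\<^bsub>fib E y\<^esub> b))"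
      using uv st by (simp add: mult_minus_mult a_def b_def)
    also have "\<dots> \<le> N m (a \<otimes>\<^bsub>fib E y\<^esub> b) + N m (a \<otimes>\<^bsub>fib E y\<^esub> t y \<oplus>\<^bsub>fib E y\<^esub> s y \<otimes>\<^bsub>fib E y\<^esub> b)"
      using ab st by (intro seminorm_add[OF sn]) auto
    also have "N m (a \<otimes>\<^bsub>fib E y\<^esub> t y \<oplus>\<^bsub>fib E y\<^esub> s y \<otimes>\<^bsub>fib E y\<^esub> b) \<le>
        N m (a \<otimes>\<^bsub>fib E y\<^esub> t y) + N m (s y \<otimes>\<^bsub>fib E y\<^esub> b)"
      using ab st by (intro seminorm_add[OF sn]) auto
    also have "N m (a \<otimes>\<^bsub>fib E y\<^esub> t y) \<le> \<delta> * K"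
      using ab st y by (intro prod) auto
    also have "N m (s y \<otimes>\<^bsub>fib E y\<^esub> b) \<le> K * \<delta>"
      using ab st y by (intro prod) auto
    finally have "N m (u \<otimes>\<^bsub>fib E y\<^esub> v \<ominus>\<^bsub>fib E y\<^esub> r y) < \<epsilon>"
      using lt \<delta>(3) r(2) yB by (simp add: algebra_simps)
    then have "u \<otimes>\<^bsub>fib E y\<^esub> v \<in> tube r V m \<epsilon>"
      using uv y yB by (simp add: mem_tube_fiber)
    then show "(case (u, v) of (u, v) \<Rightarrow> u \<otimes>\<^bsub>fib E (proj E u)\<^esub> v) \<in> W"
      using V mem_carrier[OF yB uv(1)] by auto
  qed (use \<delta> in auto)
qed

lemma continuous_smult:
  "continuous_map (prod_topology euclidean (total E)) (total E) (\<lambda>(c, u). c \<odot>\<^bsub>fib E (proj E u)\<^esub> u)"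
proof (unfold continuous_map_def, intro conjI allI impI)
  show "(\<lambda>(c, u). c \<odot>\<^bsub>fib E (proj E u)\<^esub> u) \<in> topspace (prod_topology euclidean (total E)) \<rightarrow> topspace (total E)"
  proof (rule funcsetI)
    fix p :: "complex \<times> 'e" assume p: "p \<in> topspace (prod_topology euclidean (total E))"
    obtain c u where cu: "p = (c, u)"
      by fastforce
    with p have u: "proj E u \<in> B" "u \<in> carrier (fib E (proj E u))"
      using mem_total by auto
    then show "(\<lambda>(c, u). c \<odot>\<^bsub>fib E (proj E u)\<^esub> u) p \<in> topspace (total E)"
      using mem_carrier[OF u(1) calg.smult_closed[OF calg[OF u(1)] u(2)]] cu by simp
  qed
  fix W assume W: "openin (total E) W"
  let ?P = "{p \<in> topspace (prod_topology euclidean (total E)). (\<lambda>(c, u). c \<odot>\<^bsub>fib E (proj E u)\<^esub> u) p \<in> W}"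
  show "openin (prod_topology euclidean (total E)) ?P"
  proof (subst openin_subopen, intro ballI)
    fix p assume p: "p \<in> ?P"
    then obtain c u where cu: "p = (c, u)" "u \<in> topspace (total E)" "c \<odot>\<^bsub>fib E (proj E u)\<^esub> u \<in> W"
      by auto
    obtain s x where s: "s \<in> \<Gamma>" "x \<in> B" "u = s x" "proj E u = x"
      using total_section cu by metis
    obtain r where r: "r \<in> \<Gamma>" "\<forall>x\<in>B. r x = c \<odot>\<^bsub>fib E x\<^esub> s x"
      using \<Gamma>_smult s by blast
    have "r x \<in> W"
      using cu s r by auto
    then obtain V m \<epsilon> where V: "openin (base E) V" "x \<in> V" "0 < \<epsilon>" "tube r V m \<epsilon> \<subseteq> W"
      by (rule open_nhd[OF W r(1) s(2)])
    \<comment> \<open>\<open>K\<close> exceeds the seminorm of the section near \<open>x\<close> and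
      also the modulus of every scalar within distance \<open>1\<close> of \<open>c\<close>. Each of
      the two error terms is then below \<open>K * \<delta>\<close>.\<close>
    define K where "K = max (N m (s x)) (cmod c + 1) + 1"
    have K: "0 < K" "N m (s x) < K" "cmod c + 1 \<le> K"
      by (auto simp: K_def) (use norm_ge_zero[of c] in linarith)
    define \<delta> where "\<delta> = min 1 (\<epsilon> / (2 * K))"
    have "\<delta> * (2 * K) \<le> \<epsilon> / (2 * K) * (2 * K)"
      using K(1) by (intro mult_right_mono) (auto simp: \<delta>_def)
    with K(1) V(3) have \<delta>: "0 < \<delta>" "\<delta> \<le> 1" "\<delta> * (2 * K) \<le> \<epsilon>"
      by (auto simp: \<delta>_def)
    let ?V = "V \<inter> {x \<in> B. N m (s x) < K}"
    let ?T = "ball c \<delta> \<times> tube s ?V m \<delta>"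
    have "openin (base E) ?V"
      using N_lt_open'[OF s(1)] V by (intro openin_Int) auto
    then have "openin (prod_topology euclidean (total E)) ?T"
      using open_tube[of ?V s \<delta> m] s(1) \<delta>(1) by (simp add: openin_prod_Times_iff)
    moreover have "p \<in> ?T"
      using cu(1) s(2,3) V(2) \<delta>(1) K section_mem_tube[OF s(1,2), of ?V \<delta> m] by auto
    moreover have "?T \<subseteq> ?P"
    proof
      fix p' assume p': "p' \<in> ?T"
      obtain d v where dv: "p' = (d, v)"
        by fastforce
      let ?y = "proj E v"
      have v: "v \<in> topspace (total E)" "?y \<in> V" "N m (s ?y) < K" "N m (v \<ominus>\<^bsub>fib E ?y\<^esub> s ?y) < \<delta>"
        and d: "cmod (d - c) < \<delta>"
        using p' dv by (auto simp: mem_tube dist_norm norm_minus_commute)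
      have y: "?y \<in> B" "v \<in> carrier (fib E ?y)" "s ?y \<in> carrier (fib E ?y)"
        using mem_total v \<Gamma>_closed s by auto
      interpret calg "fib E ?y"
        using y(1) by (rule calg)
      note sn = seminorm[OF y(1), of m]
      have "cmod d < K"
        using d K(3) \<delta>(2) norm_triangle_ineq2[of d c] by linarith
      have "N m (d \<odot>\<^bsub>fib E ?y\<^esub> v \<ominus>\<^bsub>fib E ?y\<^esub> r ?y) =
          N m (d \<odot>\<^bsub>fib E ?y\<^esub> (v \<ominus>\<^bsub>fib E ?y\<^esub> s ?y) \<oplus>\<^bsub>fib E ?y\<^esub> (d - c) \<odot>\<^bsub>fib E ?y\<^esub> s ?y)"
        using r(2) y by (simp add: smult_minus_smult)
      also have "\<dots> \<le> N m (d \<odot>\<^bsub>fib E ?y\<^esub> (v \<ominus>\<^bsub>fib E ?y\<^esub> s ?y)) + N m ((d - c) \<odot>\<^bsub>fib E ?y\<^esub> s ?y)"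
        using y by (intro seminorm_add[OF sn]) auto
      also have "\<dots> = cmod d * N m (v \<ominus>\<^bsub>fib E ?y\<^esub> s ?y) + cmod (d - c) * N m (s ?y)"
        using y by (simp add: seminorm_smult[OF sn])
      also have "\<dots> < K * \<delta> + \<delta> * K"
        using \<open>cmod d < K\<close> d v \<delta> K y seminorm_nonneg[OF sn]
        by (intro add_strict_mono mult_strict_mono') auto
      finally have "N m (d \<odot>\<^bsub>fib E ?y\<^esub> v \<ominus>\<^bsub>fib E ?y\<^esub> r ?y) < \<epsilon>"
        using \<delta>(3) by (simp add: algebra_simps)
      then have "d \<odot>\<^bsub>fib E ?y\<^esub> v \<in> tube r V m \<epsilon>"
        using y v by (simp add: mem_tube_fiber)
      then show "p' \<in> ?P"
        using V dv v by auto
    qed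
    ultimately show "\<exists>T. openin (prod_topology euclidean (total E)) T \<and> p \<in> T \<and> T \<subseteq> ?P"
      by blast
  qed
qed

lemma tvs_prebundle: "tvs_prebundle E"
proof -
  obtain z where "z \<in> \<Gamma>" "\<forall>x\<in>B. z x = \<zero>\<^bsub>fib E x\<^esub>"
    using \<Gamma>_zero by blast
  then have "continuous_map (base E) (total E) (\<lambda>x. \<zero>\<^bsub>fib E x\<^esub>)"
    using continuous_map_eq[OF continuous_section] by metis
  then show ?thesis
    unfolding tvs_prebundle_def vector_space_family_def
    using continuous_proj open_map_proj continuous_add continuous_smult calg.complex_vs[OF calg]
      proj_total carrier_fib by blast
qed

text \<open>Inside a tube around \<open>s\<close> the seminorm differs from its value on
  \<open>s\<close> by less than the radius, and along \<open>s\<close> it is continuous.\<close>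

lemma continuous_N: "continuous_map (total E) euclideanreal (N m)"
  unfolding continuous_map_upper_lower_semicontinuous_lt
proof (intro allI conjI)
  fix a
  show "openin (total E) {u \<in> topspace (total E). N m u < a}"
  proof (rule open_totalI)
    fix s x assume s: "s \<in> \<Gamma>" "x \<in> B" "s x \<in> {u \<in> topspace (total E). N m u < a}"
    then obtain c where c: "N m (s x) < c" "c < a"
      using dense by blast
    show "\<exists>V m' \<epsilon>. openin (base E) V \<and> x \<in> V \<and> 0 < \<epsilon> \<and> tube s V m' \<epsilon> \<subseteq> {u \<in> topspace (total E). N m u < a}"
    proof (intro exI conjI)
      show "openin (base E) {x \<in> B. N m (s x) < c}"
        using s by (intro N_lt_open')
      show "tube s {x \<in> B. N m (s x) < c} m (a - c) \<subseteq> {u \<in> topspace (total E). N m u < a}"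
      proof
        fix u assume u: "u \<in> tube s {x \<in> B. N m (s x) < c} m (a - c)"
        let ?y = "proj E u"
        have y: "?y \<in> B" "u \<in> carrier (fib E ?y)" "s ?y \<in> carrier (fib E ?y)"
          using mem_total u \<Gamma>_closed s by (auto simp: mem_tube)
        then show "u \<in> {u \<in> topspace (total E). N m u < a}"
          using calg.seminorm_diff[OF calg[OF y(1)] seminorm[OF y(1)], of u "s ?y" m] u
          by (auto simp: mem_tube)
      qed
    qed (use s c in auto)
  qed auto
  show "openin (total E) {u \<in> topspace (total E). a < N m u}"
  proof (rule open_totalI)
    fix s x assume s: "s \<in> \<Gamma>" "x \<in> B" "s x \<in> {u \<in> topspace (total E). a < N m u}"
    then obtain c where c: "a < c" "c < N m (s x)"
      using dense by blast
    show "\<exists>V m' \<epsilon>. openin (base E) V \<and> x \<in> V \<and> 0 < \<epsilon> \<and> tube s V m' \<epsilon> \<subseteq> {u \<in> topspace (total E). a < N m u}"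
    proof (intro exI conjI)
      show "openin (base E) {x \<in> B. c < N m (s x)}"
        using N_cont[OF s(1), of m] unfolding continuous_map_upper_lower_semicontinuous_lt by blast
      show "tube s {x \<in> B. c < N m (s x)} m (c - a) \<subseteq> {u \<in> topspace (total E). a < N m u}"
      proof
        fix u assume u: "u \<in> tube s {x \<in> B. c < N m (s x)} m (c - a)"
        let ?y = "proj E u"
        have y: "?y \<in> B" "u \<in> carrier (fib E ?y)" "s ?y \<in> carrier (fib E ?y)"
          using mem_total u \<Gamma>_closed s by (auto simp: mem_tube)
        then show "u \<in> {u \<in> topspace (total E). a < N m u}"
          using calg.seminorm_diff[OF calg[OF y(1)] seminorm[OF y(1)], of "s ?y" u m] u
            calg.seminorm_minus_swap[OF calg[OF y(1)] seminorm[OF y(1)], of "s ?y" u m]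
          by (auto simp: mem_tube)
      qed
    qed (use s c in auto)
  qed auto
qed

lemma open_N_ball: "openin (total E) {u \<in> topspace (total E). N m u < \<epsilon>}"
  using continuous_N[of m] unfolding continuous_map_upper_lower_semicontinuous_lt by blast

end

section \<open>The uniform structure and the base of section tubes\<close>

context section_bundle
begin

lemma smult_total:
  assumes "u \<in> topspace (total E)"
  shows "c \<odot>\<^bsub>fib E (proj E u)\<^esub> u \<in> topspace (total E)" "proj E (c \<odot>\<^bsub>fib E (proj E u)\<^esub> u) = proj E u"
  using mem_carrier[OF _ calg.smult_closed[OF calg]] mem_total[OF assms] by auto

lemma absolutely_convex_N_ball: "0 < \<epsilon> \<Longrightarrow> absolutely_convex E {u \<in> topspace (total E). N m u < \<epsilon>}"
  unfolding absolutely_convex_def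
proof (intro conjI ballI allI impI)
  fix x u v and a b :: complex
  assume \<epsilon>: "0 < \<epsilon>" and x: "x \<in> B" and u: "u \<in> {u \<in> topspace (total E). N m u < \<epsilon>} \<inter> carrier (fib E x)"
    and v: "v \<in> {u \<in> topspace (total E). N m u < \<epsilon>} \<inter> carrier (fib E x)" and ab: "cmod a + cmod b \<le> 1"
  interpret calg "fib E x"
    using x by (rule calg)
  note sn = seminorm[OF x, of m]
  define M where "M = max (N m u) (N m v)"
  have M: "N m u \<le> M" "N m v \<le> M" "M < \<epsilon>" "0 \<le> M"
    using u v seminorm_nonneg[OF sn, of u] by (auto simp: M_def)
  have "N m (a \<odot>\<^bsub>fib E x\<^esub> u \<oplus>\<^bsub>fib E x\<^esub> b \<odot>\<^bsub>fib E x\<^esub> v) \<le> cmod a * N m u + cmod b * N m v"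
    using seminorm_add[OF sn, of "a \<odot>\<^bsub>fib E x\<^esub> u" "b \<odot>\<^bsub>fib E x\<^esub> v"] u v by (simp add: seminorm_smult[OF sn])
  also have "\<dots> \<le> cmod a * M + cmod b * M"
    using M by (intro add_mono mult_left_mono) auto
  also have "\<dots> \<le> M"
    using mult_right_mono[OF ab M(4)] by (simp add: algebra_simps)
  finally show "a \<odot>\<^bsub>fib E x\<^esub> u \<oplus>\<^bsub>fib E x\<^esub> b \<odot>\<^bsub>fib E x\<^esub> v \<in> {u \<in> topspace (total E). N m u < \<epsilon>}"
    using M u v mem_carrier[OF x, of "a \<odot>\<^bsub>fib E x\<^esub> u \<oplus>\<^bsub>fib E x\<^esub> b \<odot>\<^bsub>fib E x\<^esub> v"] by auto
qed auto

lemma N_ball_unif: "0 < \<epsilon> \<Longrightarrow> {u \<in> topspace (total E). N m u < \<epsilon>} \<in> unif E"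
  using absolutely_convex_N_ball unfolding unif unif_of_seminorms_def by blast

lemma unifE:
  assumes "S \<in> unif E"
  obtains m \<epsilon> where "0 < \<epsilon>" "{u \<in> topspace (total E). N m u < \<epsilon>} \<subseteq> S"
  using assms unfolding unif unif_of_seminorms_def by blast

lemma absorbing_unif:
  assumes "S \<in> unif E"
  shows "absorbing E S"
  unfolding absorbing_def
proof (intro conjI ballI)
  show "S \<subseteq> topspace (total E)"
    using assms by (simp add: unif unif_of_seminorms_def absolutely_convex_def)
  obtain m \<epsilon> where \<epsilon>: "0 < \<epsilon>" "{u \<in> topspace (total E). N m u < \<epsilon>} \<subseteq> S"
    using assms by (rule unifE)
  fix x u assume x: "x \<in> B" and u: "u \<in> carrier (fib E x)"
  interpret calg "fib E x"
    using x by (rule calg)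
  note sn = seminorm[OF x, of m]
  have nn: "0 \<le> N m u"
    using seminorm_nonneg[OF sn u] .
  show "\<exists>\<delta>>0. \<forall>c. cmod c \<le> \<delta> \<longrightarrow> c \<odot>\<^bsub>fib E x\<^esub> u \<in> S"
  proof (intro exI conjI allI impI)
    \<comment> \<open>The summand \<open>1\<close> allows \<open>N m u = 0\<close> and makes the
      resulting inequality strict whenever \<open>c \<noteq> 0\<close>.\<close>
    show "0 < \<epsilon> / (N m u + 1)"
      using \<epsilon> nn by simp
    fix c :: complex assume c: "cmod c \<le> \<epsilon> / (N m u + 1)"
    have "cmod c * (N m u + 1) \<le> \<epsilon> / (N m u + 1) * (N m u + 1)"
      using c nn by (intro mult_right_mono) auto
    moreover have "N m u + 1 \<noteq> 0"
      using nn by linarith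
    ultimately have "cmod c * (N m u + 1) \<le> \<epsilon>"
      by simp
    then have "cmod c * N m u + cmod c \<le> \<epsilon>"
      by (simp add: distrib_left)
    then have "cmod c * N m u < \<epsilon>"
      using \<epsilon>(1) zero_less_norm_iff[of c] by (cases "c = 0") (auto simp del: zero_less_norm_iff)
    then show "c \<odot>\<^bsub>fib E x\<^esub> u \<in> S"
      using \<epsilon>(2) mem_carrier[OF x smult_closed[OF u]] seminorm_smult[OF sn u] by auto
  qed
qed

lemma scale_unif:
  assumes S: "S \<in> unif E" and c: "c \<noteq> 0"
  shows "(\<lambda>u. c \<odot>\<^bsub>fib E (proj E u)\<^esub> u) ` S \<in> unif E"
proof -
  let ?f = "\<lambda>u. c \<odot>\<^bsub>fib E (proj E u)\<^esub> u"
  have SE: "S \<subseteq> topspace (total E)" and ac: "absolutely_convex E S"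
    using S by (auto simp: unif unif_of_seminorms_def absolutely_convex_def)
  obtain m \<epsilon> where \<epsilon>: "0 < \<epsilon>" "{u \<in> topspace (total E). N m u < \<epsilon>} \<subseteq> S"
    using S by (rule unifE)
  have "{u \<in> topspace (total E). N m u < cmod c * \<epsilon>} \<subseteq> ?f ` S"
  proof
    fix u assume u: "u \<in> {u \<in> topspace (total E). N m u < cmod c * \<epsilon>}"
    let ?x = "proj E u"
    have x: "?x \<in> B" "u \<in> carrier (fib E ?x)"
      using u mem_total by auto
    interpret calg "fib E ?x"
      using x(1) by (rule calg)
    let ?v = "inverse c \<odot>\<^bsub>fib E ?x\<^esub> u"
    have v: "?v \<in> topspace (total E)" "proj E ?v = ?x"
      using u smult_total by auto
    have "N m ?v = cmod (inverse c) * N m u"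
      using seminorm_smult[OF seminorm[OF x(1)] x(2)] .
    also have "\<dots> < cmod (inverse c) * (cmod c * \<epsilon>)"
      using u c by (intro mult_strict_left_mono) auto
    also have "\<dots> = \<epsilon>"
      using c by (simp add: norm_inverse)
    finally have "N m ?v < \<epsilon>" .
    then have "?v \<in> S"
      using v \<epsilon> by auto
    moreover have "u = ?f ?v"
      using v x c by (simp add: smult_assoc[symmetric])
    ultimately show "u \<in> ?f ` S"
      by blast
  qed
  moreover have "absolutely_convex E (?f ` S)"
    unfolding absolutely_convex_def
  proof (intro conjI ballI allI impI)
    show "?f ` S \<subseteq> topspace (total E)"
      using SE smult_total by blast
    fix x u v and a b :: complex
    assume x: "x \<in> B" and "u \<in> ?f ` S \<inter> carrier (fib E x)" "v \<in> ?f ` S \<inter> carrier (fib E x)"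
      and ab: "cmod a + cmod b \<le> 1"
    then obtain u' v' where u': "u' \<in> S" "u = ?f u'" "u \<in> carrier (fib E x)"
      and v': "v' \<in> S" "v = ?f v'" "v \<in> carrier (fib E x)"
      by blast
    have p: "proj E u' = x" "proj E v' = x"
      using mem_carrier[OF x u'(3)] mem_carrier[OF x v'(3)] smult_total(2)[of u' c] smult_total(2)[of v' c]
        SE u' v' by auto
    then have c': "u' \<in> carrier (fib E x)" "v' \<in> carrier (fib E x)"
      using mem_total[of u'] mem_total[of v'] u' v' SE by auto
    interpret calg "fib E x"
      using x by (rule calg)
    let ?w = "a \<odot>\<^bsub>fib E x\<^esub> u' \<oplus>\<^bsub>fib E x\<^esub> b \<odot>\<^bsub>fib E x\<^esub> v'"
    have "?w \<in> S"
      using ac x c' u' v' ab by (simp add: absolutely_convex_def)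
    moreover have "a \<odot>\<^bsub>fib E x\<^esub> u \<oplus>\<^bsub>fib E x\<^esub> b \<odot>\<^bsub>fib E x\<^esub> v = ?f ?w"
      using mem_carrier[OF x, of ?w] c' p u' v'
      by (simp add: smult_r_distr smult_assoc[symmetric] mult.commute)
    ultimately show "a \<odot>\<^bsub>fib E x\<^esub> u \<oplus>\<^bsub>fib E x\<^esub> b \<odot>\<^bsub>fib E x\<^esub> v \<in> ?f ` S"
      by blast
  qed
  moreover have "0 < cmod c * \<epsilon>"
    using c \<epsilon> by simp
  ultimately show ?thesis
    unfolding unif unif_of_seminorms_def by blast
qed

lemma Int_unif:
  assumes S: "S \<in> unif E" and T: "T \<in> unif E"
  shows "S \<inter> T \<in> unif E"
proof -
  obtain m \<epsilon> where \<epsilon>: "0 < \<epsilon>" "{u \<in> topspace (total E). N m u < \<epsilon>} \<subseteq> S"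
    using S by (rule unifE)
  obtain m' \<epsilon>' where \<epsilon>': "0 < \<epsilon>'" "{u \<in> topspace (total E). N m' u < \<epsilon>'} \<subseteq> T"
    using T by (rule unifE)
  have ac: "absolutely_convex E S" "absolutely_convex E T"
    using S T by (auto simp: unif unif_of_seminorms_def)
  have "absolutely_convex E (S \<inter> T)"
    unfolding absolutely_convex_def
  proof (intro conjI ballI allI impI IntI)
    fix x u v and a b :: complex
    assume "x \<in> B" "u \<in> S \<inter> T \<inter> carrier (fib E x)" "v \<in> S \<inter> T \<inter> carrier (fib E x)" "cmod a + cmod b \<le> 1"
    then show "a \<odot>\<^bsub>fib E x\<^esub> u \<oplus>\<^bsub>fib E x\<^esub> b \<odot>\<^bsub>fib E x\<^esub> v \<in> S" "a \<odot>\<^bsub>fib E x\<^esub> u \<oplus>\<^bsub>fib E x\<^esub> b \<odot>\<^bsub>fib E x\<^esub> v \<in> T"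
      using ac by (simp_all add: absolutely_convex_def)
  qed (use ac in \<open>auto simp: absolutely_convex_def\<close>)
  moreover have "{u \<in> topspace (total E). N (max m m') u < min \<epsilon> \<epsilon>'} \<subseteq> S \<inter> T"
  proof
    fix u assume u: "u \<in> {u \<in> topspace (total E). N (max m m') u < min \<epsilon> \<epsilon>'}"
    then have "N m u \<le> N (max m m') u" "N m' u \<le> N (max m m') u"
      using mem_total by (auto intro!: N_mono'[of "proj E u"])
    then show "u \<in> S \<inter> T"
      using u \<epsilon> \<epsilon>' by auto
  qed
  ultimately show ?thesis
    using \<epsilon> \<epsilon>' unfolding unif unif_of_seminorms_def
    by (intro CollectI conjI bexI[of _ "N (max m m')"] exI[of _ "min \<epsilon> \<epsilon>'"]) auto
qed

lemma lc_uniform_structure: "lc_uniform_structure E (unif E)"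
  unfolding lc_uniform_structure_def
proof (intro conjI ballI allI impI)
  fix S S' assume "S \<in> unif E" "S \<subseteq> S' \<and> absolutely_convex E S'"
  then show "S' \<in> unif E"
    unfolding unif unif_of_seminorms_def by (blast intro: order_trans)
qed (use absorbing_unif scale_unif Int_unif in \<open>auto simp: unif unif_of_seminorms_def\<close>)

text \<open>Here \<open>s\<close> is any continuous section, whereas neighbourhoods are described by
  tubes around members of \<open>\<Gamma>\<close>. So \<open>s\<close> is compared near
  \<open>x\<close> with some \<open>r\<close> from \<open>\<Gamma>\<close> having the same value at
  \<open>x\<close>; continuity of \<open>s\<close> keeps the two within
  \<open>\<epsilon> / 2\<close>. With \<open>q = t - r\<close>, the identity
  \<open>(v - s) - q = (v - t) + (r - s)\<close> puts \<open>v - s\<close> into a tube around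
  \<open>q\<close> contained in \<open>U\<close>.\<close>

lemma open_section_tube:
  assumes V: "openin (base E) V" and s: "s \<in> sections V E" and U: "openin (total E) U"
  shows "openin (total E) (section_tube E s V U)"
proof (rule open_totalI)
  have VB: "V \<subseteq> B"
    using V openin_subset by blast
  have s_cont: "continuous_map (subtopology (base E) V) (total E) s" and s_proj: "\<And>x. x \<in> V \<Longrightarrow> proj E (s x) = x"
    using s by (auto simp: sections_def)
  have sc: "s x \<in> carrier (fib E x)" if "x \<in> V" for x
  proof -
    have "s x \<in> topspace (total E)"
      using continuous_map_image_subset_topspace[OF s_cont] that VB by auto
    then show ?thesis
      using mem_total[of "s x"] s_proj[OF that] by simp
  qed
  show "section_tube E s V U \<subseteq> topspace (total E)"
  proof
    fix w assume "w \<in> section_tube E s V U"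
    then obtain u where u: "w = s (proj E u) \<oplus>\<^bsub>fib E (proj E u)\<^esub> u" "u \<in> U" "proj E u \<in> V"
      by (auto simp: section_tube_def)
    then have "u \<in> carrier (fib E (proj E u))" "proj E u \<in> B"
      using U openin_subset mem_total by blast+
    then interpret calg "fib E (proj E u)"
      by (intro calg)
    have "w \<in> carrier (fib E (proj E u))"
      using u sc \<open>u \<in> carrier (fib E (proj E u))\<close> by simp
    then show "w \<in> topspace (total E)"
      using mem_carrier \<open>proj E u \<in> B\<close> by blast
  qed
  fix t x assume t: "t \<in> \<Gamma>" and x: "x \<in> B" "t x \<in> section_tube E s V U"
  interpret x: calg "fib E x"
    using x(1) by (rule calg)
  obtain u where u: "t x = s (proj E u) \<oplus>\<^bsub>fib E (proj E u)\<^esub> u" "u \<in> U" "proj E u \<in> V"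
    using x(2) by (auto simp: section_tube_def)
  have uc: "u \<in> carrier (fib E (proj E u))" "proj E u \<in> B"
    using u U openin_subset mem_total by blast+
  have "t x \<in> carrier (fib E (proj E u))"
    using u(1) sc[OF u(3)] uc ring.ring_simprules(1)[OF calg.axioms(1)[OF calg[OF uc(2)]]] by simp
  then have pu: "proj E u = x"
    using mem_carrier[OF uc(2)] mem_carrier[OF x(1) \<Gamma>_closed[OF t x(1)]] by metis
  note u = u[unfolded pu] and uc = uc[unfolded pu]
  obtain r where r: "r \<in> \<Gamma>" "r x = s x"
    using \<Gamma>_surj[OF x(1) sc[OF u(3)]] by blast
  obtain q where q: "q \<in> \<Gamma>" "\<forall>x\<in>B. q x = t x \<ominus>\<^bsub>fib E x\<^esub> r x"
    using \<Gamma>_minus[OF t r(1)] by blast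
  have "q x \<in> U"
    using q(2) x(1) r(2) u sc[OF u(3)] uc(1) by (simp add: x.add_minus_cancel_left)
  then obtain V' m \<epsilon> where V': "openin (base E) V'" "x \<in> V'" "0 < \<epsilon>" "tube q V' m \<epsilon> \<subseteq> U"
    by (rule open_nhd[OF U q(1) x(1)])
  define V'' where "V'' = V \<inter> V' \<inter> {y \<in> V. s y \<in> tube r B m (\<epsilon> / 2)}"
  have "openin (subtopology (base E) V) {y \<in> topspace (subtopology (base E) V). s y \<in> tube r B m (\<epsilon> / 2)}"
    using r V'(3) by (intro openin_continuous_map_preimage[OF s_cont] open_tube) auto
  then have "openin (subtopology (base E) V) {y \<in> V. s y \<in> tube r B m (\<epsilon> / 2)}"
    using VB by (simp add: inf.absorb2)
  then have "openin (base E) V''"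
    unfolding V''_def using V V' openin_trans_full by (intro openin_Int) blast+
  moreover have "x \<in> V''"
    using V' u(3) section_mem_tube[OF r(1) x(1) x(1), of "\<epsilon> / 2" m] r(2) by (simp add: V''_def)
  moreover have "tube t V'' m (\<epsilon> / 2) \<subseteq> section_tube E s V U"
  proof
    fix v assume v: "v \<in> tube t V'' m (\<epsilon> / 2)"
    let ?y = "proj E v"
    have y: "?y \<in> B" "?y \<in> V" "?y \<in> V'" "s ?y \<in> tube r B m (\<epsilon> / 2)" "v \<in> carrier (fib E ?y)"
      "N m (v \<ominus>\<^bsub>fib E ?y\<^esub> t ?y) < \<epsilon> / 2"
      using v mem_total by (auto simp: mem_tube V''_def)
    interpret calg "fib E ?y"
      using y(1) by (rule calg)
    note sn = seminorm[OF y(1), of m]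
    have c: "s ?y \<in> carrier (fib E ?y)" "t ?y \<in> carrier (fib E ?y)" "r ?y \<in> carrier (fib E ?y)"
      using sc \<Gamma>_closed y t r by auto
    have sr: "N m (s ?y \<ominus>\<^bsub>fib E ?y\<^esub> r ?y) < \<epsilon> / 2"
      using y(1,4) c by (simp add: mem_tube_fiber)
    let ?w = "v \<ominus>\<^bsub>fib E ?y\<^esub> s ?y"
    have w: "?w \<in> carrier (fib E ?y)"
      using y c by simp
    have "N m (?w \<ominus>\<^bsub>fib E ?y\<^esub> q ?y) = N m ((v \<ominus>\<^bsub>fib E ?y\<^esub> t ?y) \<oplus>\<^bsub>fib E ?y\<^esub> (r ?y \<ominus>\<^bsub>fib E ?y\<^esub> s ?y))"
      using q(2) y c by (simp add: minus_minus_minus)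
    also have "\<dots> \<le> N m (v \<ominus>\<^bsub>fib E ?y\<^esub> t ?y) + N m (r ?y \<ominus>\<^bsub>fib E ?y\<^esub> s ?y)"
      using y c by (intro seminorm_add[OF sn]) auto
    also have "\<dots> < \<epsilon>"
      using y(6) sr seminorm_minus_swap[OF sn c(1) c(3)] by simp
    finally have "?w \<in> tube q V' m \<epsilon>"
      using y w by (simp add: mem_tube_fiber)
    then have "?w \<in> U"
      using V' by blast
    moreover have "proj E ?w = ?y"
      using mem_carrier[OF y(1) w] by simp
    moreover have "v = s ?y \<oplus>\<^bsub>fib E ?y\<^esub> ?w"
      using y c by (simp add: add_minus_cancel)
    ultimately show "v \<in> section_tube E s V U"
      using y(2) unfolding section_tube_def by (intro CollectI exI[of _ ?w]) simp
  qed
  ultimately show "\<exists>V' m \<epsilon>'. openin (base E) V' \<and> x \<in> V' \<and> 0 < \<epsilon>' \<and> tube t V' m \<epsilon>' \<subseteq> section_tube E s V U"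
    using V'(3) by (intro exI[of _ V''] exI[of _ m] exI[of _ "\<epsilon> / 2"]) simp
qed

lemma seminorm_tube_eq:
  assumes V: "openin (base E) V" and s: "s \<in> sections V E"
  shows "tube s V m \<epsilon> = section_tube E s V {u \<in> topspace (total E). N m u < \<epsilon>}"
proof -
  have VB: "V \<subseteq> B"
    using V openin_subset by blast
  have sc: "s x \<in> carrier (fib E x)" if "x \<in> V" for x
  proof -
    have "s x \<in> topspace (total E)" "proj E (s x) = x"
      using s continuous_map_image_subset_topspace[of "subtopology (base E) V" "total E" s] that VB
      by (auto simp: sections_def)
    then show ?thesis
      using mem_total[of "s x"] by simp
  qed
  show ?thesis
  proof (intro equalityI subsetI)
    fix v assume v: "v \<in> tube s V m \<epsilon>"
    let ?y = "proj E v"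
    have y: "?y \<in> B" "?y \<in> V" "v \<in> carrier (fib E ?y)" "N m (v \<ominus>\<^bsub>fib E ?y\<^esub> s ?y) < \<epsilon>"
      using v mem_total by (auto simp: mem_tube)
    interpret calg "fib E ?y"
      using y(1) by (rule calg)
    let ?w = "v \<ominus>\<^bsub>fib E ?y\<^esub> s ?y"
    have w: "?w \<in> carrier (fib E ?y)"
      using y sc by simp
    then show "v \<in> section_tube E s V {u \<in> topspace (total E). N m u < \<epsilon>}"
      unfolding section_tube_def using mem_carrier[OF y(1) w] y sc
      by (intro CollectI exI[of _ ?w]) (simp add: add_minus_cancel)
  next
    fix v assume "v \<in> section_tube E s V {u \<in> topspace (total E). N m u < \<epsilon>}"
    then obtain u where u: "v = s (proj E u) \<oplus>\<^bsub>fib E (proj E u)\<^esub> u" "u \<in> topspace (total E)" "N m u < \<epsilon>" "proj E u \<in> V"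
      by (auto simp: section_tube_def)
    let ?y = "proj E u"
    have y: "?y \<in> B" "u \<in> carrier (fib E ?y)"
      using u mem_total by auto
    interpret calg "fib E ?y"
      using y(1) by (rule calg)
    have "v \<in> carrier (fib E ?y)"
      using u y sc by simp
    then show "v \<in> tube s V m \<epsilon>"
      using u y sc by (simp add: mem_tube_fiber add_minus_cancel_left)
  qed
qed

lemma section_in_sections: "s \<in> \<Gamma> \<Longrightarrow> s \<in> sections V E" if "V \<subseteq> B" for V
  using continuous_section[of s] \<Gamma>_closed[of s] mem_carrier that
  by (auto simp: sections_def continuous_map_from_subtopology)

text \<open>Every vector is the value of a member of \<open>\<Gamma>\<close>, so the density
  conditions in the definitions of bundles reduce to equalities.\<close>

lemma section_values_eq: "x \<in> B \<Longrightarrow> section_values E x = carrier (fib E x)"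
proof (intro equalityI subsetI)
  fix u assume x: "x \<in> B" and "u \<in> section_values E x"
  then obtain s V where s: "u = s x" "openin (base E) V" "x \<in> V" "s \<in> sections V E"
    by (auto simp: section_values_def)
  then have "s x \<in> topspace (total E)" "proj E (s x) = x"
    using continuous_map_image_subset_topspace[of "subtopology (base E) V" "total E" s] x
    by (auto simp: sections_def)
  then show "u \<in> carrier (fib E x)"
    using mem_total[of "s x"] s by simp
next
  fix u assume x: "x \<in> B" and "u \<in> carrier (fib E x)"
  then obtain s where "s \<in> \<Gamma>" "s x = u"
    using \<Gamma>_surj by blast
  then show "u \<in> section_values E x"
    unfolding section_values_def using section_in_sections[of B s] x by blast
qed

lemma topspace_fiber_topology: "x \<in> B \<Longrightarrow> topspace (fiber_topology E x) = carrier (fib E x)"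
  using mem_carrier by (auto simp: fiber_topology_def)

lemma open_section_tube_base:
  "openin (total E) = arbitrary union_of (\<lambda>W. \<exists>V s U. openin (base E) V \<and> s \<in> sections V E \<and>
        U \<in> unif E \<and> openin (total E) U \<and> W = section_tube E s V U)"
  unfolding openin_topology_base_unique
proof (intro conjI allI impI)
  fix W u assume W: "openin (total E) W \<and> u \<in> W"
  then obtain V s m \<epsilon> where V: "openin (base E) V" "s \<in> \<Gamma>" "0 < \<epsilon>" "u \<in> tube s V m \<epsilon>" "tube s V m \<epsilon> \<subseteq> W"
    using tube_base by metis
  have s: "s \<in> sections V E"
    using section_in_sections[OF openin_subset[OF V(1)] V(2)] .
  show "\<exists>W'. (\<exists>V s U. openin (base E) V \<and> s \<in> sections V E \<and> U \<in> unif E \<and> openin (total E) U \<and>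
      W' = section_tube E s V U) \<and> u \<in> W' \<and> W' \<subseteq> W"
  proof (intro exI conjI)
    show "openin (base E) V" "s \<in> sections V E" "u \<in> tube s V m \<epsilon>" "tube s V m \<epsilon> \<subseteq> W"
      using V s by simp_all
    show "{u \<in> topspace (total E). N m u < \<epsilon>} \<in> unif E"
      using V(3) by (rule N_ball_unif)
    show "openin (total E) {u \<in> topspace (total E). N m u < \<epsilon>}"
      by (rule open_N_ball)
    show "tube s V m \<epsilon> = section_tube E s V {u \<in> topspace (total E). N m u < \<epsilon>}"
      by (rule seminorm_tube_eq[OF V(1) s])
  qed
qed (auto intro: open_section_tube)

lemma locally_convex_bundle: "locally_convex_bundle E"
  unfolding locally_convex_bundle_def
proof (intro conjI ballI)
  fix U assume "U \<in> unif E"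
  then obtain m \<epsilon> where "0 < \<epsilon>" "{u \<in> topspace (total E). N m u < \<epsilon>} \<subseteq> U"
    by (rule unifE)
  then show "\<exists>U\<^sub>0\<in>unif E. openin (total E) U\<^sub>0 \<and> U\<^sub>0 \<subseteq> U"
    by (intro bexI[of _ "{u \<in> topspace (total E). N m u < \<epsilon>}"] conjI open_N_ball N_ball_unif)
next
  fix x assume "x \<in> B"
  then show "fiber_topology E x closure_of section_values E x = carrier (fib E x)"
    using closure_of_topspace[of "fiber_topology E x"] by (simp add: section_values_eq topspace_fiber_topology)
qed (rule tvs_prebundle lc_uniform_structure open_section_tube_base)+

section \<open>The fibers as Frechet algebras\<close>

lemma openin_fiber_topology:
  assumes x: "x \<in> B"
  shows "openin (fiber_topology E x) W \<longleftrightarrow> W \<subseteq> carrier (fib E x) \<and>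
    (\<forall>u\<in>W. \<exists>m. \<exists>\<epsilon>>0. \<forall>v\<in>carrier (fib E x). N m (v \<ominus>\<^bsub>fib E x\<^esub> u) < \<epsilon> \<longrightarrow> v \<in> W)"
proof (intro iffI conjI ballI)
  assume W: "openin (fiber_topology E x) W"
  show sub: "W \<subseteq> carrier (fib E x)"
    using openin_subset[OF W] by (simp add: topspace_fiber_topology x)
  obtain W' where W': "openin (total E) W'" "W = W' \<inter> carrier (fib E x)"
    using W by (auto simp: fiber_topology_def openin_subtopology)
  fix u assume u: "u \<in> W"
  with sub have "u \<in> carrier (fib E x)"
    by auto
  then obtain s where s: "s \<in> \<Gamma>" "s x = u"
    using \<Gamma>_surj[OF x] by metis
  then have "s x \<in> W'"
    using u W' by auto
  then obtain V m \<epsilon> where V: "openin (base E) V" "x \<in> V" "0 < \<epsilon>" "tube s V m \<epsilon> \<subseteq> W'"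
    by (rule open_nhd[OF W'(1) s(1) x])
  have "\<forall>v\<in>carrier (fib E x). N m (v \<ominus>\<^bsub>fib E x\<^esub> u) < \<epsilon> \<longrightarrow> v \<in> W"
  proof (intro ballI impI)
    fix v assume v: "v \<in> carrier (fib E x)" "N m (v \<ominus>\<^bsub>fib E x\<^esub> u) < \<epsilon>"
    then have "v \<in> tube s V m \<epsilon>"
      using V(2) s(2) x by (simp add: mem_tube_fiber)
    then show "v \<in> W"
      using V(4) W'(2) v(1) by auto
  qed
  then show "\<exists>m. \<exists>\<epsilon>>0. \<forall>v\<in>carrier (fib E x). N m (v \<ominus>\<^bsub>fib E x\<^esub> u) < \<epsilon> \<longrightarrow> v \<in> W"
    using V(3) by auto
next
  assume W: "W \<subseteq> carrier (fib E x) \<and>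
    (\<forall>u\<in>W. \<exists>m. \<exists>\<epsilon>>0. \<forall>v\<in>carrier (fib E x). N m (v \<ominus>\<^bsub>fib E x\<^esub> u) < \<epsilon> \<longrightarrow> v \<in> W)"
  show "openin (fiber_topology E x) W"
  proof (subst openin_subopen, intro ballI)
    fix u assume u: "u \<in> W"
    with W have "u \<in> carrier (fib E x)"
      by auto
    then obtain s where s: "s \<in> \<Gamma>" "s x = u"
      using \<Gamma>_surj[OF x] by metis
    obtain m \<epsilon> where m: "0 < \<epsilon>" "\<forall>v\<in>carrier (fib E x). N m (v \<ominus>\<^bsub>fib E x\<^esub> u) < \<epsilon> \<longrightarrow> v \<in> W"
      using W u by blast
    let ?T = "tube s B m \<epsilon> \<inter> carrier (fib E x)"
    have "openin (fiber_topology E x) ?T"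
      using open_tube[of B s \<epsilon> m] s m by (auto simp: fiber_topology_def openin_subtopology)
    moreover have "u \<in> ?T"
      using section_mem_tube[OF s(1) x x m(1)] s \<Gamma>_closed[OF s(1) x] by auto
    moreover have "?T \<subseteq> W"
      using m s x by (auto simp: mem_tube_fiber)
    ultimately show "\<exists>T. openin (fiber_topology E x) T \<and> u \<in> T \<and> T \<subseteq> W"
      by (intro exI[of _ ?T] conjI)
  qed
qed

lemma openin_fiber_ball: "x \<in> B \<Longrightarrow> openin (fiber_topology E x) {u \<in> carrier (fib E x). N m u < \<epsilon>}"
  unfolding fiber_topology_def openin_subtopology
  using open_N_ball[of m \<epsilon>] mem_carrier by (intro exI[of _ "{u \<in> topspace (total E). N m u < \<epsilon>}"]) auto

text \<open>The supremum of the seminorms capped at \<open>1 / (m + 1)\<close>: the decreasing caps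
  leave only finitely many seminorms relevant at a given scale. Off the carrier it is
  \<open>0\<close>, because \<open>Metric_space\<close> asks for nonnegativity and symmetry on the
  whole type.\<close>

definition fiber_dist :: "'x \<Rightarrow> 'e \<Rightarrow> 'e \<Rightarrow> real" where
  "fiber_dist x u v = (if u \<in> carrier (fib E x) \<and> v \<in> carrier (fib E x)
     then SUP m. min (1 / real (Suc m)) (N m (u \<ominus>\<^bsub>fib E x\<^esub> v)) else 0)"

lemma fiber_dist_le_iff:
  assumes "u \<in> carrier (fib E x)" "v \<in> carrier (fib E x)"
  shows "fiber_dist x u v \<le> c \<longleftrightarrow> (\<forall>m. min (1 / real (Suc m)) (N m (u \<ominus>\<^bsub>fib E x\<^esub> v)) \<le> c)"
proof -
  have "bdd_above (range (\<lambda>m. min (1 / real (Suc m)) (N m (u \<ominus>\<^bsub>fib E x\<^esub> v))))"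
  proof (rule bdd_aboveI2)
    show "min (1 / real (Suc m)) (N m (u \<ominus>\<^bsub>fib E x\<^esub> v)) \<le> 1" for m
      by (rule min.coboundedI1) simp
  qed
  then show ?thesis
    using assms by (simp add: fiber_dist_def cSUP_le_iff)
qed

lemma metrizable_fiber:
  assumes x: "x \<in> B"
  shows "metrizable_space (fiber_topology E x)"
proof -
  interpret calg "fib E x"
    using x by (rule calg)
  let ?C = "carrier (fib E x)" and ?d = "fiber_dist x"
  have le: "min (1 / real (Suc m)) (N m (u \<ominus>\<^bsub>fib E x\<^esub> v)) \<le> ?d u v" if "u \<in> ?C" "v \<in> ?C" for u v m
    using fiber_dist_le_iff[OF that, of "?d u v"] by simp
  have nn: "0 \<le> N m (u \<ominus>\<^bsub>fib E x\<^esub> v)" if "u \<in> ?C" "v \<in> ?C" for u v m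
    using seminorm_nonneg[OF seminorm[OF x]] that by simp
  interpret Metric_space ?C ?d
  proof
    show "0 \<le> ?d u v" for u v
    proof (cases "u \<in> ?C \<and> v \<in> ?C")
      case True
      then show ?thesis
        using le[of u v 0] nn[of u v 0] by (auto intro: order_trans[rotated])
    qed (auto simp: fiber_dist_def)
    show "?d u v = ?d v u" for u v
      unfolding fiber_dist_def using seminorm_minus_swap[OF seminorm[OF x], of u v] by auto
    show "?d u v = 0 \<longleftrightarrow> u = v" if "u \<in> ?C" "v \<in> ?C" for u v
    proof
      assume "?d u v = 0"
      then have "N m (u \<ominus>\<^bsub>fib E x\<^esub> v) = 0" for m
        using le[OF that, of m] nn[OF that, of m] by (auto simp: min_def split: if_splits)
      then show "u = v"
        using separated[OF x, of "u \<ominus>\<^bsub>fib E x\<^esub> v"] that by (simp add: minus_eq_zero_iff)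
    next
      assume "u = v"
      then show "?d u v = 0"
        using that by (simp add: fiber_dist_def minus_self seminorm_zero[OF seminorm[OF x]])
    qed
    show "?d u w \<le> ?d u v + ?d v w" if "u \<in> ?C" "v \<in> ?C" "w \<in> ?C" for u v w
    proof (subst fiber_dist_le_iff[OF that(1,3)], intro allI)
      fix m
      have min: "min c a \<le> min c b + min c d" if "a \<le> b + d" "0 \<le> b" "0 \<le> d" "0 \<le> c" for a b c d :: real
        using that by (auto simp: min_def)
      have "min (1 / real (Suc m)) (N m (u \<ominus>\<^bsub>fib E x\<^esub> w)) \<le>
          min (1 / real (Suc m)) (N m (u \<ominus>\<^bsub>fib E x\<^esub> v)) + min (1 / real (Suc m)) (N m (v \<ominus>\<^bsub>fib E x\<^esub> w))"
        by (intro min seminorm_triangle[OF seminorm[OF x]] nn that) simp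
      then show "min (1 / real (Suc m)) (N m (u \<ominus>\<^bsub>fib E x\<^esub> w)) \<le> ?d u v + ?d v w"
        using le[OF that(1,2), of m] le[OF that(2,3), of m] by linarith
    qed
  qed
  have "openin (fiber_topology E x) W \<longleftrightarrow> openin mtopology W" for W
    unfolding openin_fiber_topology[OF x] openin_mtopology
  proof (intro conj_cong refl iffI ballI allI impI)
    assume sub: "W \<subseteq> ?C"
    {
      fix u assume u: "u \<in> W"
        and "\<forall>u\<in>W. \<exists>m. \<exists>\<epsilon>>0. \<forall>v\<in>?C. N m (v \<ominus>\<^bsub>fib E x\<^esub> u) < \<epsilon> \<longrightarrow> v \<in> W"
      then obtain m \<epsilon> where m: "0 < \<epsilon>" "\<forall>v\<in>?C. N m (v \<ominus>\<^bsub>fib E x\<^esub> u) < \<epsilon> \<longrightarrow> v \<in> W"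
        by blast
      have "mball u (min \<epsilon> (1 / real (Suc m))) \<subseteq> W"
      proof
        fix v assume v: "v \<in> mball u (min \<epsilon> (1 / real (Suc m)))"
        then have "N m (u \<ominus>\<^bsub>fib E x\<^esub> v) < \<epsilon>"
          using le[of u v m] by (auto simp: min_def split: if_splits)
        then show "v \<in> W"
          using m v seminorm_minus_swap[OF seminorm[OF x], of u v m] by auto
      qed
      then show "\<exists>r>0. mball u r \<subseteq> W"
        using m(1) by (intro exI[of _ "min \<epsilon> (1 / real (Suc m))"]) auto
    }
    {
      fix u assume u: "u \<in> W" and "\<forall>u. u \<in> W \<longrightarrow> (\<exists>r>0. mball u r \<subseteq> W)"
      then obtain r where r: "0 < r" "mball u r \<subseteq> W"
        by blast
      \<comment> \<open>Terms of index above \<open>m\<close> are below \<open>r\<close> by their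
        caps, and the earlier ones are controlled by \<open>N m\<close> because the seminorms
        increase.\<close>
      obtain m where m: "1 / real (Suc m) < r"
        using r(1) nat_approx_posE by blast
      show "\<exists>m. \<exists>\<epsilon>>0. \<forall>v\<in>?C. N m (v \<ominus>\<^bsub>fib E x\<^esub> u) < \<epsilon> \<longrightarrow> v \<in> W"
      proof (intro exI conjI ballI impI)
        show "0 < r / 2"
          using r by simp
        fix v assume v: "v \<in> ?C" "N m (v \<ominus>\<^bsub>fib E x\<^esub> u) < r / 2"
        have "?d u v \<le> max (1 / real (Suc m)) (r / 2)"
        proof (subst fiber_dist_le_iff, use u v sub in auto)
          fix l
          show "min (1 / (1 + real l)) (N l (u \<ominus>\<^bsub>fib E x\<^esub> v)) \<le> max (1 / (1 + real m)) (r / 2)"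
          proof (cases "l \<le> m")
            case True
            then have "N l (u \<ominus>\<^bsub>fib E x\<^esub> v) \<le> N m (u \<ominus>\<^bsub>fib E x\<^esub> v)"
              using u v sub x by (intro N_mono') auto
            then show ?thesis
              using v u sub seminorm_minus_swap[OF seminorm[OF x], of u v m] by auto
          next
            case False
            then have "1 / (1 + real l) \<le> 1 / (1 + real m)"
              by (intro divide_left_mono) auto
            then show ?thesis
              by auto
          qed
        qed
        then have "?d u v < r"
          using m r by auto
        then have "v \<in> mball u r"
          using u v sub by auto
        then show "v \<in> W"
          using r by blast
      qed
    }
  qed
  then have "fiber_topology E x = mtopology"
    by (simp add: topology_eq)
  then show ?thesis
    using metrizable_space_mtopology by simp
qed

lemma frechet_fiber:
  assumes x: "x \<in> B"
  shows "frechet_algebra (fib E x) (fiber_topology E x)"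
proof -
  interpret calg "fib E x"
    using x by (rule calg)
  let ?C = "carrier (fib E x)" and ?T = "fiber_topology E x"
  \<comment> \<open>The product of a fiber with itself sits in the fiber product, so the fiber
    operations are restrictions of the bundle operations.\<close>
  have incl: "continuous_map (prod_topology ?T ?T) (fiber_product E) id"
    unfolding fiber_product_def fiber_topology_def prod_topology_subtopology continuous_map_in_subtopology
    using mem_carrier[OF x] by (auto simp: subtopology_subtopology continuous_map_from_subtopology continuous_map_id)
  have op: "continuous_map (prod_topology ?T ?T) ?T (\<lambda>(u, v). f x u v)"
    if "continuous_map (fiber_product E) (total E) (\<lambda>(u, v). f (proj E u) u v)"
      and "\<And>u v. u \<in> ?C \<Longrightarrow> v \<in> ?C \<Longrightarrow> f x u v \<in> ?C" for f
  proof -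
    have "continuous_map (prod_topology ?T ?T) (total E) (\<lambda>(u, v). f x u v)"
      using continuous_map_compose[OF incl that(1)]
      by (rule continuous_map_eq) (use mem_carrier[OF x] in \<open>auto simp: topspace_fiber_topology x\<close>)
    then show ?thesis
      using that(2) by (auto simp: fiber_topology_def continuous_map_in_subtopology)
  qed
  have "continuous_map (prod_topology euclidean ?T) (prod_topology euclidean (total E)) id"
    unfolding fiber_topology_def
    by (auto simp: continuous_map_pairwise o_def id_def intro: continuous_map_fst continuous_map_into_fulltopology continuous_map_snd)
  from continuous_map_compose[OF this continuous_smult]
  have "continuous_map (prod_topology euclidean ?T) (total E) (\<lambda>(c, u). c \<odot>\<^bsub>fib E x\<^esub> u)"
    by (rule continuous_map_eq) (use mem_carrier[OF x] in \<open>auto simp: topspace_fiber_topology x\<close>)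
  then have smult: "continuous_map (prod_topology euclidean ?T) ?T (\<lambda>(c, u). c \<odot>\<^bsub>fib E x\<^esub> u)"
    by (auto simp: fiber_topology_def continuous_map_in_subtopology)
  have convex: "\<exists>C. openin ?T C \<and> \<zero>\<^bsub>fib E x\<^esub> \<in> C \<and> convex_in (fib E x) C \<and> C \<subseteq> W"
    if W: "openin ?T W" "\<zero>\<^bsub>fib E x\<^esub> \<in> W" for W
  proof -
    obtain m \<epsilon> where m: "0 < \<epsilon>" "\<forall>v\<in>?C. N m (v \<ominus>\<^bsub>fib E x\<^esub> \<zero>\<^bsub>fib E x\<^esub>) < \<epsilon> \<longrightarrow> v \<in> W"
      using W openin_fiber_topology[OF x] by blast
    have "convex_in (fib E x) {u \<in> ?C. N m u < \<epsilon>}"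
      unfolding convex_in_def
    proof (intro ballI allI impI)
      fix u v and t :: real
      assume uv: "u \<in> {u \<in> ?C. N m u < \<epsilon>}" "v \<in> {u \<in> ?C. N m u < \<epsilon>}" and t: "0 \<le> t \<and> t \<le> 1"
      have "cmod (of_real (1 - t)) + cmod (of_real t :: complex) \<le> 1"
        using t unfolding norm_of_real by simp
      then have "of_real (1 - t) \<odot>\<^bsub>fib E x\<^esub> u \<oplus>\<^bsub>fib E x\<^esub> of_real t \<odot>\<^bsub>fib E x\<^esub> v \<in> {u \<in> topspace (total E). N m u < \<epsilon>}"
        using absolutely_convex_N_ball[OF m(1), of m] uv x mem_carrier[OF x]
        unfolding absolutely_convex_def by blast
      then show "of_real (1 - t) \<odot>\<^bsub>fib E x\<^esub> u \<oplus>\<^bsub>fib E x\<^esub> of_real t \<odot>\<^bsub>fib E x\<^esub> v \<in> {u \<in> ?C. N m u < \<epsilon>}"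
        using uv by simp
    qed
    moreover have "{u \<in> ?C. N m u < \<epsilon>} \<subseteq> W"
      using m by (auto simp: minus_conv_smult)
    ultimately show ?thesis
      using openin_fiber_ball[OF x, of m \<epsilon>] m(1) seminorm_zero[OF seminorm[OF x]]
      by (intro exI[of _ "{u \<in> ?C. N m u < \<epsilon>}"]) auto
  qed
  have complete: "\<exists>u. limitin ?T \<sigma> u sequentially"
    if \<sigma>: "range \<sigma> \<subseteq> ?C"
      "\<And>W. openin ?T W \<and> \<zero>\<^bsub>fib E x\<^esub> \<in> W \<Longrightarrow> \<exists>M. \<forall>k\<ge>M. \<forall>l\<ge>M. \<sigma> k \<ominus>\<^bsub>fib E x\<^esub> \<sigma> l \<in> W" for \<sigma> :: "nat \<Rightarrow> 'e"
  proof -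
    have "\<exists>M. \<forall>k\<ge>M. \<forall>l\<ge>M. N m (\<sigma> k \<ominus>\<^bsub>fib E x\<^esub> \<sigma> l) < \<epsilon>" if "0 < \<epsilon>" for m \<epsilon>
      using \<sigma>(2)[of "{u \<in> ?C. N m u < \<epsilon>}"] openin_fiber_ball[OF x, of m \<epsilon>] that
        seminorm_zero[OF seminorm[OF x], of m] by auto
    then obtain u where u: "u \<in> ?C" "\<And>m. (\<lambda>k. N m (\<sigma> k \<ominus>\<^bsub>fib E x\<^esub> u)) \<longlonglongrightarrow> 0"
      using complete[OF x \<sigma>(1)] by blast
    have "limitin ?T \<sigma> u sequentially"
      unfolding limitin_def
    proof (intro conjI allI impI)
      fix W assume "openin ?T W \<and> u \<in> W"
      then obtain m \<epsilon> where m: "0 < \<epsilon>" "\<forall>v\<in>?C. N m (v \<ominus>\<^bsub>fib E x\<^esub> u) < \<epsilon> \<longrightarrow> v \<in> W"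
        using openin_fiber_topology[OF x] by blast
      have "eventually (\<lambda>k. N m (\<sigma> k \<ominus>\<^bsub>fib E x\<^esub> u) < \<epsilon>) sequentially"
        using order_tendstoD(2)[OF u(2) m(1)] .
      then show "eventually (\<lambda>k. \<sigma> k \<in> W) sequentially"
        by (rule eventually_mono) (use m \<sigma>(1) in auto)
    qed (use u x topspace_fiber_topology in auto)
    then show ?thesis
      by blast
  qed
  show ?thesis
    unfolding frechet_algebra_def complex_algebra_iff_calg
    using op[of "\<lambda>y u v. u \<oplus>\<^bsub>fib E y\<^esub> v"] op[of "\<lambda>y u v. u \<otimes>\<^bsub>fib E y\<^esub> v"] continuous_add continuous_mult
      smult convex complete metrizable_fiber[OF x] calg_axioms topspace_fiber_topology[OF x] by auto
qed

theorem frechet_algebra_bundle: "frechet_algebra_bundle E"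
  unfolding frechet_algebra_bundle_def
proof (intro conjI ballI)
  fix U assume "U \<in> unif E"
  then obtain m \<epsilon> where \<epsilon>: "0 < \<epsilon>" "{u \<in> topspace (total E). N m u < \<epsilon>} \<subseteq> U"
    by (rule unifE)
  \<comment> \<open>One factor is bounded by \<open>1\<close> and the other by
    \<open>\<epsilon>\<close>; the index is raised because \<open>N_mult\<close> raises it.\<close>
  let ?V = "{u \<in> topspace (total E). N (Suc m) u < min 1 \<epsilon>}"
  show "\<exists>V\<in>unif E. \<forall>u\<in>V. \<forall>v\<in>V. proj E u = proj E v \<longrightarrow> u \<otimes>\<^bsub>fib E (proj E u)\<^esub> v \<in> U"
  proof (intro bexI[of _ ?V] ballI impI)
    fix u v assume uv: "u \<in> ?V" "v \<in> ?V" "proj E u = proj E v"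
    let ?x = "proj E u"
    have x: "?x \<in> B" "u \<in> carrier (fib E ?x)" "v \<in> carrier (fib E ?x)"
      using uv mem_total[of u] mem_total[of v] by auto
    interpret calg "fib E ?x"
      using x(1) by (rule calg)
    have "N m (u \<otimes>\<^bsub>fib E ?x\<^esub> v) \<le> N (Suc m) u * N (Suc m) v"
      using x by (rule N_mult)
    also have "\<dots> \<le> N (Suc m) u * 1"
      using uv seminorm_nonneg[OF seminorm[OF x(1)] x(2)] by (intro mult_left_mono) auto
    finally show "u \<otimes>\<^bsub>fib E ?x\<^esub> v \<in> U"
      using uv \<epsilon> mem_carrier[OF x(1) m_closed[OF x(2,3)]] by auto
  qed (use \<epsilon>(1) N_ball_unif[of "min 1 \<epsilon>" "Suc m"] in simp)
qed (use locally_convex_bundle frechet_fiber continuous_mult in auto)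

theorem continuous_bundle: "continuous_bundle E"
  unfolding continuous_bundle_def
proof (intro exI conjI)
  show "admissible E (range N)"
    unfolding admissible_def
  proof (intro conjI ballI)
    show "directed_seminorms E (range N)"
      unfolding directed_seminorms_def bundle_seminorm_def
    proof (intro conjI ballI)
      fix M M' assume "M \<in> range N" "M' \<in> range N"
      then obtain m m' where m: "M = N m" "M' = N m'"
        by blast
      show "\<exists>C>0. \<exists>M''\<in>range N. \<forall>u\<in>topspace (total E). M u \<le> C * M'' u \<and> M' u \<le> C * M'' u"
        unfolding m using mem_total
        by (intro exI[of _ 1] conjI bexI[of _ "N (max m m')"] ballI) (auto intro!: N_mono'[of "proj E _"])
    qed (use seminorm in auto)
    show "openin (total E) = arbitrary union_of (\<lambda>W. \<exists>V s N' \<epsilon>. openin (base E) V \<and> s \<in> sections V E \<and>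
        N' \<in> range N \<and> 0 < \<epsilon> \<and> W = seminorm_tube E s V N' \<epsilon>)"
      unfolding openin_topology_base_unique
    proof (intro conjI allI impI)
      fix W assume "\<exists>V s N' \<epsilon>. openin (base E) V \<and> s \<in> sections V E \<and>
        N' \<in> range N \<and> 0 < \<epsilon> \<and> W = seminorm_tube E s V N' \<epsilon>"
      then obtain V s m \<epsilon> where V: "openin (base E) V" "s \<in> sections V E" "W = tube s V m \<epsilon>"
        by blast
      show "openin (total E) W"
        unfolding V(3) seminorm_tube_eq[OF V(1,2)] by (rule open_section_tube[OF V(1,2) open_N_ball])
    next
      fix W u assume W: "openin (total E) W \<and> u \<in> W"
      then obtain V s m \<epsilon> where V: "openin (base E) V" "s \<in> \<Gamma>" "0 < \<epsilon>" "u \<in> tube s V m \<epsilon>" "tube s V m \<epsilon> \<subseteq> W"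
        using tube_base by metis
      have s: "s \<in> sections V E"
        using section_in_sections[OF openin_subset[OF V(1)] V(2)] .
      show "\<exists>W'. (\<exists>V s N' \<epsilon>. openin (base E) V \<and> s \<in> sections V E \<and>
        N' \<in> range N \<and> 0 < \<epsilon> \<and> W' = seminorm_tube E s V N' \<epsilon>) \<and> u \<in> W' \<and> W' \<subseteq> W"
        using V s by (intro exI[of _ "tube s V m \<epsilon>"] conjI exI[of _ V] exI[of _ s] exI[of _ "N m"] exI[of _ \<epsilon>]) simp_all
    qed
    fix x assume "x \<in> B"
    then show "seminorm_topology (fib E x) (range N) closure_of section_values E x = carrier (fib E x)"
      using closure_of_topspace[of "seminorm_topology (fib E x) (range N)"] by (simp add: section_values_eq)
  qed
qed (use continuous_N unif in auto)

end

section \<open>Graded algebras of free power series\<close>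

lemma finite_words [simp]: "finite {w :: 'n::finite list. length w = d}"
  using finite_lists_length_eq[of "UNIV :: 'n set" d] by simp

text \<open>\<open>p m d a\<close> is the \<open>m\<close>-th seminorm of the homogeneous component of \<open>a\<close> of degree \<open>d\<close>.\<close>

locale graded_norm =
  fixes p :: "nat \<Rightarrow> nat \<Rightarrow> ('n::{finite, linorder} list \<Rightarrow> complex) \<Rightarrow> real"
  assumes p_nonneg: "0 \<le> p m d a"
    and p_add: "p m d (\<lambda>w. a w + b w) \<le> p m d a + p m d b"
    and p_smult: "p m d (\<lambda>w. c * a w) = cmod c * p m d a"
    and p_solid: "(\<And>w. length w = d \<Longrightarrow> cmod (a w) \<le> cmod (b w)) \<Longrightarrow> p m d a \<le> p m d b"
    and p_basis: "0 < p m (length u) (word_basis u)"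
    and p_mono: "p m d a \<le> p (Suc m) d a"
    and p_mult: "p m d (word_mult a b) \<le> (\<Sum>i\<le>d. p m i a * p m (d - i) b)"
begin

text \<open>In both examples the topology is an l1 sum over the degrees of norms of the homogeneous
  components; they differ only within one degree, weighted l1 for the polydisk and l2 for the
  ball.\<close>

definition series :: "('n list \<Rightarrow> complex) set" where
  "series = {a. \<forall>m. summable (\<lambda>d. p m d a)}"

definition P :: "nat \<Rightarrow> ('n list \<Rightarrow> complex) \<Rightarrow> real" where
  "P m a = (suminf (\<lambda>d. p m d a))"

lemma seriesD: "a \<in> series \<Longrightarrow> summable (\<lambda>d. p m d a)"
  by (simp add: series_def)

lemma p_zero [simp]: "p m d (\<lambda>w. 0) = 0"
  using p_smult[of m d 0 "\<lambda>w. 0"] by simp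

lemma series_comparison:
  assumes "\<And>m. summable (g m)" "\<And>m d. p m d a \<le> g m d"
  shows "a \<in> series"
  unfolding series_def
proof (intro CollectI allI)
  show "summable (\<lambda>d. p m d a)" for m
    by (rule summable_comparison_test'[OF assms(1)[of m], of 0]) (simp add: p_nonneg assms(2))
qed

lemma series_add: "a \<in> series \<Longrightarrow> b \<in> series \<Longrightarrow> (\<lambda>w. a w + b w) \<in> series"
  by (rule series_comparison[where g = "\<lambda>m d. p m d a + p m d b"])
    (auto intro: summable_add seriesD p_add)

lemma series_smult: "a \<in> series \<Longrightarrow> (\<lambda>w. c * a w) \<in> series"
  by (simp add: series_def p_smult summable_mult)

lemma series_diff: "a \<in> series \<Longrightarrow> b \<in> series \<Longrightarrow> (\<lambda>w. a w - b w) \<in> series"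
  using series_add[OF _ series_smult, of a b "-1"] by simp

lemma series_solid: "b \<in> series \<Longrightarrow> (\<And>w. cmod (a w) \<le> cmod (b w)) \<Longrightarrow> a \<in> series"
  by (rule series_comparison[where g = "\<lambda>m d. p m d b"]) (auto intro: seriesD p_solid)

lemma series_finite_degree:
  assumes "\<And>w. D < length w \<Longrightarrow> a w = 0"
  shows "a \<in> series"
  unfolding series_def
proof (intro CollectI allI)
  fix m
  have "p m d a = 0" if "D < d" for d
    using p_solid[of d a "\<lambda>w. 0" m] assms that p_nonneg[of m d a] by fastforce
  then show "summable (\<lambda>d. p m d a)"
    by (intro summable_finite[of "{..D}"]) auto
qed

lemma series_finite_support:
  assumes "finite {w. a w \<noteq> 0}"
  shows "a \<in> series"
proof (rule series_finite_degree[of "Max (length ` {w. a w \<noteq> 0})"], rule ccontr)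
  fix w assume w: "Max (length ` {w. a w \<noteq> 0}) < length w" "a w \<noteq> 0"
  then have "length w \<le> Max (length ` {w. a w \<noteq> 0})"
    using assms by (intro Max_ge) auto
  then show False
    using w(1) by simp
qed

lemma series_basis: "word_basis w \<in> series"
  by (rule series_finite_support[OF finite_support_basis])

lemma series_zero: "(\<lambda>w. 0) \<in> series"
  by (simp add: series_def)

lemma P_nonneg: "a \<in> series \<Longrightarrow> 0 \<le> P m a"
  unfolding P_def by (intro suminf_nonneg seriesD p_nonneg)

lemma P_add: "a \<in> series \<Longrightarrow> b \<in> series \<Longrightarrow> P m (\<lambda>w. a w + b w) \<le> P m a + P m b"
  unfolding P_def by (subst suminf_add) (auto intro!: suminf_le summable_add seriesD series_add p_add)

lemma P_smult: "a \<in> series \<Longrightarrow> P m (\<lambda>w. c * a w) = cmod c * P m a"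
  unfolding P_def by (simp add: p_smult suminf_mult seriesD)

lemma P_zero [simp]: "P m (\<lambda>w. 0) = 0"
  by (simp add: P_def)

lemma P_diff: "a \<in> series \<Longrightarrow> b \<in> series \<Longrightarrow> P m (\<lambda>w. a w - b w) \<le> P m a + P m b"
  using P_add[OF _ series_smult, of a b m "-1"] P_smult[of b m "-1"] by simp

lemma P_diff_swap: "a \<in> series \<Longrightarrow> b \<in> series \<Longrightarrow> P m (\<lambda>w. a w - b w) = P m (\<lambda>w. b w - a w)"
  using P_smult[OF series_diff, of b a m "-1"] by simp

lemma P_solid: "b \<in> series \<Longrightarrow> (\<And>w. cmod (a w) \<le> cmod (b w)) \<Longrightarrow> P m a \<le> P m b"
  unfolding P_def by (intro suminf_le p_solid seriesD) (auto intro: series_solid)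

lemma P_mono: "a \<in> series \<Longrightarrow> P m a \<le> P (Suc m) a"
  unfolding P_def by (intro suminf_le p_mono seriesD) auto

lemma P_mono': "a \<in> series \<Longrightarrow> m \<le> m' \<Longrightarrow> P m a \<le> P m' a"
  by (rule lift_Suc_mono_le[of "\<lambda>m. P m a"]) (auto intro: P_mono)

text \<open>The submultiplicativity \<open>p_mult\<close> across degrees is the estimate by a Cauchy
  product, so products of summable families stay summable.\<close>

lemma series_mult:
  assumes "a \<in> series" "b \<in> series"
  shows "word_mult a b \<in> series"
proof (rule series_comparison)
  show "summable (\<lambda>d. \<Sum>i\<le>d. p m i a * p m (d - i) b)" for m
    using assms by (intro summable_Cauchy_product) (auto simp: p_nonneg seriesD)
qed (rule p_mult)

lemma P_mult:
  assumes "a \<in> series" "b \<in> series"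
  shows "P m (word_mult a b) \<le> P m a * P m b"
proof -
  have "P m a * P m b = (suminf (\<lambda>d. \<Sum>i\<le>d. p m i a * p m (d - i) b))"
    unfolding P_def using assms by (intro Cauchy_product) (auto simp: p_nonneg seriesD)
  moreover have "summable (\<lambda>d. \<Sum>i\<le>d. p m i a * p m (d - i) b)"
    using assms by (intro summable_Cauchy_product) (auto simp: p_nonneg seriesD)
  ultimately show ?thesis
    unfolding P_def using seriesD[OF series_mult[OF assms]] p_mult by (auto intro: suminf_le)
qed

lemma p_coeff: "cmod (a w) * p m (length w) (word_basis w) \<le> p m (length w) a"
proof -
  have "p m (length w) (\<lambda>u. a w * word_basis w u) \<le> p m (length w) a"
    by (rule p_solid) (auto simp: word_basis_def)
  then show ?thesis
    by (simp add: p_smult)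
qed

text \<open>Continuity of the coordinate functionals: by solidity a single term of the series has no
  larger seminorm than the whole, and \<open>p_basis\<close> allows division by the factor.\<close>

lemma P_coeff:
  assumes "a \<in> series"
  shows "cmod (a w) * p m (length w) (word_basis w) \<le> P m a"
proof -
  have "p m (length w) a \<le> P m a"
    unfolding P_def using sum_le_suminf[of "\<lambda>d. p m d a" "{length w}"] assms by (simp add: seriesD p_nonneg)
  then show ?thesis
    using p_coeff[of a w m] by linarith
qed

definition trunc :: "nat \<Rightarrow> ('n list \<Rightarrow> complex) \<Rightarrow> 'n list \<Rightarrow> complex" where
  "trunc D a w = (if length w \<le> D then a w else 0)"

lemma finite_length_le: "finite {w :: 'n list. length w \<le> d}"
  using finite_lists_length_le[of "UNIV :: 'n set" d] by simp

lemma finite_support_trunc: "finite {w. trunc D a w \<noteq> 0}"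
  by (rule finite_subset[OF _ finite_length_le[of D]]) (auto simp: trunc_def)

lemma series_trunc [simp]: "trunc D a \<in> series"
  by (rule series_finite_degree[of D]) (simp add: trunc_def)

lemma P_trunc: "a \<in> series \<Longrightarrow> P m (trunc D a) \<le> P m a"
  by (rule P_solid) (auto simp: trunc_def)

lemma P_tail_eq:
  assumes "a \<in> series"
  shows "P m (\<lambda>w. a w - trunc D a w) = (suminf (\<lambda>d. p m (d + Suc D) a))"
proof -
  have hi: "p m d (\<lambda>w. a w - trunc D a w) = p m d a" if "D < d" for d
    using that by (intro antisym p_solid) (auto simp: trunc_def)
  have lo: "p m d (\<lambda>w. a w - trunc D a w) = 0" if "d \<le> D" for d
  proof -
    have "p m d (\<lambda>w. a w - trunc D a w) \<le> p m d (\<lambda>w. 0)"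
      using that by (intro p_solid) (auto simp: trunc_def)
    then show ?thesis
      using p_nonneg[of m d "\<lambda>w. a w - trunc D a w"] by simp
  qed
  have "P m (\<lambda>w. a w - trunc D a w) =
      (suminf (\<lambda>d. p m (d + Suc D) (\<lambda>w. a w - trunc D a w))) + (\<Sum>d<Suc D. p m d (\<lambda>w. a w - trunc D a w))"
    unfolding P_def by (rule suminf_split_initial_segment) (intro seriesD series_diff assms series_trunc)
  then show ?thesis
    by (simp add: hi lo)
qed

lemma P_tail_tendsto: "a \<in> series \<Longrightarrow> (\<lambda>D. P m (\<lambda>w. a w - trunc D a w)) \<longlonglongrightarrow> 0"
proof -
  assume "a \<in> series"
  then have "(\<lambda>D. suminf (\<lambda>d. p m (d + D) a)) \<longlonglongrightarrow> 0"
    by (intro suminf_exist_split2 seriesD)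
  then show ?thesis
    unfolding P_tail_eq[OF \<open>a \<in> series\<close>] by (rule LIMSEQ_Suc)
qed

lemma P_tail_le: "a \<in> series \<Longrightarrow> P m (\<lambda>w. a w - trunc D a w) \<le> P m a"
  by (rule P_solid) (auto simp: trunc_def)

lemma trunc_diff: "trunc D (\<lambda>w. a w - b w) = (\<lambda>w. trunc D a w - trunc D b w)"
  by (auto simp: trunc_def)

text \<open>A degree contains only finitely many words, so in a fixed degree coordinatewise
  convergence implies convergence for \<open>p m d\<close>.\<close>

lemma p_le_sum: "p m d a \<le> (\<Sum>w | length w = d. cmod (a w) * p m d (word_basis w))"
proof -
  have sum: "p m d (\<lambda>u. \<Sum>w\<in>S. f w u) \<le> (\<Sum>w\<in>S. p m d (f w))" if "finite S" for S and f :: "'n list \<Rightarrow> 'n list \<Rightarrow> complex"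
    using that
  proof (induction S rule: finite_induct)
    case (insert x S)
    then show ?case
      using p_add[of m d "f x" "\<lambda>u. \<Sum>w\<in>S. f w u"] by simp
  qed simp
  have "p m d a \<le> p m d (\<lambda>u. \<Sum>w | length w = d. a w * word_basis w u)"
  proof (rule p_solid)
    fix u :: "'n list" assume "length u = d"
    then have "(\<Sum>w | length w = d. a w * word_basis w u) = a u"
      using finite_words by (simp add: word_basis_def if_distrib cong: if_cong)
    then show "cmod (a u) \<le> cmod (\<Sum>w | length w = d. a w * word_basis w u)"
      by simp
  qed
  also have "\<dots> \<le> (\<Sum>w | length w = d. p m d (\<lambda>u. a w * word_basis w u))"
    by (rule sum[OF finite_words])
  finally show ?thesis
    by (simp add: p_smult)
qed

text \<open>Completeness in the form that absolutely convergent series converge, the sum being taken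
  coordinatewise. The estimate is proved in each degree separately and then added up over the
  degrees.\<close>

lemma series_suminf:
  fixes f :: "nat \<Rightarrow> 'n list \<Rightarrow> complex"
  assumes f: "\<And>j. f j \<in> series" and sm: "\<And>m. summable (\<lambda>j. P m (f j))"
  shows "(\<lambda>w. suminf (\<lambda>j. f j w)) \<in> series" "P m (\<lambda>w. suminf (\<lambda>j. f j w)) \<le> (suminf (\<lambda>j. P m (f j)))" "summable (\<lambda>j. f j w)"
proof -
  show ptw: "summable (\<lambda>j. f j w)" for w
  proof (rule summable_comparison_test')
    show "summable (\<lambda>j. P 0 (f j) / p 0 (length w) (word_basis w))"
      by (intro summable_divide sm)
    show "norm (f j w) \<le> P 0 (f j) / p 0 (length w) (word_basis w)" for j
      using P_coeff[OF f, of j w 0] p_basis[of 0 w] by (simp add: field_simps)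
  qed
  let ?g = "\<lambda>w. suminf (\<lambda>j. f j w)"
  have sp: "summable (\<lambda>j. p m d (f j))" for m d
  proof (rule summable_comparison_test'[OF sm[of m]])
    show "norm (p m d (f j)) \<le> P m (f j)" for j
      unfolding P_def using sum_le_suminf[of "\<lambda>d. p m d (f j)" "{d}"] f by (simp add: seriesD p_nonneg)
  qed
  have pg: "p m d ?g \<le> (suminf (\<lambda>j. p m d (f j)))" for m d
  proof (rule LIMSEQ_le_const)
    \<comment> \<open>Bounds the seminorm, in degree \<open>d\<close>, of what is missing after
      \<open>n\<close> terms. It tends to \<open>0\<close> because the coordinates converge.\<close>
    let ?r = "\<lambda>n. \<Sum>w | length w = d. cmod (?g w - (\<Sum>j<n. f j w)) * p m d (word_basis w)"
    have "?r \<longlonglongrightarrow> (\<Sum>w | length w = d. cmod (?g w - ?g w) * p m d (word_basis w))"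
      by (intro tendsto_intros summable_LIMSEQ ptw)
    then show "(\<lambda>n. (suminf (\<lambda>j. p m d (f j))) + ?r n) \<longlonglongrightarrow> (suminf (\<lambda>j. p m d (f j)))"
      using tendsto_add[OF tendsto_const, of ?r 0 sequentially "suminf (\<lambda>j. p m d (f j))"] by simp
    have "p m d ?g \<le> (suminf (\<lambda>j. p m d (f j))) + ?r n" for n
    proof -
      have fin: "p m d (\<lambda>w. \<Sum>j<n. f j w) \<le> (\<Sum>j<n. p m d (f j))"
      proof (induction n)
        case (Suc n)
        then show ?case
          using p_add[of m d "\<lambda>w. \<Sum>j<n. f j w" "f n"] by simp
      qed simp
      have "p m d ?g \<le> p m d (\<lambda>w. \<Sum>j<n. f j w) + p m d (\<lambda>w. ?g w - (\<Sum>j<n. f j w))"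
        using p_add[of m d "\<lambda>w. \<Sum>j<n. f j w" "\<lambda>w. ?g w - (\<Sum>j<n. f j w)"] by simp
      moreover have "(\<Sum>j<n. p m d (f j)) \<le> (suminf (\<lambda>j. p m d (f j)))"
        by (rule sum_le_suminf[OF sp]) (auto simp: p_nonneg)
      ultimately show ?thesis
        using fin p_le_sum[of m d "\<lambda>w. ?g w - (\<Sum>j<n. f j w)"] by linarith
    qed
    then show "\<exists>N. \<forall>n\<ge>N. p m d ?g \<le> (suminf (\<lambda>j. p m d (f j))) + ?r n"
      by blast
  qed
  \<comment> \<open>Only finitely many degrees at a time, so that the sum over degrees may be
    exchanged with the infinite sum over \<open>j\<close>.\<close>
  have part: "(\<Sum>d<D. p m d ?g) \<le> (suminf (\<lambda>j. P m (f j)))" for m D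
  proof -
    have "(\<Sum>d<D. p m d ?g) \<le> (\<Sum>d<D. suminf (\<lambda>j. p m d (f j)))"
      by (intro sum_mono pg)
    also have "\<dots> = (suminf (\<lambda>j. \<Sum>d<D. p m d (f j)))"
      by (rule suminf_sum[symmetric]) (rule sp)
    also have "\<dots> \<le> (suminf (\<lambda>j. P m (f j)))"
      unfolding P_def
    proof (rule suminf_le)
      show "summable (\<lambda>j. suminf (\<lambda>d. p m d (f j)))"
        using sm[of m] by (simp add: P_def)
    qed (auto intro!: sum_le_suminf summable_sum sp simp: seriesD f p_nonneg)
    finally show ?thesis .
  qed
  have sg: "summable (\<lambda>d. p m d ?g)" for m
    by (rule summableI_nonneg_bounded[OF p_nonneg part])
  then show "?g \<in> series"
    by (simp add: series_def)
  show "P m ?g \<le> (suminf (\<lambda>j. P m (f j)))"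
    unfolding P_def[of m ?g] by (rule suminf_le_const[OF sg part])
qed

subsection \<open>Quotient norms\<close>

abbreviation nc :: "complex \<Rightarrow> ('n list \<Rightarrow> complex) \<Rightarrow> 'n multiset \<Rightarrow> complex" where
  "nc h \<equiv> normal_coeff (exp (\<i> * h))"

lemma nc_eq: "nc h a M = (\<Sum>w | mset w = M. a w * exp (- (\<i> * h * of_nat (inversions w))))"
  unfolding normal_coeff_def
  by (simp add: exp_minus[symmetric] exp_of_nat_mult[symmetric] mult_ac)

text \<open>A sorted coefficient is a finite combination of coordinates, hence continuous with
  respect to every \<open>P m\<close>. The constant depends on \<open>h\<close>, \<open>M\<close>
  and \<open>m\<close>.\<close>

lemma nc_bound: "\<exists>C\<ge>0. \<forall>a\<in>series. cmod (nc h a M) \<le> C * P m a"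
proof (intro exI conjI ballI)
  let ?c = "\<lambda>w. cmod (exp (- (\<i> * h * of_nat (inversions w)))) / p m (length w) (word_basis w)"
  show "0 \<le> (\<Sum>w | mset w = M. ?c w)"
    by (intro sum_nonneg divide_nonneg_nonneg) (auto simp: p_nonneg)
  fix a assume a: "a \<in> series"
  have "cmod (nc h a M) \<le> (\<Sum>w | mset w = M. ?c w * P m a)"
    unfolding nc_eq
  proof (rule sum_norm_le)
    fix w
    have "cmod (a w) \<le> P m a / p m (length w) (word_basis w)"
      using P_coeff[OF a, of w m] p_basis[of m w] by (simp add: field_simps)
    then show "cmod (a w * exp (- (\<i> * h * of_nat (inversions w)))) \<le> ?c w * P m a"
      using mult_left_mono[of "cmod (a w)" "P m a / p m (length w) (word_basis w)"
          "cmod (exp (- (\<i> * h * of_nat (inversions w))))"] by (simp add: norm_mult mult.commute)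
  qed
  then show "cmod (nc h a M) \<le> (\<Sum>w | mset w = M. ?c w) * P m a"
    by (simp add: sum_distrib_right)
qed

lemma nc_mult_cong:
  "nc h a = nc h a' \<Longrightarrow> nc h b = nc h b' \<Longrightarrow> nc h (word_mult a b) = nc h (word_mult a' b')"
  by (rule ext) (simp add: normal_coeff_word_mult)

lemma nc_trunc: "nc h (trunc D a) M = (if size M \<le> D then nc h a M else 0)"
  unfolding normal_coeff_def by (auto simp: trunc_def intro!: sum.cong sum.neutral)

text \<open>The quotient seminorm of \<open>P m\<close> modulo the common kernel of the sorted
  coefficients at \<open>h\<close>. It takes series instead of cosets as arguments, so that its
  values at different \<open>h\<close> can be compared on the same series.\<close>

definition nrm :: "nat \<Rightarrow> complex \<Rightarrow> ('n list \<Rightarrow> complex) \<Rightarrow> real" where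
  "nrm m h a = Inf {P m b |b. b \<in> series \<and> nc h b = nc h a}"

lemma nrm_bdd: "bdd_below {P m b |b. b \<in> series \<and> nc h b = nc h a}"
  by (rule bdd_belowI[of _ 0]) (auto simp: P_nonneg)

lemma nrm_le: "b \<in> series \<Longrightarrow> nc h b = nc h a \<Longrightarrow> nrm m h a \<le> P m b"
  unfolding nrm_def by (rule cInf_lower[OF _ nrm_bdd]) auto

lemma nrm_greatest:
  "a \<in> series \<Longrightarrow> (\<And>b. b \<in> series \<Longrightarrow> nc h b = nc h a \<Longrightarrow> c \<le> P m b) \<Longrightarrow> c \<le> nrm m h a"
  unfolding nrm_def by (rule cInf_greatest) auto

lemma nrm_lessE:
  assumes "a \<in> series" "nrm m h a < c"
  obtains b where "b \<in> series" "nc h b = nc h a" "P m b < c"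
  using nrm_greatest[OF assms(1), of h c m] assms(2) by (meson not_le)

lemma nrm_nonneg: "a \<in> series \<Longrightarrow> 0 \<le> nrm m h a"
  by (rule nrm_greatest) (auto simp: P_nonneg)

lemma nrm_le_P: "a \<in> series \<Longrightarrow> nrm m h a \<le> P m a"
  by (rule nrm_le) auto

lemma nrm_add:
  assumes "a \<in> series" "b \<in> series"
  shows "nrm m h (\<lambda>w. a w + b w) \<le> nrm m h a + nrm m h b"
proof -
  have "nrm m h (\<lambda>w. a w + b w) - P m b' \<le> nrm m h a" if b': "b' \<in> series" "nc h b' = nc h b" for b'
  proof (rule nrm_greatest[OF assms(1)])
    fix a' assume a': "a' \<in> series" "nc h a' = nc h a"
    have "nrm m h (\<lambda>w. a w + b w) \<le> P m (\<lambda>w. a' w + b' w)"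
      using a' b' by (intro nrm_le) (auto simp: series_add normal_coeff_add fun_eq_iff)
    then show "nrm m h (\<lambda>w. a w + b w) - P m b' \<le> P m a'"
      using P_add[OF a'(1) b'(1), of m] by simp
  qed
  then have "nrm m h (\<lambda>w. a w + b w) - nrm m h a \<le> nrm m h b"
    by (intro nrm_greatest[OF assms(2)]) (simp add: algebra_simps)
  then show ?thesis
    by simp
qed

lemma nrm_zero: "nrm m h (\<lambda>w. 0) = 0"
  using nrm_le_P[OF series_zero, of m h] nrm_nonneg[OF series_zero, of m h] by simp

lemma nrm_smult:
  assumes "a \<in> series"
  shows "nrm m h (\<lambda>w. c * a w) = cmod c * nrm m h a"
proof (cases "c = 0")
  case False
  have le: "nrm m h (\<lambda>w. c * a w) \<le> cmod c * nrm m h a" if "c \<noteq> 0" "a \<in> series" for c a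
  proof -
    have "nrm m h (\<lambda>w. c * a w) / cmod c \<le> nrm m h a"
    proof (rule nrm_greatest[OF that(2)])
      fix b assume b: "b \<in> series" "nc h b = nc h a"
      have "nrm m h (\<lambda>w. c * a w) \<le> P m (\<lambda>w. c * b w)"
        using b by (intro nrm_le) (auto simp: series_smult normal_coeff_smult fun_eq_iff)
      then show "nrm m h (\<lambda>w. c * a w) / cmod c \<le> P m b"
        using that b by (simp add: P_smult field_simps)
    qed
    then show ?thesis
      using that by (simp add: field_simps)
  qed
  have "nrm m h (\<lambda>w. inverse c * (c * a w)) \<le> cmod (inverse c) * nrm m h (\<lambda>w. c * a w)"
    using False assms by (intro le) (auto simp: series_smult)
  then have "cmod c * nrm m h a \<le> cmod c * (cmod (inverse c) * nrm m h (\<lambda>w. c * a w))"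
    using False by (intro mult_left_mono) (auto simp: mult.assoc[symmetric])
  then have "cmod c * nrm m h a \<le> nrm m h (\<lambda>w. c * a w)"
    using False by (simp add: norm_inverse mult.assoc[symmetric])
  then show ?thesis
    using le[OF False assms] by simp
qed (simp add: nrm_zero)

lemma nrm_mono: "a \<in> series \<Longrightarrow> nrm m h a \<le> nrm (Suc m) h a"
  by (rule nrm_greatest) (auto intro: order_trans[OF nrm_le P_mono])

lemma nrm_mono': "a \<in> series \<Longrightarrow> m \<le> m' \<Longrightarrow> nrm m h a \<le> nrm m' h a"
  by (rule lift_Suc_mono_le[of "\<lambda>m. nrm m h a"]) (auto intro: nrm_mono)

text \<open>By \<open>nc_mult_cong\<close> the product of two representatives represents the
  product. The slack \<open>\<epsilon>\<close> is removed by a limit, which also covers factors of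
  norm \<open>0\<close>.\<close>

lemma nrm_mult:
  assumes "a \<in> series" "b \<in> series"
  shows "nrm m h (word_mult a b) \<le> nrm m h a * nrm m h b"
proof -
  have "nrm m h (word_mult a b) \<le> (nrm m h a + \<epsilon>) * (nrm m h b + \<epsilon>)" if "0 < \<epsilon>" for \<epsilon>
  proof -
    have "nrm m h a < nrm m h a + \<epsilon>" "nrm m h b < nrm m h b + \<epsilon>"
      using that by auto
    then obtain a' b' where a': "a' \<in> series" "nc h a' = nc h a" "P m a' < nrm m h a + \<epsilon>"
      and b': "b' \<in> series" "nc h b' = nc h b" "P m b' < nrm m h b + \<epsilon>"
      using nrm_lessE assms by metis
    have "nrm m h (word_mult a b) \<le> P m (word_mult a' b')"
      using a' b' nc_mult_cong[OF a'(2) b'(2)] by (intro nrm_le series_mult)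
    also have "\<dots> \<le> P m a' * P m b'"
      using a' b' by (intro P_mult)
    also have "\<dots> \<le> (nrm m h a + \<epsilon>) * (nrm m h b + \<epsilon>)"
      using a' b' nrm_nonneg[OF assms(1), of m h] that by (intro mult_mono) (auto intro: P_nonneg)
    finally show ?thesis .
  qed
  then have ev: "eventually (\<lambda>\<epsilon>. nrm m h (word_mult a b) \<le> (nrm m h a + \<epsilon>) * (nrm m h b + \<epsilon>)) (at_right 0)"
    using eventually_at_right_less[of "0::real"] by (auto elim: eventually_mono)
  have "((\<lambda>\<epsilon>. (nrm m h a + \<epsilon>) * (nrm m h b + \<epsilon>)) \<longlongrightarrow> (nrm m h a + 0) * (nrm m h b + 0)) (at_right 0)"
    by (intro tendsto_intros)
  from tendsto_lowerbound[OF this ev] show ?thesis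
    by simp
qed

lemma nrm_diff_le: "a \<in> series \<Longrightarrow> b \<in> series \<Longrightarrow> \<bar>nrm m h a - nrm m h b\<bar> \<le> P m (\<lambda>w. a w - b w)"
proof -
  have *: "nrm m h a \<le> nrm m h b + P m (\<lambda>w. a w - b w)" if "a \<in> series" "b \<in> series" for a b
    using nrm_add[OF that(2) series_diff[OF that], of m h] nrm_le_P[OF series_diff[OF that], of m h] by simp
  assume "a \<in> series" "b \<in> series"
  then show ?thesis
    using *[of a b] *[of b a] P_diff_swap[of a b m] by linarith
qed

text \<open>There are representatives of arbitrarily small norm, all with the same sorted
  coefficients, and each coefficient is bounded by a multiple of the norm.\<close>

lemma nrm_eq_zeroD:
  assumes "a \<in> series" "nrm m h a = 0"
  shows "nc h a M = 0"
proof -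
  obtain C where C: "0 \<le> C" "\<And>b. b \<in> series \<Longrightarrow> cmod (nc h b M) \<le> C * P m b"
    using nc_bound by blast
  have "cmod (nc h a M) \<le> 0 + \<epsilon>" if "0 < \<epsilon>" for \<epsilon>
  proof -
    have "nrm m h a < \<epsilon> / (C + 1)"
      using assms that C by simp
    then obtain b where b: "b \<in> series" "nc h b = nc h a" "P m b < \<epsilon> / (C + 1)"
      by (rule nrm_lessE[OF assms(1)])
    have "cmod (nc h a M) \<le> C * P m b"
      using C(2)[OF b(1)] b(2) by simp
    also have "\<dots> \<le> C * (\<epsilon> / (C + 1))"
      using b C by (intro mult_left_mono) auto
    also have "\<dots> \<le> \<epsilon>"
      using C that by (simp add: field_simps)
    finally show ?thesis
      by simp
  qed
  then have "cmod (nc h a M) \<le> 0"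
    by (rule field_le_epsilon)
  then show ?thesis
    by simp
qed

text \<open>If \<open>b\<close> represents \<open>a\<close> at \<open>h\<close>, then
  \<open>b - a\<close> lies in the kernel at \<open>h\<close>. Applying the diagonal operator to it
  and adding \<open>a\<close> gives a representative at \<open>h'\<close>, at the cost of at most
  \<open>\<delta> * (P m b + P m a)\<close>. The bound \<open>\<delta>\<close> is available only for
  finitely many exponents, hence the restriction to degrees up to \<open>D\<close>.\<close>

lemma nrm_perturb:
  assumes a: "a \<in> series" "trunc D a = a" and \<delta>: "\<And>j. j \<le> D\<^sup>2 \<Longrightarrow> cmod (exp (\<i> * (h' - h) * of_nat j) - 1) \<le> \<delta>"
  shows "nrm m h' a \<le> nrm m h a + 2 * \<delta> * P m a"
proof -
  have \<delta>0: "0 \<le> \<delta>"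
    using \<delta>[of 0] norm_ge_zero order_trans by blast
  \<comment> \<open>The estimate \<open>P m b0 + \<delta> * (P m b0 + P m a)\<close> solved for
    \<open>P m b0\<close>, so that the infimum over the representatives \<open>b0\<close> can be
    taken.\<close>
  have "(nrm m h' a - \<delta> * P m a) / (1 + \<delta>) \<le> nrm m h a"
  proof (rule nrm_greatest[OF a(1)])
    fix b0 assume b0: "b0 \<in> series" "nc h b0 = nc h a"
    \<comment> \<open>Truncation does not increase the norm and stays in the class, because
      \<open>a\<close> has no sorted coefficients of size above \<open>D\<close>.\<close>
    define b where "b = trunc D b0"
    have "nc h a M = 0" if "\<not> size M \<le> D" for M
      using nc_trunc[of h D a M] a(2) that by simp
    then have b: "b \<in> series" "P m b \<le> P m b0" "nc h b = nc h a"
      using b0 P_trunc by (auto simp: b_def fun_eq_iff nc_trunc)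
    \<comment> \<open>The diagonal operator minus the identity, applied to \<open>b - a\<close>;
      thus \<open>b + c\<close> is \<open>a\<close> plus the transported kernel element.\<close>
    define c where "c = (\<lambda>w. (exp (\<i> * (h' - h) * of_nat (inversions w)) - 1) * (b w - a w))"
    have c: "cmod (c w) \<le> cmod (of_real \<delta> * (b w - a w))" for w
    proof (cases "length w \<le> D")
      case True
      then have "inversions w \<le> D\<^sup>2"
        using inversions_le[of w] power_mono[OF True, of 2] by linarith
      then show ?thesis
        using mult_right_mono[OF \<delta>, of "inversions w" "cmod (b w - a w)"] \<delta>0 by (simp add: c_def norm_mult)
    next
      case False
      then have "b w = 0" "a w = 0"
        using fun_cong[OF a(2), of w] by (auto simp: b_def trunc_def)
      then show ?thesis
        by (simp add: c_def)
    qed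
    have ba: "(\<lambda>w. of_real \<delta> * (b w - a w)) \<in> series"
      using a b by (intro series_smult series_diff)
    have cs: "c \<in> series" and "P m c \<le> P m (\<lambda>w. of_real \<delta> * (b w - a w))"
      using series_solid[OF ba c] P_solid[OF ba c] by auto
    then have Pc: "P m c \<le> \<delta> * (P m b + P m a)"
      using P_smult[OF series_diff[OF b(1) a(1)], of m "of_real \<delta>"] \<delta>0
        mult_left_mono[OF P_diff[OF b(1) a(1)] \<delta>0, of m] by simp
    have "nc h' (\<lambda>w. b w + c w) M = nc h' a M" for M
    proof -
      have "(b w + c w) * exp (- (\<i> * h' * of_nat (inversions w))) =
          (b w - a w) * exp (- (\<i> * h * of_nat (inversions w))) + a w * exp (- (\<i> * h' * of_nat (inversions w)))" for w
      proof -
        have "exp (\<i> * (h' - h) * of_nat (inversions w)) * exp (- (\<i> * h' * of_nat (inversions w))) =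
            exp (- (\<i> * h * of_nat (inversions w)))"
          by (simp add: exp_add[symmetric] algebra_simps)
        then show ?thesis
          unfolding c_def by (simp add: algebra_simps)
      qed
      then have "nc h' (\<lambda>w. b w + c w) M = nc h (\<lambda>w. b w - a w) M + nc h' a M"
        by (simp add: nc_eq sum.distrib)
      then show ?thesis
        using b(3) by (simp add: normal_coeff_diff)
    qed
    then have "nrm m h' a \<le> P m (\<lambda>w. b w + c w)"
      using b cs by (intro nrm_le series_add) auto
    also have "\<dots> \<le> P m b + \<delta> * (P m b + P m a)"
      using P_add[OF b(1) cs, of m] Pc by simp
    also have "\<dots> \<le> P m b0 + \<delta> * (P m b0 + P m a)"
      using b(2) \<delta>0 by (intro add_mono mult_left_mono) auto
    finally show "(nrm m h' a - \<delta> * P m a) / (1 + \<delta>) \<le> P m b0"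
      using \<delta>0 by (simp add: field_simps)
  qed
  then have "nrm m h' a \<le> nrm m h a + \<delta> * nrm m h a + \<delta> * P m a"
    using \<delta>0 by (simp add: field_simps)
  also have "\<delta> * nrm m h a \<le> \<delta> * P m a"
    using \<delta>0 nrm_le_P[OF a(1)] by (intro mult_left_mono)
  finally show ?thesis
    by simp
qed

text \<open>The bound in \<open>nrm_diff_le\<close> does not depend on \<open>h\<close>, so
  \<open>a\<close> may be replaced by a truncation for all \<open>h\<close> at once. For the
  truncation, \<open>nrm_perturb\<close> is applied from \<open>h0\<close> to \<open>h\<close> and
  back.\<close>

lemma nrm_tendsto_const:
  assumes a: "a \<in> series"
  shows "((\<lambda>h. nrm m h a) \<longlongrightarrow> nrm m h0 a) (at h0)"
proof (rule tendstoI)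
  fix \<epsilon> :: real assume \<epsilon>: "0 < \<epsilon>"
  obtain D where D: "P m (\<lambda>w. a w - trunc D a w) < \<epsilon> / 4"
    using order_tendstoD(2)[OF P_tail_tendsto[OF a, of m], of "\<epsilon> / 4"] \<epsilon>
    by (auto simp: eventually_sequentially)
  define b where "b = trunc D a"
  have b: "b \<in> series" "trunc D b = b"
    by (auto simp: b_def trunc_def)
  \<comment> \<open>Chosen to keep \<open>2 * \<delta> * P m b\<close> below
    \<open>\<epsilon> / 2\<close>; the two truncation errors account for the other half. The summand
    \<open>1\<close> covers the case \<open>P m b = 0\<close>.\<close>
  define \<delta> where "\<delta> = \<epsilon> / (8 * (P m b + 1))"
  have \<delta>: "0 < \<delta>" "2 * \<delta> * P m b < \<epsilon> / 2"
    using \<epsilon> P_nonneg[OF b(1), of m] by (auto simp: \<delta>_def field_simps add_pos_nonneg)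
  have ev: "eventually (\<lambda>h. \<forall>j\<in>{..D\<^sup>2}. cmod (exp (\<i> * (h - h0) * of_nat j) - 1) < \<delta> \<and>
      cmod (exp (\<i> * (h0 - h) * of_nat j) - 1) < \<delta>) (at h0)"
  proof (rule eventually_ball_finite[OF finite_atMost], intro ballI eventually_conj)
    fix j
    have "((\<lambda>h. cmod (exp (\<i> * (h - h0) * of_nat j) - 1)) \<longlongrightarrow> cmod (exp (\<i> * (h0 - h0) * of_nat j) - 1)) (at h0)"
      by (intro tendsto_intros)
    then show "eventually (\<lambda>h. cmod (exp (\<i> * (h - h0) * of_nat j) - 1) < \<delta>) (at h0)"
      using \<delta>(1) by (intro order_tendstoD(2)) auto
    have "((\<lambda>h. cmod (exp (\<i> * (h0 - h) * of_nat j) - 1)) \<longlongrightarrow> cmod (exp (\<i> * (h0 - h0) * of_nat j) - 1)) (at h0)"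
      by (intro tendsto_intros)
    then show "eventually (\<lambda>h. cmod (exp (\<i> * (h0 - h) * of_nat j) - 1) < \<delta>) (at h0)"
      using \<delta>(1) by (intro order_tendstoD(2)) auto
  qed
  show "eventually (\<lambda>h. dist (nrm m h a) (nrm m h0 a) < \<epsilon>) (at h0)"
    using ev
  proof eventually_elim
    case (elim h)
    have "nrm m h b \<le> nrm m h0 b + 2 * \<delta> * P m b"
      by (rule nrm_perturb[OF b]) (use elim in \<open>auto intro: less_imp_le\<close>)
    moreover have "nrm m h0 b \<le> nrm m h b + 2 * \<delta> * P m b"
      by (rule nrm_perturb[OF b]) (use elim in \<open>auto intro: less_imp_le\<close>)
    moreover have "\<bar>nrm m h a - nrm m h b\<bar> \<le> P m (\<lambda>w. a w - b w)" "\<bar>nrm m h0 a - nrm m h0 b\<bar> \<le> P m (\<lambda>w. a w - b w)"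
      using nrm_diff_le a b by auto
    ultimately show ?case
      using D \<delta> unfolding b_def[symmetric] dist_real_def by linarith
  qed
qed

text \<open>The usual argument for quotients of complete spaces: the increments of a rapidly
  converging subsequence are lifted to representatives with summable norms. The \<open>j\<close>-th
  lift is chosen with respect to \<open>P j\<close>, so that one choice serves all
  seminorms.\<close>

lemma nrm_complete:
  fixes \<sigma> :: "nat \<Rightarrow> 'n list \<Rightarrow> complex"
  assumes \<sigma>: "\<And>k. \<sigma> k \<in> series"
    and cauchy: "\<And>m \<epsilon>. 0 < \<epsilon> \<Longrightarrow> \<exists>M. \<forall>k\<ge>M. \<forall>l\<ge>M. nrm m h (\<lambda>w. \<sigma> k w - \<sigma> l w) < \<epsilon>"
  shows "\<exists>a\<in>series. \<forall>m. (\<lambda>k. nrm m h (\<lambda>w. \<sigma> k w - a w)) \<longlonglongrightarrow> 0"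
proof -
  have "\<forall>j. \<exists>M. \<forall>k\<ge>M. \<forall>l\<ge>M. nrm j h (\<lambda>w. \<sigma> k w - \<sigma> l w) < (1 / 2) ^ j"
    by (intro allI cauchy) simp
  then obtain M where M: "\<And>j k l. k \<ge> M j \<Longrightarrow> l \<ge> M j \<Longrightarrow> nrm j h (\<lambda>w. \<sigma> k w - \<sigma> l w) < (1 / 2) ^ j"
    by metis
  \<comment> \<open>Partial sums of the thresholds: both \<open>r j\<close> and
    \<open>r (Suc j)\<close> lie beyond the threshold \<open>M j\<close>.\<close>
  define r where "r j = (\<Sum>i\<le>j. M i)" for j
  have r: "M j \<le> r j" "M j \<le> r (Suc j)" for j
    using member_le_sum[of j "{..j}" M] by (auto simp: r_def)
  have "\<exists>f. f \<in> series \<and> nc h f = nc h (\<lambda>w. \<sigma> (r (Suc j)) w - \<sigma> (r j) w) \<and> P j f < (1 / 2) ^ j" for j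
    using nrm_lessE[OF series_diff[OF \<sigma> \<sigma>] M[OF r(2) r(1)]] by metis
  then obtain f where f: "\<And>j. f j \<in> series" "\<And>j. nc h (f j) = nc h (\<lambda>w. \<sigma> (r (Suc j)) w - \<sigma> (r j) w)"
    "\<And>j. P j (f j) < (1 / 2) ^ j"
    by metis
  \<comment> \<open>From index \<open>m\<close> on, \<open>P m\<close> is dominated by
    \<open>P j\<close> and therefore by the geometric series.\<close>
  have sm: "summable (\<lambda>j. P m (f j))" for m
  proof (rule summable_comparison_test'[of "\<lambda>j. (1 / 2) ^ j" m])
    show "norm (P m (f j)) \<le> (1 / 2) ^ j" if "m \<le> j" for j
      using P_mono'[OF f(1) that, of j] f(3)[of j] P_nonneg[OF f(1), of m j] by simp
  qed (simp add: summable_geometric)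
  define a where "a = (\<lambda>w. \<sigma> (r 0) w + (suminf (\<lambda>j. f j w)))"
  have a: "a \<in> series"
    unfolding a_def by (intro series_add \<sigma> series_suminf f sm)
  have tail: "nrm m h (\<lambda>w. \<sigma> (r n) w - a w) \<le> (suminf (\<lambda>j. P m (f (j + n))))" for m n
  proof -
    have shift: "(\<lambda>w. suminf (\<lambda>j. f (j + n) w)) \<in> series" "P m (\<lambda>w. suminf (\<lambda>j. f (j + n) w)) \<le> (suminf (\<lambda>j. P m (f (j + n))))"
      using series_suminf[of "\<lambda>j. f (j + n)"] f(1) sm by (auto simp: summable_iff_shift[of "\<lambda>j. P _ (f j)"])
    have tel: "nc h (\<lambda>w. \<Sum>j<n. f j w) K = nc h (\<lambda>w. \<sigma> (r n) w - \<sigma> (r 0) w) K" for K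
    proof (induction n)
      case (Suc n)
      then show ?case
        using fun_cong[OF f(2)[of n], of K] by (simp add: normal_coeff_add normal_coeff_diff)
    qed simp
    have split: "(suminf (\<lambda>j. f j w)) = (suminf (\<lambda>j. f (j + n) w)) + (\<Sum>j<n. f j w)" for w
      by (rule suminf_split_initial_segment) (rule series_suminf(3)[OF f(1) sm])
    \<comment> \<open>Modulo the kernel the lifted increments telescope, so the negated tail of the
      series represents \<open>\<sigma> (r n) - a\<close>.\<close>
    have "nc h (\<lambda>w. - 1 * (suminf (\<lambda>j. f (j + n) w))) K = nc h (\<lambda>w. \<sigma> (r n) w - a w) K" for K
      using tel[of K] unfolding a_def split normal_coeff_smult
      by (simp add: normal_coeff_add normal_coeff_diff)
    then have "nrm m h (\<lambda>w. \<sigma> (r n) w - a w) \<le> P m (\<lambda>w. - 1 * (suminf (\<lambda>j. f (j + n) w)))"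
      by (intro nrm_le series_smult shift) auto
    also have "\<dots> = P m (\<lambda>w. suminf (\<lambda>j. f (j + n) w))"
      by (subst P_smult[OF shift(1)]) simp
    finally show ?thesis
      using shift(2) by simp
  qed
  have "(\<lambda>k. nrm m h (\<lambda>w. \<sigma> k w - a w)) \<longlonglongrightarrow> 0" for m
  proof (rule LIMSEQ_I)
    fix \<epsilon> :: real assume \<epsilon>: "0 < \<epsilon>"
    have "(\<lambda>n. suminf (\<lambda>j. P m (f (j + n)))) \<longlonglongrightarrow> 0"
      by (rule suminf_exist_split2[OF sm])
    then have "eventually (\<lambda>n. (suminf (\<lambda>j. P m (f (j + n)))) < \<epsilon> / 2) sequentially"
      using \<epsilon> by (intro order_tendstoD(2)) auto
    moreover have "eventually (\<lambda>n. (1 / 2 :: real) ^ n < \<epsilon> / 2) sequentially"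
      using \<epsilon> by (intro order_tendstoD(2)[OF LIMSEQ_realpow_zero]) auto
    ultimately have "eventually (\<lambda>n. m \<le> n \<and> (suminf (\<lambda>j. P m (f (j + n)))) < \<epsilon> / 2 \<and> (1 / 2 :: real) ^ n < \<epsilon> / 2) sequentially"
      using eventually_ge_at_top[of m] by eventually_elim auto
    then obtain n where n: "m \<le> n" "(suminf (\<lambda>j. P m (f (j + n)))) < \<epsilon> / 2" "(1 / 2 :: real) ^ n < \<epsilon> / 2"
      by (auto simp: eventually_sequentially)
    have "norm (nrm m h (\<lambda>w. \<sigma> k w - a w) - 0) < \<epsilon>" if "r n \<le> k" for k
    proof -
      have s: "(\<lambda>w. \<sigma> k w - \<sigma> (r n) w) \<in> series" "(\<lambda>w. \<sigma> (r n) w - a w) \<in> series" "(\<lambda>w. \<sigma> k w - a w) \<in> series"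
        using \<sigma> a by (auto intro: series_diff)
      have "nrm m h (\<lambda>w. \<sigma> k w - \<sigma> (r n) w) \<le> nrm n h (\<lambda>w. \<sigma> k w - \<sigma> (r n) w)"
        using s n by (intro nrm_mono')
      also have "\<dots> < (1 / 2) ^ n"
        using that r(1)[of n] by (intro M) auto
      finally have "nrm m h (\<lambda>w. \<sigma> k w - \<sigma> (r n) w) < \<epsilon> / 2"
        using n by simp
      moreover have "nrm m h (\<lambda>w. \<sigma> k w - a w) \<le> nrm m h (\<lambda>w. \<sigma> k w - \<sigma> (r n) w) + nrm m h (\<lambda>w. \<sigma> (r n) w - a w)"
        using nrm_add[OF s(1,2), of m h] by simp
      ultimately show ?thesis
        using tail[of m n] n nrm_nonneg[OF s(3), of m h] by simp
    qed
    then show "\<exists>no. \<forall>k\<ge>no. norm (nrm m h (\<lambda>w. \<sigma> k w - a w) - 0) < \<epsilon>"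
      by blast
  qed
  then show ?thesis
    using a by blast
qed

end

section \<open>Holomorphic families of free power series\<close>

text \<open>\<open>\<N>\<close> is the family of seminorms in the definition of \<open>F\<close>,
  indexed by all admissible radii. The two domination assumptions make the sequence \<open>P\<close>
  equivalent to it, so that only \<open>P\<close> is used afterwards.\<close>

locale graded_family = graded_norm p
  for p :: "nat \<Rightarrow> nat \<Rightarrow> ('n::{finite, linorder} list \<Rightarrow> complex) \<Rightarrow> real" +
  fixes F :: "('n list \<Rightarrow> complex) set" and \<N> :: "(('n list \<Rightarrow> complex) \<Rightarrow> real) set"
  assumes F_eq: "F = series"
    and \<N>_lower: "\<exists>N\<in>\<N>. \<forall>a\<in>series. P m a \<le> N a"
    and \<N>_upper: "N \<in> \<N> \<Longrightarrow> \<exists>m. \<forall>a\<in>series. 0 \<le> N a \<and> N a \<le> P m a"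
begin

abbreviation "H \<equiv> holomorphic_series F \<N>"
abbreviation "HA \<equiv> hol_algebra F \<N>"
abbreviation "HT \<equiv> hol_topology F \<N>"

definition has_deriv_at :: "(complex \<Rightarrow> 'n list \<Rightarrow> complex) \<Rightarrow> complex \<Rightarrow> ('n list \<Rightarrow> complex) \<Rightarrow> bool" where
  "has_deriv_at f z g \<longleftrightarrow> g \<in> series \<and>
     (\<forall>m. ((\<lambda>w. P m (\<lambda>\<alpha>. (f w \<alpha> - f z \<alpha>) / (w - z) - g \<alpha>)) \<longlongrightarrow> 0) (at z))"

lemma series_divide: "a \<in> series \<Longrightarrow> (\<lambda>w. a w / c) \<in> series"
  using series_smult[of a "1 / c"] by simp

text \<open>The two families of seminorms dominate each other, so the difference quotients converge
  for one exactly if they do for the other.\<close>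

lemma mem_H_iff: "f \<in> H \<longleftrightarrow> (\<forall>z. f z \<in> series) \<and> (\<forall>z. \<exists>g. has_deriv_at f z g)"
proof -
  have "(\<forall>N\<in>\<N>. ((\<lambda>w. N (\<lambda>\<alpha>. (f w \<alpha> - f z \<alpha>) / (w - z) - g \<alpha>)) \<longlongrightarrow> 0) (at z)) \<longleftrightarrow>
    (\<forall>m. ((\<lambda>w. P m (\<lambda>\<alpha>. (f w \<alpha> - f z \<alpha>) / (w - z) - g \<alpha>)) \<longlongrightarrow> 0) (at z))"
    if f: "\<And>z. f z \<in> series" and g: "g \<in> series" for z g
  proof -
    have q: "(\<lambda>\<alpha>. (f w \<alpha> - f z \<alpha>) / (w - z) - g \<alpha>) \<in> series" for w
      by (intro series_diff series_divide f g)
    show ?thesis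
    proof (intro iffI ballI allI)
      fix m assume *: "\<forall>N\<in>\<N>. ((\<lambda>w. N (\<lambda>\<alpha>. (f w \<alpha> - f z \<alpha>) / (w - z) - g \<alpha>)) \<longlongrightarrow> 0) (at z)"
      obtain N where N: "N \<in> \<N>" "\<forall>a\<in>series. P m a \<le> N a"
        using \<N>_lower by blast
      show "((\<lambda>w. P m (\<lambda>\<alpha>. (f w \<alpha> - f z \<alpha>) / (w - z) - g \<alpha>)) \<longlongrightarrow> 0) (at z)"
        by (rule Lim_null_comparison[OF _ bspec[OF * N(1)]]) (auto simp: N(2) q P_nonneg)
    next
      fix N assume *: "\<forall>m. ((\<lambda>w. P m (\<lambda>\<alpha>. (f w \<alpha> - f z \<alpha>) / (w - z) - g \<alpha>)) \<longlongrightarrow> 0) (at z)"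
        and N: "N \<in> \<N>"
      obtain m where m: "\<forall>a\<in>series. 0 \<le> N a \<and> N a \<le> P m a"
        using \<N>_upper[OF N] by blast
      show "((\<lambda>w. N (\<lambda>\<alpha>. (f w \<alpha> - f z \<alpha>) / (w - z) - g \<alpha>)) \<longlongrightarrow> 0) (at z)"
        by (rule Lim_null_comparison[OF _ spec[OF *, of m]]) (auto simp: m q)
    qed
  qed
  then show ?thesis
    unfolding holomorphic_series_def has_deriv_at_def F_eq by blast
qed

lemma H_series: "f \<in> H \<Longrightarrow> f z \<in> series"
  by (simp add: mem_H_iff)

lemma H_derivE:
  assumes "f \<in> H"
  obtains g where "has_deriv_at f z g"
  using assms by (auto simp: mem_H_iff)

lemma has_deriv_at_continuous:
  assumes f: "\<And>z. f z \<in> series" and g: "has_deriv_at f z g"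
  shows "((\<lambda>w. P m (\<lambda>\<alpha>. f w \<alpha> - f z \<alpha>)) \<longlongrightarrow> 0) (at z)"
proof (rule Lim_null_comparison)
  let ?q = "\<lambda>w \<alpha>. (f w \<alpha> - f z \<alpha>) / (w - z) - g \<alpha>"
  have g': "g \<in> series" and lim: "((\<lambda>w. P m (?q w)) \<longlongrightarrow> 0) (at z)"
    using g by (auto simp: has_deriv_at_def)
  have q: "?q w \<in> series" for w
    by (intro series_diff series_divide f g')
  show "eventually (\<lambda>w. norm (P m (\<lambda>\<alpha>. f w \<alpha> - f z \<alpha>)) \<le> cmod (w - z) * (P m (?q w) + P m g)) (at z)"
    unfolding eventually_at_filter
  proof (intro always_eventually allI impI)
    fix w assume "w \<noteq> z"
    then have "(\<lambda>\<alpha>. f w \<alpha> - f z \<alpha>) = (\<lambda>\<alpha>. (w - z) * (?q w \<alpha> + g \<alpha>))"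
      by auto
    then have "P m (\<lambda>\<alpha>. f w \<alpha> - f z \<alpha>) = cmod (w - z) * P m (\<lambda>\<alpha>. ?q w \<alpha> + g \<alpha>)"
      using P_smult[OF series_add[OF q g'], of m "w - z" w] by simp
    also have "\<dots> \<le> cmod (w - z) * (P m (?q w) + P m g)"
      by (intro mult_left_mono P_add q g') simp
    finally show "norm (P m (\<lambda>\<alpha>. f w \<alpha> - f z \<alpha>)) \<le> cmod (w - z) * (P m (?q w) + P m g)"
      using P_nonneg[OF series_diff[OF f f]] by simp
  qed
  have "((\<lambda>w. cmod (w - z) * (P m (?q w) + P m g)) \<longlongrightarrow> cmod (z - z) * (0 + P m g)) (at z)"
    by (intro tendsto_intros lim)
  then show "((\<lambda>w. cmod (w - z) * (P m (?q w) + P m g)) \<longlongrightarrow> 0) (at z)"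
    by simp
qed

lemma H_continuous: "f \<in> H \<Longrightarrow> ((\<lambda>w. P m (\<lambda>\<alpha>. f w \<alpha> - f z \<alpha>)) \<longlongrightarrow> 0) (at z)"
  by (rule H_derivE[of f z]) (auto intro: has_deriv_at_continuous H_series)

lemma H_P_tendsto:
  assumes f: "f \<in> H"
  shows "((\<lambda>w. P m (f w)) \<longlongrightarrow> P m (f z)) (at z)"
proof (rule LIM_zero_cancel, rule Lim_null_comparison[OF _ H_continuous[OF f, of m z]], rule always_eventually, rule allI)
  fix w
  show "norm (P m (f w) - P m (f z)) \<le> P m (\<lambda>\<alpha>. f w \<alpha> - f z \<alpha>)"
    using P_add[OF H_series[OF f] series_diff[OF H_series[OF f] H_series[OF f]], of m z w z]
      P_add[OF H_series[OF f] series_diff[OF H_series[OF f] H_series[OF f]], of m w z w]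
      P_diff_swap[OF H_series[OF f] H_series[OF f], of m w z] by simp
qed

lemma H_bounded:
  assumes f: "f \<in> H" and K: "compact K"
  shows "\<exists>C. \<forall>z\<in>K. P m (f z) \<le> C"
proof (cases "K = {}")
  case False
  have "continuous_on K (\<lambda>z. P m (f z))"
    using H_P_tendsto[OF f] by (auto simp: continuous_on_def intro: tendsto_within_subset)
  then show ?thesis
    using continuous_attains_sup[OF K False] by blast
qed auto

lemma H_add:
  assumes "f \<in> H" "g \<in> H"
  shows "(\<lambda>z \<alpha>. f z \<alpha> + g z \<alpha>) \<in> H"
  unfolding mem_H_iff
proof (intro conjI allI)
  fix z
  obtain f' g' where f': "has_deriv_at f z f'" and g': "has_deriv_at g z g'"
    using assms H_derivE by metis
  show "\<exists>h. has_deriv_at (\<lambda>z \<alpha>. f z \<alpha> + g z \<alpha>) z h"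
    unfolding has_deriv_at_def
  proof (intro exI conjI allI)
    show fg: "(\<lambda>\<alpha>. f' \<alpha> + g' \<alpha>) \<in> series"
      using f' g' by (auto simp: has_deriv_at_def series_add)
    fix m
    let ?q = "\<lambda>w \<alpha>. (f w \<alpha> - f z \<alpha>) / (w - z) - f' \<alpha>" and ?r = "\<lambda>w \<alpha>. (g w \<alpha> - g z \<alpha>) / (w - z) - g' \<alpha>"
    have f's: "f' \<in> series" and g's: "g' \<in> series"
      using f' g' by (auto simp: has_deriv_at_def)
    have s: "?q w \<in> series" "?r w \<in> series" for w
      by (intro series_diff series_divide H_series[OF assms(1)] H_series[OF assms(2)] f's g's)+
    have eq: "(\<lambda>\<alpha>. (f w \<alpha> + g w \<alpha> - (f z \<alpha> + g z \<alpha>)) / (w - z) - (f' \<alpha> + g' \<alpha>)) = (\<lambda>\<alpha>. ?q w \<alpha> + ?r w \<alpha>)" for w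
      by (simp add: diff_divide_distrib add_divide_distrib algebra_simps)
    have lim: "((\<lambda>w. P m (?q w) + P m (?r w)) \<longlongrightarrow> 0 + 0) (at z)"
      using f' g' by (intro tendsto_add) (auto simp: has_deriv_at_def)
    show "((\<lambda>w. P m (\<lambda>\<alpha>. (f w \<alpha> + g w \<alpha> - (f z \<alpha> + g z \<alpha>)) / (w - z) - (f' \<alpha> + g' \<alpha>))) \<longlongrightarrow> 0) (at z)"
      unfolding eq
    proof (rule Lim_null_comparison, rule always_eventually, rule allI)
      fix w
      show "norm (P m (\<lambda>\<alpha>. ?q w \<alpha> + ?r w \<alpha>)) \<le> P m (?q w) + P m (?r w)"
        using P_add[OF s(1)[of w] s(2)[of w], of m] P_nonneg[OF series_add[OF s(1)[of w] s(2)[of w]], of m]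
        by simp
      show "((\<lambda>w. P m (?q w) + P m (?r w)) \<longlongrightarrow> 0) (at z)"
        using lim by simp
    qed
  qed
qed (use assms in \<open>auto intro: series_add H_series\<close>)

lemma H_scalar:
  assumes \<phi>: "\<phi> holomorphic_on UNIV" and a: "a \<in> series"
  shows "(\<lambda>z \<alpha>. \<phi> z * a \<alpha>) \<in> H"
  unfolding mem_H_iff
proof (intro conjI allI)
  fix z
  obtain \<phi>' where \<phi>': "(\<phi> has_field_derivative \<phi>') (at z)"
    using \<phi> by (auto simp: holomorphic_on_def field_differentiable_def)
  show "\<exists>g. has_deriv_at (\<lambda>z \<alpha>. \<phi> z * a \<alpha>) z g"
    unfolding has_deriv_at_def
  proof (intro exI conjI allI)
    show "(\<lambda>\<alpha>. \<phi>' * a \<alpha>) \<in> series"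
      by (rule series_smult[OF a])
    fix m
    have eq: "P m (\<lambda>\<alpha>. (\<phi> w * a \<alpha> - \<phi> z * a \<alpha>) / (w - z) - \<phi>' * a \<alpha>) =
        cmod ((\<phi> w - \<phi> z) / (w - z) - \<phi>') * P m a" for w
      by (subst P_smult[OF a, symmetric]) (simp add: algebra_simps diff_divide_distrib)
    have "((\<lambda>w. (\<phi> w - \<phi> z) / (w - z)) \<longlongrightarrow> \<phi>') (at z)"
      using \<phi>' by (simp add: has_field_derivative_iff)
    then have "((\<lambda>w. cmod ((\<phi> w - \<phi> z) / (w - z) - \<phi>') * P m a) \<longlongrightarrow> cmod (\<phi>' - \<phi>') * P m a) (at z)"
      by (intro tendsto_intros)
    then show "((\<lambda>w. P m (\<lambda>\<alpha>. (\<phi> w * a \<alpha> - \<phi> z * a \<alpha>) / (w - z) - \<phi>' * a \<alpha>)) \<longlongrightarrow> 0) (at z)"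
      unfolding eq by simp
  qed
qed (rule series_smult[OF a])

lemma H_const: "a \<in> series \<Longrightarrow> (\<lambda>z. a) \<in> H"
  using H_scalar[of "\<lambda>_. 1" a] by simp

lemma H_mult:
  assumes "f \<in> H" "g \<in> H"
  shows "(\<lambda>z. word_mult (f z) (g z)) \<in> H"
  unfolding mem_H_iff
proof (intro conjI allI)
  note fs = H_series[OF assms(1)] and gs = H_series[OF assms(2)]
  show "word_mult (f z) (g z) \<in> series" for z
    by (rule series_mult[OF fs gs])
  fix z
  obtain f' g' where f': "has_deriv_at f z f'" and g': "has_deriv_at g z g'"
    using assms H_derivE by metis
  then have f's: "f' \<in> series" and g's: "g' \<in> series"
    by (auto simp: has_deriv_at_def)
  let ?h = "\<lambda>\<alpha>. word_mult f' (g z) \<alpha> + word_mult (f z) g' \<alpha>"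
  show "\<exists>h. has_deriv_at (\<lambda>z. word_mult (f z) (g z)) z h"
    unfolding has_deriv_at_def
  proof (intro exI conjI allI)
    show hs: "?h \<in> series"
      by (intro series_add series_mult fs gs f's g's)
    fix m
    let ?q = "\<lambda>w \<alpha>. (f w \<alpha> - f z \<alpha>) / (w - z) - f' \<alpha>" and ?r = "\<lambda>w \<alpha>. (g w \<alpha> - g z \<alpha>) / (w - z) - g' \<alpha>"
    have qs: "?q w \<in> series" and rs: "?r w \<in> series" and ds: "(\<lambda>\<alpha>. g w \<alpha> - g z \<alpha>) \<in> series" for w
      using f's g's fs gs by (auto intro!: series_diff series_divide)
    \<comment> \<open>The product rule. The first term involves \<open>f'\<close> times
      \<open>g w\<close>, and the middle term replaces \<open>g w\<close> by
      \<open>g z\<close>.\<close>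
    have eq: "(\<lambda>\<alpha>. (word_mult (f w) (g w) \<alpha> - word_mult (f z) (g z) \<alpha>) / (w - z) - ?h \<alpha>) =
        (\<lambda>\<alpha>. word_mult (?q w) (g w) \<alpha> + (word_mult f' (\<lambda>\<alpha>. g w \<alpha> - g z \<alpha>) \<alpha> + word_mult (f z) (?r w) \<alpha>))" for w
    proof
      fix \<alpha>
      have 1: "word_mult (?q w) (g w) \<alpha> =
          (word_mult (f w) (g w) \<alpha> - word_mult (f z) (g w) \<alpha>) / (w - z) - word_mult f' (g w) \<alpha>"
        by (simp add: word_mult_def diff_divide_distrib left_diff_distrib sum_subtractf sum_divide_distrib)
      have 2: "word_mult (f z) (?r w) \<alpha> =
          (word_mult (f z) (g w) \<alpha> - word_mult (f z) (g z) \<alpha>) / (w - z) - word_mult (f z) g' \<alpha>"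
        by (simp add: word_mult_def diff_divide_distrib right_diff_distrib sum_subtractf sum_divide_distrib)
      show "(word_mult (f w) (g w) \<alpha> - word_mult (f z) (g z) \<alpha>) / (w - z) - ?h \<alpha> =
        word_mult (?q w) (g w) \<alpha> + (word_mult f' (\<lambda>\<alpha>. g w \<alpha> - g z \<alpha>) \<alpha> + word_mult (f z) (?r w) \<alpha>)"
        unfolding 1 2 word_mult_diff_right[of f'] by (simp add: diff_divide_distrib)
    qed
    let ?B = "\<lambda>w. P m (?q w) * P m (g w) + (P m f' * P m (\<lambda>\<alpha>. g w \<alpha> - g z \<alpha>) + P m (f z) * P m (?r w))"
    have lim: "(?B \<longlongrightarrow> 0 * P m (g z) + (P m f' * 0 + P m (f z) * 0)) (at z)"
      using f' g' by (intro tendsto_intros H_P_tendsto H_continuous assms) (auto simp: has_deriv_at_def)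
    show "((\<lambda>w. P m (\<lambda>\<alpha>. (word_mult (f w) (g w) \<alpha> - word_mult (f z) (g z) \<alpha>) / (w - z) - ?h \<alpha>)) \<longlongrightarrow> 0) (at z)"
      unfolding eq
    proof (rule Lim_null_comparison, rule always_eventually, rule allI)
      fix w
      let ?x = "word_mult (?q w) (g w)" and ?y = "word_mult f' (\<lambda>\<alpha>. g w \<alpha> - g z \<alpha>)" and ?v = "word_mult (f z) (?r w)"
      have xs: "?x \<in> series" and ys: "?y \<in> series" and vs: "?v \<in> series"
        by (intro series_mult qs rs ds gs fs f's)+
      have "P m (\<lambda>\<alpha>. ?x \<alpha> + (?y \<alpha> + ?v \<alpha>)) \<le> P m ?x + P m (\<lambda>\<alpha>. ?y \<alpha> + ?v \<alpha>)"
        by (rule P_add[OF xs series_add[OF ys vs]])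
      also have "\<dots> \<le> P m ?x + (P m ?y + P m ?v)"
        by (intro add_left_mono P_add ys vs)
      also have "\<dots> \<le> ?B w"
        by (intro add_mono P_mult qs rs ds gs fs f's)
      finally show "norm (P m (\<lambda>\<alpha>. ?x \<alpha> + (?y \<alpha> + ?v \<alpha>))) \<le> ?B w"
        using P_nonneg[OF series_add[OF xs series_add[OF ys vs]], of m] by simp
      show "(?B \<longlongrightarrow> 0) (at z)"
        using lim by simp
    qed
  qed
qed

lemma H_smult: "f \<in> H \<Longrightarrow> (\<lambda>z \<alpha>. c * f z \<alpha>) \<in> H"
  using H_mult[OF H_const[OF series_smult[OF series_basis, of c "[]"]], of f]
  by (simp add: word_mult_smult_left)

lemma H_diff: "f \<in> H \<Longrightarrow> g \<in> H \<Longrightarrow> (\<lambda>z \<alpha>. f z \<alpha> - g z \<alpha>) \<in> H"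
  using H_add[OF _ H_smult, of f g "-1"] by simp

lemma H_scalar_mult:
  assumes "\<phi> holomorphic_on UNIV" "f \<in> H"
  shows "(\<lambda>z \<alpha>. \<phi> z * f z \<alpha>) \<in> H"
  using H_mult[OF H_scalar[OF assms(1) series_basis, of "[]"] assms(2)]
  by (simp add: word_mult_smult_left)

text \<open>Coordinates are continuous functionals. The lemma makes truncations holomorphic and the
  sorted coefficients of \<open>f z\<close> entire functions of \<open>z\<close>.\<close>

lemma H_coeff_holomorphic:
  assumes f: "f \<in> H"
  shows "(\<lambda>z. f z \<alpha>) holomorphic_on UNIV"
  unfolding holomorphic_on_def field_differentiable_def
proof
  fix z
  obtain g where g: "has_deriv_at f z g"
    using f by (rule H_derivE)
  let ?q = "\<lambda>w \<alpha>. (f w \<alpha> - f z \<alpha>) / (w - z) - g \<alpha>" and ?c = "p 0 (length \<alpha>) (word_basis \<alpha>)"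
  have qs: "?q w \<in> series" for w
    using g H_series[OF f] by (auto simp: has_deriv_at_def intro!: series_diff series_divide)
  have "((\<lambda>w. P 0 (?q w) / ?c) \<longlongrightarrow> 0 / ?c) (at z)"
    using g p_basis[of 0 \<alpha>] by (intro tendsto_intros) (auto simp: has_deriv_at_def)
  then have lim: "((\<lambda>w. P 0 (?q w) / ?c) \<longlongrightarrow> 0) (at z)"
    by simp
  have le: "cmod (?q w \<alpha>) \<le> P 0 (?q w) / ?c" for w
    using P_coeff[OF qs[of w], of \<alpha> 0] p_basis[of 0 \<alpha>] by (subst pos_le_divide_eq)
  have "((\<lambda>w. ?q w \<alpha>) \<longlongrightarrow> 0) (at z)"
    by (rule Lim_null_comparison[OF always_eventually lim]) (rule allI, rule le)
  then have "((\<lambda>w. (f w \<alpha> - f z \<alpha>) / (w - z)) \<longlongrightarrow> g \<alpha>) (at z)"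
    by (rule LIM_zero_cancel)
  then show "\<exists>f'. ((\<lambda>z. f z \<alpha>) has_field_derivative f') (at z within UNIV)"
    by (auto simp: has_field_derivative_iff)
qed

lemma H_finsum:
  assumes "finite S" "\<And>i. i \<in> S \<Longrightarrow> f i \<in> H"
  shows "(\<lambda>z \<alpha>. \<Sum>i\<in>S. f i z \<alpha>) \<in> H"
  using assms by (induction S rule: finite_induct) (auto intro: H_add H_const series_zero)

lemma trunc_eq_sum: "trunc D a = (\<lambda>u. \<Sum>w | length w \<le> D. a w * word_basis w u)"
proof
  fix u
  have "(\<Sum>w | length w \<le> D. a w * word_basis w u) = (\<Sum>w | length w \<le> D. if w = u then a u else 0)"
    by (intro sum.cong) (auto simp: word_basis_def)
  then show "trunc D a u = (\<Sum>w | length w \<le> D. a w * word_basis w u)"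
    using finite_length_le by (simp add: trunc_def)
qed

lemma H_trunc: "f \<in> H \<Longrightarrow> (\<lambda>z. trunc D (f z)) \<in> H"
  unfolding trunc_eq_sum
  by (intro H_finsum finite_length_le H_scalar H_coeff_holomorphic series_basis)

text \<open>Forming the tail does not increase \<open>P m\<close>, so an estimate at
  \<open>z\<close> extends to a neighbourhood of \<open>z\<close> with a loss independent of the
  degree of truncation. Compactness then yields a common degree.\<close>

lemma H_tail_uniform:
  assumes f: "f \<in> H" and K: "compact K" and \<epsilon>: "0 < \<epsilon>"
  shows "\<exists>D. \<forall>z\<in>K. P m (\<lambda>\<alpha>. f z \<alpha> - trunc D (f z) \<alpha>) < \<epsilon>"
proof -
  note fs = H_series[OF f]
  \<comment> \<open>All degrees beyond \<open>D\<close> are included, so that the maximum over a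
    finite cover works for each of its members.\<close>
  have "\<exists>D r. 0 < r \<and> (\<forall>w\<in>ball z r. \<forall>D'\<ge>D. P m (\<lambda>\<alpha>. f w \<alpha> - trunc D' (f w) \<alpha>) < \<epsilon>)" for z
  proof -
    have "eventually (\<lambda>D. P m (\<lambda>\<alpha>. f z \<alpha> - trunc D (f z) \<alpha>) < \<epsilon> / 2) sequentially"
      using \<epsilon> by (intro order_tendstoD(2)[OF P_tail_tendsto[OF fs]]) auto
    then obtain D where D: "\<And>D'. D' \<ge> D \<Longrightarrow> P m (\<lambda>\<alpha>. f z \<alpha> - trunc D' (f z) \<alpha>) < \<epsilon> / 2"
      by (auto simp: eventually_sequentially)
    have "eventually (\<lambda>w. P m (\<lambda>\<alpha>. f w \<alpha> - f z \<alpha>) < \<epsilon> / 2) (at z)"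
      using \<epsilon> by (intro order_tendstoD(2)[OF H_continuous[OF f]]) auto
    then obtain r where r: "0 < r" "\<And>w. w \<noteq> z \<Longrightarrow> dist w z < r \<Longrightarrow> P m (\<lambda>\<alpha>. f w \<alpha> - f z \<alpha>) < \<epsilon> / 2"
      by (auto simp: eventually_at)
    have "P m (\<lambda>\<alpha>. f w \<alpha> - trunc D' (f w) \<alpha>) < \<epsilon>" if "w \<in> ball z r" "D \<le> D'" for w D'
    proof -
      have near: "P m (\<lambda>\<alpha>. f w \<alpha> - f z \<alpha>) < \<epsilon> / 2"
        using r(2)[of w] that \<epsilon> by (cases "w = z") (auto simp: dist_commute)
      have "(\<lambda>\<alpha>. f w \<alpha> - trunc D' (f w) \<alpha>) =
          (\<lambda>\<alpha>. (f z \<alpha> - trunc D' (f z) \<alpha>) + ((f w \<alpha> - f z \<alpha>) - trunc D' (\<lambda>\<alpha>. f w \<alpha> - f z \<alpha>) \<alpha>))"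
        by (simp add: trunc_diff)
      then have "P m (\<lambda>\<alpha>. f w \<alpha> - trunc D' (f w) \<alpha>) \<le> P m (\<lambda>\<alpha>. f z \<alpha> - trunc D' (f z) \<alpha>) +
          P m (\<lambda>\<alpha>. (f w \<alpha> - f z \<alpha>) - trunc D' (\<lambda>\<alpha>. f w \<alpha> - f z \<alpha>) \<alpha>)"
        using P_add[OF series_diff[OF fs series_trunc] series_diff[OF series_diff[OF fs fs] series_trunc],
            of m z D' "f z" w z D' "\<lambda>\<alpha>. f w \<alpha> - f z \<alpha>"] by simp
      then show ?thesis
        using D[OF that(2)] near P_tail_le[OF series_diff[OF fs fs], of m w z D'] by linarith
    qed
    then show ?thesis
      using r(1) by blast
  qed
  then obtain D r where r: "\<And>z. 0 < r z" "\<And>z w D'. w \<in> ball z (r z) \<Longrightarrow> D z \<le> D' \<Longrightarrow> P m (\<lambda>\<alpha>. f w \<alpha> - trunc D' (f w) \<alpha>) < \<epsilon>"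
    by metis
  have "K \<subseteq> (\<Union>z\<in>K. ball z (r z))"
    using r(1) by auto
  then obtain C where C: "C \<subseteq> K" "finite C" "K \<subseteq> (\<Union>z\<in>C. ball z (r z))"
    using compactE_image[OF K, of K "\<lambda>z. ball z (r z)"] by auto
  show ?thesis
  proof (intro exI ballI)
    fix w assume "w \<in> K"
    then obtain z where z: "z \<in> C" "w \<in> ball z (r z)"
      using C(3) by blast
    then show "P m (\<lambda>\<alpha>. f w \<alpha> - trunc (Max (D ` C)) (f w) \<alpha>) < \<epsilon>"
      using C(2) by (intro r(2)) auto
  qed
qed

section \<open>The algebra of entire families and the closed ideal of the relations\<close>

lemma HA_simps [simp]:
  "carrier HA = H" "f \<otimes>\<^bsub>HA\<^esub> g = (\<lambda>z. word_mult (f z) (g z))" "\<one>\<^bsub>HA\<^esub> = (\<lambda>z. word_basis [])"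
  "\<zero>\<^bsub>HA\<^esub> = (\<lambda>z \<alpha>. 0)" "f \<oplus>\<^bsub>HA\<^esub> g = (\<lambda>z \<alpha>. f z \<alpha> + g z \<alpha>)" "c \<odot>\<^bsub>HA\<^esub> f = (\<lambda>z \<alpha>. c * f z \<alpha>)"
  by (auto simp: hol_algebra_def)

lemma calg_HA: "calg HA"
proof -
  have "ring HA"
  proof (rule ringI)
    show "abelian_group HA"
    proof (rule abelian_groupI)
      fix f assume "f \<in> carrier HA"
      then show "\<exists>g\<in>carrier HA. g \<oplus>\<^bsub>HA\<^esub> f = \<zero>\<^bsub>HA\<^esub>"
        using H_smult[of f "-1"] by (intro bexI[of _ "\<lambda>z \<alpha>. -1 * f z \<alpha>"]) auto
    qed (auto simp: H_add H_const series_zero algebra_simps)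
    show "Group.monoid HA"
      by (rule monoidI) (auto simp: word_mult_assoc H_mult H_const series_basis)
  qed (auto simp: word_mult_add_left word_mult_add_right)
  then interpret ring HA .
  show ?thesis
    by unfold_locales
      (auto simp: H_smult algebra_simps word_mult_smult_left word_mult_smult_right)
qed

lemma HA_minus: "f \<in> H \<Longrightarrow> g \<in> H \<Longrightarrow> f \<ominus>\<^bsub>HA\<^esub> g = (\<lambda>z \<alpha>. f z \<alpha> - g z \<alpha>)"
  using calg.minus_conv_smult[OF calg_HA, of f g] by simp

text \<open>The discs of integer radius exhaust the plane and the seminorms \<open>P k\<close>
  increase, so a single index \<open>k\<close> can serve as radius and as seminorm, and finite sets
  of conditions reduce to one.\<close>

lemma openin_HT:
  "openin HT S \<longleftrightarrow> S \<subseteq> H \<and> (\<forall>f\<in>S. \<exists>k. \<exists>\<epsilon>>0. \<forall>g\<in>H.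
     (\<forall>z\<in>cball 0 (real k). P k (\<lambda>\<alpha>. g z \<alpha> - f z \<alpha>) < \<epsilon>) \<longrightarrow> g \<in> S)"
  unfolding hol_topology_def openin_seminorm_topology HA_simps(1)
proof (intro conj_cong refl iffI ballI)
  let ?sn = "{\<lambda>f. SUP z\<in>K. N (f z) |K N. compact K \<and> K \<noteq> {} \<and> N \<in> \<N>}"
  assume S: "S \<subseteq> H"
  {
    fix f assume f: "f \<in> S" and *: "\<forall>f\<in>S. \<exists>\<F> \<epsilon>. finite \<F> \<and> \<F> \<subseteq> ?sn \<and> 0 < \<epsilon> \<and>
        {g \<in> H. \<forall>N\<in>\<F>. N (g \<ominus>\<^bsub>HA\<^esub> f) < \<epsilon>} \<subseteq> S"
    obtain \<F> \<epsilon> where \<F>: "finite \<F>" "\<F> \<subseteq> ?sn" "0 < \<epsilon>" "{g \<in> H. \<forall>N\<in>\<F>. N (g \<ominus>\<^bsub>HA\<^esub> f) < \<epsilon>} \<subseteq> S"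
      by (rule exE[OF bspec[OF * f]], erule exE, elim conjE) blast
    \<comment> \<open>Stated with \<open>\<epsilon> / 2\<close> and a weak inequality because a
      supremum of values below \<open>\<epsilon>\<close> may be equal to
      \<open>\<epsilon>\<close>.\<close>
    have "\<exists>k. \<forall>g\<in>H. (\<forall>z\<in>cball 0 (real k). P k (g z) \<le> \<epsilon> / 2) \<longrightarrow> M g \<le> \<epsilon> / 2" if MF: "M \<in> \<F>" for M
    proof -
      obtain K N where KN: "M = (\<lambda>f. SUP z\<in>K. N (f z))" "compact K" "K \<noteq> {}" "N \<in> \<N>"
        using subsetD[OF \<F>(2) MF] by auto
      obtain m where m: "\<forall>a\<in>series. 0 \<le> N a \<and> N a \<le> P m a"
        using \<N>_upper KN(4) by blast
      obtain B where B: "\<forall>z\<in>K. cmod z \<le> B"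
        using compact_imp_bounded[OF KN(2)] bounded_iff by blast
      obtain k where k: "max B (real m) \<le> real k"
        using real_arch_simple by blast
      show ?thesis
      proof (intro exI ballI impI)
        fix g assume g: "g \<in> H" "\<forall>z\<in>cball 0 (real k). P k (g z) \<le> \<epsilon> / 2"
        show "M g \<le> \<epsilon> / 2"
          unfolding KN(1)
        proof (rule cSUP_least[OF KN(3)])
          fix z assume "z \<in> K"
          then have "P k (g z) \<le> \<epsilon> / 2"
            using g(2) B k by force
          moreover have "N (g z) \<le> P m (g z)" "P m (g z) \<le> P k (g z)"
            using m k H_series[OF g(1), of z] by (auto intro: P_mono')
          ultimately show "N (g z) \<le> \<epsilon> / 2"
            by linarith
        qed
      qed
    qed
    then obtain k where k: "\<And>M g. M \<in> \<F> \<Longrightarrow> g \<in> H \<Longrightarrow> \<forall>z\<in>cball 0 (real (k M)). P (k M) (g z) \<le> \<epsilon> / 2 \<Longrightarrow> M g \<le> \<epsilon> / 2"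
      by metis
    define k0 where "k0 = (\<Sum>M\<in>\<F>. k M)"
    have k0: "k M \<le> k0" if "M \<in> \<F>" for M
      using member_le_sum[of M \<F> k] \<F>(1) that by (simp add: k0_def)
    show "\<exists>k. \<exists>\<epsilon>>0. \<forall>g\<in>H. (\<forall>z\<in>cball 0 (real k). P k (\<lambda>\<alpha>. g z \<alpha> - f z \<alpha>) < \<epsilon>) \<longrightarrow> g \<in> S"
    proof (intro exI conjI ballI impI)
      show "0 < \<epsilon> / 2"
        using \<F> by simp
      fix g assume g: "g \<in> H" "\<forall>z\<in>cball 0 (real k0). P k0 (\<lambda>\<alpha>. g z \<alpha> - f z \<alpha>) < \<epsilon> / 2"
      have fH: "f \<in> H"
        using f S by blast
      have "M (g \<ominus>\<^bsub>HA\<^esub> f) \<le> \<epsilon> / 2" if "M \<in> \<F>" for M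
        unfolding HA_minus[OF g(1) fH]
      proof (rule k[OF that H_diff[OF g(1) fH]], intro ballI)
        fix z assume "z \<in> cball (0 :: complex) (real (k M))"
        then have "z \<in> cball 0 (real k0)"
          using k0[OF that] by (auto intro: order_trans)
        then have "P k0 (\<lambda>\<alpha>. g z \<alpha> - f z \<alpha>) < \<epsilon> / 2"
          using g(2) by blast
        then show "P (k M) (\<lambda>\<alpha>. g z \<alpha> - f z \<alpha>) \<le> \<epsilon> / 2"
          using P_mono'[OF H_series[OF H_diff[OF g(1) fH]] k0[OF that], of z] by simp
      qed
      then show "g \<in> S"
        using \<F>(3,4) g(1) by force
    qed
  }
  {
    fix f assume f: "f \<in> S" and *: "\<forall>f\<in>S. \<exists>k. \<exists>\<epsilon>>0. \<forall>g\<in>H.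
        (\<forall>z\<in>cball 0 (real k). P k (\<lambda>\<alpha>. g z \<alpha> - f z \<alpha>) < \<epsilon>) \<longrightarrow> g \<in> S"
    obtain k \<epsilon> where k: "0 < \<epsilon>" "\<forall>g\<in>H. (\<forall>z\<in>cball 0 (real k). P k (\<lambda>\<alpha>. g z \<alpha> - f z \<alpha>) < \<epsilon>) \<longrightarrow> g \<in> S"
      by (rule exE[OF bspec[OF * f]], erule exE, elim conjE) blast
    obtain N where N: "N \<in> \<N>" "\<forall>a\<in>series. P k a \<le> N a"
      using \<N>_lower by blast
    obtain m where m: "\<forall>a\<in>series. 0 \<le> N a \<and> N a \<le> P m a"
      using \<N>_upper N(1) by blast
    let ?M = "\<lambda>f. SUP z\<in>cball (0 :: complex) (real k). N (f z)"
    show "\<exists>\<F> \<epsilon>. finite \<F> \<and> \<F> \<subseteq> ?sn \<and> 0 < \<epsilon> \<and> {g \<in> H. \<forall>N\<in>\<F>. N (g \<ominus>\<^bsub>HA\<^esub> f) < \<epsilon>} \<subseteq> S"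
    proof (intro exI conjI subsetI)
      show "finite {?M}" "0 < \<epsilon>"
        using k by auto
      show "M \<in> ?sn" if "M \<in> {?M}" for M
        using that N(1) by (intro CollectI exI[of _ "cball 0 (real k)"] exI[of _ N] conjI compact_cball) auto
      fix g assume g: "g \<in> {g \<in> H. \<forall>N\<in>{?M}. N (g \<ominus>\<^bsub>HA\<^esub> f) < \<epsilon>}"
      have fH: "f \<in> H"
        using f S by blast
      let ?d = "\<lambda>z \<alpha>. g z \<alpha> - f z \<alpha>"
      have d: "?d \<in> H" "?M ?d < \<epsilon>"
        using g fH H_diff[of g f] HA_minus[of g f] by auto
      obtain C where C: "\<forall>z\<in>cball 0 (real k). P m (?d z) \<le> C"
        using H_bounded[OF d(1) compact_cball] by blast
      have "P k (?d z) < \<epsilon>" if "z \<in> cball 0 (real k)" for z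
      proof -
        have "bdd_above ((\<lambda>z. N (?d z)) ` cball 0 (real k))"
        proof (rule bdd_aboveI2)
          fix z assume "z \<in> cball (0 :: complex) (real k)"
          then have "P m (?d z) \<le> C"
            using C by blast
          moreover have "N (?d z) \<le> P m (?d z)"
            using m H_series[OF d(1), of z] by blast
          ultimately show "N (?d z) \<le> C"
            by linarith
        qed
        then have "N (?d z) \<le> ?M ?d"
          using that by (rule cSUP_upper[rotated])
        moreover have "P k (?d z) \<le> N (?d z)"
          using N(2) H_series[OF d(1), of z] by blast
        ultimately show ?thesis
          using d(2) by linarith
      qed
      then show "g \<in> S"
        using k(2) g by blast
    qed
  }
qed

lemma topspace_HT [simp]: "topspace HT = H"
  using topspace_seminorm_topology[of HA] by (simp add: hol_topology_def)

text \<open>\<open>L h\<close> will turn out to be the kernel of the map from \<open>HA\<close> to the fiber \<open>R\<^sub>h\<close>.\<close>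

definition L :: "complex \<Rightarrow> (complex \<Rightarrow> 'n list \<Rightarrow> complex) set" where
  "L h = {f \<in> H. nc h (f h) = (\<lambda>M. 0)}"

lemma L_ideal: "ideal (L h) HA"
proof (rule calg.idealI[OF calg_HA])
  fix f g assume fg: "f \<in> L h" "g \<in> carrier HA"
  then have "nc h (f h) = nc h (\<lambda>w. 0)"
    by (auto simp: L_def)
  then show "g \<otimes>\<^bsub>HA\<^esub> f \<in> L h" "f \<otimes>\<^bsub>HA\<^esub> g \<in> L h"
    using fg nc_mult_cong[of h "g h" "g h" "f h" "\<lambda>w. 0"] nc_mult_cong[of h "f h" "\<lambda>w. 0" "g h" "g h"]
    by (auto simp: L_def H_mult)
qed (auto simp: L_def H_const series_zero H_add normal_coeff_add fun_eq_iff)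

text \<open>Evaluation at \<open>h\<close> followed by a sorted coefficient is a continuous
  functional on the entire families, so a nonzero coefficient remains nonzero under small
  changes.\<close>

lemma L_closed: "closedin HT (L h)"
  unfolding closedin_def topspace_HT
proof (intro conjI)
  show "openin HT (H - L h)"
    unfolding openin_HT
  proof (intro conjI ballI)
    fix f assume "f \<in> H - L h"
    then obtain M where f: "f \<in> H" "nc h (f h) M \<noteq> 0"
      by (auto simp: L_def)
    obtain k where k: "cmod h \<le> real k"
      using real_arch_simple by blast
    obtain C where C: "0 \<le> C" "\<forall>a\<in>series. cmod (nc h a M) \<le> C * P k a"
      using nc_bound by blast
    let ?\<epsilon> = "cmod (nc h (f h) M) / (C + 1)"
    show "\<exists>k. \<exists>\<epsilon>>0. \<forall>g\<in>H. (\<forall>z\<in>cball 0 (real k). P k (\<lambda>\<alpha>. g z \<alpha> - f z \<alpha>) < \<epsilon>) \<longrightarrow> g \<in> H - L h"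
    proof (intro exI conjI ballI impI)
      show "0 < ?\<epsilon>"
        using f C by simp
      fix g assume g: "g \<in> H" "\<forall>z\<in>cball 0 (real k). P k (\<lambda>\<alpha>. g z \<alpha> - f z \<alpha>) < ?\<epsilon>"
      then have "P k (\<lambda>\<alpha>. g h \<alpha> - f h \<alpha>) < ?\<epsilon>"
        using k by simp
      then have "P k (\<lambda>\<alpha>. g h \<alpha> - f h \<alpha>) * (C + 1) < cmod (nc h (f h) M)"
        using C by (simp add: pos_less_divide_eq)
      moreover have "cmod (nc h (\<lambda>\<alpha>. g h \<alpha> - f h \<alpha>) M) \<le> C * P k (\<lambda>\<alpha>. g h \<alpha> - f h \<alpha>)"
        using C series_diff[OF H_series[OF g(1)] H_series[OF f(1)]] by blast
      moreover have "0 \<le> P k (\<lambda>\<alpha>. g h \<alpha> - f h \<alpha>)"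
        by (intro P_nonneg series_diff H_series g f)
      ultimately have "cmod (nc h (g h) M - nc h (f h) M) < cmod (nc h (f h) M)"
        by (simp add: normal_coeff_diff algebra_simps)
      then have "nc h (g h) M \<noteq> 0"
        by auto
      then show "g \<in> H - L h"
        using g by (auto simp: L_def)
    qed
  qed auto
qed (auto simp: L_def)

definition relations :: "(complex \<Rightarrow> 'n list \<Rightarrow> complex) set" where
  "relations = {\<lambda>z. q_relation (exp (\<i> * z)) j k |j k. j < k}"

lemma H_relation: "(\<lambda>z. q_relation (exp (\<i> * z)) j k) \<in> H"
  unfolding q_relation_def
  by (intro H_diff H_const H_scalar series_basis holomorphic_intros)

lemma relations_L: "relations \<subseteq> L h"
proof
  fix f assume "f \<in> relations"
  then obtain j k where jk: "j < k" "f = (\<lambda>z. q_relation (exp (\<i> * z)) j k)"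
    by (auto simp: relations_def)
  have "nc h (f h) = (\<lambda>M. 0)"
    unfolding jk(2) by (rule ext) (simp add: normal_coeff_q_relation jk(1))
  then show "f \<in> L h"
    unfolding L_def jk(2) using H_relation by simp
qed

abbreviation "DI \<equiv> def_ideal F \<N>"

lemma DI_eq: "DI = \<Inter>{I. ideal I HA \<and> closedin HT I \<and> relations \<subseteq> I}"
  by (simp add: def_ideal_def closed_ideal_generated_def relations_def)

text \<open>The upper bound for the ideal: \<open>L h\<close> is one of the closed ideals whose
  intersection is \<open>DI\<close>. It makes sorted coefficients at \<open>h\<close> well defined
  on \<open>R\<close> (\<open>cl_eq_nc\<close>).\<close>

lemma DI_sub_L: "DI \<subseteq> L h"
  unfolding DI_eq using L_ideal L_closed relations_L by blast

lemma relations_DI: "relations \<subseteq> DI"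
  unfolding DI_eq by blast

lemma DI_ideal: "ideal DI HA"
  unfolding DI_eq
proof (rule ring.i_Intersect[OF calg.axioms(1)[OF calg_HA]])
  show "{I. ideal I HA \<and> closedin HT I \<and> relations \<subseteq> I} \<noteq> {}"
    using L_ideal L_closed relations_L by blast
qed auto

end

section \<open>The deformation algebra and its fibers\<close>

context graded_family
begin

abbreviation "R \<equiv> def_algebra F \<N>"
abbreviation "DT \<equiv> def_topology F \<N>"
abbreviation "cl \<equiv> def_class F \<N>"

lemma calg_ideal_DI: "calg_ideal DI HA"
  by (rule calg_ideal.intro[OF calg_HA DI_ideal])

lemma calg_R: "calg R"
  unfolding def_algebra_def by (rule calg_ideal.calg_quot[OF calg_ideal_DI])

lemma carrier_R: "carrier R = cl ` H"
  unfolding def_algebra_def def_class_def[abs_def] calg_ideal.carrier_quot[OF calg_ideal_DI] by simp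

lemma cl_closed [simp]: "f \<in> H \<Longrightarrow> cl f \<in> carrier R"
  by (simp add: carrier_R)

lemma cl_add: "f \<in> H \<Longrightarrow> g \<in> H \<Longrightarrow> cl f \<oplus>\<^bsub>R\<^esub> cl g = cl (\<lambda>z \<alpha>. f z \<alpha> + g z \<alpha>)"
  using calg_ideal.add_quot[OF calg_ideal_DI, of f g] by (simp add: def_algebra_def def_class_def)

lemma cl_mult: "f \<in> H \<Longrightarrow> g \<in> H \<Longrightarrow> cl f \<otimes>\<^bsub>R\<^esub> cl g = cl (\<lambda>z. word_mult (f z) (g z))"
  using calg_ideal.mult_quot[OF calg_ideal_DI, of f g] by (simp add: def_algebra_def def_class_def)

lemma cl_smult: "f \<in> H \<Longrightarrow> c \<odot>\<^bsub>R\<^esub> cl f = cl (\<lambda>z \<alpha>. c * f z \<alpha>)"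
  using calg_ideal.smult_quot[OF calg_ideal_DI, of f c] by (simp add: def_algebra_def def_class_def)

lemma cl_one: "\<one>\<^bsub>R\<^esub> = cl (\<lambda>z. word_basis [])"
  using calg_ideal.one_quot[OF calg_ideal_DI] by (simp add: def_algebra_def def_class_def)

lemma cl_zero: "\<zero>\<^bsub>R\<^esub> = cl (\<lambda>z \<alpha>. 0)"
  using calg_ideal.zero_quot[OF calg_ideal_DI] by (simp add: def_algebra_def def_class_def)

lemma cl_minus: "f \<in> H \<Longrightarrow> g \<in> H \<Longrightarrow> cl f \<ominus>\<^bsub>R\<^esub> cl g = cl (\<lambda>z \<alpha>. f z \<alpha> - g z \<alpha>)"
  using calg_ideal.minus_quot[OF calg_ideal_DI, of f g] by (simp add: def_algebra_def def_class_def HA_minus)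

lemma cl_eq_iff: "f \<in> H \<Longrightarrow> g \<in> H \<Longrightarrow> cl f = cl g \<longleftrightarrow> (\<lambda>z \<alpha>. f z \<alpha> - g z \<alpha>) \<in> DI"
  using calg_ideal.cls_eq_iff[OF calg_ideal_DI, of f g] by (simp add: def_class_def HA_minus)

lemma cl_eq_nc: "f \<in> H \<Longrightarrow> g \<in> H \<Longrightarrow> cl f = cl g \<Longrightarrow> nc h (f h) = nc h (g h)"
  using DI_sub_L[of h] by (auto simp: cl_eq_iff L_def normal_coeff_diff fun_eq_iff)

lemma openin_DT: "openin DT S \<longleftrightarrow> S \<subseteq> carrier R \<and> openin HT {f \<in> H. cl f \<in> S}"
proof -
  let ?P = "\<lambda>S. S \<subseteq> carrier R \<and> openin HT {f \<in> H. cl f \<in> S}"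
  have "istopology ?P"
    unfolding istopology_def
  proof (rule conjI; intro allI impI)
    fix S T assume "?P S" "?P T"
    moreover have "{f \<in> H. cl f \<in> S \<inter> T} = {f \<in> H. cl f \<in> S} \<inter> {f \<in> H. cl f \<in> T}"
      by auto
    ultimately show "?P (S \<inter> T)"
      by auto
  next
    fix \<K> assume K: "\<forall>S\<in>\<K>. ?P S"
    have "{f \<in> H. cl f \<in> \<Union>\<K>} = (\<Union>S\<in>\<K>. {f \<in> H. cl f \<in> S})"
      by auto
    then show "?P (\<Union>\<K>)"
      using K by auto
  qed
  then show ?thesis
    unfolding def_topology_def quot_topology_def def_algebra_def[symmetric] def_class_def[symmetric] HA_simps(1)
    by (simp add: topology_inverse')
qed

lemma topspace_DT: "topspace DT = carrier R"
proof
  have "{f \<in> H. cl f \<in> carrier R} = H"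
    by auto
  then have "openin DT (carrier R)"
    unfolding openin_DT using openin_topspace[of HT] by simp
  then show "carrier R \<subseteq> topspace DT"
    by (rule openin_subset)
  show "topspace DT \<subseteq> carrier R"
    using openin_topspace[of DT] unfolding openin_DT by simp
qed

text \<open>\<open>L h\<close> contains \<open>DI\<close> and is therefore a union of full classes.
  Because of this, closedness passes from \<open>L h\<close> to its image in
  \<open>R\<close>.\<close>

lemma cl_L_iff: "f \<in> H \<Longrightarrow> cl f \<in> cl ` L h \<longleftrightarrow> f \<in> L h"
proof
  assume f: "f \<in> H" and "cl f \<in> cl ` L h"
  then obtain g where g: "g \<in> L h" "cl f = cl g"
    by auto
  then have "nc h (f h) = nc h (g h)"
    using f by (intro cl_eq_nc) (auto simp: L_def)
  then show "f \<in> L h"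
    using f g by (simp add: L_def)
qed auto

lemma cl_L_ideal: "ideal (cl ` L h) R"
proof (rule calg.idealI[OF calg_R])
  have LH: "L h \<subseteq> H"
    by (auto simp: L_def)
  interpret ideal "L h" HA
    by (rule L_ideal)
  show "cl ` L h \<subseteq> carrier R"
    using LH by auto
  have "(\<lambda>z \<alpha>. 0) \<in> L h"
    by (simp add: L_def H_const series_zero fun_eq_iff)
  then show "\<zero>\<^bsub>R\<^esub> \<in> cl ` L h"
    unfolding cl_zero by (rule imageI)
  fix x y assume x: "x \<in> cl ` L h"
  then obtain f where f: "f \<in> L h" "f \<in> H" "x = cl f"
    using LH by auto
  {
    assume "y \<in> cl ` L h"
    then obtain g where g: "g \<in> L h" "g \<in> H" "y = cl g"
      using LH by auto
    then have "(\<lambda>z \<alpha>. f z \<alpha> + g z \<alpha>) \<in> L h"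
      using f by (simp add: L_def H_add normal_coeff_add fun_eq_iff)
    then show "x \<oplus>\<^bsub>R\<^esub> y \<in> cl ` L h"
      using f g by (simp add: cl_add)
  }
  {
    assume "y \<in> carrier R"
    then obtain g where g: "g \<in> H" "y = cl g"
      by (auto simp: carrier_R)
    then show "y \<otimes>\<^bsub>R\<^esub> x \<in> cl ` L h" "x \<otimes>\<^bsub>R\<^esub> y \<in> cl ` L h"
      using f I_l_closed[of f g] I_r_closed[of f g] by (simp_all add: cl_mult)
  }
qed

lemma cl_L_closed: "closedin DT (cl ` L h)"
  unfolding closedin_def topspace_DT
proof (intro conjI)
  show "cl ` L h \<subseteq> carrier R"
    by (auto simp: L_def)
  have "{f \<in> H. cl f \<in> carrier R - cl ` L h} = H - L h"
    using cl_L_iff by auto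
  then show "openin DT (carrier R - cl ` L h)"
    unfolding openin_DT using L_closed[of h] by (simp add: closedin_def)
qed

section \<open>The kernel of the map onto a fiber\<close>

definition generators :: "complex \<Rightarrow> (complex \<Rightarrow> 'n list \<Rightarrow> complex) set set" where
  "generators h = {cl (\<lambda>z \<alpha>. \<phi> z * g z \<alpha>) |\<phi> g. \<phi> holomorphic_on UNIV \<and> \<phi> h = 0 \<and> g \<in> carrier HA}"

abbreviation "J \<equiv> def_max_ideal F \<N>"

lemma J_def': "J h = DT closure_of generate (add_monoid R) (generators h)"
  by (simp add: def_max_ideal_def generators_def)

text \<open>The image of \<open>L h\<close> is a closed additive subgroup containing the products
  with functions that vanish at \<open>h\<close>.\<close>

lemma J_sub: "J h \<subseteq> cl ` L h"
  unfolding J_def'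
proof (rule closure_of_minimal[OF _ cl_L_closed])
  interpret R: calg R
    by (rule calg_R)
  have "generators h \<subseteq> cl ` L h"
    by (auto simp: generators_def L_def H_scalar_mult normal_coeff_smult fun_eq_iff intro!: imageI)
  moreover have "subgroup (cl ` L h) (add_monoid R)"
    using additive_subgroup.a_subgroup[OF ideal.axioms(1)[OF cl_L_ideal]] .
  ultimately show "generate (add_monoid R) (generators h) \<subseteq> cl ` L h"
    by (rule R.add.generate_subgroup_incl)
qed

lemma H_word: "\<phi> holomorphic_on UNIV \<Longrightarrow> (\<lambda>z \<alpha>. \<phi> z * word_basis w \<alpha>) \<in> H"
  by (rule H_scalar[OF _ series_basis])

text \<open>Normal ordering carried out in \<open>R\<close> for all parameters simultaneously: the
  exchange factor is the class of an entire function in place of a number.\<close>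

lemma cl_basis_sort:
  "cl (\<lambda>z. word_basis w) = cl (\<lambda>z \<alpha>. exp (- (\<i> * z * of_nat (inversions w))) * word_basis (sort w) \<alpha>)"
proof -
  interpret R: calg R
    by (rule calg_R)
  \<comment> \<open>\<open>e m\<close> is the scalar function
    \<open>exp (- (\<i> * z * of_nat m))\<close> as an element of the algebra, supported on the
    empty word.\<close>
  define e where "e = (\<lambda>m z \<alpha>. exp (- (\<i> * z * of_nat m)) * word_basis ([] :: 'n list) \<alpha>)"
  have e: "e m \<in> H" for m
    unfolding e_def by (intro H_word holomorphic_intros)
  have emult: "word_mult (e m z) a = (\<lambda>\<alpha>. exp (- (\<i> * z * of_nat m)) * a \<alpha>)"
    "word_mult a (e m z) = (\<lambda>\<alpha>. exp (- (\<i> * z * of_nat m)) * a \<alpha>)" for m z a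
    by (simp_all add: e_def word_mult_smult_left word_mult_smult_right)
  have b: "(\<lambda>z. word_basis u) \<in> H" for u :: "'n list"
    by (rule H_const[OF series_basis])
  have pow: "cl (e 1) [^]\<^bsub>R\<^esub> m = cl (e m)" for m :: nat
  proof (induction m)
    case 0
    show ?case
      by (simp add: cl_one e_def)
  next
    case (Suc m)
    have "exp (- (\<i> * z)) * exp (- (\<i> * z * of_nat m)) = exp (- (\<i> * z * of_nat (Suc m)))" for z :: complex
      by (simp add: exp_add[symmetric] algebra_simps)
    then have "(\<lambda>z. word_mult (e m z) (e 1 z)) = e (Suc m)"
      unfolding emult by (simp add: e_def mult.assoc[symmetric])
    then show ?case
      using Suc cl_mult[OF e e, of m 1] by simp
  qed
  have "cl (\<lambda>z. word_basis w) = cl (e 1) [^]\<^bsub>R\<^esub> inversions w \<otimes>\<^bsub>R\<^esub> cl (\<lambda>z. word_basis (sort w))"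
  proof (rule R.normal_ordering[where y = "\<lambda>w. cl (\<lambda>z. word_basis w)"])
    show "cl (\<lambda>z. word_basis (u @ v)) = cl (\<lambda>z. word_basis u) \<otimes>\<^bsub>R\<^esub> cl (\<lambda>z. word_basis v)" for u v :: "'n list"
      by (simp add: cl_mult b word_mult_basis)
    show "cl (e 1) \<otimes>\<^bsub>R\<^esub> cl (\<lambda>z. word_basis u) = cl (\<lambda>z. word_basis u) \<otimes>\<^bsub>R\<^esub> cl (e 1)" for u :: "'n list"
      by (simp add: cl_mult b e emult)
  next
    fix j k :: 'n assume jk: "j < k"
    then have "(\<lambda>z. q_relation (exp (\<i> * z)) j k) \<in> DI"
      using relations_DI by (auto simp: relations_def)
    \<comment> \<open>Multiplying the relation by the invertible function
      \<open>- exp (- (\<i> * z))\<close> brings it into the form needed for sorting.\<close>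
    then have "(\<lambda>z \<alpha>. exp (- (\<i> * z)) * q_relation (exp (\<i> * z)) j k \<alpha>) \<in> DI"
      using ideal.I_l_closed[OF DI_ideal, of _ "e 1"] e[of 1] emult(1)[of 1] by simp
    then have "(\<lambda>z \<alpha>. -1 * (exp (- (\<i> * z)) * q_relation (exp (\<i> * z)) j k \<alpha>)) \<in> DI"
      using calg_ideal.smult_mem[OF calg_ideal_DI, of _ "-1"] by simp
    also have "(\<lambda>z \<alpha>. -1 * (exp (- (\<i> * z)) * q_relation (exp (\<i> * z)) j k \<alpha>)) =
        (\<lambda>z \<alpha>. word_basis [k, j] \<alpha> - exp (- (\<i> * z)) * word_basis [j, k] \<alpha>)"
    proof (intro ext)
      fix z :: complex and \<alpha>
      have "exp (- (\<i> * z)) * exp (\<i> * z) = 1"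
        by (simp add: exp_add[symmetric])
      then have "exp (- (\<i> * z)) * (exp (\<i> * z) * x) = x" for x
        by (simp add: mult.assoc[symmetric])
      then show "-1 * (exp (- (\<i> * z)) * q_relation (exp (\<i> * z)) j k \<alpha>) =
          word_basis [k, j] \<alpha> - exp (- (\<i> * z)) * word_basis [j, k] \<alpha>"
        by (simp add: q_relation_def right_diff_distrib)
    qed
    finally have "cl (\<lambda>z. word_basis [k, j]) = cl (\<lambda>z \<alpha>. exp (- (\<i> * z)) * word_basis [j, k] \<alpha>)"
      by (subst cl_eq_iff) (auto intro!: b H_word holomorphic_intros)
    then show "cl (\<lambda>z. word_basis [k, j]) = cl (e 1) \<otimes>\<^bsub>R\<^esub> cl (\<lambda>z. word_basis [j, k])"
      by (simp add: cl_mult b e emult)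
  qed (auto simp: b e cl_one)
  then show ?thesis
    unfolding pow by (simp add: cl_mult b e emult)
qed

lemma cl_scalar_sort:
  assumes "\<phi> holomorphic_on UNIV"
  shows "cl (\<lambda>z \<alpha>. \<phi> z * word_basis w \<alpha>) =
    cl (\<lambda>z \<alpha>. \<phi> z * exp (- (\<i> * z * of_nat (inversions w))) * word_basis (sort w) \<alpha>)"
proof -
  have s: "(\<lambda>z \<alpha>. \<phi> z * word_basis [] \<alpha>) \<in> H"
    by (rule H_word[OF assms])
  have "cl (\<lambda>z \<alpha>. \<phi> z * word_basis w \<alpha>) = cl (\<lambda>z \<alpha>. \<phi> z * word_basis [] \<alpha>) \<otimes>\<^bsub>R\<^esub> cl (\<lambda>z. word_basis w)"
    by (simp add: cl_mult s H_const series_basis word_mult_smult_left)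
  also have "\<dots> = cl (\<lambda>z \<alpha>. \<phi> z * word_basis [] \<alpha>) \<otimes>\<^bsub>R\<^esub>
      cl (\<lambda>z \<alpha>. exp (- (\<i> * z * of_nat (inversions w))) * word_basis (sort w) \<alpha>)"
    using cl_basis_sort by simp
  also have "\<dots> = cl (\<lambda>z \<alpha>. \<phi> z * exp (- (\<i> * z * of_nat (inversions w))) * word_basis (sort w) \<alpha>)"
    by (subst cl_mult[OF s]) (auto intro!: H_word holomorphic_intros simp: word_mult_smult_left mult.assoc)
  finally show ?thesis .
qed

lemma cl_sum_sort:
  assumes "finite S" "\<And>w. w \<in> S \<Longrightarrow> \<phi> w holomorphic_on UNIV"
  shows "cl (\<lambda>z \<alpha>. \<Sum>w\<in>S. \<phi> w z * word_basis w \<alpha>) =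
    cl (\<lambda>z \<alpha>. \<Sum>w\<in>S. \<phi> w z * exp (- (\<i> * z * of_nat (inversions w))) * word_basis (sort w) \<alpha>)"
  using assms
proof (induction S rule: finite_induct)
  case (insert w S)
  have 1: "(\<lambda>z \<alpha>. \<phi> w z * word_basis w \<alpha>) \<in> H"
    "(\<lambda>z \<alpha>. \<phi> w z * exp (- (\<i> * z * of_nat (inversions w))) * word_basis (sort w) \<alpha>) \<in> H"
    using insert by (auto intro!: H_word holomorphic_intros)
  have 2: "(\<lambda>z \<alpha>. \<Sum>w\<in>S. \<phi> w z * word_basis w \<alpha>) \<in> H"
    "(\<lambda>z \<alpha>. \<Sum>w\<in>S. \<phi> w z * exp (- (\<i> * z * of_nat (inversions w))) * word_basis (sort w) \<alpha>) \<in> H"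
    using insert by (auto intro!: H_finsum H_word holomorphic_intros)
  show ?case
    using insert cl_add[OF 1(1) 2(1)] cl_add[OF 1(2) 2(2)] cl_scalar_sort[of "\<phi> w" w] by simp
qed simp

lemma generate_sum:
  assumes "finite S" "\<And>i. i \<in> S \<Longrightarrow> t i \<in> H" "\<And>i. i \<in> S \<Longrightarrow> cl (t i) \<in> generators h"
  shows "cl (\<lambda>z \<alpha>. \<Sum>i\<in>S. t i z \<alpha>) \<in> generate (add_monoid R) (generators h)"
  using assms
proof (induction S rule: finite_induct)
  case empty
  show ?case
    using generate.one[of "add_monoid R" "generators h"] by (simp add: cl_zero)
next
  case (insert i S)
  have "cl (t i) \<oplus>\<^bsub>R\<^esub> cl (\<lambda>z \<alpha>. \<Sum>i\<in>S. t i z \<alpha>) \<in> generate (add_monoid R) (generators h)"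
    using insert generate.eng[of "cl (t i)" "add_monoid R" "generators h"] by (auto intro: generate.incl)
  then show ?case
    using insert by (simp add: cl_add H_finsum)
qed

text \<open>After sorting, the truncation is a finite sum over sorted words \<open>u\<close> with
  coefficients \<open>nc z (f z) (mset u)\<close>. These are entire in \<open>z\<close> and vanish
  at \<open>h\<close> because \<open>f\<close> is in \<open>L h\<close>, so each summand is one of
  the generators.\<close>

lemma trunc_L_generate:
  assumes f: "f \<in> L h"
  shows "cl (\<lambda>z. trunc D (f z)) \<in> generate (add_monoid R) (generators h)"
proof -
  have fH: "f \<in> H"
    using f by (simp add: L_def)
  let ?W = "{w :: 'n list. length w \<le> D}" and ?T = "{u :: 'n list. sorted u \<and> length u \<le> D}"
  have finT: "finite ?T"
    by (rule finite_subset[OF _ finite_length_le[of D]]) auto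
  define t where "t = (\<lambda>u z \<alpha>. nc z (f z) (mset u) * word_basis (u :: 'n list) \<alpha>)"
  have hol: "(\<lambda>z. nc z (f z) M) holomorphic_on UNIV" for M
    unfolding nc_eq by (intro holomorphic_intros H_coeff_holomorphic fH)
  have tH: "t u \<in> H" for u
    unfolding t_def by (rule H_word[OF hol])
  have tg: "cl (t u) \<in> generators h" for u
  proof -
    have "nc h (f h) (mset u) = 0"
      using f by (simp add: L_def)
    then show ?thesis
      unfolding generators_def t_def using hol[of "mset u"]
      by (intro CollectI exI[of _ "\<lambda>z. nc z (f z) (mset u)"] exI[of _ "\<lambda>z. word_basis u"])
        (simp add: H_const series_basis)
  qed
  have "cl (\<lambda>z. trunc D (f z)) = cl (\<lambda>z \<alpha>. \<Sum>w\<in>?W. f z w * word_basis w \<alpha>)"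
    by (simp add: trunc_eq_sum)
  also have "\<dots> = cl (\<lambda>z \<alpha>. \<Sum>w\<in>?W. f z w * exp (- (\<i> * z * of_nat (inversions w))) * word_basis (sort w) \<alpha>)"
    by (rule cl_sum_sort[OF finite_length_le H_coeff_holomorphic[OF fH]])
  also have "(\<lambda>z \<alpha>. \<Sum>w\<in>?W. f z w * exp (- (\<i> * z * of_nat (inversions w))) * word_basis (sort w) \<alpha>) =
      (\<lambda>z \<alpha>. \<Sum>u\<in>?T. t u z \<alpha>)"
  proof (intro ext)
    fix z \<alpha>
    let ?g = "\<lambda>w. f z w * exp (- (\<i> * z * of_nat (inversions w))) * word_basis (sort w) \<alpha>"
    \<comment> \<open>The words are grouped by their sorted form; the sum over one group is a sorted
      coefficient.\<close>
    have "(\<Sum>w\<in>?W. ?g w) = (\<Sum>u\<in>?T. \<Sum>w\<in>{w \<in> ?W. sort w = u}. ?g w)"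
      by (rule sum.group[symmetric]) (auto simp: finT finite_length_le)
    also have "\<dots> = (\<Sum>u\<in>?T. t u z \<alpha>)"
    proof (rule sum.cong[OF refl])
      fix u assume u: "u \<in> ?T"
      have "{w \<in> ?W. sort w = u} = {w. mset w = mset u}"
      proof (intro equalityI subsetI)
        fix w assume "w \<in> {w. mset w = mset u}"
        then show "w \<in> {w \<in> ?W. sort w = u}"
          using u properties_for_sort[where xs = w and ys = u] mset_eq_length[of w u] by auto
      qed auto
      then have "(\<Sum>w\<in>{w \<in> ?W. sort w = u}. ?g w) = (\<Sum>w | mset w = mset u. ?g w)"
        by simp
      also have "\<dots> = (\<Sum>w | mset w = mset u. f z w * exp (- (\<i> * z * of_nat (inversions w))) * word_basis u \<alpha>)"
      proof (rule sum.cong[OF refl])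
        fix w assume "w \<in> {w. mset w = mset u}"
        then have "sort w = u"
          using u properties_for_sort[where xs = w and ys = u] by auto
        then show "?g w = f z w * exp (- (\<i> * z * of_nat (inversions w))) * word_basis u \<alpha>"
          by simp
      qed
      finally show "(\<Sum>w\<in>{w \<in> ?W. sort w = u}. ?g w) = t u z \<alpha>"
        by (simp add: t_def nc_eq sum_distrib_right)
    qed
    finally show "(\<Sum>w\<in>?W. ?g w) = (\<Sum>u\<in>?T. t u z \<alpha>)" .
  qed
  finally show ?thesis
    using generate_sum[OF finT tH tg, of "\<lambda>u. u"] by simp
qed

text \<open>The reverse inclusion is by approximation: truncations of a member of \<open>L h\<close>
  lie in the algebraic span and, by \<open>H_tail_uniform\<close>, converge to it in the topology of
  the entire families.\<close>

lemma J_eq: "J h = cl ` L h"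
proof
  show "cl ` L h \<subseteq> J h"
  proof
    fix x assume "x \<in> cl ` L h"
    then obtain f where f: "f \<in> L h" "x = cl f"
      by auto
    then have fH: "f \<in> H"
      by (simp add: L_def)
    show "x \<in> J h"
      unfolding J_def' in_closure_of topspace_DT
    proof (intro conjI allI impI)
      show "x \<in> carrier R"
        using f fH by simp
      fix W assume W: "x \<in> W \<and> openin DT W"
      then have "openin HT {f \<in> H. cl f \<in> W}" "f \<in> {f \<in> H. cl f \<in> W}"
        using fH f by (auto simp: openin_DT)
      then obtain k \<epsilon> where k: "0 < \<epsilon>"
        "\<forall>g\<in>H. (\<forall>z\<in>cball 0 (real k). P k (\<lambda>\<alpha>. g z \<alpha> - f z \<alpha>) < \<epsilon>) \<longrightarrow> g \<in> {f \<in> H. cl f \<in> W}"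
        unfolding openin_HT by meson
      obtain D where D: "\<forall>z\<in>cball 0 (real k). P k (\<lambda>\<alpha>. f z \<alpha> - trunc D (f z) \<alpha>) < \<epsilon>"
        using H_tail_uniform[OF fH compact_cball k(1)] by metis
      have "\<forall>z\<in>cball 0 (real k). P k (\<lambda>\<alpha>. trunc D (f z) \<alpha> - f z \<alpha>) < \<epsilon>"
        using D P_diff_swap[OF series_trunc H_series[OF fH]] by simp
      then have "cl (\<lambda>z. trunc D (f z)) \<in> W"
        using k(2) H_trunc[OF fH, of D] by auto
      then show "\<exists>y. y \<in> generate (add_monoid R) (generators h) \<and> y \<in> W"
        using trunc_L_generate[OF f(1)] by auto
    qed
  qed
qed (rule J_sub)

lemma calg_ideal_J: "calg_ideal (J h) R"
  unfolding J_eq by (rule calg_ideal.intro[OF calg_R cl_L_ideal])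

section \<open>Points of the fibers as values of sections\<close>

abbreviation sec :: "(complex \<Rightarrow> 'n list \<Rightarrow> complex) \<Rightarrow> complex \<Rightarrow> 'n def_point" where
  "sec f h \<equiv> def_section F \<N> (cl f) h"

abbreviation "FB h \<equiv> tagged h (def_fiber F \<N> h)"

lemma tagged_simps:
  "carrier (tagged x A) = Pair x ` carrier A" "\<zero>\<^bsub>tagged x A\<^esub> = (x, \<zero>\<^bsub>A\<^esub>)" "\<one>\<^bsub>tagged x A\<^esub> = (x, \<one>\<^bsub>A\<^esub>)"
  "u \<oplus>\<^bsub>tagged x A\<^esub> v = (x, snd u \<oplus>\<^bsub>A\<^esub> snd v)" "u \<otimes>\<^bsub>tagged x A\<^esub> v = (x, snd u \<otimes>\<^bsub>A\<^esub> snd v)"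
  "c \<odot>\<^bsub>tagged x A\<^esub> u = (x, c \<odot>\<^bsub>A\<^esub> snd u)"
  by (simp_all add: tagged_def)

lemma calg_tagged:
  assumes "calg A"
  shows "calg (tagged x A)"
proof -
  interpret A: calg A
    by fact
  have "ring (tagged x A)"
  proof (rule ringI)
    show "abelian_group (tagged x A)"
    proof (rule abelian_groupI)
      fix u assume "u \<in> carrier (tagged x A)"
      then show "\<exists>v\<in>carrier (tagged x A). v \<oplus>\<^bsub>tagged x A\<^esub> u = \<zero>\<^bsub>tagged x A\<^esub>"
        by (intro bexI[of _ "(x, \<ominus>\<^bsub>A\<^esub> snd u)"]) (auto simp: tagged_simps A.l_neg)
    qed (auto simp: tagged_simps A.a_ac)
    show "Group.monoid (tagged x A)"
      by (rule monoidI) (auto simp: tagged_simps A.m_assoc)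
  qed (auto simp: tagged_simps A.l_distr A.r_distr)
  then interpret ring "tagged x A" .
  show ?thesis
    by unfold_locales
      (auto simp: tagged_simps A.smult_l_distr A.smult_r_distr A.smult_assoc A.smult_mult_l A.smult_mult_r)
qed

lemma calg_FB: "calg (FB h)"
  unfolding def_fiber_def by (rule calg_tagged[OF calg_ideal.calg_quot[OF calg_ideal_J]])

lemma carrier_FB: "carrier (FB h) = {sec f h |f. f \<in> H}"
  by (auto simp: tagged_simps def_fiber_def calg_ideal.carrier_quot[OF calg_ideal_J] carrier_R def_section_def)

lemma sec_closed [simp]: "f \<in> H \<Longrightarrow> sec f h \<in> carrier (FB h)"
  by (auto simp: carrier_FB)

lemma fst_sec [simp]: "fst (sec f h) = h"
  by (simp add: def_section_def)

lemma sec_add: "f \<in> H \<Longrightarrow> g \<in> H \<Longrightarrow> sec f h \<oplus>\<^bsub>FB h\<^esub> sec g h = sec (\<lambda>z \<alpha>. f z \<alpha> + g z \<alpha>) h"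
  by (simp add: tagged_simps def_section_def def_fiber_def calg_ideal.add_quot[OF calg_ideal_J] cl_add)

lemma sec_mult: "f \<in> H \<Longrightarrow> g \<in> H \<Longrightarrow> sec f h \<otimes>\<^bsub>FB h\<^esub> sec g h = sec (\<lambda>z. word_mult (f z) (g z)) h"
  by (simp add: tagged_simps def_section_def def_fiber_def calg_ideal.mult_quot[OF calg_ideal_J] cl_mult)

lemma sec_smult: "f \<in> H \<Longrightarrow> c \<odot>\<^bsub>FB h\<^esub> sec f h = sec (\<lambda>z \<alpha>. c * f z \<alpha>) h"
  by (simp add: tagged_simps def_section_def def_fiber_def calg_ideal.smult_quot[OF calg_ideal_J] cl_smult)

lemma sec_zero: "\<zero>\<^bsub>FB h\<^esub> = sec (\<lambda>z \<alpha>. 0) h"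
  by (simp add: tagged_simps def_section_def def_fiber_def calg_ideal.zero_quot[OF calg_ideal_J] cl_zero)

lemma sec_one: "\<one>\<^bsub>FB h\<^esub> = sec (\<lambda>z. word_basis []) h"
  by (simp add: tagged_simps def_section_def def_fiber_def calg_ideal.one_quot[OF calg_ideal_J] cl_one)

lemma sec_minus: "f \<in> H \<Longrightarrow> g \<in> H \<Longrightarrow> sec f h \<ominus>\<^bsub>FB h\<^esub> sec g h = sec (\<lambda>z \<alpha>. f z \<alpha> - g z \<alpha>) h"
  using calg.minus_conv_smult[OF calg_FB, of "sec f h" h "sec g h"] H_smult[of g "-1"]
    sec_add[of f "\<lambda>z \<alpha>. -1 * g z \<alpha>" h] by (simp add: sec_smult)

text \<open>By \<open>J_eq\<close> a point of the fiber depends on the family only through the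
  sorted coefficients of its value at \<open>h\<close>. This presents the fibers as quotients of the
  fixed space \<open>F\<close>.\<close>

lemma sec_eq_iff:
  assumes "f \<in> H" "g \<in> H"
  shows "sec f h = sec g h' \<longleftrightarrow> h = h' \<and> nc h (f h) = nc h (g h)"
proof -
  have "J h +>\<^bsub>R\<^esub> cl f = J h +>\<^bsub>R\<^esub> cl g \<longleftrightarrow> cl f \<ominus>\<^bsub>R\<^esub> cl g \<in> J h"
    using assms by (intro calg_ideal.cls_eq_iff[OF calg_ideal_J]) auto
  also have "\<dots> \<longleftrightarrow> (\<lambda>z \<alpha>. f z \<alpha> - g z \<alpha>) \<in> L h"
    using assms by (simp add: cl_minus J_eq cl_L_iff H_diff)
  also have "\<dots> \<longleftrightarrow> nc h (f h) = nc h (g h)"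
    using assms by (simp add: L_def H_diff normal_coeff_diff fun_eq_iff)
  finally show ?thesis
    by (auto simp: def_section_def)
qed

lemma snd_sec: "f \<in> H \<Longrightarrow> snd (sec f h) = {cl g |g. g \<in> H \<and> nc h (g h) = nc h (f h)}"
proof (intro equalityI subsetI)
  fix u assume f: "f \<in> H" and "u \<in> snd (sec f h)"
  then have "u \<in> carrier R" "J h +>\<^bsub>R\<^esub> u = J h +>\<^bsub>R\<^esub> cl f"
    using calg_ideal.mem_cls_iff[OF calg_ideal_J, of "cl f" u h] by (auto simp: def_section_def)
  moreover from this obtain g where "g \<in> H" "u = cl g"
    by (auto simp: carrier_R)
  ultimately show "u \<in> {cl g |g. g \<in> H \<and> nc h (g h) = nc h (f h)}"
    using sec_eq_iff[of g f h h] f by (auto simp: def_section_def)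
next
  fix u assume f: "f \<in> H" and "u \<in> {cl g |g. g \<in> H \<and> nc h (g h) = nc h (f h)}"
  then obtain g where g: "g \<in> H" "u = cl g" "nc h (g h) = nc h (f h)"
    by auto
  then have "J h +>\<^bsub>R\<^esub> u = J h +>\<^bsub>R\<^esub> cl f"
    using sec_eq_iff[of g f h h] f by (auto simp: def_section_def)
  then show "u \<in> snd (sec f h)"
    using calg_ideal.mem_cls_iff[OF calg_ideal_J, of "cl f" u h] f g by (auto simp: def_section_def)
qed

end

section \<open>The bundle over the complex plane\<close>

context graded_family
begin

text \<open>A continuous seminorm on \<open>R\<close> sees an entire function only on a compact set, so it induces the zero
  seminorm on all fibers outside a larger compact set. Seminorms generating the same uniform structure
  have to be cut off accordingly.\<close>

definition cutoff :: "nat \<Rightarrow> complex \<Rightarrow> real" where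
  "cutoff m h = max 0 (min 1 (real m + 1 - cmod h))"

lemma cutoff_bounds: "0 \<le> cutoff m h" "cutoff m h \<le> 1"
  by (auto simp: cutoff_def)

lemma cutoff_one: "cmod h \<le> real m \<Longrightarrow> cutoff m h = 1"
  by (auto simp: cutoff_def)

lemma cutoff_pos: "0 < cutoff m h \<Longrightarrow> cmod h < real m + 1"
  by (auto simp: cutoff_def)

lemma cutoff_mono: "cutoff m h \<le> cutoff (Suc m) h"
  by (auto simp: cutoff_def)

definition fiber_norm :: "nat \<Rightarrow> 'n def_point \<Rightarrow> real" where
  "fiber_norm m v = cutoff m (fst v) * Inf {P m (f (fst v)) |f. f \<in> H \<and> sec f (fst v) = v}"

text \<open>Constant families are holomorphic, so the infimum over entire families through a point
  agrees with the infimum over series.\<close>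

lemma fiber_norm_sec:
  assumes f: "f \<in> H"
  shows "fiber_norm m (sec f h) = cutoff m h * nrm m h (f h)"
proof -
  have "{P m (g h) |g. g \<in> H \<and> sec g h = sec f h} = {P m b |b. b \<in> series \<and> nc h b = nc h (f h)}"
  proof (intro equalityI subsetI)
    fix x assume "x \<in> {P m b |b. b \<in> series \<and> nc h b = nc h (f h)}"
    then obtain b where b: "b \<in> series" "nc h b = nc h (f h)" "x = P m b"
      by auto
    then show "x \<in> {P m (g h) |g. g \<in> H \<and> sec g h = sec f h}"
      using f H_const[OF b(1)] by (intro CollectI exI[of _ "\<lambda>z. b"]) (simp add: sec_eq_iff)
  next
    fix x assume "x \<in> {P m (g h) |g. g \<in> H \<and> sec g h = sec f h}"
    then obtain g where g: "g \<in> H" "sec g h = sec f h" "x = P m (g h)"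
      by auto
    then show "x \<in> {P m b |b. b \<in> series \<and> nc h b = nc h (f h)}"
      using f H_series[OF g(1), of h] by (intro CollectI exI[of _ "g h"]) (simp add: sec_eq_iff)
  qed
  then show ?thesis
    by (simp add: fiber_norm_def nrm_def)
qed

lemma seminorm_fiber_norm: "seminorm_on (FB h) (fiber_norm m)"
  unfolding seminorm_on_def
proof (intro conjI ballI allI)
  fix u assume "u \<in> carrier (FB h)"
  then obtain f where f: "f \<in> H" "u = sec f h"
    by (auto simp: carrier_FB)
  show "0 \<le> fiber_norm m u"
    using f by (simp add: fiber_norm_sec cutoff_bounds nrm_nonneg H_series)
  show "fiber_norm m (c \<odot>\<^bsub>FB h\<^esub> u) = cmod c * fiber_norm m u" for c
    using f by (simp add: sec_smult fiber_norm_sec H_smult nrm_smult H_series)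
  fix v assume "v \<in> carrier (FB h)"
  then obtain g where g: "g \<in> H" "v = sec g h"
    by (auto simp: carrier_FB)
  show "fiber_norm m (u \<oplus>\<^bsub>FB h\<^esub> v) \<le> fiber_norm m u + fiber_norm m v"
    using f g mult_left_mono[OF nrm_add[OF H_series[OF f(1)] H_series[OF g(1)], of m h h h] cutoff_bounds(1)[of m h]]
    by (simp add: sec_add fiber_norm_sec H_add distrib_left)
qed

text \<open>Two effects are separated: passing from the series \<open>f h0\<close> to
  \<open>f h\<close> changes \<open>nrm\<close> by at most a quantity that does not involve the
  fiber, and moving the fiber with \<open>f h0\<close> fixed is
  \<open>nrm_tendsto_const\<close>.\<close>

lemma fiber_norm_continuous:
  assumes f: "f \<in> H"
  shows "((\<lambda>h. fiber_norm m (sec f h)) \<longlongrightarrow> fiber_norm m (sec f h0)) (at h0)"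
proof -
  have "((\<lambda>h. nrm m h (f h) - nrm m h (f h0)) \<longlongrightarrow> 0) (at h0)"
  proof (rule Lim_null_comparison[OF _ H_continuous[OF f, of m h0]], rule always_eventually, rule allI)
    fix h
    show "norm (nrm m h (f h) - nrm m h (f h0)) \<le> P m (\<lambda>\<alpha>. f h \<alpha> - f h0 \<alpha>)"
      using nrm_diff_le[OF H_series[OF f] H_series[OF f], of m h h h0] by simp
  qed
  from tendsto_add[OF this nrm_tendsto_const[OF H_series[OF f], of m h0 h0]]
  have "((\<lambda>h. nrm m h (f h)) \<longlongrightarrow> nrm m h0 (f h0)) (at h0)"
    by simp
  moreover have "(cutoff m \<longlongrightarrow> cutoff m h0) (at h0)"
    unfolding cutoff_def[abs_def] by (intro tendsto_intros)
  ultimately show ?thesis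
    unfolding fiber_norm_sec[OF f] by (intro tendsto_mult)
qed

lemma fiber_norm_continuous_on: "f \<in> H \<Longrightarrow> continuous_on UNIV (\<lambda>h. fiber_norm m (sec f h))"
  using fiber_norm_continuous by (simp add: continuous_on_def)

lemma fiber_norm_open:
  assumes "f \<in> H"
  shows "open {h. fiber_norm m (sec f h) < c}"
  using open_Collect_less[OF fiber_norm_continuous_on[OF assms] continuous_on_const] .

section \<open>Quotient seminorms of the deformation algebra\<close>

definition quot_norm :: "((complex \<Rightarrow> 'n list \<Rightarrow> complex) set \<Rightarrow> real) \<Rightarrow> 'n def_point \<Rightarrow> real" where
  "quot_norm N v = (INF u\<in>snd v. N u)"

definition good_seminorm :: "((complex \<Rightarrow> 'n list \<Rightarrow> complex) set \<Rightarrow> real) \<Rightarrow> bool" where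
  "good_seminorm N \<longleftrightarrow> seminorm_on R N \<and> continuous_map DT euclideanreal N"

lemma quotient_seminorms_eq: "quotient_seminorms F \<N> = {quot_norm N |N. good_seminorm N}"
  by (simp add: quotient_seminorms_def quot_norm_def[abs_def] good_seminorm_def)

lemma good_seminorm_nonneg: "good_seminorm N \<Longrightarrow> f \<in> H \<Longrightarrow> 0 \<le> N (cl f)"
  by (simp add: good_seminorm_def seminorm_on_def)

lemma good_seminorm_add: "good_seminorm N \<Longrightarrow> f \<in> H \<Longrightarrow> g \<in> H \<Longrightarrow>
    N (cl (\<lambda>z \<alpha>. f z \<alpha> + g z \<alpha>)) \<le> N (cl f) + N (cl g)"
  unfolding good_seminorm_def seminorm_on_def by (simp flip: cl_add)

lemma good_seminorm_smult: "good_seminorm N \<Longrightarrow> f \<in> H \<Longrightarrow> N (cl (\<lambda>z \<alpha>. c * f z \<alpha>)) = cmod c * N (cl f)"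
  unfolding good_seminorm_def seminorm_on_def by (simp flip: cl_smult)

lemma quot_norm_sec: "f \<in> H \<Longrightarrow> quot_norm N (sec f h) = Inf {N (cl g) |g. g \<in> H \<and> nc h (g h) = nc h (f h)}"
  by (simp add: quot_norm_def snd_sec setcompr_eq_image image_image)

lemma quot_norm_le:
  assumes "good_seminorm N" "f \<in> H" "g \<in> H" "nc h (g h) = nc h (f h)"
  shows "quot_norm N (sec f h) \<le> N (cl g)"
  unfolding quot_norm_sec[OF assms(2)]
proof (rule cInf_lower)
  show "bdd_below {N (cl g) |g. g \<in> H \<and> nc h (g h) = nc h (f h)}"
    using assms(1) by (intro bdd_belowI[of _ 0]) (auto simp: good_seminorm_nonneg)
qed (use assms in auto)

lemma quot_norm_greatest:
  assumes "f \<in> H" "\<And>g. g \<in> H \<Longrightarrow> nc h (g h) = nc h (f h) \<Longrightarrow> c \<le> N (cl g)"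
  shows "c \<le> quot_norm N (sec f h)"
  unfolding quot_norm_sec[OF assms(1)] by (rule cInf_greatest) (use assms in auto)

lemma quot_norm_lessE:
  assumes "f \<in> H" "quot_norm N (sec f h) < c"
  obtains g where "g \<in> H" "nc h (g h) = nc h (f h)" "N (cl g) < c"
  using quot_norm_greatest[OF assms(1), of h c N] assms(2) by (meson not_le)

lemma quot_norm_add:
  assumes N: "good_seminorm N" and f: "f \<in> H" and g: "g \<in> H"
  shows "quot_norm N (sec (\<lambda>z \<alpha>. f z \<alpha> + g z \<alpha>) h) \<le> quot_norm N (sec f h) + quot_norm N (sec g h)"
proof -
  let ?s = "quot_norm N (sec (\<lambda>z \<alpha>. f z \<alpha> + g z \<alpha>) h)"
  have "?s - N (cl g') \<le> quot_norm N (sec f h)" if g': "g' \<in> H" "nc h (g' h) = nc h (g h)" for g'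
  proof (rule quot_norm_greatest[OF f])
    fix f' assume f': "f' \<in> H" "nc h (f' h) = nc h (f h)"
    have "?s \<le> N (cl (\<lambda>z \<alpha>. f' z \<alpha> + g' z \<alpha>))"
      using f' g' by (intro quot_norm_le[OF N] H_add f g) (auto simp: normal_coeff_add fun_eq_iff)
    then show "?s - N (cl g') \<le> N (cl f')"
      using good_seminorm_add[OF N f'(1) g'(1)] by simp
  qed
  then have "?s - quot_norm N (sec f h) \<le> quot_norm N (sec g h)"
    by (intro quot_norm_greatest[OF g]) (simp add: algebra_simps)
  then show ?thesis
    by simp
qed

text \<open>Upper semicontinuity of the quotient seminorms along sections: a single representative \<open>e\<close> bounds
  \<open>quot_norm N (sec e h)\<close> for all \<open>h\<close> simultaneously.\<close>

lemma quot_norm_usc: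
  assumes N: "good_seminorm N" and f: "f \<in> H" and less: "quot_norm N (sec f h) < c"
  obtains e where "e \<in> H" "sec e h = sec f h" "\<And>y. quot_norm N (sec e y) < c"
proof -
  obtain e where e: "e \<in> H" "nc h (e h) = nc h (f h)" "N (cl e) < c"
    using f less by (rule quot_norm_lessE)
  have "quot_norm N (sec e y) < c" for y
    using quot_norm_le[OF N e(1) e(1), of y] e(3) by simp
  then show ?thesis
    using that[of e] e f by (simp add: sec_eq_iff)
qed

text \<open>Continuity at \<open>0\<close> provides a disc, an index and a radius
  \<open>\<epsilon>\<close>; homogeneity turns the resulting bound on a neighbourhood into a linear
  one.\<close>

lemma good_seminorm_bound:
  assumes N: "good_seminorm N"
  shows "\<exists>k C. 0 < C \<and> (\<forall>f\<in>H. \<forall>s. (\<forall>z\<in>cball 0 (real k). P k (f z) \<le> s) \<longrightarrow> N (cl f) \<le> C * s)"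
proof -
  have zero: "(\<lambda>z \<alpha>. 0) \<in> H"
    by (rule H_const[OF series_zero])
  have "openin DT {u \<in> topspace DT. N u < 1}"
    using N unfolding good_seminorm_def continuous_map_upper_lower_semicontinuous_lt by blast
  then have "openin HT {f \<in> H. cl f \<in> {u \<in> topspace DT. N u < 1}}"
    by (simp add: openin_DT)
  moreover have "N (cl (\<lambda>z \<alpha>. 0)) = 0"
    using good_seminorm_smult[OF N zero, of 0] by simp
  then have "(\<lambda>z \<alpha>. 0) \<in> {f \<in> H. cl f \<in> {u \<in> topspace DT. N u < 1}}"
    using zero by (simp add: topspace_DT)
  ultimately obtain k \<epsilon> where k: "0 < \<epsilon>"
    "\<forall>g\<in>H. (\<forall>z\<in>cball 0 (real k). P k (\<lambda>\<alpha>. g z \<alpha> - 0) < \<epsilon>) \<longrightarrow> g \<in> {f \<in> H. cl f \<in> {u \<in> topspace DT. N u < 1}}"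
    unfolding openin_HT by meson
  have bound: "N (cl f) \<le> 2 / \<epsilon> * s" if f: "f \<in> H" and s: "\<forall>z\<in>cball 0 (real k). P k (f z) \<le> s" for f s
  proof -
    have "0 \<le> P k (f 0)" "P k (f 0) \<le> s"
      using s P_nonneg[OF H_series[OF f]] by auto
    then have s0: "0 \<le> s"
      by linarith
    have "N (cl f) \<le> 2 / \<epsilon> * s + \<eta>" if \<eta>: "0 < \<eta>" for \<eta>
    proof -
      \<comment> \<open>Slightly larger than \<open>s\<close>, because \<open>s\<close> may be
        \<open>0\<close> and is going to be a divisor. The surplus \<open>\<eta>\<close> is
        arbitrary and disappears at the end.\<close>
      define t where "t = s + \<epsilon> * \<eta> / 2"
      have t: "0 < t" "s < t"
        using s0 k(1) \<eta> by (auto simp: t_def add_nonneg_pos)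
      let ?c = "of_real (\<epsilon> / (2 * t)) :: complex"
      have c: "cmod ?c = \<epsilon> / (2 * t)"
        using t k(1) unfolding norm_of_real by simp
      have small: "P k (\<lambda>\<alpha>. ?c * f z \<alpha> - 0) < \<epsilon>" if "z \<in> cball 0 (real k)" for z
      proof -
        have "P k (\<lambda>\<alpha>. ?c * f z \<alpha> - 0) = \<epsilon> / (2 * t) * P k (f z)"
          using P_smult[OF H_series[OF f], of k ?c z] unfolding c by simp
        also have "\<dots> \<le> \<epsilon> / (2 * t) * t"
          using s that t k(1) by (intro mult_left_mono) (auto intro: order_trans[OF _ less_imp_le])
        also have "\<dots> < \<epsilon>"
          using t k(1) by simp
        finally show ?thesis .
      qed
      have "(\<lambda>z \<alpha>. ?c * f z \<alpha>) \<in> {f \<in> H. cl f \<in> {u \<in> topspace DT. N u < 1}}"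
        by (rule mp[OF bspec[OF k(2) H_smult[OF f]]]) (intro ballI small)
      then have "N (cl (\<lambda>z \<alpha>. ?c * f z \<alpha>)) < 1"
        by simp
      then have "\<epsilon> / (2 * t) * N (cl f) < 1"
        unfolding good_seminorm_smult[OF N f] c .
      then have "N (cl f) < 2 * t / \<epsilon>"
        using t k(1) by (simp add: field_simps)
      also have "2 * t / \<epsilon> = 2 / \<epsilon> * s + \<eta>"
        using k(1) by (simp add: t_def field_simps)
      finally show ?thesis
        by simp
    qed
    then show ?thesis
      by (rule field_le_epsilon)
  qed
  then show ?thesis
    using k(1) by (intro exI[of _ k] exI[of _ "2 / \<epsilon>"]) auto
qed

text \<open>For \<open>h\<close> in a disc, constant families are representatives and
  \<open>good_seminorm_bound\<close> applies. For \<open>h\<close> far outside the disc seen by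
  \<open>N\<close>, there are representatives that are arbitrarily small on that disc, so the
  quotient seminorm vanishes and the cutoff does no harm.\<close>

lemma quot_norm_le_fiber_norm:
  assumes N: "good_seminorm N"
  shows "\<exists>m C. 0 < C \<and> (\<forall>f\<in>H. \<forall>h. quot_norm N (sec f h) \<le> C * fiber_norm m (sec f h))"
proof -
  obtain k C where C: "0 < C" "\<And>f s. f \<in> H \<Longrightarrow> \<forall>z\<in>cball 0 (real k). P k (f z) \<le> s \<Longrightarrow> N (cl f) \<le> C * s"
    using good_seminorm_bound[OF N] by metis
  have "quot_norm N (sec f h) \<le> C * fiber_norm (Suc k) (sec f h)" if f: "f \<in> H" for f h
  proof (cases "cmod h \<le> real (Suc k)")
    case True
    have "quot_norm N (sec f h) / C \<le> nrm (Suc k) h (f h)"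
    proof (rule nrm_greatest[OF H_series[OF f]])
      fix b assume b: "b \<in> series" "nc h b = nc h (f h)"
      have "quot_norm N (sec f h) \<le> N (cl (\<lambda>z. b))"
        using b by (intro quot_norm_le[OF N f H_const])
      also have "\<dots> \<le> C * P k b"
        using H_const[OF b(1)] by (rule C(2)) simp
      also have "\<dots> \<le> C * P (Suc k) b"
        using C(1) P_mono[OF b(1)] by simp
      finally show "quot_norm N (sec f h) / C \<le> P (Suc k) b"
        using C(1) by (simp add: field_simps)
    qed
    then show ?thesis
      using C(1) cutoff_one[OF True] f by (simp add: fiber_norm_sec field_simps)
  next
    case False
    \<comment> \<open>On the disc of radius \<open>k\<close> the function \<open>(z / h) ^ j\<close>
      is bounded by \<open>\<rho> ^ j\<close>, while it equals \<open>1\<close> at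
      \<open>h\<close>.\<close>
    define \<rho> where "\<rho> = real k / cmod h"
    have h: "h \<noteq> 0" "0 \<le> \<rho>" "\<rho> < 1"
      using False by (auto simp: \<rho>_def divide_less_eq)
    have "quot_norm N (sec f h) \<le> C * (\<rho> ^ j * P k (f h))" for j
    proof -
      let ?g = "\<lambda>z \<alpha>. (z / h) ^ j * f h \<alpha>"
      have g: "?g \<in> H"
        using h by (intro H_scalar H_series[OF f] holomorphic_intros) auto
      have "quot_norm N (sec f h) \<le> N (cl ?g)"
        using h by (intro quot_norm_le[OF N f g]) simp
      also have "\<dots> \<le> C * (\<rho> ^ j * P k (f h))"
      proof (rule C(2)[OF g], intro ballI)
        fix z assume "z \<in> cball (0 :: complex) (real k)"
        then have "cmod (z / h) \<le> \<rho>"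
          by (simp add: \<rho>_def norm_divide divide_right_mono)
        then have "cmod ((z / h) ^ j) \<le> \<rho> ^ j"
          unfolding norm_power by (rule power_mono) simp
        then show "P k (?g z) \<le> \<rho> ^ j * P k (f h)"
          unfolding P_smult[OF H_series[OF f]] by (rule mult_right_mono) (rule P_nonneg[OF H_series[OF f]])
      qed
      finally show ?thesis .
    qed
    moreover have "(\<lambda>j. C * (\<rho> ^ j * P k (f h))) \<longlonglongrightarrow> C * (0 * P k (f h))"
      using h by (intro tendsto_intros LIMSEQ_realpow_zero)
    ultimately have "quot_norm N (sec f h) \<le> C * (0 * P k (f h))"
      by (intro LIMSEQ_le_const) auto
    also have "\<dots> \<le> C * fiber_norm (Suc k) (sec f h)"
      using C(1) f by (simp add: fiber_norm_sec cutoff_bounds nrm_nonneg H_series)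
    finally show ?thesis .
  qed
  then show ?thesis
    using C(1) by blast
qed

text \<open>The radius \<open>m + 1\<close> makes the disc contain every \<open>h\<close> at which
  \<open>cutoff m\<close> is nonzero.\<close>

definition sup_norm :: "nat \<Rightarrow> (complex \<Rightarrow> 'n list \<Rightarrow> complex) \<Rightarrow> real" where
  "sup_norm m f = (SUP z\<in>cball 0 (real m + 1). P m (f z))"

lemma sup_norm_upper: "f \<in> H \<Longrightarrow> z \<in> cball 0 (real m + 1) \<Longrightarrow> P m (f z) \<le> sup_norm m f"
  unfolding sup_norm_def
proof (rule cSUP_upper)
  assume "f \<in> H"
  then obtain C where "\<forall>z\<in>cball 0 (real m + 1). P m (f z) \<le> C"
    using H_bounded compact_cball by metis
  then show "bdd_above ((\<lambda>z. P m (f z)) ` cball 0 (real m + 1))"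
    by (auto intro: bdd_aboveI2)
qed

lemma sup_norm_least: "(\<And>z. z \<in> cball 0 (real m + 1) \<Longrightarrow> P m (f z) \<le> c) \<Longrightarrow> sup_norm m f \<le> c"
  unfolding sup_norm_def by (rule cSUP_least) auto

lemma sup_norm_nonneg: "f \<in> H \<Longrightarrow> 0 \<le> sup_norm m f"
  using sup_norm_upper[of f 0 m] P_nonneg[OF H_series, of f m 0] by simp

lemma sup_norm_add: "f \<in> H \<Longrightarrow> g \<in> H \<Longrightarrow> sup_norm m (\<lambda>z \<alpha>. f z \<alpha> + g z \<alpha>) \<le> sup_norm m f + sup_norm m g"
proof (rule sup_norm_least)
  fix z assume fg: "f \<in> H" "g \<in> H" and z: "z \<in> cball (0 :: complex) (real m + 1)"
  show "P m (\<lambda>\<alpha>. f z \<alpha> + g z \<alpha>) \<le> sup_norm m f + sup_norm m g"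
    using P_add[OF H_series[OF fg(1)] H_series[OF fg(2)], of m z z] sup_norm_upper[OF fg(1) z] sup_norm_upper[OF fg(2) z]
    by linarith
qed

lemma sup_norm_smult: "f \<in> H \<Longrightarrow> sup_norm m (\<lambda>z \<alpha>. c * f z \<alpha>) \<le> cmod c * sup_norm m f"
proof (rule sup_norm_least)
  fix z assume f: "f \<in> H" and z: "z \<in> cball (0 :: complex) (real m + 1)"
  show "P m (\<lambda>\<alpha>. c * f z \<alpha>) \<le> cmod c * sup_norm m f"
    using P_smult[OF H_series[OF f], of m c z] mult_left_mono[OF sup_norm_upper[OF f z], of "cmod c"] by simp
qed

definition class_norm :: "nat \<Rightarrow> (complex \<Rightarrow> 'n list \<Rightarrow> complex) set \<Rightarrow> real" where
  "class_norm m u = Inf {sup_norm m g |g. g \<in> H \<and> cl g = u}"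

lemma class_norm_le: "g \<in> H \<Longrightarrow> cl g = u \<Longrightarrow> class_norm m u \<le> sup_norm m g"
  unfolding class_norm_def
  by (rule cInf_lower) (auto intro!: bdd_belowI[of _ 0] simp: sup_norm_nonneg)

lemma class_norm_greatest: "u \<in> carrier R \<Longrightarrow> (\<And>g. g \<in> H \<Longrightarrow> cl g = u \<Longrightarrow> c \<le> sup_norm m g) \<Longrightarrow> c \<le> class_norm m u"
  unfolding class_norm_def by (rule cInf_greatest) (auto simp: carrier_R)

lemma class_norm_add:
  assumes "u \<in> carrier R" "v \<in> carrier R"
  shows "class_norm m (u \<oplus>\<^bsub>R\<^esub> v) \<le> class_norm m u + class_norm m v"
proof -
  have "class_norm m (u \<oplus>\<^bsub>R\<^esub> v) - sup_norm m g \<le> class_norm m u" if g: "g \<in> H" "cl g = v" for g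
  proof (rule class_norm_greatest[OF assms(1)])
    fix f assume f: "f \<in> H" "cl f = u"
    have "class_norm m (u \<oplus>\<^bsub>R\<^esub> v) \<le> sup_norm m (\<lambda>z \<alpha>. f z \<alpha> + g z \<alpha>)"
      using f g by (intro class_norm_le H_add) (auto simp: cl_add[symmetric])
    then show "class_norm m (u \<oplus>\<^bsub>R\<^esub> v) - sup_norm m g \<le> sup_norm m f"
      using sup_norm_add[OF f(1) g(1), of m] by simp
  qed
  then have "class_norm m (u \<oplus>\<^bsub>R\<^esub> v) - class_norm m u \<le> class_norm m v"
    by (intro class_norm_greatest[OF assms(2)]) (simp add: algebra_simps)
  then show ?thesis
    by simp
qed

lemma class_norm_nonneg: "u \<in> carrier R \<Longrightarrow> 0 \<le> class_norm m u"
  by (rule class_norm_greatest) (auto simp: sup_norm_nonneg)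

lemma class_norm_smult_le:
  assumes "u \<in> carrier R" "c \<noteq> 0"
  shows "class_norm m (c \<odot>\<^bsub>R\<^esub> u) \<le> cmod c * class_norm m u"
proof -
  have "class_norm m (c \<odot>\<^bsub>R\<^esub> u) / cmod c \<le> class_norm m u"
  proof (rule class_norm_greatest[OF assms(1)])
    fix f assume f: "f \<in> H" "cl f = u"
    have "class_norm m (c \<odot>\<^bsub>R\<^esub> u) \<le> sup_norm m (\<lambda>z \<alpha>. c * f z \<alpha>)"
      using f by (intro class_norm_le H_smult) (auto simp: cl_smult[symmetric])
    also have "\<dots> \<le> cmod c * sup_norm m f"
      by (rule sup_norm_smult[OF f(1)])
    finally show "class_norm m (c \<odot>\<^bsub>R\<^esub> u) / cmod c \<le> sup_norm m f"
      using assms(2) by (simp add: field_simps)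
  qed
  then show ?thesis
    using assms(2) by (simp add: field_simps)
qed

lemma class_norm_smult:
  assumes u: "u \<in> carrier R"
  shows "class_norm m (c \<odot>\<^bsub>R\<^esub> u) = cmod c * class_norm m u"
proof -
  interpret R: calg R
    by (rule calg_R)
  show ?thesis
  proof (cases "c = 0")
    case True
    have "class_norm m \<zero>\<^bsub>R\<^esub> \<le> 0"
      using class_norm_le[of "\<lambda>z \<alpha>. 0" "\<zero>\<^bsub>R\<^esub>" m] H_const[OF series_zero]
      by (simp add: cl_zero sup_norm_def)
    then show ?thesis
      using True u class_norm_nonneg[of "\<zero>\<^bsub>R\<^esub>" m] by simp
  next
    case False
    have "class_norm m (inverse c \<odot>\<^bsub>R\<^esub> (c \<odot>\<^bsub>R\<^esub> u)) \<le> cmod (inverse c) * class_norm m (c \<odot>\<^bsub>R\<^esub> u)"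
      using u False by (intro class_norm_smult_le) auto
    then have "class_norm m u \<le> inverse (cmod c) * class_norm m (c \<odot>\<^bsub>R\<^esub> u)"
      using u False by (simp add: R.smult_assoc[symmetric] norm_inverse)
    then have "cmod c * class_norm m u \<le> class_norm m (c \<odot>\<^bsub>R\<^esub> u)"
      using False by (simp add: field_simps)
    then show ?thesis
      using class_norm_smult_le[OF u False, of m] by simp
  qed
qed

lemma good_class_norm: "good_seminorm (class_norm m)"
  unfolding good_seminorm_def
proof
  interpret R: calg R
    by (rule calg_R)
  show sn: "seminorm_on R (class_norm m)"
    by (auto simp: seminorm_on_def class_norm_nonneg class_norm_add class_norm_smult)
  \<comment> \<open>The index \<open>Suc m\<close> serves two purposes: its disc has the radius
    \<open>m + 1\<close> used in \<open>sup_norm m\<close>, and its seminorm dominates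
    \<open>P m\<close>.\<close>
  have diff: "class_norm m (cl g) \<le> class_norm m (cl f) + \<epsilon>" if fg: "f \<in> H" "g \<in> H"
    and \<epsilon>: "\<forall>z\<in>cball 0 (real (Suc m)). P (Suc m) (\<lambda>\<alpha>. g z \<alpha> - f z \<alpha>) < \<epsilon>" for f g \<epsilon>
  proof -
    note gf = H_diff[OF fg(2,1)]
    have "sup_norm m (\<lambda>z \<alpha>. g z \<alpha> - f z \<alpha>) \<le> \<epsilon>"
    proof (rule sup_norm_least)
      fix z assume "z \<in> cball (0 :: complex) (real m + 1)"
      then have "z \<in> cball 0 (real (Suc m))"
        by (simp add: add.commute)
      then have "P (Suc m) (\<lambda>\<alpha>. g z \<alpha> - f z \<alpha>) < \<epsilon>"
        using \<epsilon> by blast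
      then show "P m (\<lambda>\<alpha>. g z \<alpha> - f z \<alpha>) \<le> \<epsilon>"
        using P_mono[OF H_series[OF gf], of m z] by simp
    qed
    moreover have "class_norm m (cl g) \<le> class_norm m (cl f) + class_norm m (cl (\<lambda>z \<alpha>. g z \<alpha> - f z \<alpha>))"
      using class_norm_add[OF cl_closed[OF fg(1)] cl_closed[OF gf], of m] cl_add[OF fg(1) gf] by simp
    ultimately show ?thesis
      using class_norm_le[OF gf refl, of m] by linarith
  qed
  have swap: "\<forall>z\<in>cball 0 (real (Suc m)). P (Suc m) (\<lambda>\<alpha>. f z \<alpha> - g z \<alpha>) < \<epsilon>"
    if "f \<in> H" "g \<in> H" "\<forall>z\<in>cball 0 (real (Suc m)). P (Suc m) (\<lambda>\<alpha>. g z \<alpha> - f z \<alpha>) < \<epsilon>" for f g \<epsilon>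
    using that(3) P_diff_swap[OF H_series[OF that(1)] H_series[OF that(2)]] by simp
  show "continuous_map DT euclideanreal (class_norm m)"
    unfolding continuous_map_upper_lower_semicontinuous_lt topspace_DT
  proof (intro allI conjI)
    fix a
    show "openin DT {u \<in> carrier R. class_norm m u < a}"
      unfolding openin_DT openin_HT
    proof (intro conjI ballI)
      fix f assume "f \<in> {f \<in> H. cl f \<in> {u \<in> carrier R. class_norm m u < a}}"
      then have f: "f \<in> H" "class_norm m (cl f) < a"
        by auto
      show "\<exists>k. \<exists>\<epsilon>>0. \<forall>g\<in>H. (\<forall>z\<in>cball 0 (real k). P k (\<lambda>\<alpha>. g z \<alpha> - f z \<alpha>) < \<epsilon>) \<longrightarrow>
          g \<in> {f \<in> H. cl f \<in> {u \<in> carrier R. class_norm m u < a}}"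
      proof (intro exI conjI ballI impI)
        show "0 < (a - class_norm m (cl f)) / 2"
          using f by simp
        fix g assume g: "g \<in> H"
          "\<forall>z\<in>cball 0 (real (Suc m)). P (Suc m) (\<lambda>\<alpha>. g z \<alpha> - f z \<alpha>) < (a - class_norm m (cl f)) / 2"
        then show "g \<in> {f \<in> H. cl f \<in> {u \<in> carrier R. class_norm m u < a}}"
          using diff[OF f(1) g] f(2) by (simp add: field_simps)
      qed
    qed auto
    show "openin DT {u \<in> carrier R. a < class_norm m u}"
      unfolding openin_DT openin_HT
    proof (intro conjI ballI)
      fix f assume "f \<in> {f \<in> H. cl f \<in> {u \<in> carrier R. a < class_norm m u}}"
      then have f: "f \<in> H" "a < class_norm m (cl f)"
        by auto
      show "\<exists>k. \<exists>\<epsilon>>0. \<forall>g\<in>H. (\<forall>z\<in>cball 0 (real k). P k (\<lambda>\<alpha>. g z \<alpha> - f z \<alpha>) < \<epsilon>) \<longrightarrow>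
          g \<in> {f \<in> H. cl f \<in> {u \<in> carrier R. a < class_norm m u}}"
      proof (intro exI conjI ballI impI)
        show "0 < (class_norm m (cl f) - a) / 2"
          using f by simp
        fix g assume g: "g \<in> H"
          "\<forall>z\<in>cball 0 (real (Suc m)). P (Suc m) (\<lambda>\<alpha>. g z \<alpha> - f z \<alpha>) < (class_norm m (cl f) - a) / 2"
        then show "g \<in> {f \<in> H. cl f \<in> {u \<in> carrier R. a < class_norm m u}}"
          using diff[OF g(1) f(1) swap[OF f(1) g]] f(2) by (simp add: field_simps)
      qed
    qed auto
  qed
qed

text \<open>Every family in a class of the coset takes at \<open>h\<close> a value representing the
  given point, and \<open>h\<close> belongs to the disc of \<open>sup_norm m\<close> unless the
  cutoff is \<open>0\<close>. Together with \<open>quot_norm_le_fiber_norm\<close> this makes the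
  two systems of seminorms equivalent.\<close>

lemma fiber_norm_le_quot_norm:
  assumes f: "f \<in> H"
  shows "fiber_norm m (sec f h) \<le> quot_norm (class_norm m) (sec f h)"
proof (rule quot_norm_greatest[OF f])
  fix g assume g: "g \<in> H" "nc h (g h) = nc h (f h)"
  show "fiber_norm m (sec f h) \<le> class_norm m (cl g)"
  proof (rule class_norm_greatest)
    show "cl g \<in> carrier R"
      using g by simp
    fix g' assume g': "g' \<in> H" "cl g' = cl g"
    then have nc: "nc h (g' h) = nc h (f h)"
      using cl_eq_nc[OF g'(1) g(1) g'(2), of h] g by simp
    show "fiber_norm m (sec f h) \<le> sup_norm m g'"
    proof (cases "cutoff m h = 0")
      case True
      then show ?thesis
        using f g' by (simp add: fiber_norm_sec sup_norm_nonneg)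
    next
      case False
      then have "0 < cutoff m h"
        using cutoff_bounds(1)[of m h] by simp
      then have "h \<in> cball 0 (real m + 1)"
        using cutoff_pos by fastforce
      then have "nrm m h (f h) \<le> sup_norm m g'"
        using nrm_le[OF H_series[OF g'(1)] nc, of m] sup_norm_upper[OF g'(1), of h m] by linarith
      moreover have "cutoff m h * nrm m h (f h) \<le> 1 * nrm m h (f h)"
        using cutoff_bounds nrm_nonneg[OF H_series[OF f]] by (intro mult_right_mono)
      ultimately show ?thesis
        using f by (simp add: fiber_norm_sec)
    qed
  qed
qed

end

section \<open>Comparison of topologies and uniform structures\<close>

context graded_family
begin

abbreviation "E \<equiv> def_bundle F \<N>"

lemma E_simps [simp]:
  "base E = top_of_set UNIV" "total E = def_total_topology F \<N>" "proj E = fst" "fib E = (\<lambda>h. FB h)"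
  by (simp_all add: def_bundle_def Let_def)

lemma unif_E: "unif E = unif_of_seminorms E (quotient_seminorms F \<N>)"
  by (simp add: def_bundle_def Let_def unif_of_seminorms_def absolutely_convex_def)

definition points :: "'n def_point set" where
  "points = {sec f h |f h. f \<in> H}"

lemma mem_points_iff: "v \<in> points \<longleftrightarrow> v \<in> carrier (FB (fst v))"
  by (auto simp: points_def carrier_FB)

definition tube_of :: "('n def_point \<Rightarrow> real) \<Rightarrow> complex set \<Rightarrow> (complex \<Rightarrow> 'n list \<Rightarrow> complex) \<Rightarrow> real \<Rightarrow> 'n def_point set" where
  "tube_of M V f \<epsilon> = {v \<in> points. fst v \<in> V \<and> M (v \<ominus>\<^bsub>FB (fst v)\<^esub> sec f (fst v)) < \<epsilon>}"

lemma sec_mem_tube: "f \<in> H \<Longrightarrow> g \<in> H \<Longrightarrow>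
    sec g h \<in> tube_of M V f \<epsilon> \<longleftrightarrow> h \<in> V \<and> M (sec (\<lambda>z \<alpha>. g z \<alpha> - f z \<alpha>) h) < \<epsilon>"
  by (auto simp: tube_of_def points_def sec_minus)

lemma tube_subset:
  assumes "f \<in> H" "f' \<in> H" "\<And>y u. y \<in> V \<Longrightarrow> u \<in> H \<Longrightarrow> M (sec (\<lambda>z \<alpha>. u z \<alpha> - f z \<alpha>) y) < \<epsilon> \<Longrightarrow>
      y \<in> V' \<and> M' (sec (\<lambda>z \<alpha>. u z \<alpha> - f' z \<alpha>) y) < \<epsilon>'"
  shows "tube_of M V f \<epsilon> \<subseteq> tube_of M' V' f' \<epsilon>'"
proof
  fix v assume v: "v \<in> tube_of M V f \<epsilon>"
  then obtain u y where u: "u \<in> H" "v = sec u y"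
    by (auto simp: tube_of_def points_def)
  then show "v \<in> tube_of M' V' f' \<epsilon>'"
    using v assms sec_mem_tube[OF assms(1) u(1)] sec_mem_tube[OF assms(2) u(1)] by auto
qed

lemma fiber_norm_add: "f \<in> H \<Longrightarrow> g \<in> H \<Longrightarrow>
    fiber_norm m (sec (\<lambda>z \<alpha>. f z \<alpha> + g z \<alpha>) h) \<le> fiber_norm m (sec f h) + fiber_norm m (sec g h)"
  using calg.seminorm_add[OF calg_FB seminorm_fiber_norm, of "sec f h" h "sec g h" m] by (simp add: sec_add)

lemma fiber_norm_triangle:
  assumes "f \<in> H" "g \<in> H" "u \<in> H"
  shows "fiber_norm m (sec (\<lambda>z \<alpha>. u z \<alpha> - f z \<alpha>) h) \<le>
    fiber_norm m (sec (\<lambda>z \<alpha>. u z \<alpha> - g z \<alpha>) h) + fiber_norm m (sec (\<lambda>z \<alpha>. g z \<alpha> - f z \<alpha>) h)"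
  using fiber_norm_add[OF H_diff[OF assms(3,2)] H_diff[OF assms(2,1)], of m h] by simp

lemma fiber_norm_mono: "f \<in> H \<Longrightarrow> fiber_norm m (sec f h) \<le> fiber_norm (Suc m) (sec f h)"
  by (simp add: fiber_norm_sec) (intro mult_mono cutoff_mono nrm_mono H_series cutoff_bounds nrm_nonneg)

lemma fiber_norm_mono': "f \<in> H \<Longrightarrow> m \<le> m' \<Longrightarrow> fiber_norm m (sec f h) \<le> fiber_norm m' (sec f h)"
  by (rule lift_Suc_mono_le[of "\<lambda>m. fiber_norm m (sec f h)"]) (auto intro: fiber_norm_mono)

lemma fiber_norm_zero: "fiber_norm m (sec (\<lambda>z \<alpha>. 0) h) = 0"
  using fiber_norm_sec[OF H_const[OF series_zero]] by (simp add: nrm_zero)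

text \<open>The same argument as in \<open>open_nhd\<close>, repeated before the tubes are known to
  generate a topology.\<close>

lemma tube_recenter:
  assumes f: "f \<in> H" and g: "g \<in> H" and V: "open V" "h \<in> V" and less: "fiber_norm m (sec (\<lambda>z \<alpha>. g z \<alpha> - f z \<alpha>) h) < \<epsilon>"
  obtains V' \<delta> where "open V'" "h \<in> V'" "0 < \<delta>" "tube_of (fiber_norm m) V' g \<delta> \<subseteq> tube_of (fiber_norm m) V f \<epsilon>"
proof -
  obtain c where c: "fiber_norm m (sec (\<lambda>z \<alpha>. g z \<alpha> - f z \<alpha>) h) < c" "c < \<epsilon>"
    using dense less by blast
  let ?V = "V \<inter> {y. fiber_norm m (sec (\<lambda>z \<alpha>. g z \<alpha> - f z \<alpha>) y) < c}"
  have "tube_of (fiber_norm m) ?V g (\<epsilon> - c) \<subseteq> tube_of (fiber_norm m) V f \<epsilon>"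
  proof (rule tube_subset[OF g f])
    fix y u assume "y \<in> ?V" "u \<in> H" "fiber_norm m (sec (\<lambda>z \<alpha>. u z \<alpha> - g z \<alpha>) y) < \<epsilon> - c"
    then show "y \<in> V \<and> fiber_norm m (sec (\<lambda>z \<alpha>. u z \<alpha> - f z \<alpha>) y) < \<epsilon>"
      using fiber_norm_triangle[OF f g, of u m y] by auto
  qed
  moreover have "open ?V"
    using V fiber_norm_open[OF H_diff[OF g f]] by (intro open_Int) auto
  ultimately show ?thesis
    using that[of ?V "\<epsilon> - c"] V c by auto
qed

definition norm_tube :: "'n def_point set \<Rightarrow> bool" where
  "norm_tube W \<longleftrightarrow> (\<exists>V f m \<epsilon>. open V \<and> f \<in> H \<and> 0 < \<epsilon> \<and> W = tube_of (fiber_norm m) V f \<epsilon>)"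

definition quot_tube :: "'n def_point set \<Rightarrow> bool" where
  "quot_tube W \<longleftrightarrow> (\<exists>V f N \<epsilon>. open V \<and> f \<in> H \<and> good_seminorm N \<and> 0 < \<epsilon> \<and> W = tube_of (quot_norm N) V f \<epsilon>)"

lemma norm_tubeI: "open V \<Longrightarrow> f \<in> H \<Longrightarrow> 0 < \<epsilon> \<Longrightarrow> norm_tube (tube_of (fiber_norm m) V f \<epsilon>)"
  unfolding norm_tube_def by blast

lemma quot_tubeI: "open V \<Longrightarrow> f \<in> H \<Longrightarrow> good_seminorm N \<Longrightarrow> 0 < \<epsilon> \<Longrightarrow> quot_tube (tube_of (quot_norm N) V f \<epsilon>)"
  unfolding quot_tube_def by blast

text \<open>The quotient seminorm of \<open>N\<close> is only known to be upper semicontinuous, so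
  the offset \<open>g - f\<close> of the point from the centre is split as \<open>e + d\<close>. The
  part \<open>e\<close> stays below \<open>c\<close> over all base points by
  \<open>quot_norm_usc\<close>, and \<open>d\<close> vanishes at \<open>h\<close>, so it is small
  nearby by continuity of the fiber norms.\<close>

lemma norm_tube_nhd:
  assumes W: "quot_tube W" "v \<in> W"
  shows "\<exists>U. norm_tube U \<and> v \<in> U \<and> U \<subseteq> W"
proof -
  obtain V f N \<epsilon> where W': "open V" "f \<in> H" "good_seminorm N" "0 < \<epsilon>" "W = tube_of (quot_norm N) V f \<epsilon>"
    using W(1) unfolding quot_tube_def by blast
  obtain g h where g: "g \<in> H" "v = sec g h"
    using W(2) by (auto simp: W'(5) tube_of_def points_def)
  note f = W'(2) and N = W'(3)
  have h: "h \<in> V" "quot_norm N (sec (\<lambda>z \<alpha>. g z \<alpha> - f z \<alpha>) h) < \<epsilon>"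
    using W(2) unfolding W'(5) g(2) by (simp_all add: sec_mem_tube[OF f g(1)])
  obtain c where c: "quot_norm N (sec (\<lambda>z \<alpha>. g z \<alpha> - f z \<alpha>) h) < c" "c < \<epsilon>"
    using dense h(2) by blast
  obtain e where e: "e \<in> H" "sec e h = sec (\<lambda>z \<alpha>. g z \<alpha> - f z \<alpha>) h" "\<And>y. quot_norm N (sec e y) < c"
    using quot_norm_usc[OF N H_diff[OF g(1) f] c(1)] by metis
  obtain m C where C: "0 < C" "\<And>f h. f \<in> H \<Longrightarrow> quot_norm N (sec f h) \<le> C * fiber_norm m (sec f h)"
    using quot_norm_le_fiber_norm[OF N] by metis
  define d where "d = (\<lambda>z \<alpha>. (g z \<alpha> - f z \<alpha>) - e z \<alpha>)"
  have d: "d \<in> H"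
    unfolding d_def by (intro H_diff g f e)
  have "sec d h = sec (\<lambda>z \<alpha>. g z \<alpha> - f z \<alpha>) h \<ominus>\<^bsub>FB h\<^esub> sec e h"
    unfolding d_def using H_diff[OF g(1) f] e(1) by (simp add: sec_minus)
  also have "\<dots> = \<zero>\<^bsub>FB h\<^esub>"
    using e(1) by (simp add: e(2)[symmetric] calg.minus_self[OF calg_FB])
  finally have dh: "fiber_norm m (sec d h) = 0"
    by (simp add: sec_zero fiber_norm_zero)
  \<comment> \<open>Two terms, \<open>u - g\<close> and \<open>d\<close>, are measured by the fiber
    norm and multiplied by \<open>C\<close>; each may use half of the gap
    \<open>\<epsilon> - c\<close>.\<close>
  define \<delta> where "\<delta> = (\<epsilon> - c) / (2 * C)"
  have \<delta>: "0 < \<delta>" "C * \<delta> = (\<epsilon> - c) / 2"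
    using c C(1) by (auto simp: \<delta>_def)
  let ?V = "V \<inter> {y. fiber_norm m (sec d y) < \<delta>}"
  have "tube_of (fiber_norm m) ?V g \<delta> \<subseteq> W"
    unfolding W'(5)
  proof (rule tube_subset[OF g(1) f])
    fix y u assume y: "y \<in> ?V" and u: "u \<in> H" "fiber_norm m (sec (\<lambda>z \<alpha>. u z \<alpha> - g z \<alpha>) y) < \<delta>"
    note ug = H_diff[OF u(1) g(1)]
    have "(\<lambda>z \<alpha>. u z \<alpha> - f z \<alpha>) = (\<lambda>z \<alpha>. (u z \<alpha> - g z \<alpha>) + (d z \<alpha> + e z \<alpha>))"
      by (simp add: d_def)
    then have "quot_norm N (sec (\<lambda>z \<alpha>. u z \<alpha> - f z \<alpha>) y) \<le>
        quot_norm N (sec (\<lambda>z \<alpha>. u z \<alpha> - g z \<alpha>) y) + quot_norm N (sec (\<lambda>z \<alpha>. d z \<alpha> + e z \<alpha>) y)"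
      using quot_norm_add[OF N ug H_add[OF d e(1)], of y] by simp
    moreover have "quot_norm N (sec (\<lambda>z \<alpha>. d z \<alpha> + e z \<alpha>) y) \<le> quot_norm N (sec d y) + quot_norm N (sec e y)"
      by (rule quot_norm_add[OF N d e(1)])
    moreover have "quot_norm N (sec d y) < (\<epsilon> - c) / 2"
      using C(2)[OF d, of y] mult_strict_left_mono[of "fiber_norm m (sec d y)" \<delta> C] y C(1) \<delta>(2) by auto
    moreover have "quot_norm N (sec (\<lambda>z \<alpha>. u z \<alpha> - g z \<alpha>) y) < (\<epsilon> - c) / 2"
      using C(2)[OF ug, of y] mult_strict_left_mono[OF u(2) C(1)] \<delta>(2) by auto
    ultimately show "y \<in> V \<and> quot_norm N (sec (\<lambda>z \<alpha>. u z \<alpha> - f z \<alpha>) y) < \<epsilon>"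
      using e(3)[of y] y by (auto simp: field_simps)
  qed
  moreover have "open ?V"
    using W'(1) fiber_norm_open[OF d] by (intro open_Int) auto
  moreover have "v \<in> tube_of (fiber_norm m) ?V g \<delta>"
    unfolding g(2) sec_mem_tube[OF g(1) g(1)] using h(1) dh \<delta>(1) by (simp add: fiber_norm_zero)
  ultimately show ?thesis
    using norm_tubeI[OF _ g(1) \<delta>(1), of ?V m] by (intro exI[of _ "tube_of (fiber_norm m) ?V g \<delta>"]) simp
qed

text \<open>After recentring at a section through the point, a tube for the quotient seminorm of
  \<open>class_norm m\<close> is contained in the fiber norm tube of the same radius.\<close>

lemma quot_tube_nhd:
  assumes W: "norm_tube W" "v \<in> W"
  shows "\<exists>U. quot_tube U \<and> v \<in> U \<and> U \<subseteq> W"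
proof -
  obtain V f m \<epsilon> where W': "open V" "f \<in> H" "0 < \<epsilon>" "W = tube_of (fiber_norm m) V f \<epsilon>"
    using W(1) unfolding norm_tube_def by blast
  obtain g h where g: "g \<in> H" "v = sec g h"
    using W(2) by (auto simp: W'(4) tube_of_def points_def)
  note f = W'(2)
  have h: "h \<in> V" "fiber_norm m (sec (\<lambda>z \<alpha>. g z \<alpha> - f z \<alpha>) h) < \<epsilon>"
    using W(2) unfolding W'(4) g(2) by (simp_all add: sec_mem_tube[OF f g(1)])
  obtain V' \<delta> where V': "open V'" "h \<in> V'" "0 < \<delta>"
    "tube_of (fiber_norm m) V' g \<delta> \<subseteq> tube_of (fiber_norm m) V f \<epsilon>"
    using f g(1) W'(1) h by (rule tube_recenter)
  let ?N = "class_norm m"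
  have "tube_of (quot_norm ?N) V' g \<delta> \<subseteq> tube_of (fiber_norm m) V' g \<delta>"
  proof (rule tube_subset[OF g(1) g(1)])
    fix y u assume "y \<in> V'" "u \<in> H" "quot_norm ?N (sec (\<lambda>z \<alpha>. u z \<alpha> - g z \<alpha>) y) < \<delta>"
    then show "y \<in> V' \<and> fiber_norm m (sec (\<lambda>z \<alpha>. u z \<alpha> - g z \<alpha>) y) < \<delta>"
      using fiber_norm_le_quot_norm[OF H_diff[OF _ g(1)], of u m y] by auto
  qed
  moreover have "v \<in> tube_of (quot_norm ?N) V' g \<delta>"
  proof -
    have z: "(\<lambda>z \<alpha>. 0) \<in> H"
      by (rule H_const[OF series_zero])
    have "quot_norm ?N (sec (\<lambda>z \<alpha>. 0) h) \<le> ?N (cl (\<lambda>z \<alpha>. 0))"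
      by (rule quot_norm_le[OF good_class_norm z z refl])
    also have "\<dots> = 0"
      using good_seminorm_smult[OF good_class_norm z, of m 0] by simp
    finally show ?thesis
      unfolding g(2) sec_mem_tube[OF g(1) g(1)] using V' by simp
  qed
  ultimately show ?thesis
    using quot_tubeI[OF V'(1) g(1) good_class_norm V'(3), of m] V'(4) W'(4)
    by (intro exI[of _ "tube_of (quot_norm ?N) V' g \<delta>"]) auto
qed

lemma union_of_tubes: "arbitrary union_of quot_tube = arbitrary union_of norm_tube"
proof (rule ext, unfold arbitrary_union_of_alt, intro iffI ballI)
  fix S and v :: "'n def_point"
  assume v: "v \<in> S"
  {
    assume "\<forall>x\<in>S. \<exists>U. quot_tube U \<and> x \<in> U \<and> U \<subseteq> S"
    then obtain U where U: "quot_tube U" "v \<in> U" "U \<subseteq> S"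
      using v by auto
    obtain U' where "norm_tube U'" "v \<in> U'" "U' \<subseteq> U"
      using norm_tube_nhd[OF U(1,2)] by auto
    then show "\<exists>U. norm_tube U \<and> v \<in> U \<and> U \<subseteq> S"
      using U by auto
  }
  {
    assume "\<forall>x\<in>S. \<exists>U. norm_tube U \<and> x \<in> U \<and> U \<subseteq> S"
    then obtain U where U: "norm_tube U" "v \<in> U" "U \<subseteq> S"
      using v by auto
    obtain U' where "quot_tube U'" "v \<in> U'" "U' \<subseteq> U"
      using quot_tube_nhd[OF U(1,2)] by auto
    then show "\<exists>U. quot_tube U \<and> v \<in> U \<and> U \<subseteq> S"
      using U by auto
  }
qed

text \<open>Both tubes are recentred at one section through the common point. The larger of the two
  indices then gives a tube inside the intersection.\<close>

lemma istopology_tubes: "istopology (arbitrary union_of norm_tube)"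
  unfolding istopology_base_eq
proof (intro allI impI, unfold arbitrary_union_of_alt, intro ballI)
  fix S T and v :: "'n def_point"
  assume ST: "norm_tube S \<and> norm_tube T" and v: "v \<in> S \<inter> T"
  obtain V f m \<epsilon> where S: "open V" "f \<in> H" "0 < \<epsilon>" "S = tube_of (fiber_norm m) V f \<epsilon>"
    using ST unfolding norm_tube_def by blast
  obtain V' f' m' \<epsilon>' where T: "open V'" "f' \<in> H" "0 < \<epsilon>'" "T = tube_of (fiber_norm m') V' f' \<epsilon>'"
    using ST unfolding norm_tube_def by blast
  obtain g h where g: "g \<in> H" "v = sec g h"
    using v by (auto simp: S(4) tube_of_def points_def)
  have h: "h \<in> V" "fiber_norm m (sec (\<lambda>z \<alpha>. g z \<alpha> - f z \<alpha>) h) < \<epsilon>"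
    "h \<in> V'" "fiber_norm m' (sec (\<lambda>z \<alpha>. g z \<alpha> - f' z \<alpha>) h) < \<epsilon>'"
    using v unfolding S(4) T(4) g(2) by (simp_all add: sec_mem_tube S(2) T(2) g(1))
  obtain U \<delta> where U: "open U" "h \<in> U" "0 < \<delta>"
    "tube_of (fiber_norm m) U g \<delta> \<subseteq> tube_of (fiber_norm m) V f \<epsilon>"
    using S(2) g(1) S(1) h(1,2) by (rule tube_recenter)
  obtain U' \<delta>' where U': "open U'" "h \<in> U'" "0 < \<delta>'"
    "tube_of (fiber_norm m') U' g \<delta>' \<subseteq> tube_of (fiber_norm m') V' f' \<epsilon>'"
    using T(2) g(1) T(1) h(3,4) by (rule tube_recenter)
  let ?X = "tube_of (fiber_norm (max m m')) (U \<inter> U') g (min \<delta> \<delta>')"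
  have "?X \<subseteq> tube_of (fiber_norm m) U g \<delta>"
  proof (rule tube_subset[OF g(1) g(1)])
    fix y u assume "y \<in> U \<inter> U'" "u \<in> H" "fiber_norm (max m m') (sec (\<lambda>z \<alpha>. u z \<alpha> - g z \<alpha>) y) < min \<delta> \<delta>'"
    then show "y \<in> U \<and> fiber_norm m (sec (\<lambda>z \<alpha>. u z \<alpha> - g z \<alpha>) y) < \<delta>"
      using fiber_norm_mono'[OF H_diff[OF _ g(1)], of u m "max m m'" y] by auto
  qed
  moreover have "?X \<subseteq> tube_of (fiber_norm m') U' g \<delta>'"
  proof (rule tube_subset[OF g(1) g(1)])
    fix y u assume "y \<in> U \<inter> U'" "u \<in> H" "fiber_norm (max m m') (sec (\<lambda>z \<alpha>. u z \<alpha> - g z \<alpha>) y) < min \<delta> \<delta>'"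
    then show "y \<in> U' \<and> fiber_norm m' (sec (\<lambda>z \<alpha>. u z \<alpha> - g z \<alpha>) y) < \<delta>'"
      using fiber_norm_mono'[OF H_diff[OF _ g(1)], of u m' "max m m'" y] by auto
  qed
  ultimately have "?X \<subseteq> S \<inter> T"
    using U(4) U'(4) S(4) T(4) by auto
  moreover have "v \<in> ?X"
    unfolding g(2) sec_mem_tube[OF g(1) g(1)] using U U' by (simp add: fiber_norm_zero)
  moreover have "norm_tube ?X"
    using U U' g(1) by (intro norm_tubeI open_Int) auto
  ultimately show "\<exists>X. norm_tube X \<and> v \<in> X \<and> X \<subseteq> S \<inter> T"
    by (intro exI[of _ ?X] conjI)
qed

lemma def_tube_eq:
  assumes "f \<in> H"
  shows "{(h, v) |h v. h \<in> V \<and> v \<in> carrier (def_fiber F \<N> h) \<and> M ((h, v) \<ominus>\<^bsub>FB h\<^esub> sec f h) < \<epsilon>} = tube_of M V f \<epsilon>"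
proof -
  have "v \<in> points \<longleftrightarrow> snd v \<in> carrier (def_fiber F \<N> (fst v))" for v
    unfolding mem_points_iff by (cases v) (auto simp: tagged_simps)
  then show ?thesis
    by (auto simp: tube_of_def)
qed

text \<open>\<open>topology\<close> can be inverted only on a predicate known to be a topology. This
  is established for the norm tubes and carried over to the defining tubes, since both families have
  the same unions.\<close>

lemma openin_total: "openin (total E) = arbitrary union_of norm_tube"
proof -
  have "def_total_topology F \<N> = topology (arbitrary union_of quot_tube)"
    unfolding def_total_topology_def
  proof (rule arg_cong[where f = "\<lambda>Q. topology (arbitrary union_of Q)"], rule ext)
    fix W
    show "(\<exists>V u Q \<epsilon>. open V \<and> u \<in> carrier R \<and> Q \<in> quotient_seminorms F \<N> \<and> 0 < \<epsilon> \<and>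
        W = {(h, v) |h v. h \<in> V \<and> v \<in> carrier (def_fiber F \<N> h) \<and> Q ((h, v) \<ominus>\<^bsub>FB h\<^esub> def_section F \<N> u h) < \<epsilon>}) \<longleftrightarrow>
      quot_tube W"
    proof
      assume "\<exists>V u Q \<epsilon>. open V \<and> u \<in> carrier R \<and> Q \<in> quotient_seminorms F \<N> \<and> 0 < \<epsilon> \<and>
        W = {(h, v) |h v. h \<in> V \<and> v \<in> carrier (def_fiber F \<N> h) \<and> Q ((h, v) \<ominus>\<^bsub>FB h\<^esub> def_section F \<N> u h) < \<epsilon>}"
      then obtain V u Q \<epsilon> where *: "open V" "u \<in> carrier R" "Q \<in> quotient_seminorms F \<N>" "0 < \<epsilon>"
        "W = {(h, v) |h v. h \<in> V \<and> v \<in> carrier (def_fiber F \<N> h) \<and> Q ((h, v) \<ominus>\<^bsub>FB h\<^esub> def_section F \<N> u h) < \<epsilon>}"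
        by (elim exE conjE) (rule that)
      obtain f where f: "f \<in> H" "u = cl f"
        using *(2) by (auto simp: carrier_R)
      obtain N where N: "good_seminorm N" "Q = quot_norm N"
        using *(3) by (auto simp: quotient_seminorms_eq)
      have "W = tube_of (quot_norm N) V f \<epsilon>"
        unfolding *(5) f(2) N(2) by (rule def_tube_eq[OF f(1)])
      then show "quot_tube W"
        using quot_tubeI[OF *(1) f(1) N(1) *(4)] by simp
    next
      assume "quot_tube W"
      then obtain V f N \<epsilon> where *: "open V" "f \<in> H" "good_seminorm N" "0 < \<epsilon>" "W = tube_of (quot_norm N) V f \<epsilon>"
        unfolding quot_tube_def by (elim exE conjE) (rule that)
      have "W = {(h, v) |h v. h \<in> V \<and> v \<in> carrier (def_fiber F \<N> h) \<and> quot_norm N ((h, v) \<ominus>\<^bsub>FB h\<^esub> sec f h) < \<epsilon>}"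
        unfolding *(5) by (rule def_tube_eq[OF *(2), symmetric])
      moreover have "quot_norm N \<in> quotient_seminorms F \<N>"
        using *(3) by (auto simp: quotient_seminorms_eq)
      ultimately show "\<exists>V u Q \<epsilon>. open V \<and> u \<in> carrier R \<and> Q \<in> quotient_seminorms F \<N> \<and> 0 < \<epsilon> \<and>
        W = {(h, v) |h v. h \<in> V \<and> v \<in> carrier (def_fiber F \<N> h) \<and> Q ((h, v) \<ominus>\<^bsub>FB h\<^esub> def_section F \<N> u h) < \<epsilon>}"
        using * by (intro exI conjI) (assumption | rule cl_closed)+
    qed
  qed
  then show ?thesis
    using istopology_tubes by (simp add: union_of_tubes topology_inverse')
qed

lemma topspace_total: "topspace (total E) = points"
proof
  have "(arbitrary union_of norm_tube) points"
    unfolding arbitrary_union_of_alt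
  proof
    fix v assume "v \<in> points"
    then obtain g h where g: "g \<in> H" "v = sec g h"
      by (auto simp: points_def)
    have "v \<in> tube_of (fiber_norm 0) UNIV g 1"
      unfolding g(2) sec_mem_tube[OF g(1) g(1)] by (simp add: fiber_norm_zero)
    then show "\<exists>U. norm_tube U \<and> v \<in> U \<and> U \<subseteq> points"
      using norm_tubeI[OF open_UNIV g(1), of 1 0]
      by (intro exI[of _ "tube_of (fiber_norm 0) UNIV g 1"]) (auto simp: tube_of_def)
  qed
  then have "openin (total E) points"
    by (simp only: openin_total)
  then show "points \<subseteq> topspace (total E)"
    by (rule openin_subset)
  have "(arbitrary union_of norm_tube) (topspace (total E))"
    using openin_topspace[of "total E"] by (simp only: openin_total)
  then have "\<forall>v\<in>topspace (total E). \<exists>U. norm_tube U \<and> v \<in> U \<and> U \<subseteq> topspace (total E)"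
    unfolding arbitrary_union_of_alt .
  then show "topspace (total E) \<subseteq> points"
    by (auto simp: norm_tube_def tube_of_def)
qed

text \<open>Each seminorm of one system is bounded by a multiple of one from the other with the same
  constant on all fibers. This uniformity is why the fiber norms carry cutoffs.\<close>

lemma unif_eq: "unif E = unif_of_seminorms E (range fiber_norm)"
proof -
  have "(\<exists>Q\<in>quotient_seminorms F \<N>. \<exists>\<epsilon>>0. {u \<in> points. Q u < \<epsilon>} \<subseteq> S) \<longleftrightarrow>
      (\<exists>M\<in>range fiber_norm. \<exists>\<epsilon>>0. {u \<in> points. M u < \<epsilon>} \<subseteq> S)" for S
  proof
    assume "\<exists>Q\<in>quotient_seminorms F \<N>. \<exists>\<epsilon>>0. {u \<in> points. Q u < \<epsilon>} \<subseteq> S"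
    then obtain N \<epsilon> where N: "good_seminorm N" "0 < \<epsilon>" "{u \<in> points. quot_norm N u < \<epsilon>} \<subseteq> S"
      by (auto simp: quotient_seminorms_eq)
    obtain m C where C: "0 < C" "\<And>f h. f \<in> H \<Longrightarrow> quot_norm N (sec f h) \<le> C * fiber_norm m (sec f h)"
      using quot_norm_le_fiber_norm[OF N(1)] by metis
    have "{u \<in> points. fiber_norm m u < \<epsilon> / C} \<subseteq> S"
    proof
      fix u assume u: "u \<in> {u \<in> points. fiber_norm m u < \<epsilon> / C}"
      then obtain f h where f: "f \<in> H" "u = sec f h"
        by (auto simp: points_def)
      have "C * fiber_norm m u < \<epsilon>"
        using u C(1) by (simp add: pos_less_divide_eq mult.commute)
      then have "quot_norm N u < \<epsilon>"
        using C(2)[OF f(1), of h] f(2) by simp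
      then show "u \<in> S"
        using N(3) u by auto
    qed
    then show "\<exists>M\<in>range fiber_norm. \<exists>\<epsilon>>0. {u \<in> points. M u < \<epsilon>} \<subseteq> S"
      using N(2) C(1) by (intro bexI[of _ "fiber_norm m"] exI[of _ "\<epsilon> / C"]) auto
  next
    assume "\<exists>M\<in>range fiber_norm. \<exists>\<epsilon>>0. {u \<in> points. M u < \<epsilon>} \<subseteq> S"
    then obtain m \<epsilon> where m: "0 < \<epsilon>" "{u \<in> points. fiber_norm m u < \<epsilon>} \<subseteq> S"
      by auto
    have "{u \<in> points. quot_norm (class_norm m) u < \<epsilon>} \<subseteq> S"
    proof
      fix u assume u: "u \<in> {u \<in> points. quot_norm (class_norm m) u < \<epsilon>}"
      then obtain f h where f: "f \<in> H" "u = sec f h"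
        by (auto simp: points_def)
      then have "fiber_norm m u < \<epsilon>"
        using fiber_norm_le_quot_norm[OF f(1), of m h] u by simp
      then show "u \<in> S"
        using m u by auto
    qed
    then show "\<exists>Q\<in>quotient_seminorms F \<N>. \<exists>\<epsilon>>0. {u \<in> points. Q u < \<epsilon>} \<subseteq> S"
      using m good_class_norm by (intro bexI[of _ "quot_norm (class_norm m)"]) (auto simp: quotient_seminorms_eq)
  qed
  then show ?thesis
    unfolding unif_E unif_of_seminorms_def topspace_total by simp
qed

definition family_sections :: "(complex \<Rightarrow> 'n def_point) set" where
  "family_sections = {def_section F \<N> (cl f) |f. f \<in> H}"

lemma family_sectionsI: "f \<in> H \<Longrightarrow> def_section F \<N> (cl f) \<in> family_sections"
  by (auto simp: family_sections_def)

lemma section_bundle_E: "section_bundle E fiber_norm family_sections"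
proof (rule section_bundle.intro)
  have carrier: "carrier (fib E x) = {u \<in> topspace (total E). proj E u = x}" for x
    unfolding topspace_total by (auto simp: mem_points_iff carrier_FB)
  then show "carrier (fib E x) = {u \<in> topspace (total E). proj E u = x}" for x .
  have "x \<in> proj E ` points" for x
    using H_const[OF series_zero] by (intro image_eqI[of _ _ "sec (\<lambda>z \<alpha>. 0) x"]) (auto simp: points_def)
  then show "proj E ` topspace (total E) = topspace (base E)"
    unfolding topspace_total by auto
  show "calg (fib E x)" for x
    by (simp add: calg_FB)
  show "s x \<in> carrier (fib E x)" if "s \<in> family_sections" for s x
    using that by (auto simp: family_sections_def)
  show "\<exists>s\<in>family_sections. s x = u" if u: "u \<in> carrier (fib E x)" for x u
  proof -
    obtain f where "f \<in> H" "u = sec f x"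
      using u by (auto simp: carrier_FB)
    then show ?thesis
      using family_sectionsI[of f] by (intro bexI[of _ "def_section F \<N> (cl f)"]) auto
  qed
  show "\<exists>r\<in>family_sections. \<forall>x\<in>topspace (base E). r x = \<zero>\<^bsub>fib E x\<^esub>"
    using family_sectionsI[OF H_const[OF series_zero]] by (intro bexI) (auto simp: sec_zero)
  fix s assume "s \<in> family_sections"
  then obtain f where f: "f \<in> H" "s = def_section F \<N> (cl f)"
    by (auto simp: family_sections_def)
  show "\<exists>r\<in>family_sections. \<forall>x\<in>topspace (base E). r x = c \<odot>\<^bsub>fib E x\<^esub> s x" for c
    using family_sectionsI[OF H_smult[OF f(1), of c]] f by (intro bexI) (auto simp: sec_smult)
  show "continuous_map (base E) euclideanreal (\<lambda>x. fiber_norm m (s x))" for m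
    using fiber_norm_continuous_on[OF f(1), of m] f(2) by simp
  fix t assume "t \<in> family_sections"
  then obtain g where g: "g \<in> H" "t = def_section F \<N> (cl g)"
    by (auto simp: family_sections_def)
  show "\<exists>r\<in>family_sections. \<forall>x\<in>topspace (base E). r x = s x \<oplus>\<^bsub>fib E x\<^esub> t x"
    using family_sectionsI[OF H_add[OF f(1) g(1)]] f g by (intro bexI) (auto simp: sec_add)
  show "\<exists>r\<in>family_sections. \<forall>x\<in>topspace (base E). r x = s x \<otimes>\<^bsub>fib E x\<^esub> t x"
    using family_sectionsI[OF H_mult[OF f(1) g(1)]] f g by (intro bexI) (auto simp: sec_mult)
next
  show "seminorm_on (fib E x) (fiber_norm m)" for x m
    by (simp add: seminorm_fiber_norm)
  fix x u and m :: nat assume "u \<in> carrier (fib E x)"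
  then obtain f where f: "f \<in> H" "u = sec f x"
    by (auto simp: carrier_FB)
  show "fiber_norm m u \<le> fiber_norm (Suc m) u"
    using f by (simp add: fiber_norm_mono)
  show "u = \<zero>\<^bsub>fib E x\<^esub>" if "\<And>m. fiber_norm m u = 0"
  proof -
    \<comment> \<open>An index whose cutoff is \<open>1\<close> at \<open>x\<close>; for it the
      fiber norm separates the points of the fiber.\<close>
    obtain m where "cmod x \<le> real m"
      using real_arch_simple by blast
    then have "nrm m x (f x) = 0"
      using that[of m] f by (simp add: fiber_norm_sec cutoff_one)
    then have "nc x (f x) = nc x (\<lambda>\<alpha>. 0)"
      using nrm_eq_zeroD[OF H_series[OF f(1)]] by (auto simp: fun_eq_iff)
    then show ?thesis
      using f H_const[OF series_zero] by (simp add: sec_zero sec_eq_iff)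
  qed
  fix v assume "v \<in> carrier (fib E x)"
  then obtain g where g: "g \<in> H" "v = sec g x"
    by (auto simp: carrier_FB)
  note fs = H_series[OF f(1), of x] and gs = H_series[OF g(1), of x]
  show "fiber_norm m (u \<otimes>\<^bsub>fib E x\<^esub> v) \<le> fiber_norm (Suc m) u * fiber_norm (Suc m) v"
  proof (cases "cutoff m x = 0")
    case True
    then show ?thesis
      using f g nrm_nonneg[OF fs] nrm_nonneg[OF gs] by (simp add: sec_mult fiber_norm_sec H_mult cutoff_bounds)
  next
    case False
    then have "0 < cutoff m x"
      using cutoff_bounds(1)[of m x] by simp
    \<comment> \<open>The index shift at work: where the \<open>m\<close>-th cutoff is nonzero, the
      next one equals \<open>1\<close>.\<close>
    then have "cmod x \<le> real (Suc m)"
      using cutoff_pos[of m x] by simp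
    then have "cutoff (Suc m) x = 1"
      by (rule cutoff_one)
    moreover have "cutoff m x * nrm m x (word_mult (f x) (g x)) \<le> 1 * nrm m x (word_mult (f x) (g x))"
      using cutoff_bounds by (intro mult_right_mono nrm_nonneg series_mult fs gs)
    moreover have "nrm m x (word_mult (f x) (g x)) \<le> nrm m x (f x) * nrm m x (g x)"
      by (rule nrm_mult[OF fs gs])
    moreover have "nrm m x (f x) * nrm m x (g x) \<le> nrm (Suc m) x (f x) * nrm (Suc m) x (g x)"
      by (intro mult_mono nrm_mono nrm_nonneg fs gs)
    ultimately show ?thesis
      using f g by (simp add: sec_mult fiber_norm_sec H_mult)
  qed
next
  fix x and \<sigma> :: "nat \<Rightarrow> 'n def_point"
  assume \<sigma>: "range \<sigma> \<subseteq> carrier (fib E x)"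
    and cauchy: "\<And>m \<epsilon>. 0 < \<epsilon> \<Longrightarrow> \<exists>M. \<forall>k\<ge>M. \<forall>l\<ge>M. fiber_norm m (\<sigma> k \<ominus>\<^bsub>fib E x\<^esub> \<sigma> l) < \<epsilon>"
  have "\<forall>k. \<exists>f. f \<in> H \<and> \<sigma> k = sec f x"
    using \<sigma> by (auto simp: carrier_FB)
  then obtain f where f: "\<And>k. f k \<in> H" "\<And>k. \<sigma> k = sec (f k) x"
    by metis
  \<comment> \<open>From index \<open>m0\<close> on the cutoff is \<open>1\<close> at
    \<open>x\<close>, so the Cauchy condition for the fiber norms becomes the one for
    \<open>nrm\<close>.\<close>
  obtain m0 where m0: "cmod x \<le> real m0"
    using real_arch_simple by blast
  have "\<exists>a\<in>series. \<forall>m. (\<lambda>k. nrm m x (\<lambda>w. f k x w - a w)) \<longlonglongrightarrow> 0"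
  proof (rule nrm_complete)
    fix m and \<epsilon> :: real assume "0 < \<epsilon>"
    then obtain M where M: "\<And>k l. k \<ge> M \<Longrightarrow> l \<ge> M \<Longrightarrow> fiber_norm (max m m0) (\<sigma> k \<ominus>\<^bsub>fib E x\<^esub> \<sigma> l) < \<epsilon>"
      using cauchy[of \<epsilon> "max m m0"] by auto
    have "nrm m x (\<lambda>w. f k x w - f l x w) < \<epsilon>" if "k \<ge> M" "l \<ge> M" for k l
    proof -
      have "nrm m x (\<lambda>w. f k x w - f l x w) \<le> nrm (max m m0) x (\<lambda>w. f k x w - f l x w)"
        by (intro nrm_mono' series_diff H_series f) simp
      moreover have "cutoff (max m m0) x = 1"
        using m0 by (intro cutoff_one) simp
      ultimately show ?thesis
        using M[OF that] f by (simp add: sec_minus fiber_norm_sec H_diff)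
    qed
    then show "\<exists>M. \<forall>k\<ge>M. \<forall>l\<ge>M. nrm m x (\<lambda>w. f k x w - f l x w) < \<epsilon>"
      by blast
  qed (rule H_series[OF f(1)])
  then obtain a where a: "a \<in> series" "\<And>m. (\<lambda>k. nrm m x (\<lambda>w. f k x w - a w)) \<longlonglongrightarrow> 0"
    by blast
  have "(\<lambda>k. fiber_norm m (\<sigma> k \<ominus>\<^bsub>fib E x\<^esub> sec (\<lambda>z. a) x)) \<longlonglongrightarrow> 0" for m
    using tendsto_mult_right_zero[OF a(2)[of m], of "cutoff m x"] f a(1)
    by (simp add: sec_minus H_const fiber_norm_sec H_diff)
  then show "\<exists>u\<in>carrier (fib E x). \<forall>m. (\<lambda>k. fiber_norm m (\<sigma> k \<ominus>\<^bsub>fib E x\<^esub> u)) \<longlonglongrightarrow> 0"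
    using a(1) by (intro bexI[of _ "sec (\<lambda>z. a) x"]) (auto simp: H_const)
next
  have "seminorm_tube E (def_section F \<N> (cl f)) V (fiber_norm m) \<epsilon> = tube_of (fiber_norm m) V f \<epsilon>" for f V m \<epsilon>
    unfolding seminorm_tube_def tube_of_def topspace_total by simp
  then have "(\<exists>V s m \<epsilon>. openin (base E) V \<and> s \<in> family_sections \<and> 0 < \<epsilon> \<and>
      W = seminorm_tube E s V (fiber_norm m) \<epsilon>) \<longleftrightarrow> norm_tube W" for W
    unfolding norm_tube_def family_sections_def by (auto simp: subtopology_UNIV) metis+
  then show "openin (total E) = arbitrary union_of (\<lambda>W. \<exists>V s m \<epsilon>. openin (base E) V \<and>
      s \<in> family_sections \<and> 0 < \<epsilon> \<and> W = seminorm_tube E s V (fiber_norm m) \<epsilon>)"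
    unfolding openin_total by simp
qed (rule unif_eq)

text \<open>A representative is chosen in the free algebra. By \<open>emb_qcls\<close> the choice is
  immaterial, because the ideal of the relations and the kernel onto the fiber are described by the
  same sorted coefficients.\<close>

definition emb :: "complex \<Rightarrow> ('n list \<Rightarrow> complex) set \<Rightarrow> 'n def_point" where
  "emb h v = sec (\<lambda>z. SOME a. finite {w. a w \<noteq> 0} \<and> v = qcls (exp (\<i> * h)) a) h"

lemma emb_qcls:
  assumes "finite {w. a w \<noteq> 0}"
  shows "emb h (qcls (exp (\<i> * h)) a) = sec (\<lambda>z. a) h"
proof -
  let ?b = "SOME b. finite {w. b w \<noteq> 0} \<and> qcls (exp (\<i> * h)) a = qcls (exp (\<i> * h)) b"
  have b: "finite {w. ?b w \<noteq> 0} \<and> qcls (exp (\<i> * h)) a = qcls (exp (\<i> * h)) ?b"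
    by (rule someI[of _ a]) (use assms in simp)
  then have "nc h a = nc h ?b"
    using assms qcls_eq_iff[of "exp (\<i> * h)" a ?b] by simp
  then show ?thesis
    unfolding emb_def using b assms by (subst sec_eq_iff) (auto intro!: H_const series_finite_support)
qed

text \<open>Injectivity holds because sorted coefficients at \<open>h\<close> decide equality in
  \<open>qreg\<close> as well as in the fiber. Density comes from truncation, and the generators are
  values of constant families, hence continuous sections.\<close>

lemma contains_qreg_E: "contains_qreg E emb"
  unfolding contains_qreg_def
proof (intro conjI ballI allI)
  interpret section_bundle E fiber_norm family_sections
    by (rule section_bundle_E)
  fix h :: complex
  let ?q = "exp (\<i> * h)"
  have car: "\<exists>a. finite {w. a w \<noteq> 0} \<and> x = qcls ?q a" if "x \<in> carrier (qreg ?q)" for x :: "('n list \<Rightarrow> complex) set"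
    using that by (auto simp: qreg_simps)
  have C: "finite {w. a w \<noteq> 0} \<Longrightarrow> (\<lambda>z. a) \<in> H" for a :: "'n list \<Rightarrow> complex"
    by (intro H_const series_finite_support)
  have "complex_linear (qreg ?q) (fib E h) (emb h)"
    unfolding complex_linear_def
  proof (intro conjI ballI allI funcsetI)
    fix x :: "('n list \<Rightarrow> complex) set" assume "x \<in> carrier (qreg ?q)"
    then obtain a where a: "finite {w. a w \<noteq> 0}" "x = qcls ?q a"
      using car by blast
    show "emb h x \<in> carrier (fib E h)"
      using a C by (simp add: emb_qcls)
    show "emb h (c \<odot>\<^bsub>qreg ?q\<^esub> x) = c \<odot>\<^bsub>fib E h\<^esub> emb h x" for c
      using a C[OF a(1)] finite_support_smult[OF a(1), of c] by (simp add: qreg_simps emb_qcls sec_smult)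
    fix y :: "('n list \<Rightarrow> complex) set" assume "y \<in> carrier (qreg ?q)"
    then obtain b where b: "finite {w. b w \<noteq> 0}" "y = qcls ?q b"
      using car by blast
    show "emb h (x \<oplus>\<^bsub>qreg ?q\<^esub> y) = emb h x \<oplus>\<^bsub>fib E h\<^esub> emb h y"
      using a b C[OF a(1)] C[OF b(1)] finite_support_add[OF a(1) b(1)]
      by (simp add: qreg_simps emb_qcls sec_add)
  qed
  moreover have "emb h \<in> ring_hom (qreg ?q) (fib E h)"
  proof (rule ring_hom_memI)
    fix x y :: "('n list \<Rightarrow> complex) set" assume "x \<in> carrier (qreg ?q)" "y \<in> carrier (qreg ?q)"
    then obtain a b where a: "finite {w. a w \<noteq> 0}" "x = qcls ?q a" and b: "finite {w. b w \<noteq> 0}" "y = qcls ?q b"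
      using car by metis
    show "emb h (x \<otimes>\<^bsub>qreg ?q\<^esub> y) = emb h x \<otimes>\<^bsub>fib E h\<^esub> emb h y"
      using a b C[OF a(1)] C[OF b(1)] finite_support_word_mult[OF a(1) b(1)]
      by (simp add: qreg_simps emb_qcls sec_mult)
    show "emb h x \<in> carrier (fib E h)"
      using a C by (simp add: emb_qcls)
    show "emb h (x \<oplus>\<^bsub>qreg ?q\<^esub> y) = emb h x \<oplus>\<^bsub>fib E h\<^esub> emb h y"
      using a b C[OF a(1)] C[OF b(1)] finite_support_add[OF a(1) b(1)]
      by (simp add: qreg_simps emb_qcls sec_add)
  next
    show "emb h \<one>\<^bsub>qreg ?q\<^esub> = \<one>\<^bsub>fib E h\<^esub>"
      by (simp add: qreg_simps emb_qcls finite_support_basis sec_one)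
  qed
  ultimately show "complex_alg_hom (qreg ?q) (fib E h) (emb h)"
    by (simp add: complex_alg_hom_def)
  show "inj_on (emb h) (carrier (qreg ?q))"
  proof (rule inj_onI)
    fix x y :: "('n list \<Rightarrow> complex) set"
    assume xy: "x \<in> carrier (qreg ?q)" "y \<in> carrier (qreg ?q)" "emb h x = emb h y"
    then obtain a b where a: "finite {w. a w \<noteq> 0}" "x = qcls ?q a" and b: "finite {w. b w \<noteq> 0}" "y = qcls ?q b"
      using car by metis
    then have "nc h a = nc h b"
      using xy(3) C[OF a(1)] C[OF b(1)] by (simp add: emb_qcls sec_eq_iff)
    then show "x = y"
      using a b by (simp add: qcls_eq_iff)
  qed
  show "fiber_topology E h closure_of (emb h ` carrier (qreg ?q)) = carrier (fib E h)"
  proof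
    show "fiber_topology E h closure_of (emb h ` carrier (qreg ?q)) \<subseteq> carrier (fib E h)"
      using closure_of_subset_topspace[of "fiber_topology E h"] topspace_fiber_topology[of h] by simp
    show "carrier (fib E h) \<subseteq> fiber_topology E h closure_of (emb h ` carrier (qreg ?q))"
    proof
      fix u assume u: "u \<in> carrier (fib E h)"
      then obtain f where f: "f \<in> H" "u = sec f h"
        by (auto simp: carrier_FB)
      note fs = H_series[OF f(1), of h]
      show "u \<in> fiber_topology E h closure_of (emb h ` carrier (qreg ?q))"
        unfolding in_closure_of
      proof (intro conjI allI impI)
        show "u \<in> topspace (fiber_topology E h)"
          using u topspace_fiber_topology[of h] by simp
        fix W assume "u \<in> W \<and> openin (fiber_topology E h) W"
        then obtain m \<epsilon> where m: "0 < \<epsilon>" "\<forall>v\<in>carrier (fib E h). fiber_norm m (v \<ominus>\<^bsub>fib E h\<^esub> u) < \<epsilon> \<longrightarrow> v \<in> W"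
          using openin_fiber_topology[of h W] by auto
        obtain D where D: "P m (\<lambda>w. f h w - trunc D (f h) w) < \<epsilon>"
          using order_tendstoD(2)[OF P_tail_tendsto[OF fs, of m] m(1)] by (auto simp: eventually_sequentially)
        let ?b = "trunc D (f h)"
        have b: "(\<lambda>z. ?b) \<in> H" "emb h (qcls ?q ?b) = sec (\<lambda>z. ?b) h"
          using C[OF finite_support_trunc] emb_qcls[OF finite_support_trunc] by auto
        have "fiber_norm m (sec (\<lambda>z. ?b) h \<ominus>\<^bsub>fib E h\<^esub> u) = cutoff m h * nrm m h (\<lambda>w. ?b w - f h w)"
          using f b by (simp add: sec_minus fiber_norm_sec H_diff)
        also have "\<dots> \<le> 1 * P m (\<lambda>w. ?b w - f h w)"
          by (intro mult_mono cutoff_bounds nrm_le_P nrm_nonneg series_diff fs series_trunc) simp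
        also have "\<dots> < \<epsilon>"
          using D P_diff_swap[OF series_trunc fs, of m D "f h"] by simp
        finally have "emb h (qcls ?q ?b) \<in> W"
          using m(2) b by simp
        moreover have "qcls ?q ?b \<in> carrier (qreg ?q)"
          using finite_support_trunc by (simp add: qreg_simps)
        ultimately show "\<exists>y. y \<in> emb h ` carrier (qreg ?q) \<and> y \<in> W"
          by blast
      qed
    qed
  qed
  fix j
  have "continuous_map (base E) (total E) (def_section F \<N> (cl (\<lambda>z. word_basis [j])))"
    by (intro continuous_section family_sectionsI H_const series_basis)
  then show "continuous_map (base E) (total E) (\<lambda>h. emb h (qreg_var (exp (\<i> * h)) j))"
    by (simp add: qreg_var_def emb_qcls finite_support_basis eta_contract_eq)
qed

theorem def_bundle_hypotheses: "def_bundle_hypotheses F \<N>"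
  unfolding def_bundle_hypotheses_def
proof (intro conjI exI[of _ emb] allI contains_qreg_E)
  show "frechet_algebra_bundle E" "continuous_bundle E"
    using section_bundle.frechet_algebra_bundle[OF section_bundle_E]
      section_bundle.continuous_bundle[OF section_bundle_E] by auto
  show "emb h (qreg_var (exp (\<i> * h)) j) = sec (\<lambda>z. word_basis [j]) h" for h j
    by (simp add: qreg_var_def emb_qcls finite_support_basis)
qed

end

section \<open>The free polydisk and the free ball\<close>

text \<open>A countable cofinal family of radii, so that the uncountably many defining seminorms can
  be replaced by an increasing sequence.\<close>

lemma radius_sequence:
  assumes "0 < (r :: ereal)"
  obtains \<rho> :: "nat \<Rightarrow> real" where "\<And>m. 0 < \<rho> m" "\<And>m. ereal (\<rho> m) < r" "\<And>m. \<rho> m \<le> \<rho> (Suc m)"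
    "\<And>s. ereal s < r \<Longrightarrow> \<exists>m. s \<le> \<rho> m"
proof (cases r)
  case (real R)
  then have R: "0 < R"
    using assms by simp
  show thesis
  \<comment> \<open>The denominator starts at \<open>2\<close> so that already the first radius is
    positive.\<close>
  proof (rule that[of "\<lambda>m. R * (1 - 1 / (real m + 2))"])
    show "0 < R * (1 - 1 / (real m + 2))" "ereal (R * (1 - 1 / (real m + 2))) < r"
      "R * (1 - 1 / (real m + 2)) \<le> R * (1 - 1 / (real (Suc m) + 2))" for m
      using R by (simp_all add: real field_simps add_pos_nonneg)
    fix s assume "ereal s < r"
    then have s: "0 < R - s"
      by (simp add: real)
    obtain m where "R / (R - s) \<le> real m"
      using real_arch_simple by blast
    then have "R \<le> (real m + 2) * (R - s)"
      using s by (simp add: field_simps)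
    then have "R / (real m + 2) \<le> R - s"
      by (simp add: field_simps)
    then show "\<exists>m. s \<le> R * (1 - 1 / (real m + 2))"
      by (intro exI[of _ m]) (simp add: algebra_simps)
  qed
next
  case PInf
  show thesis
  proof (rule that[of "\<lambda>m. real m + 1"])
    fix s :: real
    obtain m where "s \<le> real m"
      using real_arch_simple by blast
    then show "\<exists>m. s \<le> real m + 1"
      by (intro exI[of _ m]) simp
  qed (simp_all add: PInf)
qed (use assms in simp)

lemma sum_words_split:
  fixes g h :: "'n::finite list \<Rightarrow> real"
  assumes "i \<le> d"
  shows "(\<Sum>w | length w = d. g (take i w) * h (drop i w)) =
    (\<Sum>u | length u = i. g u) * (\<Sum>v | length v = d - i. h v)"
proof -
  have "(\<Sum>u | length u = i. g u) * (\<Sum>v | length v = d - i. h v) =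
      (\<Sum>(u, v)\<in>{u. length u = i} \<times> {v. length v = d - i}. g u * h v)"
    by (simp add: sum_product sum.cartesian_product)
  also have "\<dots> = (\<Sum>w | length w = d. g (take i w) * h (drop i w))"
    using assms by (intro sum.reindex_bij_witness[of _ "\<lambda>w. (take i w, drop i w)" "\<lambda>(u, v). u @ v"]) auto
  finally show ?thesis ..
qed

text \<open>Regroups an unordered sum over all words by degree. This brings the norm of the polydisk
  algebra into the form of \<open>P\<close>.\<close>

lemma nonneg_has_sum_words:
  fixes f :: "'n::finite list \<Rightarrow> real"
  assumes f: "\<And>w. 0 \<le> f w"
  shows "f summable_on UNIV \<longleftrightarrow> summable (\<lambda>d. \<Sum>w | length w = d. f w)"
    and "f summable_on UNIV \<Longrightarrow> infsum f UNIV = suminf (\<lambda>d. \<Sum>w | length w = d. f w)"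
proof -
  let ?S = "Sigma UNIV (\<lambda>d. {w :: 'n list. length w = d})"
  have inner: "((\<lambda>w. f (snd (d, w))) has_sum (\<Sum>w | length w = d. f w)) {w. length w = d}" for d
    by (simp add: has_sum_finite)
  have bij: "bij_betw snd ?S UNIV"
    by (rule bij_betwI[where g = "\<lambda>w. (length w, w)"]) auto
  have S: "(f has_sum s) UNIV \<longleftrightarrow> ((\<lambda>x. f (snd x)) has_sum s) ?S" for s
    using has_sum_reindex_bij_betw[OF bij, of f s] by simp
  have *: "(\<lambda>d. \<Sum>w | length w = d. f w) sums s" if "(f has_sum s) UNIV" for s
    using has_sum_SigmaD[OF that[unfolded S], of "\<lambda>d. \<Sum>w | length w = d. f w"] inner
    by (intro has_sum_imp_sums) auto
  have "f summable_on UNIV" if "summable (\<lambda>d. \<Sum>w | length w = d. f w)"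
  proof -
    have "(\<lambda>d. \<Sum>w | length w = d. f w) summable_on UNIV"
      using that by (subst summable_on_UNIV_nonneg_real_iff) (auto intro: sum_nonneg f)
    then have "((\<lambda>x. f (snd x)) has_sum infsum (\<lambda>d. \<Sum>w | length w = d. f w) UNIV) ?S"
      using inner f by (intro has_sum_SigmaI[where g = "\<lambda>d. \<Sum>w | length w = d. f w"] summable_on_SigmaI[where g = "\<lambda>d. \<Sum>w | length w = d. f w"]) auto
    then show ?thesis
      using S by (auto simp: summable_on_def)
  qed
  then show "f summable_on UNIV \<longleftrightarrow> summable (\<lambda>d. \<Sum>w | length w = d. f w)"
    using * by (auto simp: summable_on_def sums_iff)
  show "infsum f UNIV = suminf (\<lambda>d. \<Sum>w | length w = d. f w)" if "f summable_on UNIV"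
    using *[OF has_sum_infsum[OF that]] by (simp add: sums_iff)
qed

text \<open>With this normalization \<open>switches w + 1\<close> is the number of maximal constant
  blocks of \<open>w\<close>, also for words of length at most one.\<close>

lemma switches_eq:
  "switches w = (if w = [] then -1 else int (card {i. Suc i < length w \<and> w ! i \<noteq> w ! Suc i}))"
proof (cases "2 \<le> length w")
  case True
  have *: "{i. i < length w - 1 \<and> w ! i \<noteq> w ! Suc i} = {i. Suc i < length w \<and> w ! i \<noteq> w ! Suc i}"
    by (rule Collect_cong) (simp only: less_diff_conv Suc_eq_plus1)
  have "w \<noteq> []"
    using True by (rule contrapos_pn) simp
  then show ?thesis
    unfolding switches_def if_P[OF True] * by (simp only: if_False)
next
  case False
  then have "length w = 0 \<or> length w = 1"
    by linarith
  then show ?thesis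
  proof
    assume l: "length w = 1"
    then have "{i. Suc i < length w \<and> w ! i \<noteq> w ! Suc i} = {}"
      by simp
    moreover have "w \<noteq> []"
      using l by (rule contrapos_pn) simp
    ultimately show ?thesis
      unfolding switches_def if_not_P[OF False] l by (simp only: if_False card.empty) simp
  qed (simp add: switches_def)
qed

lemma switches_nonneg: "0 \<le> switches w + 1"
  by (simp add: switches_eq)

text \<open>The number of blocks is subadditive: concatenation creates no blocks, and two may merge
  at the joint. In terms of positions, a switch lies in \<open>u\<close>, at the joint or in the
  shifted copy of \<open>v\<close>.\<close>

lemma switches_append: "switches (u @ v) + 1 \<le> (switches u + 1) + (switches v + 1)"
proof (cases "u = [] \<or> v = []")
  case True
  then show ?thesis
    by (auto simp: switches_eq)
next
  case False
  let ?S = "\<lambda>w. {i. Suc i < length w \<and> w ! i \<noteq> w ! Suc i}"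
  have fin: "finite (?S w)" for w :: "'a list"
    by (rule finite_subset[of _ "{..<length w}"]) auto
  have "?S (u @ v) \<subseteq> ?S u \<union> ({length u - 1} \<union> (+) (length u) ` ?S v)"
  proof
    fix i assume i: "i \<in> ?S (u @ v)"
    consider "Suc i < length u" | "i = length u - 1" | "length u \<le> i"
      by linarith
    then show "i \<in> ?S u \<union> ({length u - 1} \<union> (+) (length u) ` ?S v)"
    proof cases
      case 3
      then have "i - length u \<in> ?S v" "i = length u + (i - length u)"
        using i by (auto simp: nth_append Suc_diff_le)
      then show ?thesis
        by blast
    qed (use i in \<open>auto simp: nth_append\<close>)
  qed
  then have "card (?S (u @ v)) \<le> card (?S u \<union> ({length u - 1} \<union> (+) (length u) ` ?S v))"
    by (intro card_mono finite_UnI finite_imageI fin) auto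
  also have "\<dots> \<le> card (?S u) + (1 + card (?S v))"
    by (rule order_trans[OF card_Un_le] add_left_mono)+
      (use card_image_le[OF fin[of v], of "(+) (length u)"] in simp)
  finally show ?thesis
    using False by (simp add: switches_eq)
qed

lemma powi_switches_append:
  assumes "1 \<le> (\<tau> :: real)"
  shows "\<tau> powi (switches (u @ v) + 1) \<le> \<tau> powi (switches u + 1) * \<tau> powi (switches v + 1)"
proof -
  have "\<tau> powi (switches (u @ v) + 1) \<le> \<tau> powi ((switches u + 1) + (switches v + 1))"
    using assms by (intro power_int_increasing switches_append)
  also have "\<dots> = \<tau> powi (switches u + 1) * \<tau> powi (switches v + 1)"
    using assms by (intro power_int_add) auto
  finally show ?thesis .
qed

lemma powi_switches_mono:
  assumes "1 \<le> \<tau>" "\<tau> \<le> (\<sigma> :: real)"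
  shows "\<tau> powi (switches w + 1) \<le> \<sigma> powi (switches w + 1)"
  using assms switches_nonneg[of w] by (intro power_int_mono) auto

text \<open>The norms are weighted l1 norms, and the weights are submultiplicative under
  concatenation because lengths add and the number of blocks is subadditive.\<close>

theorem def_bundle_hypotheses_polydisk:
  assumes "0 < r"
  shows "def_bundle_hypotheses (polydisk_series r :: ('n::{finite, linorder} list \<Rightarrow> complex) set) (polydisk_norms r)"
proof -
  obtain \<rho> :: "nat \<Rightarrow> real" where \<rho>: "\<And>m. 0 < \<rho> m" "\<And>m. ereal (\<rho> m) < r" "\<And>m. \<rho> m \<le> \<rho> (Suc m)"
    "\<And>s. ereal s < r \<Longrightarrow> \<exists>m. s \<le> \<rho> m"
    using assms by (rule radius_sequence) blast
  define \<omega> :: "real \<Rightarrow> real \<Rightarrow> 'n list \<Rightarrow> real" where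
    "\<omega> s \<tau> w = s ^ length w * \<tau> powi (switches w + 1)" for s \<tau> w
  define L :: "real \<Rightarrow> real \<Rightarrow> nat \<Rightarrow> ('n list \<Rightarrow> complex) \<Rightarrow> real" where
    "L s \<tau> d a = (\<Sum>w | length w = d. cmod (a w) * \<omega> s \<tau> w)" for s \<tau> d a
  \<comment> \<open>Radius and block parameter increase together, so that one sequence dominates all
    pairs in the definition (see \<open>dom\<close>).\<close>
  let ?p = "\<lambda>m. L (\<rho> m) (real (Suc m))"
  have pos: "0 < \<omega> s \<tau> w" if "0 < s" "1 \<le> \<tau>" for s \<tau> w
    using that by (simp add: \<omega>_def zero_less_power_int)
  have L_nonneg: "0 \<le> L s \<tau> d a" if "0 < s" "1 \<le> \<tau>" for s \<tau> d a
    unfolding L_def using pos[OF that] by (intro sum_nonneg mult_nonneg_nonneg) (auto intro: less_imp_le)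
  have L_mono: "L s \<tau> d a \<le> L s' \<tau>' d a" if "0 < s" "1 \<le> \<tau>" "s \<le> s'" "\<tau> \<le> \<tau>'" for s \<tau> s' \<tau>' d a
    unfolding L_def \<omega>_def using that
    by (intro sum_mono mult_left_mono mult_mono power_mono powi_switches_mono) (auto simp: zero_le_power_int)
  have norm_eq: "(\<lambda>w. cmod (a w) * s ^ length w * \<tau> powi (switches w + 1)) = (\<lambda>w. cmod (a w) * \<omega> s \<tau> w)" for a s \<tau>
    by (simp add: \<omega>_def mult.assoc)
  have summable_iff: "(\<lambda>w. cmod (a w) * s ^ length w * \<tau> powi (switches w + 1)) summable_on UNIV \<longleftrightarrow>
      summable (\<lambda>d. L s \<tau> d a)" if "0 < s" "1 \<le> \<tau>" for a s \<tau>
    unfolding norm_eq L_def using pos[OF that, THEN less_imp_le] by (intro nonneg_has_sum_words(1)) simp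
  have norm: "polydisk_norm s \<tau> a = suminf (\<lambda>d. L s \<tau> d a)"
    if "0 < s" "1 \<le> \<tau>" "summable (\<lambda>d. L s \<tau> d a)" for a s \<tau>
    using summable_iff[OF that(1,2), of a] that(3) pos[OF that(1,2), THEN less_imp_le]
    unfolding polydisk_norm_def norm_eq L_def by (intro nonneg_has_sum_words(2)) auto
  have dom: "\<exists>m. s \<le> \<rho> m \<and> \<tau> \<le> real (Suc m)" if "ereal s < r" for s \<tau> :: real
  proof -
    obtain m where "s \<le> \<rho> m"
      using \<rho>(4) \<open>ereal s < r\<close> by blast
    moreover obtain m' where "\<tau> \<le> real m'"
      using real_arch_simple by blast
    moreover have "\<rho> m \<le> \<rho> (max m m')"
      by (rule lift_Suc_mono_le[of \<rho>]) (auto intro: \<rho>(3))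
    ultimately show ?thesis
      by (intro exI[of _ "max m m'"]) auto
  qed
  interpret graded_norm ?p
  proof
    fix m d and a b :: "'n list \<Rightarrow> complex" and c :: complex and u :: "'n list"
    note \<omega> = pos[OF \<rho>(1), of "real (Suc m)" m]
    show "0 \<le> ?p m d a"
      by (rule L_nonneg) (simp_all add: \<rho>(1))
    show "?p m d (\<lambda>w. a w + b w) \<le> ?p m d a + ?p m d b"
      unfolding L_def sum.distrib[symmetric] distrib_right[symmetric] using \<omega>
      by (intro sum_mono mult_right_mono norm_triangle_ineq) (auto intro: less_imp_le)
    show "?p m d (\<lambda>w. c * a w) = cmod c * ?p m d a"
      by (simp add: L_def sum_distrib_left norm_mult mult.assoc)
    show "?p m d a \<le> ?p m d b" if "\<And>w. length w = d \<Longrightarrow> cmod (a w) \<le> cmod (b w)"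
      unfolding L_def using \<omega> that by (intro sum_mono mult_right_mono) (auto intro: less_imp_le)
    have "?p m (length u) (word_basis u) \<ge> cmod (word_basis u u) * \<omega> (\<rho> m) (real (Suc m)) u"
      unfolding L_def using \<omega>[THEN less_imp_le] by (intro member_le_sum) auto
    then show "0 < ?p m (length u) (word_basis u)"
      using \<omega>[of u] by (simp add: word_basis_def)
    show "?p m d a \<le> ?p (Suc m) d a"
      by (rule L_mono) (simp_all add: \<rho>(1,3))
    have sub: "\<omega> (\<rho> m) (real (Suc m)) w \<le>
        \<omega> (\<rho> m) (real (Suc m)) (take i w) * \<omega> (\<rho> m) (real (Suc m)) (drop i w)" for i w
    proof -
      have "\<rho> m ^ length w = \<rho> m ^ length (take i w) * \<rho> m ^ length (drop i w)"
        by (simp only: power_add[symmetric] length_append[symmetric] append_take_drop_id)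
      moreover have "real (Suc m) powi (switches w + 1) \<le>
          real (Suc m) powi (switches (take i w) + 1) * real (Suc m) powi (switches (drop i w) + 1)"
        using powi_switches_append[of "real (Suc m)" "take i w" "drop i w"] by simp
      ultimately show ?thesis
        using mult_left_mono[of "real (Suc m) powi (switches w + 1)" _ "\<rho> m ^ length w"] \<rho>(1)[of m]
        unfolding \<omega>_def by (simp add: algebra_simps)
    qed
    let ?\<omega> = "\<omega> (\<rho> m) (real (Suc m))"
    have "?p m d (word_mult a b) \<le> (\<Sum>w | length w = d. \<Sum>i\<le>d.
        (cmod (a (take i w)) * ?\<omega> (take i w)) * (cmod (b (drop i w)) * ?\<omega> (drop i w)))"
      unfolding L_def
    proof (rule sum_mono)
      fix w :: "'n list" assume "w \<in> {w. length w = d}"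
      then have "cmod (word_mult a b w) * ?\<omega> w \<le> (\<Sum>i\<le>d. cmod (a (take i w) * b (drop i w))) * ?\<omega> w"
        using \<omega>[THEN less_imp_le] unfolding word_mult_def by (intro mult_right_mono) (auto intro: norm_sum)
      also have "\<dots> \<le> (\<Sum>i\<le>d. cmod (a (take i w) * b (drop i w)) * (?\<omega> (take i w) * ?\<omega> (drop i w)))"
        unfolding sum_distrib_right using sub by (intro sum_mono mult_left_mono) auto
      finally show "cmod (word_mult a b w) * ?\<omega> w \<le>
          (\<Sum>i\<le>d. (cmod (a (take i w)) * ?\<omega> (take i w)) * (cmod (b (drop i w)) * ?\<omega> (drop i w)))"
        by (simp add: norm_mult mult_ac)
    qed
    also have "\<dots> = (\<Sum>i\<le>d. \<Sum>w | length w = d.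
        (cmod (a (take i w)) * ?\<omega> (take i w)) * (cmod (b (drop i w)) * ?\<omega> (drop i w)))"
      by (rule sum.swap)
    also have "\<dots> = (\<Sum>i\<le>d. ?p m i a * ?p m (d - i) b)"
      unfolding L_def
      by (intro sum.cong refl sum_words_split[where g = "\<lambda>u. cmod (a u) * ?\<omega> u" and h = "\<lambda>v. cmod (b v) * ?\<omega> v"]) simp
    finally show "?p m d (word_mult a b) \<le> (\<Sum>i\<le>d. ?p m i a * ?p m (d - i) b)" .
  qed
  have summable: "summable (\<lambda>d. L s \<tau> d a)" if a: "a \<in> series" and s: "0 < s" "ereal s < r" and \<tau>: "1 \<le> \<tau>" for a s \<tau>
  proof -
    obtain m where "s \<le> \<rho> m" "\<tau> \<le> real (Suc m)"
      using dom[OF s(2)] by blast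
    then show ?thesis
      using L_nonneg[OF s(1) \<tau>] L_mono[OF s(1) \<tau>]
      by (intro summable_comparison_test'[OF seriesD[OF a, of m], of 0]) simp
  qed
  have "graded_family ?p (polydisk_series r) (polydisk_norms r)"
  proof (unfold_locales)
    have "a \<in> polydisk_series r \<longleftrightarrow> a \<in> series" for a
    proof
      assume "a \<in> polydisk_series r"
      then have "(\<lambda>w. cmod (a w) * \<rho> m ^ length w * real (Suc m) powi (switches w + 1)) summable_on UNIV" for m
        using \<rho>(1,2) by (simp add: polydisk_series_def)
      then have "summable (\<lambda>d. ?p m d a)" for m
        using summable_iff[OF \<rho>(1)[of m], of "real (Suc m)" a] by simp
      then show "a \<in> series"
        unfolding series_def by blast
    qed (use summable summable_iff in \<open>auto simp: polydisk_series_def\<close>)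
    then show "polydisk_series r = series"
      by blast
    fix m
    show "\<exists>N\<in>polydisk_norms r. \<forall>a\<in>series. P m a \<le> N a"
    proof (intro bexI ballI)
      show "polydisk_norm (\<rho> m) (real (Suc m)) \<in> polydisk_norms r"
        unfolding polydisk_norms_def using \<rho>(1,2) by (intro CollectI exI conjI) auto
      show "P m a \<le> polydisk_norm (\<rho> m) (real (Suc m)) a" if "a \<in> series" for a
        unfolding P_def using norm[OF \<rho>(1) _ seriesD[OF that, of m]] by simp
    qed
  next
    fix N :: "('n list \<Rightarrow> complex) \<Rightarrow> real" assume "N \<in> polydisk_norms r"
    then obtain s \<tau> where s: "0 < s" "ereal s < r" "1 \<le> \<tau>" "N = polydisk_norm s \<tau>"
      by (auto simp: polydisk_norms_def)
    obtain m where m: "s \<le> \<rho> m" "\<tau> \<le> real (Suc m)"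
      using dom[OF s(2)] by blast
    have "0 \<le> N a \<and> N a \<le> P m a" if a: "a \<in> series" for a
      unfolding s(4) norm[OF s(1,3) summable[OF a s(1-3)]] P_def
      using L_nonneg[OF s(1,3)] L_mono[OF s(1,3) m] summable[OF a s(1-3)] seriesD[OF a, of m]
      by (intro conjI suminf_nonneg suminf_le) auto
    then show "\<exists>m. \<forall>a\<in>series. 0 \<le> N a \<and> N a \<le> P m a"
      by blast
  qed
  then show ?thesis
    by (rule graded_family.def_bundle_hypotheses)
qed

lemma degree_norm_eq_L2_set: "degree_norm d a = L2_set (\<lambda>w. cmod (a w)) {w. length w = d}"
  by (simp add: degree_norm_def L2_set_def)

lemma L2_set_sum_le: "finite I \<Longrightarrow> L2_set (\<lambda>w. \<Sum>i\<in>I. f i w) A \<le> (\<Sum>i\<in>I. L2_set (f i) A)"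
proof (induction I rule: finite_induct)
  case (insert i I)
  then show ?case
    using L2_set_triangle_ineq[of "f i" "\<lambda>w. \<Sum>i\<in>I. f i w" A] by simp
qed (simp add: L2_set_def)

text \<open>For a fixed cutting position the words of length \<open>d\<close> are pairs of words, so
  the l2 norm of the product family factorizes. Minkowski's inequality then adds up the cutting
  positions.\<close>

lemma degree_norm_word_mult:
  "degree_norm d (word_mult a b) \<le> (\<Sum>i\<le>d. degree_norm i a * degree_norm (d - i) b)"
proof -
  let ?W = "{w. length w = d}"
  have "degree_norm d (word_mult a b) \<le> L2_set (\<lambda>w. \<Sum>i\<le>d. cmod (a (take i w) * b (drop i w))) ?W"
    unfolding degree_norm_eq_L2_set word_mult_def by (intro L2_set_mono) (auto intro: norm_sum)
  also have "\<dots> \<le> (\<Sum>i\<le>d. L2_set (\<lambda>w. cmod (a (take i w) * b (drop i w))) ?W)"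
    by (rule L2_set_sum_le) simp
  also have "\<dots> = (\<Sum>i\<le>d. degree_norm i a * degree_norm (d - i) b)"
  proof (rule sum.cong)
    fix i assume "i \<in> {..d}"
    then show "L2_set (\<lambda>w. cmod (a (take i w) * b (drop i w))) ?W = degree_norm i a * degree_norm (d - i) b"
      using sum_words_split[of i d "\<lambda>u. (cmod (a u))\<^sup>2" "\<lambda>v. (cmod (b v))\<^sup>2"]
      by (simp add: L2_set_def degree_norm_def norm_mult power_mult_distrib real_sqrt_mult)
  qed simp
  finally show ?thesis .
qed

theorem def_bundle_hypotheses_ball:
  assumes "0 < r"
  shows "def_bundle_hypotheses (ball_series r :: ('n::{finite, linorder} list \<Rightarrow> complex) set) (ball_norms r)"
proof -
  obtain \<rho> :: "nat \<Rightarrow> real" where \<rho>: "\<And>m. 0 < \<rho> m" "\<And>m. ereal (\<rho> m) < r" "\<And>m. \<rho> m \<le> \<rho> (Suc m)"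
    "\<And>s. ereal s < r \<Longrightarrow> \<exists>m. s \<le> \<rho> m"
    using assms by (rule radius_sequence) blast
  let ?p = "\<lambda>m d (a :: 'n list \<Rightarrow> complex). degree_norm d a * \<rho> m ^ d"
  have nonneg: "0 \<le> degree_norm d (a :: 'n list \<Rightarrow> complex)" for d a
    by (simp add: degree_norm_eq_L2_set)
  have mono: "degree_norm d (a :: 'n list \<Rightarrow> complex) * s ^ d \<le> degree_norm d a * s' ^ d"
    if "0 < s" "s \<le> s'" for s s' d a
    using that nonneg by (intro mult_left_mono power_mono) auto
  interpret graded_norm ?p
  proof
    fix m d and a b :: "'n list \<Rightarrow> complex" and c :: complex and u :: "'n list"
    have \<rho>': "0 \<le> \<rho> m ^ d" for d
      using \<rho>(1)[of m] by simp
    show "0 \<le> ?p m d a"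
      using nonneg \<rho>' by simp
    have "degree_norm d (\<lambda>w. a w + b w) \<le> L2_set (\<lambda>w. cmod (a w) + cmod (b w)) {w. length w = d}"
      unfolding degree_norm_eq_L2_set by (intro L2_set_mono norm_triangle_ineq norm_ge_zero)
    also have "\<dots> \<le> degree_norm d a + degree_norm d b"
      unfolding degree_norm_eq_L2_set by (rule L2_set_triangle_ineq)
    finally show "?p m d (\<lambda>w. a w + b w) \<le> ?p m d a + ?p m d b"
      unfolding distrib_right[symmetric] by (intro mult_right_mono \<rho>')
    show "?p m d (\<lambda>w. c * a w) = cmod c * ?p m d a"
      by (simp add: degree_norm_eq_L2_set norm_mult L2_set_right_distrib)
    show "?p m d a \<le> ?p m d b" if "\<And>w. length w = d \<Longrightarrow> cmod (a w) \<le> cmod (b w)"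
      unfolding degree_norm_eq_L2_set using that by (intro mult_right_mono \<rho>' L2_set_mono) auto
    have "cmod (word_basis u u) \<le> degree_norm (length u) (word_basis u)"
      unfolding degree_norm_eq_L2_set by (rule member_le_L2_set) auto
    then show "0 < ?p m (length u) (word_basis u)"
      using \<rho>(1)[of m] by (simp add: word_basis_def)
    show "?p m d a \<le> ?p (Suc m) d a"
      by (rule mono) (simp_all add: \<rho>(1,3))
    have "?p m d (word_mult a b) \<le> (\<Sum>i\<le>d. degree_norm i a * degree_norm (d - i) b) * \<rho> m ^ d"
      by (intro mult_right_mono \<rho>' degree_norm_word_mult)
    also have "\<dots> = (\<Sum>i\<le>d. ?p m i a * ?p m (d - i) b)"
      unfolding sum_distrib_right
    proof (rule sum.cong)
      fix i assume "i \<in> {..d}"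
      then have "\<rho> m ^ d = \<rho> m ^ i * \<rho> m ^ (d - i)"
        by (simp add: power_add[symmetric])
      then show "degree_norm i a * degree_norm (d - i) b * \<rho> m ^ d = ?p m i a * ?p m (d - i) b"
        by (simp add: mult_ac)
    qed simp
    finally show "?p m d (word_mult a b) \<le> (\<Sum>i\<le>d. ?p m i a * ?p m (d - i) b)" .
  qed
  have summable: "summable (\<lambda>d. degree_norm d a * s ^ d)" if a: "a \<in> series" and s: "0 < s" "ereal s < r" for a s
  proof -
    obtain m where "s \<le> \<rho> m"
      using \<rho>(4)[OF s(2)] by blast
    then show ?thesis
      using nonneg[of _ a] mono[OF s(1), of "\<rho> m" _ a] s(1)
      by (intro summable_comparison_test'[OF seriesD[OF a, of m], of 0]) simp
  qed
  have "graded_family ?p (ball_series r) (ball_norms r)"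
  proof (unfold_locales)
    have "a \<in> ball_series r \<longleftrightarrow> a \<in> series" for a
    proof
      show "a \<in> series" if "a \<in> ball_series r"
        using that \<rho>(1,2) unfolding ball_series_def series_def by blast
    qed (use summable in \<open>auto simp: ball_series_def\<close>)
    then show "ball_series r = series"
      by blast
    fix m
    show "\<exists>N\<in>ball_norms r. \<forall>a\<in>series. P m a \<le> N a"
    proof (intro bexI ballI)
      show "ball_norm (\<rho> m) \<in> ball_norms r"
        unfolding ball_norms_def using \<rho>(1,2) by blast
      show "P m a \<le> ball_norm (\<rho> m) a" for a
        unfolding P_def ball_norm_def by (rule order_refl)
    qed
  next
    fix N :: "('n list \<Rightarrow> complex) \<Rightarrow> real" assume "N \<in> ball_norms r"
    then obtain s where s: "0 < s" "ereal s < r" "N = ball_norm s"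
      by (auto simp: ball_norms_def)
    obtain m where m: "s \<le> \<rho> m"
      using \<rho>(4)[OF s(2)] by blast
    have "0 \<le> N a \<and> N a \<le> P m a" if a: "a \<in> series" for a
      unfolding s(3) ball_norm_def P_def
      using nonneg mono[OF s(1) m] summable[OF a s(1,2)] seriesD[OF a, of m] s(1)
      by (intro conjI suminf_nonneg suminf_le) auto
    then show "\<exists>m. \<forall>a\<in>series. 0 \<le> N a \<and> N a \<le> P m a"
      by blast
  qed
  then show ?thesis
    by (rule graded_family.def_bundle_hypotheses)
qed

theorem theorem8p4:
  fixes X :: "complex set" and A :: "(complex, 'e) bundle_data"
    and \<iota> :: "complex \<Rightarrow> ('n::{finite, linorder} list \<Rightarrow> complex) set \<Rightarrow> 'e"
    and r :: ereal
  shows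
    "(open X \<and> connected X \<and> 0 \<in> X \<and> base A = top_of_set X \<and>
      frechet_algebra_bundle A \<and> continuous_bundle A \<and> contains_qreg A \<iota> \<longrightarrow>
      strict_frechet_deformation_quantization (poly_alg :: (complex, 'n mpol) module) poly_bracket X A
        (\<lambda>h. \<iota> h ` carrier (qreg (exp (\<i> * h))))
        (\<lambda>h f. \<iota> h (qreg_of_poly (exp (\<i> * h)) f)))
     \<and>
     (0 < r \<longrightarrow>
      def_bundle_hypotheses (polydisk_series r :: ('n list \<Rightarrow> complex) set) (polydisk_norms r) \<and>
      def_bundle_hypotheses (ball_series r :: ('n list \<Rightarrow> complex) set) (ball_norms r))"
proof (intro conjI impI)
  assume "open X \<and> connected X \<and> 0 \<in> X \<and> base A = top_of_set X \<and>
      frechet_algebra_bundle A \<and> continuous_bundle A \<and> contains_qreg A \<iota>"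
  then show "strict_frechet_deformation_quantization (poly_alg :: (complex, 'n mpol) module) poly_bracket X A
        (\<lambda>h. \<iota> h ` carrier (qreg (exp (\<i> * h))))
        (\<lambda>h f. \<iota> h (qreg_of_poly (exp (\<i> * h)) f))"
    by (elim conjE) (rule strict_deformation_quantization)
qed (rule def_bundle_hypotheses_polydisk def_bundle_hypotheses_ball, assumption)+

end
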